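(* Let $C\in V(d,c,n)$ be an irreducible Plücker curve, i.e. its dual curve $C^{\vee}$ belongs to some $V(d^*,c^*,n^* )$. Let $\chi$ and $\chi^*$ be the topological Euler characteristics of the normalizations of $C$ and $C^\vee$. Then $$d^*=2d-c-\chi,\qquad c^*=3d-2c-3\chi,\qquad \chi^*=\chi .$$ That is, in the coordinates $(d,c,\chi)$ projective duality is given by the linear transformation $$D=\begin{pmatrix}2&-1&-1\\3&-2&-3\\0&0&1\end{pmatrix}.$$ This transformation is diagonalizable with eigenvalues $(-1,1,1)$; the linear form $d-c-\chi=d^*-d$ is an eigenvector (for the induced action on linear forms) with eigenvalue $-1$. So $D$ gives a reflection in the lattice $\mathbb{Z}\oplus\mathbb{Z}\oplus 2\mathbb{Z}$.
   Context: The base field is $\mathbb{C}$. $V(d,c,n)$ denotes the variety of plane curves in $\mathbb{P}^2$ of degree $d$ with exactly $c$ cusps and $n$ nodes as their only singularities. For such an irreducible curve the geometric genus is $g=\frac12(d-1)(d-2)-c-n$ and $\chi=2-2g$. *)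

theory Defs
  imports
    "HOL-Complex_Analysis.Complex_Analysis"
    "HOL-Homology.Homology"
    "HOL-Library.Poly_Mapping"
    "HOL-Computational_Algebra.Squarefree"
begin

section \<open>The complex projective plane\<close>

quotient_type P2 = "complex^3" / partial:
  "\<lambda>v w. v \<noteq> 0 \<and> w \<noteq> 0 \<and> (\<exists>a. w = a *s v)"
  morphisms coords pt
proof (rule part_equivpI)
  show "\<exists>v::complex^3. v \<noteq> 0 \<and> v \<noteq> 0 \<and> (\<exists>a. v = a *s v)"
    by (rule exI[of _ "axis 1 1"]) (auto simp: axis_eq_0_iff intro: exI[of _ 1])
  show "symp (\<lambda>v w::complex^3. v \<noteq> 0 \<and> w \<noteq> 0 \<and> (\<exists>a. w = a *s v))"
  proof (rule sympI, elim conjE exE)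
    fix v w :: "complex^3" and a
    assume *: "v \<noteq> 0" "w \<noteq> 0" "w = a *s v"
    then have "a \<noteq> 0" by auto
    with * have "v = inverse a *s w" by simp
    with * show "w \<noteq> 0 \<and> v \<noteq> 0 \<and> (\<exists>a. v = a *s w)" by blast
  qed
  show "transp (\<lambda>v w::complex^3. v \<noteq> 0 \<and> w \<noteq> 0 \<and> (\<exists>a. w = a *s v))"
    by (rule transpI) (metis vector_smult_assoc)
qed

text \<open>
  \<open>coords p\<close> is an arbitrarily chosen vector of homogeneous coordinates of \<open>p\<close>.  It is only used
  in notions that do not depend on the choice.

  The dual plane is identified with \<open>P2\<close> by means of the standard pairing: \<open>l\<close>, regarded as a point
  of the dual plane, is the line with equation \<open>l\<^sub>1 x\<^sub>1 + l\<^sub>2 x\<^sub>2 + l\<^sub>3 x\<^sub>3 = 0\<close>.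
\<close>

definition line :: "P2 \<Rightarrow> P2 set" where
  "line l = {p. (\<Sum>i\<in>UNIV. coords l $ i * coords p $ i) = 0}"

section \<open>Plane curves and their singularities\<close>

type_synonym ternary = "(3 \<Rightarrow>\<^sub>0 nat) \<Rightarrow>\<^sub>0 complex"

definition homogeneous :: "nat \<Rightarrow> ternary \<Rightarrow> bool" where
  "homogeneous d F \<longleftrightarrow> (\<forall>m\<in>Poly_Mapping.keys F. (\<Sum>i\<in>UNIV. Poly_Mapping.lookup m i) = d)"

definition eval_form :: "ternary \<Rightarrow> complex^3 \<Rightarrow> complex" where
  "eval_form F v = (\<Sum>m\<in>Poly_Mapping.keys F.
     Poly_Mapping.lookup F m * (\<Prod>i\<in>UNIV. (v $ i) ^ Poly_Mapping.lookup m i))"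

definition zeros :: "ternary \<Rightarrow> P2 set" where
  "zeros F = {p. eval_form F (coords p) = 0}"

definition zariski_closure :: "P2 set \<Rightarrow> P2 set" where
  "zariski_closure S = {p. \<forall>d F. homogeneous d F \<and> S \<subseteq> zeros F \<longrightarrow> p \<in> zeros F}"

text \<open>
  Reduced plane curves are identified with their sets of points; the equation \<open>F\<close> is determined by
  the curve up to a scalar.
\<close>

definition reduced_equation :: "nat \<Rightarrow> ternary \<Rightarrow> P2 set \<Rightarrow> bool" where
  "reduced_equation d F C \<longleftrightarrow> d > 0 \<and> homogeneous d F \<and> squarefree F \<and> C = zeros F"

definition irreducible_curve :: "P2 set \<Rightarrow> bool" where
  "irreducible_curve C \<longleftrightarrow> (\<exists>d F. homogeneous d F \<and> irreducible F \<and> C = zeros F)"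

text \<open>The polynomial \<open>F (v + t w)\<close> in \<open>t\<close>, where \<open>v\<close> and \<open>w\<close> are coordinates of \<open>p\<close> and \<open>q\<close>:\<close>

definition expansion :: "ternary \<Rightarrow> P2 \<Rightarrow> P2 \<Rightarrow> complex poly" where
  "expansion F p q = (\<Sum>m\<in>Poly_Mapping.keys F.
     Polynomial.smult (Poly_Mapping.lookup F m)
       (\<Prod>i\<in>UNIV. [:coords p $ i, coords q $ i:] ^ Poly_Mapping.lookup m i))"

text \<open>The multiplicity of \<open>F\<close> at \<open>p\<close> is the degree of the lowest term of the Taylor expansion.\<close>

definition mult_at :: "ternary \<Rightarrow> P2 \<Rightarrow> nat" where
  "mult_at F p = (LEAST k. \<exists>q. Polynomial.coeff (expansion F p q) k \<noteq> 0)"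

text \<open>For \<open>q \<noteq> p\<close>: the intersection multiplicity at \<open>p\<close> of \<open>F\<close> with the line through \<open>p\<close> and \<open>q\<close>.\<close>

definition line_intersection :: "ternary \<Rightarrow> P2 \<Rightarrow> P2 \<Rightarrow> enat" where
  "line_intersection F p q =
     (if expansion F p q = 0 then \<infinity> else enat (Polynomial.order 0 (expansion F p q)))"

text \<open>
  The tangent lines at \<open>p\<close> are the linear factors of the lowest term of the Taylor expansion, i.e. the
  lines through \<open>p\<close> that meet \<open>F\<close> there with multiplicity exceeding that of the point.
\<close>

definition tangent_lines :: "ternary \<Rightarrow> P2 \<Rightarrow> P2 set" where
  "tangent_lines F p = {l. p \<in> line l \<and>
     (\<exists>q\<in>line l. q \<noteq> p \<and> line_intersection F p q > enat (mult_at F p))}"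

definition singular_points :: "ternary \<Rightarrow> P2 set" where
  "singular_points F = {p\<in>zeros F. mult_at F p \<ge> 2}"

text \<open>A node is a double point with two distinct tangent lines.\<close>

definition nodes :: "ternary \<Rightarrow> P2 set" where
  "nodes F = {p\<in>zeros F. mult_at F p = 2 \<and> card (tangent_lines F p) = 2}"

text \<open>
  A cusp, locally \<open>y\<^sup>2 = x\<^sup>3\<close>, is a double point with a single tangent line, which meets the curve
  there with multiplicity exactly 3.
\<close>

definition cusps :: "ternary \<Rightarrow> P2 set" where
  "cusps F = {p\<in>zeros F. mult_at F p = 2 \<and>
     (\<exists>l. tangent_lines F p = {l} \<and> (\<forall>q\<in>line l. q \<noteq> p \<longrightarrow> line_intersection F p q = 3))}"

definition V :: "nat \<Rightarrow> nat \<Rightarrow> nat \<Rightarrow> P2 set set" where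
  "V d c n = {C. \<exists>F. reduced_equation d F C \<and>
     singular_points F = nodes F \<union> cusps F \<and>
     finite (cusps F) \<and> card (cusps F) = c \<and>
     finite (nodes F) \<and> card (nodes F) = n}"

definition dual_curve :: "P2 set \<Rightarrow> P2 set" where
  "dual_curve C = zariski_closure
     {l. \<exists>d F. reduced_equation d F C \<and> (\<exists>p\<in>C. p \<notin> singular_points F \<and> l \<in> tangent_lines F p)}"

section \<open>Normalization\<close>

type_synonym 'a atlas = "('a set \<times> ('a \<Rightarrow> complex)) set"

definition compact_riemann_surface :: "'a topology \<Rightarrow> 'a atlas \<Rightarrow> bool" where
  "compact_riemann_surface X A \<longleftrightarrow>
     compact_space X \<and> connected_space X \<and> Hausdorff_space X \<and> topspace X = (\<Union>(U, \<phi>)\<in>A. U) \<and>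
     (\<forall>(U, \<phi>)\<in>A. openin X U \<and> open (\<phi> ` U) \<and>
        homeomorphic_map (subtopology X U) (top_of_set (\<phi> ` U)) \<phi>) \<and>
     (\<forall>(U, \<phi>)\<in>A. \<forall>(W, \<psi>)\<in>A. (\<psi> \<circ> inv_into U \<phi>) holomorphic_on \<phi> ` (U \<inter> W))"

text \<open>Maps to the plane that lift locally to holomorphic maps to the space of nonzero vectors:\<close>

definition holomorphic_to_P2 :: "'a atlas \<Rightarrow> ('a \<Rightarrow> P2) \<Rightarrow> bool" where
  "holomorphic_to_P2 A \<nu> \<longleftrightarrow>
     (\<forall>(U, \<phi>)\<in>A. \<forall>x\<in>U. \<exists>W (f :: complex \<Rightarrow> complex^3).
        open W \<and> \<phi> x \<in> W \<and> W \<subseteq> \<phi> ` U \<and> (\<forall>i. (\<lambda>t. f t $ i) holomorphic_on W) \<and>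
        (\<forall>t\<in>W. f t \<noteq> 0 \<and> \<nu> (inv_into U \<phi> t) = pt (f t)))"

text \<open>
  The normalization of an irreducible curve: a compact Riemann surface with a holomorphic map onto the
  curve that is injective outside the preimage of a finite set.  It is unique up to isomorphism.
\<close>

definition normalization :: "P2 set \<Rightarrow> 'a topology \<Rightarrow> 'a atlas \<Rightarrow> ('a \<Rightarrow> P2) \<Rightarrow> bool" where
  "normalization C X A \<nu> \<longleftrightarrow> compact_riemann_surface X A \<and> holomorphic_to_P2 A \<nu> \<and>
     \<nu> ` topspace X = C \<and> (\<exists>S. finite S \<and> inj_on \<nu> {x \<in> topspace X. \<nu> x \<notin> S})"

section \<open>Topological Euler characteristic\<close>

text \<open>The rank of an abelian group (in multiplicative notation), if it is finite:\<close>

definition abelian_rank :: "('a, 'b) monoid_scheme \<Rightarrow> nat" where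
  "abelian_rank G = Sup {card S |S. finite S \<and> S \<subseteq> carrier G \<and>
     (\<forall>k :: 'a \<Rightarrow> int. finprod G (\<lambda>x. x [^]\<^bsub>G\<^esub> k x) S = \<one>\<^bsub>G\<^esub> \<longrightarrow> (\<forall>x\<in>S. k x = 0))}"

definition betti :: "nat \<Rightarrow> 'a topology \<Rightarrow> nat" where
  "betti p X = abelian_rank (homology_group (int p) X)"

definition euler_characteristic :: "'a topology \<Rightarrow> int" where
  "euler_characteristic X = (\<Sum>p\<in>{p. betti p X \<noteq> 0}. (-1) ^ p * int (betti p X))"

section \<open>The linear transformation\<close>

definition plucker_matrix :: "('a::comm_ring_1)^3^3" where
  "plucker_matrix = vector [vector [2, -1, -1], vector [3, -2, -3], vector [0, 0, 1]]"

definition plucker_form :: "('a::comm_ring_1)^3 \<Rightarrow> 'a" where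
  "plucker_form x = x $ 1 - x $ 2 - x $ 3"

definition diagonalizable_with :: "('a::field)^'n^'n \<Rightarrow> 'a^'n \<Rightarrow> bool" where
  "diagonalizable_with M e \<longleftrightarrow>
     (\<exists>P. invertible P \<and> matrix_inv P ** M ** P = (\<chi> i j. if i = j then e $ i else 0))"

text \<open>A matrix \<open>M\<close> acts on linear forms by \<open>f \<mapsto> f \<circ> M\<close>.\<close>

definition eigenform :: "('a::field)^'n^'n \<Rightarrow> 'a \<Rightarrow> ('a^'n \<Rightarrow> 'a) \<Rightarrow> bool" where
  "eigenform M a f \<longleftrightarrow> Vector_Spaces.linear (*s) (*) f \<and> f \<noteq> (\<lambda>x. 0) \<and> f \<circ> (*v) M = (\<lambda>x. a * f x)"

text \<open>Reflections \<open>x \<mapsto> x - f(x) r\<close> of a lattice, for a vector \<open>r\<close> and an integral form \<open>f\<close> with \<open>f(r) = 2\<close>:\<close>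

definition lattice_reflection :: "(int^'n) set \<Rightarrow> (int^'n \<Rightarrow> int^'n) \<Rightarrow> bool" where
  "lattice_reflection L s \<longleftrightarrow> s ` L = L \<and>
     (\<exists>r\<in>L. \<exists>f :: int^'n \<Rightarrow> int. (\<forall>x\<in>L. \<forall>y\<in>L. f (x + y) = f x + f y) \<and> f r = 2 \<and>
        (\<forall>x\<in>L. s x = x - f x *s r))"

end

theory Submission
  imports Defs "HOL-Computational_Algebra.Fundamental_Theorem_Algebra"
begin

text \<open>
  Pull everything back to the normalization \<open>\<nu> : X \<rightarrow> C\<close>. The tangent line at \<open>\<nu> x\<close> extends across
  the cusps to a holomorphic Gauss map \<open>\<gamma>\<close> on \<open>X\<close>: in a lift \<open>f\<close> of \<open>\<nu>\<close> the cross product of \<open>f\<close>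
  and \<open>f'\<close> is \<open>(t - x)\<^sup>k g\<close>, where \<open>g\<close> has no zeros, \<open>\<gamma> = [g]\<close> and \<open>k\<close> is 1 at the cusps and 0
  elsewhere. Riemann-Hurwitz for the projection of \<open>C\<close> from a general point \<open>v\<close> reads
  \<open>\<chi> = 2 d - c - d\<^sup>*\<close>, because the ramification divisor, given by the Wronskian of two linear forms
  on \<open>f\<close>, is the sum of the cusps and the pullback under \<open>\<gamma>\<close> of the line dual to \<open>v\<close>. The Gauss
  map of \<open>\<gamma>\<close> is \<open>\<nu>\<close>, so \<open>\<gamma>\<close> is a normalization of the dual curve; onto, since a connected
  normalization of the dual curve cannot be split into the points over \<open>\<gamma>(X)\<close> and the others.
  Exchanging the roles of \<open>C\<close> and its dual gives \<open>\<chi> = 2 d\<^sup>* - c\<^sup>* - d\<close>, and applying this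
  relation to any other normalization of the dual curve gives \<open>\<chi>\<^sup>* = \<chi>\<close>.
\<close>

text \<open>The Betti numbers are ranks of singular homology groups, so Riemann-Hurwitz is proved
  without triangulations: excision makes the Euler characteristic additive on open sets, local
  models \<open>b + r s^e\<close> compute it over small rectangles, and the sphere is glued from
  rectangles. Finiteness of all ranks has to be carried along, since a default value of a supremum
  would spoil additivity. The second difficulty is that nodes, cusps and degrees are defined by
  polynomials, while the Riemann surface only knows orders of vanishing on branches. The bridge is
  the restriction of \<open>F\<close> to a line: it is a product of linear factors, one for each
  point of \<open>X\<close> over the line, with the order of vanishing as exponent. On a general
  line of a pencil this holds because the roots are simple; on a special one it follows by a limit.
  Multiplicities and tangent lines are then read off branch by branch. Finally, the dual curve is a
  Zariski closure, so a priori the Gauss map only lands in it; the given normalization of the dual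
  curve is what forces surjectivity.\<close>

no_notation fps_nth (infixl "$" 75)

section \<open>Rank of abelian groups\<close>

text \<open>Gaussian elimination without division: \<open>M s\<close> is an integer row indexed by
  \<open>T\<close>, and a pivot row \<open>p\<close> with \<open>M p t\<close> nonzero clears the
  coordinate \<open>t\<close> from all other rows. A coordinate in which all rows vanish is simply
  dropped.\<close>

lemma integer_elimination:
  fixes M :: "'s \<Rightarrow> 't \<Rightarrow> int"
  assumes "finite T" "finite S" "card T < card S"
  shows "\<exists>c. (\<exists>s\<in>S. c s \<noteq> 0) \<and> (\<forall>t\<in>T. (\<Sum>s\<in>S. c s * M s t) = 0)"
  using assms
proof (induction T arbitrary: S M rule: finite_induct)
  case empty
  then have "S \<noteq> {}" by auto
  then show ?case by (intro exI[of _ "\<lambda>_. 1"]) auto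
next
  case (insert t T)
  show ?case
  proof (cases "\<forall>s\<in>S. M s t = 0")
    case True
    obtain c where c: "\<exists>s\<in>S. c s \<noteq> 0" "\<forall>t\<in>T. (\<Sum>s\<in>S. c s * M s t) = 0"
      using insert.IH[of S M] insert.prems insert.hyps by auto
    then show ?thesis using True by (intro exI[of _ c]) auto
  next
    case False
    then obtain p where p: "p \<in> S" "M p t \<noteq> 0" by auto
    define M' where "M' s u = M p t * M s u - M s t * M p u" for s u
    have "card T < card (S - {p})"
      using insert p by (simp add: card_Diff_singleton)
    then obtain c where c: "\<exists>s\<in>S - {p}. c s \<noteq> 0" "\<forall>u\<in>T. (\<Sum>s\<in>S - {p}. c s * M' s u) = 0"
      using insert.IH[of "S - {p}" M'] insert.prems by auto
    \<comment> \<open>The coefficient of the pivot is chosen so that a relation between the rows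
      \<open>M'\<close> becomes one between the rows \<open>M\<close>; multiplying the others by
      \<open>M p t\<close> keeps everything integral.\<close>
    define c' where "c' s = (if s = p then - (\<Sum>r\<in>S - {p}. c r * M r t) else c s * M p t)" for s
    have sum: "(\<Sum>s\<in>S. c' s * M s u) = (\<Sum>s\<in>S - {p}. c s * M' s u)" for u
    proof -
      have "(\<Sum>s\<in>S. c' s * M s u) = c' p * M p u + (\<Sum>s\<in>S - {p}. c' s * M s u)"
        using p insert.prems by (simp add: sum.remove)
      also have "(\<Sum>s\<in>S - {p}. c' s * M s u) = (\<Sum>s\<in>S - {p}. c s * M p t * M s u)"
        by (intro sum.cong) (auto simp: c'_def)
      also have "c' p * M p u = - (\<Sum>s\<in>S - {p}. c s * M s t * M p u)"
        by (simp add: c'_def sum_distrib_right)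
      finally show ?thesis
        by (simp add: M'_def right_diff_distrib sum_subtractf mult.assoc)
    qed
    have "\<forall>u\<in>insert t T. (\<Sum>s\<in>S. c' s * M s u) = 0"
      using c(2) sum by (auto simp: M'_def mult.commute)
    moreover have "\<exists>s\<in>S. c' s \<noteq> 0" using c(1) p by (auto simp: c'_def)
    ultimately show ?thesis by blast
  qed
qed

definition int_comb :: "('a, 'b) monoid_scheme \<Rightarrow> 'a set \<Rightarrow> ('a \<Rightarrow> int) \<Rightarrow> 'a" where
  "int_comb G S k = finprod G (\<lambda>x. x [^]\<^bsub>G\<^esub> k x) S"

definition int_indep :: "('a, 'b) monoid_scheme \<Rightarrow> 'a set \<Rightarrow> bool" where
  "int_indep G S \<longleftrightarrow> finite S \<and> S \<subseteq> carrier G \<and>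
     (\<forall>k. int_comb G S k = \<one>\<^bsub>G\<^esub> \<longrightarrow> (\<forall>x\<in>S. k x = 0))"

text \<open>Rank of a subset \<open>A\<close>, used for kernels and images inside the ambient group.
  The maximum has to be attained: a supremum of natural numbers says nothing when the sizes are
  unbounded.\<close>

definition rank_on :: "('a, 'b) monoid_scheme \<Rightarrow> 'a set \<Rightarrow> nat \<Rightarrow> bool" where
  "rank_on G A n \<longleftrightarrow> (\<forall>S. int_indep G S \<and> S \<subseteq> A \<longrightarrow> card S \<le> n) \<and>
     (\<exists>S. int_indep G S \<and> S \<subseteq> A \<and> card S = n)"

lemma rank_on_unique: "rank_on G A m \<Longrightarrow> rank_on G A n \<Longrightarrow> m = n"
  unfolding rank_on_def by (metis le_antisym)

lemma abelian_rank_eq: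
  assumes "rank_on G (carrier G) n"
  shows "abelian_rank G = n"
proof -
  have eq: "{card S |S. finite S \<and> S \<subseteq> carrier G \<and>
     (\<forall>k :: 'a \<Rightarrow> int. finprod G (\<lambda>x. x [^]\<^bsub>G\<^esub> k x) S = \<one>\<^bsub>G\<^esub> \<longrightarrow> (\<forall>x\<in>S. k x = 0))}
     = {card S |S. int_indep G S}"
    by (simp add: int_indep_def int_comb_def)
  have "n \<in> {card S |S. int_indep G S}"
    using assms unfolding rank_on_def by blast
  moreover have "m \<le> n" if "m \<in> {card S |S. int_indep G S}" for m
    using assms that unfolding rank_on_def by (auto simp: int_indep_def)
  ultimately show ?thesis unfolding abelian_rank_def eq
    by (rule cSup_eq_maximum) assumption
qed

lemma rank_on_exists:
  assumes "\<And>S. int_indep G S \<Longrightarrow> S \<subseteq> A \<Longrightarrow> card S \<le> N" "comm_group G"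
  shows "\<exists>n\<le>N. rank_on G A n"
proof -
  interpret comm_group G by fact
  let ?C = "{card S |S. int_indep G S \<and> S \<subseteq> A}"
  have "int_indep G {}" by (simp add: int_indep_def)
  then have ne: "0 \<in> ?C" by (force intro!: exI[of _ "{}"])
  have sub: "?C \<subseteq> {..N}" using assms by auto
  then have fin: "finite ?C" by (rule finite_subset) simp
  have "Max ?C \<in> ?C" using fin ne by (intro Max_in) auto
  then obtain S where S: "int_indep G S" "S \<subseteq> A" "card S = Max ?C" by auto
  have "\<forall>S. int_indep G S \<and> S \<subseteq> A \<longrightarrow> card S \<le> Max ?C" using fin by (auto intro!: Max_ge)
  then have "rank_on G A (Max ?C)" unfolding rank_on_def using S by blast
  moreover have "Max ?C \<le> N" using S sub fin ne by auto
  ultimately show ?thesis by blast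
qed

lemma rank_on_mono:
  assumes "rank_on G A n" "B \<subseteq> A" "comm_group G"
  shows "\<exists>m\<le>n. rank_on G B m"
proof (rule rank_on_exists)
  show "card S \<le> n" if "int_indep G S" "S \<subseteq> B" for S
    using assms that unfolding rank_on_def by blast
qed fact

context comm_group begin

lemma int_comb_closed [simp]: "S \<subseteq> carrier G \<Longrightarrow> int_comb G S k \<in> carrier G"
  unfolding int_comb_def by (intro finprod_closed) auto

lemma int_comb_zero: "(\<And>x. x \<in> S \<Longrightarrow> k x = 0) \<Longrightarrow> int_comb G S k = \<one>"
  unfolding int_comb_def by (intro finprod_one_eqI) auto

lemma int_comb_cong: "S \<subseteq> carrier G \<Longrightarrow> (\<And>x. x \<in> S \<Longrightarrow> k x = l x) \<Longrightarrow> int_comb G S k = int_comb G S l"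
  unfolding int_comb_def by (intro finprod_cong') auto

lemma int_comb_insert:
  "finite S \<Longrightarrow> x \<notin> S \<Longrightarrow> insert x S \<subseteq> carrier G \<Longrightarrow>
   int_comb G (insert x S) k = x [^] k x \<otimes> int_comb G S k"
  unfolding int_comb_def by (subst finprod_insert) auto

lemma int_comb_add: "S \<subseteq> carrier G \<Longrightarrow>
   int_comb G S (\<lambda>x. k x + l x) = int_comb G S k \<otimes> int_comb G S l"
  unfolding int_comb_def
  by (subst finprod_multf[symmetric], blast, blast) (intro finprod_cong', auto simp: int_pow_mult subset_iff)

lemma int_comb_mult: "S \<subseteq> carrier G \<Longrightarrow> int_comb G S (\<lambda>x. c * k x) = int_comb G S k [^] (c::int)"
proof (induction S rule: infinite_finite_induct)
  case (insert x F)
  then show ?case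
    by (simp add: int_comb_insert int_pow_mult_distrib m_comm int_pow_pow mult.commute)
qed (auto simp: int_comb_def)

lemma int_comb_Un:
  "finite S \<Longrightarrow> finite T \<Longrightarrow> S \<inter> T = {} \<Longrightarrow> S \<subseteq> carrier G \<Longrightarrow> T \<subseteq> carrier G \<Longrightarrow>
   int_comb G (S \<union> T) k = int_comb G S k \<otimes> int_comb G T k"
  unfolding int_comb_def by (subst finprod_Un_disjoint) auto

text \<open>Substitution with denominators: only the powers \<open>s [^] m s\<close> are
  combinations of \<open>T\<close>, and coefficients transform by the matrix
  \<open>K\<close>.\<close>

lemma int_comb_comb:
  assumes "finite S" "S \<subseteq> carrier G" "T \<subseteq> carrier G"
    "\<And>s. s \<in> S \<Longrightarrow> s [^] m s = int_comb G T (K s)"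
  shows "int_comb G S (\<lambda>s. c s * m s) = int_comb G T (\<lambda>t. \<Sum>s\<in>S. c s * K s t)"
  using assms(1,2,4)
proof (induction S rule: finite_induct)
  case empty
  then show ?case using assms(3) by (simp add: int_comb_zero) (simp add: int_comb_def)
next
  case (insert x F)
  have "int_comb G (insert x F) (\<lambda>s. c s * m s) = x [^] (c x * m x) \<otimes> int_comb G T (\<lambda>t. \<Sum>s\<in>F. c s * K s t)"
    using insert by (simp add: int_comb_insert)
  also have "x [^] (c x * m x) = int_comb G T (\<lambda>t. c x * K x t)"
    using insert assms(3) by (simp add: int_comb_mult flip: int_pow_pow) (metis int_pow_pow mult.commute)
  also have "\<dots> \<otimes> int_comb G T (\<lambda>t. \<Sum>s\<in>F. c s * K s t) = int_comb G T (\<lambda>t. c x * K x t + (\<Sum>s\<in>F. c s * K s t))"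
    using assms(3) by (simp add: int_comb_add)
  finally show ?case using insert by simp
qed

text \<open>Steinitz exchange over the rationals: \<open>T\<close> spans \<open>A\<close> only up to
  nonzero multiples. If \<open>S\<close> were larger than \<open>T\<close>, an integer relation
  between the rows \<open>K s\<close> would yield a relation between the elements of
  \<open>S\<close> with coefficients \<open>c s * m s\<close>, not all zero.\<close>

lemma indep_card_le:
  assumes T: "finite T" "T \<subseteq> carrier G"
    and span: "\<And>g. g \<in> A \<Longrightarrow> \<exists>m k. m \<noteq> 0 \<and> g [^] (m::int) = int_comb G T k"
    and S: "int_indep G S" "S \<subseteq> A"
  shows "card S \<le> card T"
proof (rule ccontr)
  assume "\<not> card S \<le> card T"
  then have lt: "card T < card S" by simp
  obtain m K where mK: "\<And>g. g \<in> A \<Longrightarrow> m g \<noteq> 0 \<and> g [^] (m g::int) = int_comb G T (K g)"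
    using span by metis
  have finS: "finite S" and SG: "S \<subseteq> carrier G" using S by (auto simp: int_indep_def)
  obtain c where c: "\<exists>s\<in>S. c s \<noteq> 0" "\<forall>t\<in>T. (\<Sum>s\<in>S. c s * K s t) = 0"
    using integer_elimination[OF T(1) finS lt, of K] by auto
  have "int_comb G S (\<lambda>s. c s * m s) = int_comb G T (\<lambda>t. \<Sum>s\<in>S. c s * K s t)"
    using finS SG T(2) mK S(2) by (intro int_comb_comb) auto
  also have "\<dots> = \<one>" using c T by (intro int_comb_zero) auto
  finally have one: "int_comb G S (\<lambda>s. c s * m s) = \<one>" .
  have "\<forall>k. int_comb G S k = \<one> \<longrightarrow> (\<forall>x\<in>S. k x = 0)" using S(1) unfolding int_indep_def by blast
  from this[rule_format, OF one] have "\<forall>s\<in>S. c s * m s = 0" by blast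
  then show False using c(1) mK S(2) by auto
qed

text \<open>Adding \<open>g\<close> to a maximal independent set creates a relation, and
  independence of \<open>S\<close> forces its coefficient at \<open>g\<close> to be nonzero. Over
  the integers only a multiple of \<open>g\<close> need lie in the span.\<close>

lemma maximal_indep_spans:
  assumes "rank_on G A (card S)" "int_indep G S" "S \<subseteq> A" "g \<in> A" "A \<subseteq> carrier G"
  shows "\<exists>m k. m \<noteq> 0 \<and> g [^] (m::int) = int_comb G S k"
proof (cases "g \<in> S")
  case True
  have SG: "finite S" "S \<subseteq> carrier G" using assms by (auto simp: int_indep_def)
  have *: "insert g (S - {g}) = S" using True by auto
  have "int_comb G (S - {g}) (\<lambda>x. if x = g then 1 else 0) = \<one>" by (rule int_comb_zero) auto
  then have "int_comb G (insert g (S - {g})) (\<lambda>x. if x = g then 1 else 0) = g \<otimes> \<one>"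
    using SG True by (subst int_comb_insert) auto
  then have "int_comb G S (\<lambda>x. if x = g then 1 else 0) = g [^] (1::int)"
    using * assms by (auto simp: subset_iff)
  then show ?thesis by (metis zero_neq_one)
next
  case False
  have SG: "finite S" "S \<subseteq> carrier G" "g \<in> carrier G" using assms by (auto simp: int_indep_def)
  have "\<not> int_indep G (insert g S)"
    using assms(1,3,4) False SG unfolding rank_on_def by (metis card_insert_disjoint insert_subset not_less_eq_eq order_refl)
  then obtain k where k: "int_comb G (insert g S) k = \<one>" "\<exists>x\<in>insert g S. k x \<noteq> 0"
    using SG unfolding int_indep_def by auto
  have eq: "g [^] k g \<otimes> int_comb G S k = \<one>"
    using k(1) SG False by (simp add: int_comb_insert)
  have "k g \<noteq> 0"
  proof
    assume "k g = 0"
    then have "int_comb G S k = \<one>" using eq SG by simp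
    then show False using assms(2) k(2) \<open>k g = 0\<close> by (auto simp: int_indep_def)
  qed
  moreover have "g [^] k g = inv (int_comb G S k)"
    using eq SG by (simp add: inv_equality)
  then have "g [^] k g = int_comb G S (\<lambda>x. (-1) * k x)"
    using SG by (simp only: int_comb_mult int_pow_neg int_comb_closed int_pow_1)
  ultimately show ?thesis by blast
qed

end

section \<open>Rank and nullity of a homomorphism\<close>

lemma int_comb_hom:
  assumes "comm_group G" "comm_group H" "f \<in> hom G H" "S \<subseteq> carrier G" "inj_on f S"
  shows "int_comb H (f ` S) k = f (int_comb G S (\<lambda>x. k (f x)))"
proof -
  interpret G: comm_group G by fact
  interpret H: comm_group H by fact
  interpret group_hom G H f by (unfold_locales) (use assms in auto)
  show ?thesis using assms(4,5)
  proof (induction S rule: infinite_finite_induct)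
    case (infinite A)
    then show ?case by (simp add: int_comb_def finite_image_iff)
  next
    case (insert x F)
    then have *: "int_comb H (f ` F) k = f (int_comb G F (\<lambda>x. k (f x)))" by auto
    have "int_comb H (f ` insert x F) k = f x [^]\<^bsub>H\<^esub> k (f x) \<otimes>\<^bsub>H\<^esub> int_comb H (f ` F) k"
      using insert.hyps insert.prems by (simp, subst H.int_comb_insert) auto
    also have "\<dots> = f (int_comb G (insert x F) (\<lambda>x. k (f x)))"
      using insert.hyps insert.prems * by (simp add: G.int_comb_insert hom_int_pow)
    finally show ?case .
  qed (simp add: int_comb_def)
qed

text \<open>An independent set \<open>S\<close> of the kernel and lifts \<open>T\<close> of an
  independent set of the image form an independent set, because applying \<open>f\<close> first
  kills the part in \<open>S\<close>. They span up to multiples, because a multiple of any element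
  differs from a combination of \<open>T\<close> by an element of the kernel.\<close>

lemma rank_on_hom:
  assumes G: "comm_group G" and H: "comm_group H" and f: "f \<in> hom G H"
    and a: "rank_on G (kernel G H f) a" and b: "rank_on H (f ` carrier G) b"
  shows "rank_on G (carrier G) (a + b)"
proof -
  interpret G: comm_group G by fact
  interpret H: comm_group H by fact
  interpret group_hom G H f by (unfold_locales) (use assms in auto)
  obtain S where S: "int_indep G S" "S \<subseteq> kernel G H f" "card S = a"
    using a by (auto simp: rank_on_def)
  obtain T' where T': "int_indep H T'" "T' \<subseteq> f ` carrier G" "card T' = b"
    using b by (auto simp: rank_on_def)
  obtain T where T: "T \<subseteq> carrier G" "inj_on f T" "f ` T = T'"
    by (metis T'(2) subset_image_inj)
  have fin: "finite S" "finite T" using S T' T by (auto simp: int_indep_def finite_image_iff)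
  have SG: "S \<subseteq> carrier G" using S by (auto simp: int_indep_def)
  have fS: "f x = \<one>\<^bsub>H\<^esub>" if "x \<in> S" for x using S that by (auto simp: kernel_def)
  have ker_comb: "f (int_comb G S k) = \<one>\<^bsub>H\<^esub>" for k
    using fin(1) SG fS
  proof (induction S rule: finite_induct)
    case (insert x F)
    then show ?case by (simp add: G.int_comb_insert hom_int_pow)
  qed (simp add: int_comb_def)
  have kT: "\<forall>x\<in>T. k x = 0" if "f (int_comb G T k) = \<one>\<^bsub>H\<^esub>" for k
  proof -
    define l where "l y = k (the_inv_into T f y)" for y
    have "int_comb G T k = int_comb G T (\<lambda>x. l (f x))"
      using T by (intro G.int_comb_cong) (auto simp: l_def the_inv_into_f_f)
    then have "int_comb H T' l = \<one>\<^bsub>H\<^esub>"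
      using that int_comb_hom[OF G H f T(1,2), of l] T(3) by simp
    then have "\<forall>y\<in>T'. l y = 0" using T'(1) by (auto simp: int_indep_def)
    then show ?thesis using T by (auto simp: l_def the_inv_into_f_f)
  qed
  have disj: "S \<inter> T = {}"
  proof (rule ccontr)
    assume "S \<inter> T \<noteq> {}"
    then obtain x where x: "x \<in> S" "x \<in> T" by auto
    have "T = insert x (T - {x})" using x by auto
    then have "int_comb G T (\<lambda>y. if y = x then 1 else 0) = x [^]\<^bsub>G\<^esub> (1::int) \<otimes>\<^bsub>G\<^esub> int_comb G (T - {x}) (\<lambda>y. if y = x then 1 else 0)"
      using G.int_comb_insert[of "T - {x}" x "\<lambda>y. if y = x then 1 else 0"] fin T x by (simp add: insert_absorb)
    also have "int_comb G (T - {x}) (\<lambda>y. if y = x then 1 else 0) = \<one>\<^bsub>G\<^esub>"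
      by (rule G.int_comb_zero) auto
    finally have "int_comb G T (\<lambda>y. if y = x then 1 else 0) = x" using x T by auto
    with kT[of "\<lambda>y. if y = x then 1 else 0"] fS[OF x(1)] x show False by auto
  qed
  have ind: "int_indep G (S \<union> T)"
    unfolding int_indep_def
  proof (intro conjI allI impI)
    fix k assume k: "int_comb G (S \<union> T) k = \<one>\<^bsub>G\<^esub>"
    then have eq: "int_comb G S k \<otimes>\<^bsub>G\<^esub> int_comb G T k = \<one>\<^bsub>G\<^esub>"
      using fin disj SG T by (simp add: G.int_comb_Un)
    have "f (int_comb G S k) \<otimes>\<^bsub>H\<^esub> f (int_comb G T k) = \<one>\<^bsub>H\<^esub>"
      using eq SG T by (metis G.int_comb_closed hom_mult hom_one)
    then have "f (int_comb G T k) = \<one>\<^bsub>H\<^esub>" using ker_comb T by simp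
    then have k0: "\<forall>x\<in>T. k x = 0" by (rule kT)
    then have "int_comb G T k = \<one>\<^bsub>G\<^esub>" by (intro G.int_comb_zero) auto
    then have "int_comb G S k = \<one>\<^bsub>G\<^esub>" using eq SG by simp
    then have "\<forall>x\<in>S. k x = 0" using S by (auto simp: int_indep_def)
    with k0 show "\<forall>x\<in>S \<union> T. k x = 0" by auto
  qed (use fin SG T in auto)
  have card: "card (S \<union> T) = a + b"
    using fin disj S(3) T'(3) T by (simp add: card_Un_disjoint) (metis card_image)
  have span: "\<exists>m k. m \<noteq> 0 \<and> g [^]\<^bsub>G\<^esub> (m::int) = int_comb G (S \<union> T) k" if g: "g \<in> carrier G" for g
  proof -
    obtain m k where mk: "m \<noteq> 0" "f g [^]\<^bsub>H\<^esub> (m::int) = int_comb H T' k"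
      using H.maximal_indep_spans[of "f ` carrier G" T' "f g"] b T' g by fastforce
    define h where "h = g [^]\<^bsub>G\<^esub> m \<otimes>\<^bsub>G\<^esub> inv\<^bsub>G\<^esub> int_comb G T (\<lambda>x. k (f x))"
    have "f h = \<one>\<^bsub>H\<^esub>"
    proof -
      have "f (int_comb G T (\<lambda>x. k (f x))) = f g [^]\<^bsub>H\<^esub> m"
        using mk(2) int_comb_hom[OF G H f T(1,2), of k] T(3) by simp
      then show ?thesis using T(1) g by (simp add: h_def hom_int_pow)
    qed
    then have hk: "h \<in> kernel G H f" using g T by (auto simp: kernel_def h_def)
    then obtain m' k' where mk': "m' \<noteq> 0" "h [^]\<^bsub>G\<^esub> (m'::int) = int_comb G S k'"
      using G.maximal_indep_spans[of "kernel G H f" S h] a S by (auto simp: kernel_def)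
    \<comment> \<open>Both denominators are cleared: \<open>m\<close> comes from the image and
      \<open>m'\<close> from the kernel, so \<open>m * m'\<close> works for
      \<open>g\<close>.\<close>
    define l where "l x = (if x \<in> S then k' x else m' * k (f x))" for x
    have "g [^]\<^bsub>G\<^esub> m = h \<otimes>\<^bsub>G\<^esub> int_comb G T (\<lambda>x. k (f x))"
      unfolding h_def using g T by (simp add: G.m_assoc)
    then have "g [^]\<^bsub>G\<^esub> (m * m') = (h \<otimes>\<^bsub>G\<^esub> int_comb G T (\<lambda>x. k (f x))) [^]\<^bsub>G\<^esub> m'"
      using g by (simp flip: G.int_pow_pow)
    also have "\<dots> = h [^]\<^bsub>G\<^esub> m' \<otimes>\<^bsub>G\<^esub> int_comb G T (\<lambda>x. k (f x)) [^]\<^bsub>G\<^esub> m'"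
      using hk T by (intro G.int_pow_mult_distrib) (auto simp: kernel_def G.m_comm)
    also have "\<dots> = int_comb G S l \<otimes>\<^bsub>G\<^esub> int_comb G T l"
    proof -
      have "int_comb G S k' = int_comb G S l" using SG by (intro G.int_comb_cong) (auto simp: l_def)
      moreover have "int_comb G T (\<lambda>x. m' * k (f x)) = int_comb G T l"
        using T disj by (intro G.int_comb_cong) (auto simp: l_def)
      ultimately show ?thesis using T mk' by (simp add: G.int_comb_mult)
    qed
    also have "\<dots> = int_comb G (S \<union> T) l" using fin disj SG T by (simp add: G.int_comb_Un)
    finally show ?thesis using mk(1) mk'(1) by (intro exI[of _ "m * m'"] exI[of _ l]) auto
  qed
  show ?thesis
    unfolding rank_on_def
  proof (intro conjI allI impI)
    fix U assume "int_indep G U \<and> U \<subseteq> carrier G"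
    then have "card U \<le> card (S \<union> T)"
      using fin SG T span by (intro G.indep_card_le[of _ "carrier G"]) auto
    then show "card U \<le> a + b" using card by simp
  qed (use ind card SG T in auto)
qed

text \<open>For use when only the rank of the source is known: independent sets of the kernel and of
  the image are no larger than those of \<open>G\<close>, in the case of the image because lifts of
  independent elements remain independent.\<close>

lemma rank_on_hom_exists:
  assumes G: "comm_group G" and H: "comm_group H" and f: "f \<in> hom G H"
    and n: "rank_on G (carrier G) n"
  shows "\<exists>a b. rank_on G (kernel G H f) a \<and> rank_on H (f ` carrier G) b \<and> n = a + b"
proof -
  have "kernel G H f \<subseteq> carrier G" by (auto simp: kernel_def)
  then obtain a where a: "rank_on G (kernel G H f) a" using rank_on_mono[OF n _ G] by blast
  have "card T' \<le> n" if T': "int_indep H T'" "T' \<subseteq> f ` carrier G" for T'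
  proof -
    obtain T where T: "T \<subseteq> carrier G" "inj_on f T" "f ` T = T'"
      by (metis T'(2) subset_image_inj)
    interpret G: comm_group G by fact
    interpret H: comm_group H by fact
    interpret group_hom G H f by (unfold_locales) (use assms in auto)
    have "int_indep G T"
      unfolding int_indep_def
    proof (intro conjI allI impI)
      show "finite T" using T' T by (auto simp: int_indep_def finite_image_iff)
      fix k assume k: "int_comb G T k = \<one>\<^bsub>G\<^esub>"
      define l where "l y = k (the_inv_into T f y)" for y
      have "int_comb G T k = int_comb G T (\<lambda>x. l (f x))"
        using T by (intro G.int_comb_cong) (auto simp: l_def the_inv_into_f_f)
      then have "int_comb H T' l = \<one>\<^bsub>H\<^esub>"
        using k int_comb_hom[OF G H f T(1,2), of l] T(3) by (metis hom_one)
      then have "\<forall>y\<in>T'. l y = 0" using T'(1) by (auto simp: int_indep_def)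
      then show "\<forall>x\<in>T. k x = 0" using T by (auto simp: l_def the_inv_into_f_f)
    qed (use T in auto)
    then have "card T \<le> n" using n T by (auto simp: rank_on_def)
    then show ?thesis using T card_image by metis
  qed
  then obtain b where b: "rank_on H (f ` carrier G) b" using rank_on_exists[OF _ H] by metis
  show ?thesis using a b rank_on_hom[OF G H f a b] rank_on_unique[OF n] by blast
qed

section \<open>Euler characteristics and exact sequences\<close>

text \<open>Degrees run over the integers, as in the axioms of homology. Ranks vanish outside a
  finite range, so that alternating sums are finite and telescoping sums have vanishing
  ends.\<close>

definition graded_ranks :: "(int \<Rightarrow> ('a, 'b) monoid_scheme) \<Rightarrow> (int \<Rightarrow> nat) \<Rightarrow> bool" where
  "graded_ranks H r \<longleftrightarrow> (\<forall>p. comm_group (H p) \<and> rank_on (H p) (carrier (H p)) (r p)) \<and>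
     (\<exists>N::nat. \<forall>p. p < 0 \<or> p > int N \<longrightarrow> r p = 0)"

definition alternating_sum :: "(int \<Rightarrow> nat) \<Rightarrow> int" where
  "alternating_sum r = (\<Sum>p | r (int p) \<noteq> 0. (-1) ^ p * int (r (int p)))"

lemma alternating_sum_eq:
  assumes "\<And>p. p > int N \<Longrightarrow> r p = 0"
  shows "alternating_sum r = (\<Sum>p\<le>N. (-1) ^ p * int (r (int p)))"
  unfolding alternating_sum_def
proof (rule sum.mono_neutral_cong_left)
  show "{p. r (int p) \<noteq> 0} \<subseteq> {..N}"
    using assms by (metis (mono_tags, lifting) atMost_iff linorder_not_le mem_Collect_eq of_nat_less_iff subsetI)
qed auto

text \<open>\<open>\<alpha>\<close>, \<open>\<beta>\<close> and \<open>\<delta>\<close> are the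
  ranks of the images of the three maps of the sequence, so that rank and nullity split each term
  into two. The contributions of \<open>\<delta>\<close> cancel between neighbouring degrees, up to
  \<open>\<delta> 0\<close> and \<open>\<delta> (N + 1)\<close>, which both vanish.\<close>

lemma alternating_sum_long_exact:
  assumes a: "\<And>p. a p = \<delta> (p + 1) + \<alpha> p" and b: "\<And>p. b p = \<alpha> p + \<beta> p" and c: "\<And>p. c p = \<beta> p + \<delta> p"
    and N: "\<And>p. p < 0 \<or> p > int N \<Longrightarrow> a p = 0 \<and> b p = 0 \<and> c p = 0"
  shows "alternating_sum b = alternating_sum a + alternating_sum c"
proof -
  have tel: "(\<Sum>p\<le>M. (-1) ^ p * (int (\<delta> (int p + 1)) + int (\<delta> (int p)))) = int (\<delta> 0) + (-1) ^ M * int (\<delta> (int M + 1))" for M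
    by (induction M) (auto simp: algebra_simps)
  \<comment> \<open>\<open>\<delta> 0\<close> is a summand of the rank of the first term in degree
    -1.\<close>
  have "\<delta> 0 = 0" using a[of "-1"] N[of "-1"] by simp
  moreover have "\<delta> (int N + 1) = 0" using c[of "int N + 1"] N[of "int N + 1"] by simp
  ultimately have 0: "(\<Sum>p\<le>N. (-1) ^ p * (int (\<delta> (int p + 1)) + int (\<delta> (int p)))) = 0"
    using tel[of N] by simp
  have "alternating_sum a + alternating_sum c = (\<Sum>p\<le>N. (-1) ^ p * int (a (int p)) + (-1) ^ p * int (c (int p)))"
    using N by (simp add: alternating_sum_eq[of N] sum.distrib)
  also have "\<dots> = (\<Sum>p\<le>N. (-1) ^ p * int (b (int p)) + (-1) ^ p * (int (\<delta> (int p + 1)) + int (\<delta> (int p))))"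
    by (intro sum.cong) (auto simp: a b c algebra_simps)
  also have "\<dots> = alternating_sum b"
    using N 0 by (simp add: alternating_sum_eq[of N] sum.distrib)
  finally show ?thesis by simp
qed

locale long_exact =
  fixes A B C :: "int \<Rightarrow> ('a, 'b) monoid_scheme" and i j d
  assumes grp: "\<And>p. comm_group (A p)" "\<And>p. comm_group (B p)" "\<And>p. comm_group (C p)"
    and hom: "\<And>p. i p \<in> hom (A p) (B p)" "\<And>p. j p \<in> hom (B p) (C p)" "\<And>p. d p \<in> hom (C p) (A (p - 1))"
    and exact: "\<And>p. kernel (B p) (C p) (j p) = i p ` carrier (A p)"
      "\<And>p. kernel (C p) (A (p - 1)) (d p) = j p ` carrier (B p)"
      "\<And>p. kernel (A p) (B p) (i p) = d (p + 1) ` carrier (C (p + 1))"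
begin

text \<open>Two out of three: finite ranks of the outer terms give those of the middle one.
  Exactness identifies the kernel of \<open>i p\<close> with the image of \<open>d (p + 1)\<close>,
  hence the shift between \<open>\<delta>'\<close> and \<open>\<delta>\<close>.\<close>

lemma ranks_B:
  assumes A: "graded_ranks A a" and C: "graded_ranks C c"
  shows "\<exists>b. graded_ranks B b \<and> alternating_sum b = alternating_sum a + alternating_sum c"
proof -
  have "\<exists>u v. rank_on (A p) (kernel (A p) (B p) (i p)) u \<and> rank_on (B p) (i p ` carrier (A p)) v \<and> a p = u + v" for p
    using A grp hom by (intro rank_on_hom_exists) (auto simp: graded_ranks_def)
  then obtain \<delta>' \<alpha> where 1: "\<And>p. rank_on (A p) (kernel (A p) (B p) (i p)) (\<delta>' p)"
      "\<And>p. rank_on (B p) (i p ` carrier (A p)) (\<alpha> p)" "\<And>p. a p = \<delta>' p + \<alpha> p" by metis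
  have "\<exists>u v. rank_on (C p) (kernel (C p) (A (p - 1)) (d p)) u \<and> rank_on (A (p - 1)) (d p ` carrier (C p)) v \<and> c p = u + v" for p
    using C grp hom by (intro rank_on_hom_exists) (auto simp: graded_ranks_def)
  then obtain \<beta> \<delta> where 2: "\<And>p. rank_on (C p) (kernel (C p) (A (p - 1)) (d p)) (\<beta> p)"
      "\<And>p. rank_on (A (p - 1)) (d p ` carrier (C p)) (\<delta> p)" "\<And>p. c p = \<beta> p + \<delta> p" by metis
  have \<delta>: "\<delta>' p = \<delta> (p + 1)" for p
    using 1(1)[of p] 2(2)[of "p + 1"] exact(3)[of p] by (auto intro: rank_on_unique)
  have B: "rank_on (B p) (carrier (B p)) (\<alpha> p + \<beta> p)" for p
    using 1(2)[of p] 2(1)[of p] exact grp hom by (intro rank_on_hom[where f = "j p" and H = "C p"]) auto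
  obtain N M where N: "\<And>p. p < 0 \<or> p > int N \<Longrightarrow> a p = 0" and M: "\<And>p. p < 0 \<or> p > int M \<Longrightarrow> c p = 0"
    using A C unfolding graded_ranks_def by metis
  have a: "a p = 0" and c: "c p = 0" if "p < 0 \<or> p > int (max N M)" for p
    using N[of p] M[of p] that by auto
  have b: "\<alpha> p + \<beta> p = 0" if "p < 0 \<or> p > int (max N M)" for p
    using a[OF that] c[OF that] 1(3)[of p] 2(3)[of p] by simp
  have "graded_ranks B (\<lambda>p. \<alpha> p + \<beta> p)"
    unfolding graded_ranks_def using B grp b by blast
  moreover have "alternating_sum (\<lambda>p. \<alpha> p + \<beta> p) = alternating_sum a + alternating_sum c"
    by (rule alternating_sum_long_exact[where \<delta> = \<delta> and \<alpha> = \<alpha> and \<beta> = \<beta> and N = "max N M"])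
       (use 1(3) 2(3) \<delta> a b c in auto)
  ultimately show ?thesis by blast
qed

lemma ranks_C:
  assumes A: "graded_ranks A a" and B: "graded_ranks B b"
  shows "\<exists>c. graded_ranks C c \<and> alternating_sum b = alternating_sum a + alternating_sum c"
proof -
  have "\<exists>u v. rank_on (A p) (kernel (A p) (B p) (i p)) u \<and> rank_on (B p) (i p ` carrier (A p)) v \<and> a p = u + v" for p
    using A grp hom by (intro rank_on_hom_exists) (auto simp: graded_ranks_def)
  then obtain \<delta>' \<alpha> where 1: "\<And>p. rank_on (A p) (kernel (A p) (B p) (i p)) (\<delta>' p)"
      "\<And>p. rank_on (B p) (i p ` carrier (A p)) (\<alpha> p)" "\<And>p. a p = \<delta>' p + \<alpha> p" by metis
  have "\<exists>u v. rank_on (B p) (kernel (B p) (C p) (j p)) u \<and> rank_on (C p) (j p ` carrier (B p)) v \<and> b p = u + v" for p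
    using B grp hom by (intro rank_on_hom_exists) (auto simp: graded_ranks_def)
  then obtain \<alpha>' \<beta> where 2: "\<And>p. rank_on (B p) (kernel (B p) (C p) (j p)) (\<alpha>' p)"
      "\<And>p. rank_on (C p) (j p ` carrier (B p)) (\<beta> p)" "\<And>p. b p = \<alpha>' p + \<beta> p" by metis
  define \<delta> where "\<delta> p = \<delta>' (p - 1)" for p
  have \<alpha>: "\<alpha>' p = \<alpha> p" for p
    using 1(2)[of p] 2(1)[of p] exact(1)[of p] by (auto intro: rank_on_unique)
  have im: "rank_on (A (p - 1)) (d p ` carrier (C p)) (\<delta> p)" for p
    using 1(1)[of "p - 1"] exact(3)[of "p - 1"] by (simp add: \<delta>_def)
  have C: "rank_on (C p) (carrier (C p)) (\<beta> p + \<delta> p)" for p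
    using im[of p] 2(2)[of p] exact grp hom by (intro rank_on_hom[where f = "d p" and H = "A (p - 1)"]) auto
  obtain N M where N: "\<And>p. p < 0 \<or> p > int N \<Longrightarrow> a p = 0" and M: "\<And>p. p < 0 \<or> p > int M \<Longrightarrow> b p = 0"
    using A B unfolding graded_ranks_def by metis
  \<comment> \<open>One degree is added because \<open>c p\<close> also contains a part of
    \<open>a (p - 1)\<close>.\<close>
  have a: "a p = 0" and b: "b p = 0" if "p < 0 \<or> p > int (Suc (max N M))" for p
    using N[of p] M[of p] that by auto
  have c: "\<beta> p + \<delta> p = 0" if "p < 0 \<or> p > int (Suc (max N M))" for p
  proof -
    have "a (p - 1) = 0" using N[of "p - 1"] that by auto
    then show ?thesis using b[OF that] 1(3)[of "p - 1"] 2(3)[of p] by (simp add: \<delta>_def)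
  qed
  have "graded_ranks C (\<lambda>p. \<beta> p + \<delta> p)"
    unfolding graded_ranks_def using C grp c by blast
  moreover have "alternating_sum b = alternating_sum a + alternating_sum (\<lambda>p. \<beta> p + \<delta> p)"
    by (rule alternating_sum_long_exact[where \<delta> = \<delta> and \<alpha> = \<alpha> and \<beta> = \<beta> and N = "Suc (max N M)"])
       (use 1(3) 2(3) \<alpha> a b c in \<open>auto simp: \<delta>_def\<close>)
  ultimately show ?thesis by blast
qed

end

section \<open>The Euler characteristic of a space\<close>

lemma long_exact_homology:
  "long_exact (\<lambda>p. homology_group p (subtopology X S)) (\<lambda>p. homology_group p X)
     (\<lambda>p. relative_homology_group p X S)
     (\<lambda>p. hom_induced p (subtopology X S) {} X {} id) (\<lambda>p. hom_induced p X {} X S id)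
     (\<lambda>p. hom_boundary p X S)"
proof (unfold long_exact_def, intro conjI allI)
  fix p :: int
  show "kernel (homology_group p X) (relative_homology_group p X S) (hom_induced p X {} X S id) =
        hom_induced p (subtopology X S) {} X {} id ` carrier (homology_group p (subtopology X S))"
    using homology_exactness_axiom_3[of p X S] by simp
  show "kernel (relative_homology_group p X S) (homology_group (p - 1) (subtopology X S)) (hom_boundary p X S) =
        hom_induced p X {} X S id ` carrier (homology_group p X)"
    using homology_exactness_axiom_1[of p X S] by simp
  show "kernel (homology_group p (subtopology X S)) (homology_group p X) (hom_induced p (subtopology X S) {} X {} id) =
        hom_boundary (p + 1) X S ` carrier (relative_homology_group (p + 1) X S)"
    using homology_exactness_axiom_2[of "p + 1" X S] by simp
qed (simp_all add: hom_induced_hom hom_boundary_hom abelian_homology_group)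

lemma rank_on_iso:
  assumes H: "comm_group H" "rank_on H (carrier H) r" and H': "comm_group H'" and "H \<cong> H'"
  shows "rank_on H' (carrier H') r"
proof -
  obtain f where f: "f \<in> iso H H'" using assms(4) by (auto simp: is_iso_def)
  interpret H: comm_group H by fact
  interpret H': comm_group H' by fact
  interpret group_hom H H' f by (unfold_locales) (use f in \<open>auto simp: iso_def\<close>)
  have im: "f ` carrier H = carrier H'" and ker: "kernel H H' f = {\<one>\<^bsub>H\<^esub>}"
    using f by (auto simp: iso_def bij_betw_def inj_iff_trivial_ker)
  obtain a b where ab: "rank_on H {\<one>\<^bsub>H\<^esub>} a" "rank_on H' (carrier H') b" "r = a + b"
    using rank_on_hom_exists[OF H(1) H' homh H(2)] unfolding im ker by auto
  have "a = 0"
  proof -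
    obtain S where S: "int_indep H S" "S \<subseteq> {\<one>\<^bsub>H\<^esub>}" "card S = a" using ab by (auto simp: rank_on_def)
    have "int_comb H {\<one>\<^bsub>H\<^esub>} (\<lambda>_. 1) = \<one>\<^bsub>H\<^esub>" by (simp add: int_comb_def)
    then have "\<not> int_indep H {\<one>\<^bsub>H\<^esub>}" unfolding int_indep_def by (metis singletonI zero_neq_one)
    then have "S = {}" using S by (metis subset_singletonD)
    then show ?thesis using S by simp
  qed
  then show ?thesis using ab by simp
qed

lemma graded_ranks_iso:
  assumes "graded_ranks H r" "\<And>p. comm_group (H' p)" "\<And>p. H p \<cong> H' p"
  shows "graded_ranks H' r"
  using assms rank_on_iso[of "H p" "r p" "H' p" for p] unfolding graded_ranks_def by blast

text \<open>Unlike \<open>euler_characteristic\<close>, which is a number for every space, this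
  records that all ranks are finite and almost all vanish; in this form the invariant is
  additive.\<close>

definition has_euler :: "'a topology \<Rightarrow> int \<Rightarrow> bool" where
  "has_euler X n \<longleftrightarrow> (\<exists>r. graded_ranks (\<lambda>p. homology_group p X) r \<and> alternating_sum r = n)"

lemma has_euler_imp: "has_euler X n \<Longrightarrow> euler_characteristic X = n"
proof -
  assume "has_euler X n"
  then obtain r where r: "graded_ranks (\<lambda>p. homology_group p X) r" "alternating_sum r = n"
    unfolding has_euler_def by auto
  have "abelian_rank (homology_group (int p) X) = r (int p)" for p
    using r(1) unfolding graded_ranks_def by (intro abelian_rank_eq) auto
  then show ?thesis using r(2) by (simp add: euler_characteristic_def betti_def alternating_sum_def)
qed

lemma has_euler_homotopy:
  assumes "has_euler X n" "X homotopy_equivalent_space Y"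
  shows "has_euler Y n"
proof -
  obtain r where r: "graded_ranks (\<lambda>p. homology_group p X) r" "alternating_sum r = n"
    using assms unfolding has_euler_def by auto
  have "graded_ranks (\<lambda>p. homology_group p Y) r"
    by (rule graded_ranks_iso[OF r(1)])
       (simp_all add: abelian_homology_group homotopy_equivalent_space_imp_isomorphic_homology_groups assms(2))
  then show ?thesis using r(2) unfolding has_euler_def by auto
qed

lemma has_euler_homeomorphic: "has_euler X n \<Longrightarrow> X homeomorphic_space Y \<Longrightarrow> has_euler Y n"
  using has_euler_homotopy homeomorphic_imp_homotopy_equivalent_space by blast

lemma rank_on_trivial:
  assumes "comm_group G" "trivial_group G"
  shows "rank_on G (carrier G) 0"
proof -
  interpret comm_group G by fact
  have "S = {}" if "int_indep G S" for S
  proof (rule ccontr)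
    assume "S \<noteq> {}"
    moreover have "S \<subseteq> {\<one>\<^bsub>G\<^esub>}" using that assms(2) by (auto simp: int_indep_def trivial_group_def)
    moreover have "int_comb G S (\<lambda>_. 1) = \<one>\<^bsub>G\<^esub>"
      unfolding int_comb_def by (rule finprod_one_eqI) (use \<open>S \<subseteq> {\<one>\<^bsub>G\<^esub>}\<close> in auto)
    ultimately show False using that unfolding int_indep_def by (metis all_not_in_conv zero_neq_one)
  qed
  moreover have "int_indep G {}" by (simp add: int_indep_def)
  ultimately show ?thesis by (force simp: rank_on_def)
qed

lemma has_euler_empty:
  assumes "topspace X = {}" shows "has_euler X 0"
  unfolding has_euler_def
  by (rule exI[of _ "\<lambda>_. 0"])
     (auto simp: graded_ranks_def alternating_sum_def abelian_homology_group assms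
        intro!: rank_on_trivial trivial_homology_group_empty)

lemma rank_on_integer_group: "rank_on integer_group (carrier integer_group) 1"
proof -
  interpret comm_group integer_group by (rule abelian_integer_group)
  have pow: "x [^]\<^bsub>integer_group\<^esub> (k::int) = k * x" for x k :: int
    by simp
  have ind: "int_indep integer_group {1}"
    by (auto simp: int_indep_def int_comb_def pow)
  have "card S \<le> card {1::int}" if "int_indep integer_group S" for S
  proof (rule indep_card_le[of _ UNIV])
    fix g :: int
    show "\<exists>m k. m \<noteq> 0 \<and> g [^]\<^bsub>integer_group\<^esub> (m::int) = int_comb integer_group {1} k"
      by (rule exI[of _ 1], rule exI[of _ "\<lambda>_. g"]) (auto simp: int_comb_def pow)
  qed (use that in auto)
  then show ?thesis using ind by (auto simp: rank_on_def intro!: exI[of _ "{1}"])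
qed

lemma has_euler_singleton:
  assumes "topspace X = {a}" shows "has_euler X 1"
proof -
  have "rank_on (homology_group 0 X) (carrier (homology_group 0 X)) 1"
  proof (rule rank_on_iso[OF abelian_integer_group rank_on_integer_group abelian_homology_group])
    show "integer_group \<cong> homology_group 0 X"
      by (rule group.iso_sym[OF _ homology_coefficients[OF assms]]) simp
  qed
  then have "graded_ranks (\<lambda>p. homology_group p X) (\<lambda>p. if p = 0 then 1 else 0)"
    by (auto simp: graded_ranks_def abelian_homology_group
        intro!: rank_on_trivial homology_dimension_axiom[OF assms])
  moreover have "alternating_sum (\<lambda>p. if p = 0 then 1 else 0) = 1"
    by (subst alternating_sum_eq[of 0]) auto
  ultimately show ?thesis unfolding has_euler_def by blast
qed

lemma has_euler_contractible:
  assumes "contractible_space X" "topspace X \<noteq> {}" shows "has_euler X 1"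
proof -
  have "X \<noteq> trivial_topology" using assms(2) by auto
  then obtain a where a: "a \<in> topspace X" "X homotopy_equivalent_space (subtopology X {a})"
    using assms(1) unfolding contractible_eq_homotopy_equivalent_singleton_subtopology by auto
  have "has_euler (subtopology X {a}) 1" using a by (intro has_euler_singleton[of _ a]) auto
  then show ?thesis using a(2) has_euler_homotopy homotopy_equivalent_space_sym by metis
qed

text \<open>By excision both pairs \<open>(X, A)\<close> and \<open>(B, A \<inter> B)\<close> have the same Euler characteristic.\<close>

lemma has_euler_Un:
  assumes "openin X A" "openin X B" "has_euler (subtopology X A) a" "has_euler (subtopology X B) b"
    "has_euler (subtopology X (A \<inter> B)) c"
  shows "has_euler (subtopology X (A \<union> B)) (a + b - c)"
proof -
  define Y where "Y = subtopology X (A \<union> B)"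
  have AB: "openin Y A" "openin Y B" "topspace Y = A \<union> B"
    using assms(1,2) openin_subset unfolding Y_def by (auto simp: openin_open_subtopology openin_Un)
  have sub: "subtopology Y A = subtopology X A" "subtopology Y B = subtopology X B"
    "subtopology (subtopology Y B) A = subtopology X (A \<inter> B)"
  proof -
    have *: "(A \<union> B) \<inter> A = A" "(A \<union> B) \<inter> B = B" "B \<inter> A = A \<inter> B" by auto
    show "subtopology Y A = subtopology X A" "subtopology Y B = subtopology X B"
      "subtopology (subtopology Y B) A = subtopology X (A \<inter> B)"
      unfolding Y_def by (simp_all only: subtopology_subtopology *)
  qed
  obtain ra rb rc where r: "graded_ranks (\<lambda>p. homology_group p (subtopology Y A)) ra" "alternating_sum ra = a"
     "graded_ranks (\<lambda>p. homology_group p (subtopology Y B)) rb" "alternating_sum rb = b"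
     "graded_ranks (\<lambda>p. homology_group p (subtopology (subtopology Y B) A)) rc" "alternating_sum rc = c"
    using assms(3-5) sub unfolding has_euler_def by metis
  interpret B: long_exact "\<lambda>p. homology_group p (subtopology (subtopology Y B) A)"
     "\<lambda>p. homology_group p (subtopology Y B)" "\<lambda>p. relative_homology_group p (subtopology Y B) A"
     "\<lambda>p. hom_induced p (subtopology (subtopology Y B) A) {} (subtopology Y B) {} id"
     "\<lambda>p. hom_induced p (subtopology Y B) {} (subtopology Y B) A id"
     "\<lambda>p. hom_boundary p (subtopology Y B) A"
    by (rule long_exact_homology)
  interpret Y: long_exact "\<lambda>p. homology_group p (subtopology Y A)"
     "\<lambda>p. homology_group p Y" "\<lambda>p. relative_homology_group p Y A"
     "\<lambda>p. hom_induced p (subtopology Y A) {} Y {} id"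
     "\<lambda>p. hom_induced p Y {} Y A id"
     "\<lambda>p. hom_boundary p Y A"
    by (rule long_exact_homology)
  obtain rr where rr: "graded_ranks (\<lambda>p. relative_homology_group p (subtopology Y B) A) rr" "b = c + alternating_sum rr"
    using B.ranks_C[OF r(5) r(3)] r by auto
  have "relative_homology_group p (subtopology Y B) A \<cong> relative_homology_group p Y A" for p
  proof -
    \<comment> \<open>Excising the part of \<open>Y\<close> outside \<open>B\<close> turns the pair
      of \<open>Y\<close> and \<open>A\<close> into that of \<open>B\<close> and
      \<open>A \<inter> B\<close>; \<open>U\<close> is closed and lies in the open set
      \<open>A\<close>.\<close>
    define U where "U = topspace Y - B"
    have U: "closedin Y U" using AB(2) unfolding U_def by blast
    have "Y closure_of U \<subseteq> Y interior_of A"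
      using U AB by (auto simp: closure_of_closedin interior_of_openin U_def)
    moreover have "A \<subseteq> topspace Y" using AB by auto
    ultimately have "hom_induced p (subtopology Y (topspace Y - U)) (A - U) (subtopology Y (topspace Y)) A id
      \<in> iso (relative_homology_group p (subtopology Y (topspace Y - U)) (A - U))
            (relative_homology_group p (subtopology Y (topspace Y)) A)"
      by (rule homology_excision_axiom)
    moreover have "topspace Y - U = B" "A - U = A \<inter> B" using AB openin_subset by (auto simp: U_def)
    \<comment> \<open>A relative group depends only on the part of the subset that lies inside the
      space.\<close>
    moreover have "relative_homology_group p (subtopology Y B) (A \<inter> B) = relative_homology_group p (subtopology Y B) A"
      using relative_homology_group_restrict[of p "subtopology Y B" A] relative_homology_group_restrict[of p "subtopology Y B" "A \<inter> B"]
      by (simp add: Int_ac)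
    ultimately show ?thesis by (auto simp: is_iso_def)
  qed
  then have "graded_ranks (\<lambda>p. relative_homology_group p Y A) rr"
    by (intro graded_ranks_iso[OF rr(1)]) auto
  from Y.ranks_B[OF r(1) this] show ?thesis
    using rr(2) r unfolding has_euler_def Y_def by auto
qed

lemma has_euler_disjoint_UN:
  assumes "finite I" "\<And>i. i \<in> I \<Longrightarrow> openin X (U i)" "disjoint_family_on U I"
    "\<And>i. i \<in> I \<Longrightarrow> has_euler (subtopology X (U i)) (n i)"
  shows "has_euler (subtopology X (\<Union>i\<in>I. U i)) (\<Sum>i\<in>I. n i)"
  using assms
proof (induction I rule: finite_induct)
  case empty
  then show ?case by (simp add: has_euler_empty)
next
  case (insert i I)
  have "U i \<inter> (\<Union>i\<in>I. U i) = {}" using insert.prems(2) insert.hyps by (auto simp: disjoint_family_on_def)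
  then have "has_euler (subtopology X (U i \<inter> (\<Union>i\<in>I. U i))) 0" by (simp add: has_euler_empty)
  moreover have "has_euler (subtopology X (\<Union>i\<in>I. U i)) (\<Sum>i\<in>I. n i)"
    using insert by (intro insert.IH) (auto simp: disjoint_family_on_def)
  moreover have "openin X (\<Union>i\<in>I. U i)" using insert.prems by auto
  ultimately have "has_euler (subtopology X (U i \<union> (\<Union>i\<in>I. U i))) (n i + (\<Sum>i\<in>I. n i) - 0)"
    using insert.prems by (intro has_euler_Un) auto
  then show ?case using insert.hyps by simp
qed

section \<open>The Riemann-Hurwitz formula\<close>

lemma has_euler_top_of_set:
  assumes "contractible T" "T \<noteq> {}" shows "has_euler (top_of_set T) 1"
  using assms by (intro has_euler_contractible) (auto simp: contractible_space_top_of_set)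

text \<open>Shrinking \<open>s\<close> by \<open>t\<close> shrinks \<open>s ^ e\<close> by
  \<open>t ^ e\<close>, so the preimage of a set star-shaped about 0 is again star-shaped about
  0.\<close>

lemma has_euler_root_starlike:
  fixes W :: "complex set"
  assumes "0 \<in> W" "\<And>w t. w \<in> W \<Longrightarrow> 0 \<le> t \<Longrightarrow> t \<le> 1 \<Longrightarrow> of_real t * w \<in> W" "e > 0"
  shows "has_euler (top_of_set {s \<in> ball 0 1. s ^ e \<in> W}) 1"
proof (rule has_euler_top_of_set)
  let ?T = "{s \<in> ball 0 1. s ^ e \<in> W}"
  have 0: "0 \<in> ?T" using assms by (simp add: zero_power)
  then show "?T \<noteq> {}" by blast
  show "contractible ?T"
  proof (rule starlike_imp_contractible)
    have "closed_segment 0 s \<subseteq> ?T" if s: "s \<in> ?T" for s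
    proof
      fix u assume "u \<in> closed_segment 0 s"
      then obtain t where t: "u = of_real t * s" "0 \<le> t" "t \<le> 1"
        by (auto simp: in_segment scaleR_conv_of_real)
      have "u ^ e = of_real (t ^ e) * s ^ e" by (simp add: t(1) power_mult_distrib)
      then have "u ^ e \<in> W" using assms(2)[of "s ^ e" "t ^ e"] s t by (simp add: power_le_one)
      moreover have "norm u \<le> norm s" using t by (simp add: norm_mult mult_left_le_one_le)
      ultimately show "u \<in> ?T" using s by auto
    qed
    then show "starlike ?T" using 0 unfolding starlike_def by blast
  qed
qed

text \<open>\<open>W\<close> is convex and misses 0, so a logarithm and hence a root
  \<open>g\<close> exist on it. The preimage is the disjoint union of the \<open>e\<close> sheets
  \<open>\<zeta> * g w\<close>, one for each root of unity, each homeomorphic to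
  \<open>W\<close>.\<close>

lemma has_euler_root_convex:
  fixes W :: "complex set"
  assumes W: "open W" "convex W" "W \<noteq> {}" "W \<subseteq> ball 0 1" "0 \<notin> W" and e: "e > 0"
  shows "has_euler (top_of_set {s \<in> ball 0 1. s ^ e \<in> W}) (int e)"
proof -
  have cW: "contractible W" by (rule convex_imp_contractible[OF W(2)])
  have "\<And>w. w \<in> W \<Longrightarrow> w \<noteq> 0" using W(5) by blast
  then obtain L where L: "continuous_on W L" "\<And>w. w \<in> W \<Longrightarrow> w = exp (L w)"
    using continuous_logarithm_on_contractible[OF continuous_on_id cW] by blast
  define g where "g w = exp (L w / of_nat e)" for w
  have ge: "g w ^ e = w" if "w \<in> W" for w
    using L(2)[OF that] e by (simp add: g_def flip: exp_of_nat_mult)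
  have gcont: "continuous_on W g" unfolding g_def by (intro continuous_intros L)  (use e in auto)
  define R where "R = {\<zeta>::complex. \<zeta> ^ e = 1}"
  have R: "finite R" "card R = e"
    using e card_roots_unity_eq[of e] finite_roots_unity[of e] by (auto simp: R_def)
  define T where "T \<zeta> = (\<lambda>w. \<zeta> * g w) ` W" for \<zeta>
  have pw: "(\<zeta> * g w) ^ e = w" if "\<zeta> \<in> R" "w \<in> W" for \<zeta> w
    using that ge by (simp add: R_def power_mult_distrib)
  have inj: "inj_on (\<lambda>w. \<zeta> * g w) W" if "\<zeta> \<in> R" for \<zeta>
    by (rule inj_on_inverseI[where g = "\<lambda>s. s ^ e"]) (rule pw[OF that])
  have op: "open (T \<zeta>)" if "\<zeta> \<in> R" for \<zeta>
    unfolding T_def using inj[OF that] W gcont by (intro invariance_of_domain continuous_intros) auto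
  have eu: "has_euler (top_of_set (T \<zeta>)) 1" if "\<zeta> \<in> R" for \<zeta>
  proof -
    have "homeomorphic_maps (top_of_set W) (top_of_set (T \<zeta>)) (\<lambda>w. \<zeta> * g w) (\<lambda>s. s ^ e)"
      unfolding homeomorphic_maps_def continuous_map_subtopology_eu using pw[OF that] gcont
      by (auto simp: T_def intro!: continuous_intros)
    then have "top_of_set W homeomorphic_space top_of_set (T \<zeta>)"
      by (rule homeomorphic_maps_imp_homeomorphic_space)
    moreover have "has_euler (top_of_set W) 1"
      by (rule has_euler_top_of_set[OF cW W(3)])
    ultimately show ?thesis using has_euler_homeomorphic by blast
  qed
  have dis: "disjoint_family_on T R"
    unfolding disjoint_family_on_def
  proof (intro ballI impI)
    fix \<zeta> \<xi> assume *: "\<zeta> \<in> R" "\<xi> \<in> R" "\<zeta> \<noteq> \<xi>"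
    have False if "\<zeta> * g w = \<xi> * g w'" "w \<in> W" "w' \<in> W" for w w'
    proof -
      have "w = w'" using pw[OF *(1) that(2)] pw[OF *(2) that(3)] that(1) by simp
      then show False using that *(3) by (auto simp: g_def)
    qed
    then show "T \<zeta> \<inter> T \<xi> = {}" unfolding T_def by blast
  qed
  have un: "(\<Union>\<zeta>\<in>R. T \<zeta>) = {s \<in> ball 0 1. s ^ e \<in> W}"
  proof (intro equalityI subsetI)
    fix s assume "s \<in> (\<Union>\<zeta>\<in>R. T \<zeta>)"
    then obtain \<zeta> w where *: "\<zeta> \<in> R" "w \<in> W" "s = \<zeta> * g w" by (auto simp: T_def)
    then have "s ^ e \<in> W" using pw by simp
    moreover have "norm s ^ e < 1"
      using W(4) \<open>s ^ e \<in> W\<close> by (auto simp: norm_power[symmetric])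
    then have "norm s < 1" by (metis norm_ge_zero not_less one_le_power)
    ultimately show "s \<in> {s \<in> ball 0 1. s ^ e \<in> W}" by auto
  next
    fix s assume s: "s \<in> {s \<in> ball 0 1. s ^ e \<in> W}"
    define w where "w = s ^ e"
    have w: "w \<in> W" "g w \<noteq> 0" using s by (auto simp: w_def g_def)
    have "w \<noteq> 0" using w W(5) by metis
    then have "(s / g w) ^ e = 1" by (simp add: power_divide ge[OF w(1)] flip: w_def)
    then have "s / g w \<in> R" by (simp add: R_def)
    moreover have "s = (s / g w) * g w" using w by simp
    ultimately show "s \<in> (\<Union>\<zeta>\<in>R. T \<zeta>)" using w unfolding T_def by blast
  qed
  have "has_euler (subtopology euclidean (\<Union>\<zeta>\<in>R. T \<zeta>)) (\<Sum>\<zeta>\<in>R. 1)"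
    using R op eu dis by (intro has_euler_disjoint_UN) auto
  then show ?thesis using R un by simp
qed

text \<open>Over the disc of radius \<open>r\<close> about \<open>b\<close> the map \<open>h\<close>
  is, up to homeomorphism, a disjoint union of power maps of the unit disc, scaled by
  \<open>r\<close>. The last conjunct is a form of properness: every point over the disc lies in one
  of the pieces.\<close>

definition local_model ::
  "'a topology \<Rightarrow> 'a set \<Rightarrow> ('a \<Rightarrow> complex) \<Rightarrow> ('a \<Rightarrow> nat) \<Rightarrow> complex \<Rightarrow> real \<Rightarrow> ('a \<Rightarrow> complex \<Rightarrow> 'a) \<Rightarrow> bool" where
  "local_model X X0 h e b r \<psi> \<longleftrightarrow> r > 0 \<and> finite {x\<in>X0. h x = b} \<and>
     (\<forall>x\<in>X0. h x = b \<longrightarrow> e x > 0 \<and> openin X (\<psi> x ` ball 0 1) \<and>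
        homeomorphic_map (top_of_set (ball 0 1)) (subtopology X (\<psi> x ` ball 0 1)) (\<psi> x) \<and>
        \<psi> x 0 = x \<and> (\<forall>s\<in>ball 0 1. h (\<psi> x s) = b + of_real r * s ^ e x)) \<and>
     disjoint_family_on (\<lambda>x. \<psi> x ` ball 0 1) {x\<in>X0. h x = b} \<and>
     {y\<in>X0. h y \<in> ball b r} = (\<Union>x\<in>{x\<in>X0. h x = b}. \<psi> x ` ball 0 1)"

lemma has_euler_homeo_piece:
  assumes "openin X (\<psi> ` ball 0 1)" "homeomorphic_map (top_of_set (ball 0 1)) (subtopology X (\<psi> ` ball 0 1)) \<psi>"
    "T \<subseteq> ball 0 1" "open T"
  shows "openin X (\<psi> ` T)" "has_euler (top_of_set T) n \<Longrightarrow> has_euler (subtopology X (\<psi> ` T)) n"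
proof -
  have "openin (subtopology X (\<psi> ` ball 0 1)) (\<psi> ` T)"
    using homeomorphic_map_openness_eq[OF assms(2)] assms(3,4) homeomorphic_imp_open_map[OF assms(2)]
    by (metis open_map_def open_subset)
  then show "openin X (\<psi> ` T)" using assms(1) by (metis openin_trans_full)
  have "homeomorphic_map (subtopology (top_of_set (ball 0 1)) T) (subtopology (subtopology X (\<psi> ` ball 0 1)) (\<psi> ` T)) \<psi>"
    using assms(3) openin_subset[OF assms(1)]
    by (intro homeomorphic_map_subtopologies[OF assms(2)]) auto
  moreover have "subtopology (top_of_set (ball 0 1)) T = top_of_set T"
    using assms(3) by (simp add: subtopology_subtopology Int_absorb1)
  moreover have "subtopology (subtopology X (\<psi> ` ball 0 1)) (\<psi> ` T) = subtopology X (\<psi> ` T)"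
  proof -
    have "\<psi> ` ball 0 1 \<inter> \<psi> ` T = \<psi> ` T" using assms(3) by blast
    then show ?thesis by (simp add: subtopology_subtopology)
  qed
  ultimately have "top_of_set T homeomorphic_space subtopology X (\<psi> ` T)"
    by (auto intro: homeomorphic_map_imp_homeomorphic_space)
  then show "has_euler (top_of_set T) n \<Longrightarrow> has_euler (subtopology X (\<psi> ` T)) n"
    using has_euler_homeomorphic by blast
qed

lemma local_model_preimage:
  assumes "local_model X X0 h e b r \<psi>" "W \<subseteq> ball b r"
  shows "{y\<in>X0. h y \<in> W} = (\<Union>x\<in>{x\<in>X0. h x = b}. \<psi> x ` {s\<in>ball 0 1. b + of_real r * s ^ e x \<in> W})" (is "?L = ?R")
proof (intro equalityI subsetI)
  fix y assume "y \<in> ?L"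
  then have "y \<in> {y\<in>X0. h y \<in> ball b r}" using assms(2) by auto
  then obtain x s where x: "x \<in> X0" "h x = b" "s \<in> ball 0 1" "y = \<psi> x s"
    using assms(1) unfolding local_model_def by blast
  then have "h y = b + of_real r * s ^ e x" using assms(1) unfolding local_model_def by blast
  then show "y \<in> ?R" using x \<open>y \<in> ?L\<close> by auto
next
  fix y assume "y \<in> ?R"
  then obtain x s where x: "x \<in> X0" "h x = b" "s \<in> ball 0 1" "y = \<psi> x s" "b + of_real r * s ^ e x \<in> W" by auto
  moreover have "h y = b + of_real r * s ^ e x" using assms(1) x unfolding local_model_def by blast
  moreover have "y \<in> (\<Union>x\<in>{x\<in>X0. h x = b}. \<psi> x ` ball 0 1)" using x by blast
  then have "y \<in> X0" using assms(1) unfolding local_model_def by blast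
  ultimately show "y \<in> ?L" by auto
qed

lemma local_model_euler:
  assumes m: "local_model X X0 h e b r \<psi>" and W: "W \<subseteq> ball b r" "open W"
    and n: "\<And>x. x \<in> X0 \<Longrightarrow> h x = b \<Longrightarrow> has_euler (top_of_set {s\<in>ball 0 1. s ^ e x \<in> {w. b + of_real r * w \<in> W}}) (n x)"
  shows "has_euler (subtopology X {y\<in>X0. h y \<in> W}) (\<Sum>x | x \<in> X0 \<and> h x = b. n x)"
proof -
  define T where "T x = {s\<in>ball 0 1. b + of_real r * s ^ e x \<in> W}" for x
  have op: "open (T x)" for x
  proof -
    have "T x = ball 0 1 \<inter> (\<lambda>s. b + of_real r * s ^ e x) -` W" by (auto simp: T_def)
    then show ?thesis using W(2) by (auto intro!: open_Int open_vimage continuous_intros)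
  qed
  have sub: "T x \<subseteq> ball 0 1" for x by (auto simp: T_def)
  have "disjoint_family_on (\<lambda>x. \<psi> x ` ball 0 1) {x\<in>X0. h x = b}"
    using m unfolding local_model_def by (elim conjE) assumption
  then have dis: "disjoint_family_on (\<lambda>x. \<psi> x ` T x) {x\<in>X0. h x = b}"
    unfolding disjoint_family_on_def using image_mono[OF sub] by (meson disjoint_iff in_mono)
  have "has_euler (subtopology X (\<Union>x\<in>{x\<in>X0. h x = b}. \<psi> x ` T x)) (\<Sum>x | x \<in> X0 \<and> h x = b. n x)"
  proof (rule has_euler_disjoint_UN)
    fix x assume x: "x \<in> {x\<in>X0. h x = b}"
    have *: "openin X (\<psi> x ` ball 0 1)" "homeomorphic_map (top_of_set (ball 0 1)) (subtopology X (\<psi> x ` ball 0 1)) (\<psi> x)"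
      using m x unfolding local_model_def by simp_all
    show "openin X (\<psi> x ` T x)" by (rule has_euler_homeo_piece(1)[OF * sub op])
    show "has_euler (subtopology X (\<psi> x ` T x)) (n x)"
      using n[of x] x by (intro has_euler_homeo_piece(2)[OF * sub op]) (auto simp: T_def)
  qed (use m dis in \<open>auto simp: local_model_def\<close>)
  then show ?thesis using local_model_preimage[OF m W(1)] by (simp add: T_def)
qed

text \<open>Each piece is star-shaped about its center, hence contributes 1, and there is one piece
  for each point of the fiber.\<close>

lemma local_model_euler_center:
  assumes m: "local_model X X0 h e b r \<psi>" and W: "W \<subseteq> ball b r" "open W" "b \<in> W"
    and star: "\<And>w t. w \<in> W \<Longrightarrow> 0 \<le> t \<Longrightarrow> t \<le> 1 \<Longrightarrow> b + of_real t * (w - b) \<in> W"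
  shows "has_euler (subtopology X {y\<in>X0. h y \<in> W}) (int (card {x\<in>X0. h x = b}))"
proof -
  have "has_euler (subtopology X {y\<in>X0. h y \<in> W}) (\<Sum>x | x \<in> X0 \<and> h x = b. 1)"
  proof (rule local_model_euler[OF m W(1,2)])
    fix x assume "x \<in> X0" "h x = b"
    then have "e x > 0" using m by (auto simp: local_model_def)
    then show "has_euler (top_of_set {s \<in> ball 0 1. s ^ e x \<in> {w. b + complex_of_real r * w \<in> W}}) 1"
    proof (rule has_euler_root_starlike[rotated 2])
      fix w :: complex and t :: real
      assume "w \<in> {w. b + complex_of_real r * w \<in> W}" "0 \<le> t" "t \<le> 1"
      then show "of_real t * w \<in> {w. b + complex_of_real r * w \<in> W}"
        using star[of "b + complex_of_real r * w" t] by (simp add: mult_ac)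
    qed (use W in auto)
  qed
  then show ?thesis by simp
qed

text \<open>Away from the center the piece at \<open>x\<close> splits into \<open>e x\<close>
  contractible sheets.\<close>

lemma local_model_euler_off:
  assumes m: "local_model X X0 h e b r \<psi>" and W: "W \<subseteq> ball b r" "open W" "convex W" "b \<notin> W" "W \<noteq> {}"
  shows "has_euler (subtopology X {y\<in>X0. h y \<in> W}) (\<Sum>x | x \<in> X0 \<and> h x = b. int (e x))"
proof (rule local_model_euler[OF m W(1,2)])
  fix x assume "x \<in> X0" "h x = b"
  then have e: "e x > 0" using m by (auto simp: local_model_def)
  have r: "r > 0" using m by (auto simp: local_model_def)
  define W' where "W' = {w. b + complex_of_real r * w \<in> W}"
  have eq: "W' = (\<lambda>v. (v - b) / of_real r) ` W"
    using r by (force simp: W'_def image_iff field_simps)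
  have eq2: "(\<lambda>v. (v - b) / of_real r) ` W = (\<lambda>v. (1/r) *\<^sub>R v) ` ((\<lambda>v. - b + v) ` W)"
    unfolding image_image by (rule image_cong) (auto simp: scaleR_conv_of_real)
  show "has_euler (top_of_set {s \<in> ball 0 1. s ^ e x \<in> {w. b + complex_of_real r * w \<in> W}}) (int (e x))"
    unfolding W'_def[symmetric]
  proof (rule has_euler_root_convex)
    have "W' = (\<lambda>w. b + complex_of_real r * w) -` W" by (auto simp: W'_def)
    then show "open W'" using W(2) by (auto intro!: open_vimage continuous_intros)
    show "convex W'" unfolding eq eq2 by (rule convex_scaling[OF convex_translation[OF W(3)]])
    show "W' \<noteq> {}" using W by (simp add: eq)
    show "W' \<subseteq> ball 0 1"
    proof
      fix w assume "w \<in> W'"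
      then have "dist b (b + complex_of_real r * w) < r" using W(1) by (auto simp: W'_def)
      then show "w \<in> ball 0 1" using r by (simp add: dist_norm norm_mult)
    qed
    show "0 \<notin> W'" using W(4) by (auto simp: W'_def)
  qed (rule e)
qed

text \<open>A nearby value has \<open>e x\<close> preimages in the piece at \<open>x\<close>, the
  solutions of \<open>s ^ e x = (y - b) / r\<close>.\<close>

lemma local_model_card:
  assumes m: "local_model X X0 h e b r \<psi>" and y: "y \<in> ball b r" "y \<noteq> b"
  shows "finite {x\<in>X0. h x = y}" "card {x\<in>X0. h x = y} = (\<Sum>x | x \<in> X0 \<and> h x = b. e x)"
proof -
  let ?S = "{x\<in>X0. h x = b}"
  define T where "T x = {s\<in>ball 0 1. b + of_real r * s ^ e x = y}" for x
  have r: "r > 0" and fin: "finite ?S" using m by (auto simp: local_model_def)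
  have un: "{x\<in>X0. h x = y} = (\<Union>x\<in>?S. \<psi> x ` T x)"
    using local_model_preimage[OF m, of "{y}"] y by (simp add: T_def)
  have T: "finite (T x) \<and> card (\<psi> x ` T x) = e x" if x: "x \<in> ?S" for x
  proof -
    have e: "e x > 0" using m x by (auto simp: local_model_def)
    define c where "c = (y - b) / of_real r"
    have c: "c \<noteq> 0" "norm c < 1" using y r by (auto simp: c_def dist_norm norm_divide norm_minus_commute)
    have "T x = {s. s ^ e x = c}"
    proof (intro equalityI subsetI)
      fix s assume "s \<in> {s. s ^ e x = c}"
      then have "norm s ^ e x < 1" using c by (auto simp: norm_power[symmetric])
      then have "norm s < 1" by (metis norm_ge_zero not_less one_le_power)
      then show "s \<in> T x" using \<open>s \<in> {s. s ^ e x = c}\<close> r by (simp add: T_def c_def)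
    qed (use r in \<open>auto simp: T_def c_def field_simps\<close>)
    then have "card (T x) = e x" using card_nth_roots[of c "e x"] c e by simp
    moreover have "inj_on (\<psi> x) (ball 0 1)"
      using m x homeomorphic_imp_injective_map unfolding local_model_def by fastforce
    then have "inj_on (\<psi> x) (T x)" by (rule inj_on_subset) (auto simp: T_def)
    ultimately show ?thesis using e by (metis card.infinite card_image less_numeral_extra(3))
  qed
  show "finite {x\<in>X0. h x = y}" unfolding un using fin T by auto
  have "card (\<Union>x\<in>?S. \<psi> x ` T x) = (\<Sum>x\<in>?S. card (\<psi> x ` T x))"
  proof (rule card_UN_disjoint)
    have "disjoint_family_on (\<lambda>x. \<psi> x ` ball 0 1) ?S" using m unfolding local_model_def by blast
    then show "\<forall>i\<in>?S. \<forall>j\<in>?S. i \<noteq> j \<longrightarrow> \<psi> i ` T i \<inter> \<psi> j ` T j = {}"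
      unfolding disjoint_family_on_def T_def by blast
  qed (use fin T in auto)
  then show "card {x\<in>X0. h x = y} = (\<Sum>x | x \<in> X0 \<and> h x = b. e x)" using un T by simp
qed

section \<open>Gluing over intervals and rectangles\<close>

definition rect :: "real \<Rightarrow> real \<Rightarrow> real \<Rightarrow> real \<Rightarrow> complex set" where
  "rect a b c d = {z. a < Re z \<and> Re z < b \<and> c < Im z \<and> Im z < d}"

lemma open_rect [simp]: "open (rect a b c d)"
  unfolding rect_def by (intro open_Collect_conj open_Collect_less continuous_intros)

lemma convex_rect [simp]: "convex (rect a b c d)"
proof -
  have "rect a b c d = {z. Re z > a} \<inter> {z. Re z < b} \<inter> {z. Im z > c} \<inter> {z. Im z < d}"
    by (auto simp: rect_def)
  then show ?thesis
    by (simp add: convex_Int convex_halfspace_Re_gt convex_halfspace_Re_lt convex_halfspace_Im_gt convex_halfspace_Im_lt)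
qed

lemma rect_Int: "rect a b c d \<inter> rect a' b' c' d' = rect (max a a') (min b b') (max c c') (min d d')"
  by (auto simp: rect_def)

lemma rect_Un_Re: "a \<le> a' \<Longrightarrow> a' < b \<Longrightarrow> b \<le> b' \<Longrightarrow> rect a b c d \<union> rect a' b' c d = rect a b' c d"
  by (auto simp: rect_def)

lemma rect_Un_Im: "c \<le> c' \<Longrightarrow> c' < d \<Longrightarrow> d \<le> d' \<Longrightarrow> rect a b c d \<union> rect a b c' d' = rect a b c d'"
  by (auto simp: rect_def)

lemma rect_nonempty: "a < b \<Longrightarrow> c < d \<Longrightarrow> Complex ((a + b) / 2) ((c + d) / 2) \<in> rect a b c d"
  by (auto simp: rect_def)

text \<open>A property spreads from short intervals to all intervals by cutting off pieces at the
  left end, always with an overlap, since Euler characteristics are glued along open sets.\<close>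

lemma interval_chain:
  fixes P :: "real \<Rightarrow> real \<Rightarrow> bool"
  assumes "\<epsilon> > 0" and small: "\<And>a b. l \<le> a \<Longrightarrow> b \<le> u \<Longrightarrow> a < b \<Longrightarrow> b - a < \<epsilon> \<Longrightarrow> P a b"
    and glue: "\<And>a c b d. l \<le> a \<Longrightarrow> d \<le> u \<Longrightarrow> a < c \<Longrightarrow> c < b \<Longrightarrow> b < d \<Longrightarrow> P a b \<Longrightarrow> P c d \<Longrightarrow> P c b \<Longrightarrow> P a d"
    and ab: "l \<le> a" "a < b" "b \<le> u"
  shows "P a b"
proof -
  \<comment> \<open>Each cut shortens the interval by half of \<open>\<epsilon>\<close>; for
    \<open>n = 0\<close> the bound is \<open>\<epsilon>\<close> itself.\<close>
  have "P a b" if "l \<le> a" "a < b" "b \<le> u" "b - a < \<epsilon> * (real n + 2) / 2" for n a b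
    using that
  proof (induction n arbitrary: a)
    case 0
    then show ?case by (intro small) auto
  next
    case (Suc n)
    show ?case
    proof (cases "b - a < \<epsilon>")
      case True
      then show ?thesis using Suc.prems by (intro small) auto
    next
      case False
      have 1: "P (a + \<epsilon> / 2) b"
        using Suc.prems False \<open>\<epsilon> > 0\<close> by (intro Suc.IH) (auto simp: field_simps)
      \<comment> \<open>The piece cut off ends at \<open>a + 3 * \<epsilon> / 4\<close>, beyond the
        start \<open>a + \<epsilon> / 2\<close> of the rest; both the piece and the overlap are
        short.\<close>
      have 2: "P a (a + 3 * \<epsilon> / 4)" "P (a + \<epsilon> / 2) (a + 3 * \<epsilon> / 4)"
        using Suc.prems False \<open>\<epsilon> > 0\<close> by (auto intro!: small)
      show ?thesis
        by (rule glue[OF _ _ _ _ _ 2(1) 1 2(2)]) (use Suc.prems False \<open>\<epsilon> > 0\<close> in auto)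
    qed
  qed
  moreover obtain n where "(b - a) * 2 / \<epsilon> < real n" using reals_Archimedean2 by blast
  then have "b - a < \<epsilon> * (real n + 2) / 2" using \<open>\<epsilon> > 0\<close> by (simp add: field_simps)
  ultimately show ?thesis using ab by blast
qed

text \<open>A map to the Riemann sphere in two charts: \<open>z\<close> on the part
  \<open>X0\<close> over the plane and \<open>w = 1 / z\<close> on the part \<open>X1\<close> over
  the complement of 0. Infinity is the point \<open>w = 0\<close>, the only one that needs a model
  in the second chart. The function \<open>e\<close> gives the ramification indices.\<close>

locale branched_cover =
  fixes X :: "'a topology" and X0 X1 :: "'a set" and z w :: "'a \<Rightarrow> complex" and e :: "'a \<Rightarrow> nat"
  assumes open_X0: "openin X X0" and open_X1: "openin X X1" and cover: "X0 \<union> X1 = topspace X"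
    and X1_iff: "\<And>x. x \<in> X0 \<Longrightarrow> x \<in> X1 \<longleftrightarrow> z x \<noteq> 0"
    and X0_iff: "\<And>x. x \<in> X1 \<Longrightarrow> x \<in> X0 \<longleftrightarrow> w x \<noteq> 0"
    and wz: "\<And>x. x \<in> X0 \<Longrightarrow> x \<in> X1 \<Longrightarrow> w x = 1 / z x"
    and cont_z: "continuous_map (subtopology X X0) euclidean z"
    and cont_w: "continuous_map (subtopology X X1) euclidean w"
    and model_z: "\<And>b. \<exists>r \<psi>. local_model X X0 z e b r \<psi>"
    and model_w: "\<exists>r \<psi>. local_model X X1 w e 0 r \<psi>"
begin

definition fiber :: "complex \<Rightarrow> 'a set" where "fiber b = {x\<in>X0. z x = b}"
definition fiber_inf :: "'a set" where "fiber_inf = {x\<in>X1. w x = 0}"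
definition degr :: nat where "degr = (\<Sum>x\<in>fiber 0. e x)"

lemma open_preimage: "open W \<Longrightarrow> openin X {x\<in>X0. z x \<in> W}"
  using openin_continuous_map_preimage[OF cont_z, of W] open_X0 openin_subset[OF open_X0]
  by (simp add: Int_absorb1 inf.absorb2 openin_open_subtopology)

lemma open_preimage_w: "open W \<Longrightarrow> openin X {x\<in>X1. w x \<in> W}"
  using openin_continuous_map_preimage[OF cont_w, of W] open_X1 openin_subset[OF open_X1]
  by (simp add: Int_absorb1 inf.absorb2 openin_open_subtopology)

text \<open>The size of a fiber, counted with ramification, is locally constant: two models are
  compared at a common value \<open>u\<close> away from both centers, where the number of points
  equals either sum.\<close>

lemma sum_fiber: "(\<Sum>x\<in>fiber b. e x) = degr"
proof -
  define N where "N b = (\<Sum>x\<in>fiber b. e x)" for b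
  have "N constant_on UNIV"
  proof (rule locally_constant_imp_constant)
    fix b
    obtain r \<psi> where r: "local_model X X0 z e b r \<psi>" using model_z by blast
    have "N y = N b" if y: "y \<in> ball b r" for y
    proof (cases "y = b")
      case False
      obtain r' \<psi>' where r': "local_model X X0 z e y r' \<psi>'" using model_z by blast
      have "open (ball y r' \<inter> ball b r - {b})" by auto
      moreover have "y \<in> ball y r' \<inter> ball b r - {b}" using y False r' by (auto simp: local_model_def)
      ultimately obtain u where u: "u \<noteq> y" "u \<in> ball y r' \<inter> ball b r - {b}"
        by (metis islimpt_UNIV islimptE UNIV_I)
      have "card {x\<in>X0. z x = u} = N b" using local_model_card(2)[OF r] u by (auto simp: N_def fiber_def)
      moreover have "card {x\<in>X0. z x = u} = N y" using local_model_card(2)[OF r'] u by (auto simp: N_def fiber_def)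
      ultimately show ?thesis by simp
    qed auto
    moreover have "r > 0" using r by (auto simp: local_model_def)
    ultimately have "\<exists>T. open T \<and> b \<in> T \<and> (\<forall>y\<in>T. N y = N b)" by (meson centre_in_ball open_ball)
    then show "\<exists>T. openin (top_of_set UNIV) T \<and> b \<in> T \<and> (\<forall>y\<in>T. N y = N b)" by simp
  qed (rule convex_connected[OF convex_UNIV])
  then show ?thesis unfolding constant_on_def N_def degr_def by (metis UNIV_I)
qed

lemma card_fiber_near:
  assumes "local_model X X0 z e b r \<psi>" "y \<in> ball b r" "y \<noteq> b"
  shows "card (fiber y) = degr"
  using local_model_card(2)[OF assms] sum_fiber[of b] by (simp add: fiber_def)

lemma finite_fiber: "finite (fiber b)" and e_pos_fiber: "x \<in> fiber b \<Longrightarrow> e x > 0"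
  using model_z[of b] by (auto simp: local_model_def fiber_def)

lemma finite_fiber_inf: "finite fiber_inf" and e_pos_fiber_inf: "x \<in> fiber_inf \<Longrightarrow> e x > 0"
  using model_w by (auto simp: local_model_def fiber_inf_def)

text \<open>A value \<open>b\<close> of large modulus corresponds to the small nonzero value
  \<open>1 / b\<close> of \<open>w\<close>, to which the model at infinity applies.\<close>

lemma card_fiber_far_aux:
  assumes m: "local_model X X1 w e 0 \<rho> \<psi>" and b: "norm b > 1 / \<rho>"
  shows "card (fiber b) = (\<Sum>x\<in>fiber_inf. e x)"
proof -
  have \<rho>: "\<rho> > 0" using m by (auto simp: local_model_def)
  have b0: "b \<noteq> 0" using b \<rho> by (auto simp: field_simps)
  have "{x\<in>X1. w x = 1 / b} = fiber b"
  proof (intro equalityI subsetI)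
    fix x assume x: "x \<in> {x\<in>X1. w x = 1 / b}"
    then have "x \<in> X0" using X0_iff b0 by auto
    then show "x \<in> fiber b" using x wz[of x] b0 by (simp add: fiber_def field_simps)
  next
    fix x assume "x \<in> fiber b"
    then show "x \<in> {x\<in>X1. w x = 1 / b}" using X1_iff[of x] wz[of x] b0 by (auto simp: fiber_def)
  qed
  moreover have "1 / b \<in> ball 0 \<rho>" "1 / b \<noteq> 0" using b \<rho> b0 by (auto simp: norm_divide field_simps)
  ultimately show ?thesis using local_model_card(2)[OF m, of "1 / b"] by (simp add: fiber_inf_def)
qed

text \<open>Some value \<open>y\<close> lies both in the punctured disc around infinity and in the
  punctured disc of a model in the chart \<open>z\<close>; the size of its fiber is computed by
  either.\<close>

lemma sum_fiber_inf: "(\<Sum>x\<in>fiber_inf. e x) = degr"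
proof -
  obtain \<rho> \<psi> where m: "local_model X X1 w e 0 \<rho> \<psi>" using model_w by blast
  then have \<rho>: "\<rho> > 0" by (auto simp: local_model_def)
  \<comment> \<open>Any \<open>b\<close> of modulus beyond \<open>1 / \<rho>\<close> would do;
    moving outwards by \<open>r / 2\<close> keeps \<open>y\<close> in that region and away from the
    center \<open>b\<close>.\<close>
  define b where "b = complex_of_real (2 / \<rho>)"
  obtain r \<psi>' where r: "local_model X X0 z e b r \<psi>'" using model_z by blast
  have r0: "r > 0" using r by (auto simp: local_model_def)
  define y where "y = complex_of_real (2 / \<rho> + r / 2)"
  have "y - b = complex_of_real (r / 2)" by (simp add: y_def b_def)
  then have "dist y b = r / 2" using r0 by (metis dist_norm norm_of_real abs_of_pos half_gt_zero)
  then have "y \<in> ball b r" "y \<noteq> b" using r0 by (auto simp: dist_commute)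
  then have "card (fiber y) = degr" using card_fiber_near[OF r] by blast
  have "norm y = 2 / \<rho> + r / 2" using \<rho> r0 by (simp only: y_def norm_of_real) simp
  moreover have "1 / \<rho> < 2 / \<rho>" using \<rho> by (simp add: divide_strict_right_mono)
  ultimately have "norm y > 1 / \<rho>" using r0 by linarith
  with \<open>card (fiber y) = degr\<close> show ?thesis using card_fiber_far_aux[OF m] by simp
qed

text \<open>The branch values: by \<open>sum_fiber\<close> a fiber has \<open>degr\<close> points
  exactly when all its ramification indices are 1.\<close>

definition special :: "complex set" where "special = {b. card (fiber b) \<noteq> degr}"

lemma card_fiber_far:
  obtains \<rho> \<psi> where "local_model X X1 w e 0 \<rho> \<psi>" "\<And>b. norm b > 1 / \<rho> \<Longrightarrow> b \<notin> special"
  using model_w card_fiber_far_aux sum_fiber_inf by (auto simp: special_def)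

text \<open>Only centers of local models can be special, finitely many models cover a compact disc,
  and beyond that disc nothing is special.\<close>

lemma finite_special: "finite special"
proof -
  obtain \<rho> \<psi>0 where far: "\<And>b. norm b > 1 / \<rho> \<Longrightarrow> b \<notin> special" using card_fiber_far by metis
  obtain r \<psi> where r: "\<And>b. local_model X X0 z e b (r b) (\<psi> b)" using model_z by metis
  have "cball 0 (1 / \<rho>) \<subseteq> (\<Union>b\<in>cball 0 (1/\<rho>). ball b (r b))"
  proof
    fix b :: complex assume "b \<in> cball 0 (1 / \<rho>)"
    moreover have "b \<in> ball b (r b)" using r[of b] by (simp add: local_model_def)
    ultimately show "b \<in> (\<Union>b\<in>cball 0 (1/\<rho>). ball b (r b))" by blast
  qed
  then obtain C where C: "finite C" "cball 0 (1 / \<rho>) \<subseteq> (\<Union>b\<in>C. ball b (r b))"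
    using compactE_image[OF compact_cball, of "cball 0 (1/\<rho>)" "\<lambda>b. ball b (r b)"] by (metis open_ball)
  have "special \<subseteq> C"
  proof
    fix b assume b: "b \<in> special"
    then have "\<not> norm b > 1 / \<rho>" using far by blast
    then have "b \<in> cball 0 (1 / \<rho>)" by simp
    then obtain c where "c \<in> C" "b \<in> ball c (r c)" using C by auto
    then show "b \<in> C" using card_fiber_near[OF r[of c], of b] b by (auto simp: special_def)
  qed
  then show ?thesis using C finite_subset by blast
qed

definition deficit :: "complex \<Rightarrow> int" where "deficit b = int degr - int (card (fiber b))"

text \<open>The parameter \<open>k\<close> stands for the Euler characteristic of \<open>W\<close>.
  Leaving it free, every instance follows by inclusion and exclusion from the case of convex sets
  inside a local model.\<close>

definition euler_over :: "complex set \<Rightarrow> int \<Rightarrow> bool" where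
  "euler_over W k \<longleftrightarrow> open W \<and>
     has_euler (subtopology X {x\<in>X0. z x \<in> W}) (k * int degr - (\<Sum>b\<in>special \<inter> W. deficit b))"

text \<open>Inclusion and exclusion holds for the Euler characteristic, for \<open>k\<close> and for
  the sum of the deficits alike.\<close>

lemma euler_over_Un:
  assumes "euler_over A k" "euler_over B l" "euler_over (A \<inter> B) m"
  shows "euler_over (A \<union> B) (k + l - m)"
proof -
  let ?P = "\<lambda>W. {x\<in>X0. z x \<in> W}"
  have eq: "?P A \<union> ?P B = ?P (A \<union> B)" "?P A \<inter> ?P B = ?P (A \<inter> B)" by auto
  have eu: "has_euler (subtopology X (?P A \<union> ?P B))
     ((k * int degr - (\<Sum>b\<in>special \<inter> A. deficit b)) + (l * int degr - (\<Sum>b\<in>special \<inter> B. deficit b))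
       - (m * int degr - (\<Sum>b\<in>special \<inter> (A \<inter> B). deficit b)))"
    by (rule has_euler_Un) (use assms eq in \<open>auto simp: euler_over_def intro: open_preimage\<close>)
  have "(\<Sum>b\<in>special \<inter> (A \<union> B). deficit b) + (\<Sum>b\<in>special \<inter> (A \<inter> B). deficit b) =
      (\<Sum>b\<in>special \<inter> A. deficit b) + (\<Sum>b\<in>special \<inter> B. deficit b)"
    using sum.union_inter[of "special \<inter> A" "special \<inter> B" deficit] finite_special
    by (simp add: Int_Un_distrib Int_assoc Int_left_commute)
  then have "(k * int degr - (\<Sum>b\<in>special \<inter> A. deficit b)) + (l * int degr - (\<Sum>b\<in>special \<inter> B. deficit b))
       - (m * int degr - (\<Sum>b\<in>special \<inter> (A \<inter> B). deficit b))
     = (k + l - m) * int degr - (\<Sum>b\<in>special \<inter> (A \<union> B). deficit b)"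
    unfolding left_diff_distrib distrib_right by linarith
  with eu have "has_euler (subtopology X (?P (A \<union> B)))
      ((k + l - m) * int degr - (\<Sum>b\<in>special \<inter> (A \<union> B). deficit b))"
    unfolding eq by metis
  then show ?thesis using assms by (simp add: euler_over_def open_Un)
qed

lemma euler_over_empty: "euler_over {} 0"
  by (simp add: euler_over_def has_euler_empty)

lemma euler_over_disjoint:
  "euler_over A k \<Longrightarrow> euler_over B l \<Longrightarrow> A \<inter> B = {} \<Longrightarrow> euler_over (A \<union> B) (k + l)"
  using euler_over_Un[of A k B l 0] euler_over_empty by simp

text \<open>If \<open>W\<close> contains the center, its preimage has one contractible piece for
  each point of the fiber over \<open>b\<close>, that is, \<open>degr\<close> minus the deficit;
  otherwise it has \<open>degr\<close> sheets.\<close>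

lemma euler_over_small:
  assumes m: "local_model X X0 z e b r \<psi>" and W: "open W" "convex W" "W \<noteq> {}" "W \<subseteq> ball b r"
  shows "euler_over W 1"
proof (cases "b \<in> W")
  case True
  have star: "b + of_real t * (w - b) \<in> W" if "w \<in> W" "0 \<le> t" "t \<le> 1" for w and t :: real
  proof -
    have "(1 - t) *\<^sub>R b + t *\<^sub>R w \<in> W" using W(2) True that by (intro convexD) auto
    then show ?thesis by (simp add: scaleR_conv_of_real algebra_simps)
  qed
  have sub: "special \<inter> W \<subseteq> {b}" using card_fiber_near[OF m] W(4) unfolding special_def by blast
  have "(\<Sum>b\<in>special \<inter> W. deficit b) = (\<Sum>b\<in>{b}. deficit b)"
  proof (rule sum.mono_neutral_left)
    show "\<forall>i\<in>{b} - special \<inter> W. deficit i = 0" using True by (auto simp: special_def deficit_def)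
  qed (use sub in simp_all)
  then show ?thesis
    using local_model_euler_center[OF m W(4) W(1) True star] W(1)
    by (simp add: euler_over_def deficit_def fiber_def)
next
  case False
  have "special \<inter> W = {}" using card_fiber_near[OF m] W(4) False unfolding special_def by blast
  then show ?thesis
    using local_model_euler_off[OF m W(4,1,2) False W(3)] W(1) sum_fiber[of b]
    by (simp add: euler_over_def fiber_def flip: of_nat_sum)
qed

text \<open>By a Lebesgue number for the discs of the models, small rectangles lie in a single
  model. They are glued first to strips and then to large rectangles; every overlap is again a
  rectangle, so \<open>1 + 1 - 1 = 1\<close> is preserved.\<close>

lemma euler_over_rect:
  assumes ab: "a < b" and cd: "c < d"
  shows "euler_over (rect a b c d) 1"
proof -
  define M where "M = \<bar>a\<bar> + \<bar>b\<bar> + \<bar>c\<bar> + \<bar>d\<bar>"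
  have M: "-M \<le> a" "b \<le> M" "-M \<le> c" "d \<le> M" by (auto simp: M_def)
  define K where "K = cbox (Complex (-M) (-M)) (Complex M M)"
  obtain r \<psi> where r: "\<And>b. local_model X X0 z e b (r b) (\<psi> b)" using model_z by metis
  have "compact K" by (simp add: K_def)
  moreover have "K \<subseteq> \<Union> (range (\<lambda>b. ball b (r b)))" 
  proof
    fix b
    have "b \<in> ball b (r b)" using r[of b] by (simp add: local_model_def)
    then show "b \<in> \<Union> (range (\<lambda>b. ball b (r b)))" by blast
  qed
  ultimately obtain \<epsilon> where \<epsilon>: "\<epsilon> > 0" "\<And>x. x \<in> K \<Longrightarrow> \<exists>G\<in>range (\<lambda>b. ball b (r b)). ball x \<epsilon> \<subseteq> G"
    by (rule Heine_Borel_lemma) auto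
  have small: "euler_over (rect a b c d) 1"
    if "a < b" "c < d" "-M \<le> a" "b \<le> M" "-M \<le> c" "d \<le> M" "b - a < \<epsilon> / 2" "d - c < \<epsilon> / 2" for a b c d
  proof -
    have "Complex a c \<in> K" using that by (auto simp: K_def in_cbox_complex_iff)
    then obtain y where y: "ball (Complex a c) \<epsilon> \<subseteq> ball y (r y)" using \<epsilon>(2) by blast
    have "rect a b c d \<subseteq> ball (Complex a c) \<epsilon>"
    proof
      fix u assume u: "u \<in> rect a b c d"
      have "norm (u - Complex a c) \<le> \<bar>Re (u - Complex a c)\<bar> + \<bar>Im (u - Complex a c)\<bar>" by (rule cmod_le)
      also have "\<dots> < \<epsilon>" using u that by (auto simp: rect_def)
      finally show "u \<in> ball (Complex a c) \<epsilon>" by (simp add: dist_norm norm_minus_commute)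
    qed
    moreover have "rect a b c d \<noteq> {}" using rect_nonempty[OF that(1,2)] by blast
    ultimately show ?thesis using euler_over_small[OF r[of y]] y by simp
  qed
  have strip: "euler_over (rect a b c d) 1"
    if "a < b" "c < d" "-M \<le> a" "b \<le> M" "-M \<le> c" "d \<le> M" "d - c < \<epsilon> / 2" for a b c d
  proof (rule interval_chain[of "\<epsilon> / 2" "- M" M "\<lambda>a b. euler_over (rect a b c d) 1"])
    fix a c' b d' assume *: "a < c'" "c' < b" "b < d'" "euler_over (rect a b c d) 1" "euler_over (rect c' d' c d) 1"
      "euler_over (rect c' b c d) 1"
    have "euler_over (rect a b c d \<union> rect c' d' c d) (1 + 1 - 1)"
      using * by (intro euler_over_Un) (auto simp: rect_Int max_absorb2 min_absorb1)
    then show "euler_over (rect a d' c d) 1" using * by (simp add: rect_Un_Re)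
  qed (use small that \<epsilon> in auto)
  show ?thesis
  proof (rule interval_chain[of "\<epsilon> / 2" "- M" M "\<lambda>c d. euler_over (rect a b c d) 1"])
    fix c c' d d' assume *: "c < c'" "c' < d" "d < d'" "euler_over (rect a b c d) 1" "euler_over (rect a b c' d') 1"
      "euler_over (rect a b c' d) 1"
    have "euler_over (rect a b c d \<union> rect a b c' d') (1 + 1 - 1)"
      using * by (intro euler_over_Un) (auto simp: rect_Int max_absorb2 min_absorb1)
    then show "euler_over (rect a b c d') 1" using * by (simp add: rect_Un_Im)
  qed (use strip ab cd \<epsilon> M in auto)
qed

lemma euler_over_two_rects:
  assumes "a < b" "c < d" "a' < b'" "c' < d'" "b \<le> a' \<or> d \<le> c'"
  shows "euler_over (rect a b c d \<union> rect a' b' c' d') 2"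
  using euler_over_disjoint[OF euler_over_rect[OF assms(1,2)] euler_over_rect[OF assms(3,4)]] assms(5)
  by (force simp: rect_def)

text \<open>Two vertical and two horizontal bars meet in four corner squares: 2 + 2 - 4 = 0.\<close>

lemma euler_over_annulus:
  assumes "0 < R" "R < S"
  shows "euler_over (rect (-S) S (-S) S - {u. \<bar>Re u\<bar> \<le> R \<and> \<bar>Im u\<bar> \<le> R}) 0"
proof -
  define A where "A = rect (-S) (-R) (-S) S \<union> rect R S (-S) S"
  define B where "B = rect (-S) S (-S) (-R) \<union> rect (-S) S R S"
  have A: "euler_over A 2" and B: "euler_over B 2"
    unfolding A_def B_def using assms by (simp_all add: euler_over_two_rects)
  define C where "C = rect (-S) (-R) (-S) (-R) \<union> rect (-S) (-R) R S"
  define D where "D = rect R S (-S) (-R) \<union> rect R S R S"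
  have AB: "A \<inter> B = C \<union> D"
    using assms unfolding A_def B_def C_def D_def rect_def by auto
  have C: "euler_over C 2" and D: "euler_over D 2"
    unfolding C_def D_def using assms by (simp_all add: euler_over_two_rects)
  have "C \<inter> D = {}" using assms by (auto simp: C_def D_def rect_def)
  from euler_over_disjoint[OF C D this] have "euler_over (A \<inter> B) 4" unfolding AB by simp
  from euler_over_Un[OF A B this] have "euler_over (A \<union> B) 0" by simp
  moreover have "A \<union> B = rect (-S) S (-S) S - {u. \<bar>Re u\<bar> \<le> R \<and> \<bar>Im u\<bar> \<le> R}"
    using assms unfolding A_def B_def rect_def by auto
  ultimately show ?thesis by simp
qed

text \<open>\<open>X\<close> is the union of the preimage of a large square \<open>Q\<close> and a
  neighbourhood of the fiber at infinity; they overlap in the preimage of a square annulus, which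
  contributes 0.\<close>

lemma euler_total:
  "has_euler X (int degr - (\<Sum>b\<in>special. deficit b) + int (card fiber_inf))"
proof -
  obtain \<rho> \<psi> where m: "local_model X X1 w e 0 \<rho> \<psi>" and far: "\<And>b. norm b > 1 / \<rho> \<Longrightarrow> b \<notin> special"
    using card_fiber_far by metis
  have \<rho>: "\<rho> > 0" using m by (auto simp: local_model_def)
  \<comment> \<open>So large that the square \<open>K\<close> contains all special values.\<close>
  define R where "R = 1 / \<rho> + 1"
  have R: "R > 1 / \<rho>" "R > 0" using \<rho> by (auto simp: R_def add_pos_pos)
  define K where "K = {u. \<bar>Re u\<bar> \<le> R \<and> \<bar>Im u\<bar> \<le> R}"
  \<comment> \<open>The complement of \<open>K\<close> in the sphere, seen in the coordinate
    \<open>1 / u\<close>; it is star-shaped about 0 because \<open>K\<close> is.\<close>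
  define V where "V = {v. v = 0 \<or> 1 / v \<notin> K}"
  have notK: "norm u > R" if "u \<notin> K" for u
    using that abs_Re_le_cmod[of u] abs_Im_le_cmod[of u] by (auto simp: K_def)
  have Vsub: "V \<subseteq> ball 0 \<rho>"
  proof
    fix v assume v: "v \<in> V"
    show "v \<in> ball 0 \<rho>"
    proof (cases "v = 0")
      case False
      then have "norm (1 / v) > 1 / \<rho>" using v notK[of "1 / v"] R by (auto simp: V_def)
      then show ?thesis using \<rho> False by (simp add: norm_divide field_simps)
    qed (use \<rho> in auto)
  qed
  have "V = ball 0 (1 / (2 * R)) \<union> {v \<in> - {0}. 1 / v \<in> - K}"
  proof (intro equalityI subsetI)
    fix v assume v: "v \<in> ball 0 (1 / (2 * R)) \<union> {v \<in> - {0}. 1 / v \<in> - K}"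
    show "v \<in> V"
    proof (cases "v \<in> {v \<in> - {0}. 1 / v \<in> - K} \<or> v = 0")
      case False
      then have "norm v < 1 / (2 * R)" "v \<noteq> 0" using v by auto
      then have "norm (1 / v) > 2 * R" using R by (simp add: norm_divide field_simps)
      moreover have "norm (1 / v) \<le> \<bar>Re (1 / v)\<bar> + \<bar>Im (1 / v)\<bar>" by (rule cmod_le)
      ultimately have "1 / v \<notin> K" by (auto simp: K_def)
      then show ?thesis by (simp add: V_def)
    qed (auto simp: V_def)
  qed (use R in \<open>auto simp: V_def\<close>)
  moreover have "open {v \<in> - {0}. 1 / v \<in> - K}"
  proof -
    have "K = cbox (Complex (-R) (-R)) (Complex R R)" by (auto simp: K_def in_cbox_complex_iff)
    then have "open (- K)" by (simp add: closed_cbox open_Compl)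
    moreover have "continuous_on (- {0}) (\<lambda>v::complex. 1 / v)" by (intro continuous_intros) auto
    moreover have "{v \<in> - {0}. 1 / v \<in> - K} = (- {0}) \<inter> (\<lambda>v. 1 / v) -` (- K)" by auto
    ultimately show ?thesis by (metis continuous_on_open_vimage open_Compl closed_singleton Int_commute)
  qed
  ultimately have openV: "open V" by (metis open_Un open_ball)
  have star: "0 + of_real t * (v - 0) \<in> V" if v: "v \<in> V" "0 \<le> t" "t \<le> 1" for v and t :: real
  proof (cases "t = 0 \<or> v = 0")
    case False
    then have "1 / v \<notin> K" using v by (auto simp: V_def)
    moreover have "1 / v = of_real t * (1 / (of_real t * v))" using False by simp
    moreover have "of_real t * u \<in> K" if "u \<in> K" for u
    proof -
      have "t * \<bar>Re u\<bar> \<le> 1 * R"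
        by (rule mult_mono) (use that v in \<open>auto simp: K_def\<close>)
      moreover have "t * \<bar>Im u\<bar> \<le> 1 * R"
        by (rule mult_mono) (use that v in \<open>auto simp: K_def\<close>)
      ultimately show ?thesis using v by (simp add: K_def abs_mult)
    qed
    ultimately have "1 / (of_real t * v) \<notin> K" by metis
    then show ?thesis by (simp add: V_def)
  qed (auto simp: V_def)
  have "0 \<in> V" by (simp add: V_def)
  have inf: "has_euler (subtopology X {x\<in>X1. w x \<in> V}) (int (card fiber_inf))"
    unfolding fiber_inf_def
    by (rule local_model_euler_center[OF m Vsub openV]) (use star \<open>0 \<in> V\<close> in auto)
  define Q where "Q = rect (-(R+1)) (R+1) (-(R+1)) (R+1)"
  have KQ: "K \<subseteq> Q" using R by (auto simp: K_def Q_def rect_def)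
  have "special \<subseteq> K" using far notK R(1) by (meson less_trans subsetI)
  then have sp: "special \<inter> Q = special" "special \<inter> (Q - K) = {}" using KQ by auto
  have fin: "has_euler (subtopology X {x\<in>X0. z x \<in> Q}) (int degr - (\<Sum>b\<in>special. deficit b))"
    using euler_over_rect[of "-(R+1)" "R+1" "-(R+1)" "R+1"] R sp unfolding euler_over_def Q_def by simp
  have ann: "has_euler (subtopology X {x\<in>X0. z x \<in> Q - K}) 0"
    using euler_over_annulus[of R "R + 1"] R sp unfolding euler_over_def Q_def K_def by simp
  have Int: "{x\<in>X0. z x \<in> Q} \<inter> {x\<in>X1. w x \<in> V} = {x\<in>X0. z x \<in> Q - K}"
  proof (intro equalityI subsetI)
    fix x assume x: "x \<in> {x\<in>X0. z x \<in> Q} \<inter> {x\<in>X1. w x \<in> V}"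
    then have "z x \<noteq> 0" "w x = 1 / z x" "w x \<in> V" using X1_iff wz by auto
    then have "z x \<notin> K" by (auto simp: V_def)
    then show "x \<in> {x\<in>X0. z x \<in> Q - K}" using x by auto
  next
    fix x assume x: "x \<in> {x\<in>X0. z x \<in> Q - K}"
    then have "z x \<noteq> 0" using R by (auto simp: K_def)
    then have "x \<in> X1" "w x = 1 / z x" using x X1_iff wz by auto
    then show "x \<in> {x\<in>X0. z x \<in> Q} \<inter> {x\<in>X1. w x \<in> V}" using x by (auto simp: V_def)
  qed
  have Un: "{x\<in>X0. z x \<in> Q} \<union> {x\<in>X1. w x \<in> V} = topspace X"
  proof (intro equalityI subsetI)
    fix x assume "x \<in> topspace X"
    then consider "x \<in> X0" | "x \<in> X1" "x \<notin> X0" using cover by auto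
    then show "x \<in> {x\<in>X0. z x \<in> Q} \<union> {x\<in>X1. w x \<in> V}"
    proof cases
      case 1
      show ?thesis
      proof (cases "z x \<in> K")
        case False
        then have "z x \<noteq> 0" using R by (auto simp: K_def)
        then have "x \<in> X1" "w x = 1 / z x" using 1 X1_iff wz by auto
        then show ?thesis using False by (auto simp: V_def)
      qed (use 1 KQ in auto)
    next
      case 2
      then have "w x = 0" using X0_iff by auto
      then show ?thesis using 2 by (auto simp: V_def)
    qed
  qed (use cover in auto)
  have "has_euler (subtopology X ({x\<in>X0. z x \<in> Q} \<union> {x\<in>X1. w x \<in> V}))
     (int degr - (\<Sum>b\<in>special. deficit b) + int (card fiber_inf) - 0)"
    using fin inf ann openV unfolding Int[symmetric] 
    by (intro has_euler_Un open_preimage open_preimage_w) (auto simp: Q_def)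
  then show ?thesis by (simp add: Un)
qed

text \<open>Each deficit is the sum of \<open>e x - 1\<close> over its fiber, and so is
  \<open>degr\<close> minus the size of the fiber at infinity. This turns \<open>euler_total\<close>
  into \<open>2 * degr\<close> minus the total ramification.\<close>

theorem riemann_hurwitz:
  "finite {x\<in>topspace X. e x \<noteq> 1}"
  "has_euler X (2 * int degr - (\<Sum>x | x \<in> topspace X \<and> e x \<noteq> 1. int (e x) - 1))"
proof -
  have def_sum: "deficit b = (\<Sum>x\<in>fiber b. int (e x) - 1)" for b
    using sum_fiber[of b] by (simp add: deficit_def sum_subtractf flip: of_nat_sum)
  have sub: "{x\<in>topspace X. e x \<noteq> 1} \<subseteq> (\<Union>b\<in>special. fiber b) \<union> fiber_inf"
  proof
    fix x assume x: "x \<in> {x\<in>topspace X. e x \<noteq> 1}"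
    show "x \<in> (\<Union>b\<in>special. fiber b) \<union> fiber_inf"
    proof (cases "x \<in> X0")
      case True
      then have xf: "x \<in> fiber (z x)" by (simp add: fiber_def)
      have "0 < int (e x) - 1" using x e_pos_fiber[OF xf] by auto
      also have "\<dots> \<le> deficit (z x)"
        unfolding def_sum
      proof (rule member_le_sum[OF xf])
        fix y assume "y \<in> fiber (z x) - {x}"
        then show "0 \<le> int (e y) - 1" using e_pos_fiber[of y "z x"] by simp
      qed (rule finite_fiber)
      finally have "z x \<in> special" by (simp add: special_def deficit_def)
      then show ?thesis using xf by blast
    next
      case False
      then show ?thesis using x cover X0_iff by (auto simp: fiber_inf_def)
    qed
  qed
  show fin: "finite {x\<in>topspace X. e x \<noteq> 1}"
    by (rule finite_subset[OF sub]) (use finite_special finite_fiber finite_fiber_inf in auto)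
  have disj: "(\<Union>b\<in>special. fiber b) \<inter> fiber_inf = {}"
    using X1_iff X0_iff by (auto simp: fiber_def fiber_inf_def)
  have "(\<Sum>x | x \<in> topspace X \<and> e x \<noteq> 1. int (e x) - 1) = (\<Sum>x\<in>(\<Union>b\<in>special. fiber b) \<union> fiber_inf. int (e x) - 1)"
    using sub finite_special finite_fiber finite_fiber_inf cover
    by (intro sum.mono_neutral_left) (auto simp: fiber_def fiber_inf_def)
  also have "\<dots> = (\<Sum>x\<in>(\<Union>b\<in>special. fiber b). int (e x) - 1) + (\<Sum>x\<in>fiber_inf. int (e x) - 1)"
    using finite_special finite_fiber finite_fiber_inf disj by (intro sum.union_disjoint) auto
  also have "(\<Sum>x\<in>(\<Union>b\<in>special. fiber b). int (e x) - 1) = (\<Sum>b\<in>special. deficit b)"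
    unfolding def_sum using finite_special finite_fiber
    by (intro sum.UNION_disjoint) (auto simp: fiber_def)
  also have "(\<Sum>x\<in>fiber_inf. int (e x) - 1) = int degr - int (card fiber_inf)"
    using sum_fiber_inf by (simp add: sum_subtractf flip: of_nat_sum)
  finally have "int degr - (\<Sum>b\<in>special. deficit b) + int (card fiber_inf)
    = 2 * int degr - (\<Sum>x | x \<in> topspace X \<and> e x \<noteq> 1. int (e x) - 1)" by linarith
  then show "has_euler X (2 * int degr - (\<Sum>x | x \<in> topspace X \<and> e x \<noteq> 1. int (e x) - 1))"
    using euler_total by metis
qed

end

section \<open>Orders of vanishing\<close>

text \<open>The factorization on a disc is part of the definition, so that products and compositions
  are handled by multiplying factors. No \<open>n\<close> qualifies for a function vanishing
  identically near \<open>a\<close>.\<close>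

definition zero_order :: "(complex \<Rightarrow> complex) \<Rightarrow> complex \<Rightarrow> nat \<Rightarrow> bool" where
  "zero_order g a n \<longleftrightarrow> (\<exists>h r. r > 0 \<and> h holomorphic_on ball a r \<and>
     (\<forall>t\<in>ball a r. h t \<noteq> 0 \<and> g t = (t - a) ^ n * h t))"

lemma zero_orderE:
  assumes "zero_order g a n" "\<epsilon> > 0"
  obtains h r where "0 < r" "r \<le> \<epsilon>" "h holomorphic_on ball a r"
    "\<And>t. t \<in> ball a r \<Longrightarrow> h t \<noteq> 0" "\<And>t. t \<in> ball a r \<Longrightarrow> g t = (t - a) ^ n * h t"
proof -
  obtain h r where h: "r > 0" "h holomorphic_on ball a r" "\<forall>t\<in>ball a r. h t \<noteq> 0 \<and> g t = (t - a) ^ n * h t"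
    using assms(1) unfolding zero_order_def by blast
  show ?thesis
    by (rule that[of "min r \<epsilon>" h]) (use h assms(2) in \<open>auto intro: holomorphic_on_subset\<close>)
qed

lemma zero_orderI_nonzero:
  assumes h: "h holomorphic_on W" "open W" "a \<in> W" "h a \<noteq> 0" and g: "\<And>t. t \<in> W \<Longrightarrow> g t = (t - a) ^ n * h t"
  shows "zero_order g a n"
proof -
  have "open {t\<in>W. h t \<noteq> 0}"
    using continuous_open_preimage[OF holomorphic_on_imp_continuous_on[OF h(1)] h(2), of "- {0}"]
    by (simp add: Int_def vimage_def open_Compl)
  moreover have "a \<in> {t\<in>W. h t \<noteq> 0}" using h by auto
  ultimately obtain r where r: "r > 0" "ball a r \<subseteq> {t\<in>W. h t \<noteq> 0}" using openE by blast
  show ?thesis unfolding zero_order_def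
    by (rule exI[of _ h], rule exI[of _ r]) (use r g h in \<open>auto intro: holomorphic_on_subset\<close>)
qed

lemma zero_order_0I: "g holomorphic_on W \<Longrightarrow> open W \<Longrightarrow> a \<in> W \<Longrightarrow> g a \<noteq> 0 \<Longrightarrow> zero_order g a 0"
  by (rule zero_orderI_nonzero[of g W]) auto

lemma zero_order_eq_0_iff: "zero_order g a n \<Longrightarrow> g a = 0 \<longleftrightarrow> n > 0"
  unfolding zero_order_def by (metis centre_in_ball diff_self gr0I mult_eq_0_iff mult_zero_left power_0 one_neq_zero zero_power)

lemma zero_order_near:
  assumes "zero_order g a n"
  obtains r where "r > 0" "\<And>t. t \<in> ball a r \<Longrightarrow> t \<noteq> a \<Longrightarrow> g t \<noteq> 0"
proof -
  obtain h r where "r > 0" "\<forall>t\<in>ball a r. h t \<noteq> 0 \<and> g t = (t - a) ^ n * h t"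
    using assms unfolding zero_order_def by blast
  then show ?thesis by (intro that[of r]) auto
qed

lemma zero_order_not_zero:
  assumes z: "zero_order g a n" and r: "r > 0" "\<And>t. t \<in> ball a r \<Longrightarrow> g t = 0"
  shows False
proof -
  obtain s where s: "s > 0" "\<And>t. t \<in> ball a s \<Longrightarrow> t \<noteq> a \<Longrightarrow> g t \<noteq> 0" using zero_order_near[OF z] by blast
  define t where "t = a + of_real (min r s / 2)"
  have "norm (t - a) = min r s / 2" using r(1) s(1) by (simp add: t_def)
  then have "t \<in> ball a r" "t \<in> ball a s" "t \<noteq> a" using r(1) s(1) by (auto simp: dist_norm norm_minus_commute)
  then show False using s(2) r(2) by blast
qed

lemma zero_order_cong:
  assumes "zero_order g a n" "open W" "a \<in> W" "\<And>t. t \<in> W \<Longrightarrow> g' t = g t"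
  shows "zero_order g' a n"
proof -
  obtain \<epsilon> where "\<epsilon> > 0" "ball a \<epsilon> \<subseteq> W" using assms openE by blast
  then obtain h r where h: "0 < r" "r \<le> \<epsilon>" "h holomorphic_on ball a r"
    "\<And>t. t \<in> ball a r \<Longrightarrow> h t \<noteq> 0" "\<And>t. t \<in> ball a r \<Longrightarrow> g t = (t - a) ^ n * h t"
    using zero_orderE[OF assms(1)] by metis
  moreover have "ball a r \<subseteq> W" using h(2) \<open>ball a \<epsilon> \<subseteq> W\<close> by auto
  ultimately show ?thesis unfolding zero_order_def using assms(4)
    by (intro exI[of _ h] exI[of _ r]) auto
qed

lemma zero_order_mult:
  assumes "zero_order g a n" "zero_order h a m"
  shows "zero_order (\<lambda>t. g t * h t) a (n + m)"
proof -
  obtain u r where u: "0 < r" "u holomorphic_on ball a r"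
    "\<And>t. t \<in> ball a r \<Longrightarrow> u t \<noteq> 0" "\<And>t. t \<in> ball a r \<Longrightarrow> g t = (t - a) ^ n * u t"
    using zero_orderE[OF assms(1), of 1] by (metis zero_less_one)
  obtain v s where v: "0 < s" "s \<le> r" "v holomorphic_on ball a s"
    "\<And>t. t \<in> ball a s \<Longrightarrow> v t \<noteq> 0" "\<And>t. t \<in> ball a s \<Longrightarrow> h t = (t - a) ^ m * v t"
    using zero_orderE[OF assms(2) u(1)] by metis
  have "ball a s \<subseteq> ball a r" using v by auto
  then show ?thesis unfolding zero_order_def using u v
    by (intro exI[of _ "\<lambda>t. u t * v t"] exI[of _ s])
       (auto simp: power_add intro!: holomorphic_intros intro: holomorphic_on_subset)
qed

lemma zero_order_cmult: "zero_order g a n \<Longrightarrow> c \<noteq> 0 \<Longrightarrow> zero_order (\<lambda>t. c * g t) a n"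
  using zero_order_mult[OF zero_order_0I[of "\<lambda>_. c" UNIV a], of g n] by auto

text \<open>If \<open>n > m\<close>, cancelling \<open>(t - a) ^ m\<close> away from
  \<open>a\<close> and passing to the limit makes the nonvanishing factor \<open>v\<close> vanish at
  \<open>a\<close>.\<close>

lemma zero_order_unique:
  assumes "zero_order g a n" "zero_order g a m" shows "n = m"
proof -
  have le: "n \<le> m" if A: "zero_order g a n" and B: "zero_order g a m" for n m
  proof (rule ccontr)
    assume "\<not> n \<le> m"
    obtain u r where u: "0 < r" "u holomorphic_on ball a r"
      "\<And>t. t \<in> ball a r \<Longrightarrow> u t \<noteq> 0" "\<And>t. t \<in> ball a r \<Longrightarrow> g t = (t - a) ^ n * u t"
      using zero_orderE[OF A, of 1] by (metis zero_less_one)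
    obtain v s where v: "0 < s" "s \<le> r" "v holomorphic_on ball a s"
      "\<And>t. t \<in> ball a s \<Longrightarrow> v t \<noteq> 0" "\<And>t. t \<in> ball a s \<Longrightarrow> g t = (t - a) ^ m * v t"
      using zero_orderE[OF B u(1)] by metis
    have eq: "v t = (t - a) ^ (n - m) * u t" if "t \<in> ball a s - {a}" for t
    proof -
      have "(t - a) ^ m * v t = (t - a) ^ n * u t" using u(4)[of t] v(5)[of t] v(2) that by auto
      also have "\<dots> = (t - a) ^ m * ((t - a) ^ (n - m) * u t)"
        using \<open>\<not> n \<le> m\<close> by (simp flip: power_add mult.assoc)
      finally show ?thesis using that by auto
    qed
    have "continuous_on (ball a s) v" using v holomorphic_on_imp_continuous_on by blast
    then have "isCont v a" using v(1) by (simp add: continuous_on_eq_continuous_at)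
    then have 1: "(v \<longlongrightarrow> v a) (at a)" by (simp add: isCont_def)
    have "continuous_on (ball a r) u" using u holomorphic_on_imp_continuous_on by blast
    then have "isCont u a" using u(1) by (simp add: continuous_on_eq_continuous_at)
    then have "((\<lambda>t. (t - a) ^ (n - m) * u t) \<longlongrightarrow> (a - a) ^ (n - m) * u a) (at a)"
      by (intro tendsto_intros) (simp add: isCont_def)
    moreover have "\<forall>\<^sub>F t in at a. v t = (t - a) ^ (n - m) * u t"
      unfolding eventually_at using v(1) eq by (intro exI[of _ s]) (auto simp: dist_commute)
    ultimately have 2: "(v \<longlongrightarrow> (a - a) ^ (n - m) * u a) (at a)" by (simp add: filterlim_cong)
    have "v a = (a - a) ^ (n - m) * u a" by (rule tendsto_unique[OF _ 1 2]) simp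
    then have "v a = 0" using \<open>\<not> n \<le> m\<close> by (simp add: zero_power)
    then show False using v(1,4) by auto
  qed
  show ?thesis using le[OF assms] le[OF assms(2,1)] by simp
qed

lemma zero_order_exists:
  assumes "g holomorphic_on W" "open W" "a \<in> W"
  shows "(\<exists>n. zero_order g a n) \<or> (\<exists>r>0. \<forall>t\<in>ball a r. g t = 0)"
proof (cases "g a = 0")
  case False
  then show ?thesis using zero_order_0I[OF assms] by blast
next
  case True
  obtain \<epsilon> where \<epsilon>: "\<epsilon> > 0" "ball a \<epsilon> \<subseteq> W" using assms openE by blast
  have hol: "g holomorphic_on ball a \<epsilon>" using assms \<epsilon> holomorphic_on_subset by blast
  show ?thesis
  proof (cases "g constant_on ball a \<epsilon>")
    case True
    then have "\<forall>t\<in>ball a \<epsilon>. g t = 0" using \<open>g a = 0\<close> \<epsilon> unfolding constant_on_def by (metis centre_in_ball)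
    then show ?thesis using \<epsilon> by blast
  next
    case False
    then obtain h r n where "0 < n" "0 < r" "h holomorphic_on ball a r"
       "\<And>w. w \<in> ball a r \<Longrightarrow> g w = (w - a) ^ n * h w" "\<And>w. w \<in> ball a r \<Longrightarrow> h w \<noteq> 0"
      using holomorphic_factor_zero_nonconstant[OF hol _ _ _ \<open>g a = 0\<close>] \<epsilon> by (metis centre_in_ball connected_ball open_ball)
    then show ?thesis unfolding zero_order_def by blast
  qed
qed

text \<open>The difference quotient of \<tau> extends holomorphically to \<open>a\<close> with the
  nonzero value \<open>deriv \<tau> a\<close>, so \<open>\<tau> t - \<tau> a\<close> has a simple
  zero.\<close>

lemma zero_order_compose:
  assumes g: "zero_order g (\<tau> a) n" and \<tau>: "\<tau> holomorphic_on W" "open W" "a \<in> W" "deriv \<tau> a \<noteq> 0"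
  shows "zero_order (\<lambda>t. g (\<tau> t)) a n"
proof -
  obtain h r where h: "0 < r" "h holomorphic_on ball (\<tau> a) r"
    "\<And>t. t \<in> ball (\<tau> a) r \<Longrightarrow> h t \<noteq> 0" "\<And>t. t \<in> ball (\<tau> a) r \<Longrightarrow> g t = (t - \<tau> a) ^ n * h t"
    using zero_orderE[OF g, of 1] by (metis zero_less_one)
  define d where "d t = (if t = a then deriv \<tau> a else (\<tau> t - \<tau> a) / (t - a))" for t
  have d: "d holomorphic_on W" 
    using pole_theorem_open[OF \<tau>(1,2), of a "\<lambda>t. \<tau> t / (t - a)"] unfolding d_def diff_divide_distrib by simp
  have \<tau>d: "\<tau> t - \<tau> a = (t - a) * d t" for t by (simp add: d_def)
  have "continuous_on W \<tau>" using \<tau> holomorphic_on_imp_continuous_on by blast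
  then have op: "open (W \<inter> \<tau> -` ball (\<tau> a) r)" using \<tau>(2) by (intro continuous_open_preimage) auto
  show ?thesis
  proof (rule zero_orderI_nonzero[OF _ op])
    show "(\<lambda>t. d t ^ n * (h \<circ> \<tau>) t) holomorphic_on W \<inter> \<tau> -` ball (\<tau> a) r"
      by (intro holomorphic_intros holomorphic_on_compose holomorphic_on_subset[OF d] holomorphic_on_subset[OF \<tau>(1)] holomorphic_on_subset[OF h(2)]) auto
    show "a \<in> W \<inter> \<tau> -` ball (\<tau> a) r" using \<tau> h by auto
    show "d a ^ n * (h \<circ> \<tau>) a \<noteq> 0" using \<tau>(4) h by (simp add: d_def)
    fix t assume "t \<in> W \<inter> \<tau> -` ball (\<tau> a) r"
    then show "g (\<tau> t) = (t - a) ^ n * (d t ^ n * (h \<circ> \<tau>) t)"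
      using h(4)[of "\<tau> t"] by (simp add: \<tau>d power_mult_distrib)
  qed
qed

text \<open>The derivative of \<open>(t - a) ^ Suc n * h t\<close> is \<open>(t - a) ^ n\<close>
  times a function that takes a nonzero multiple of \<open>h a\<close> at \<open>a\<close>.\<close>

lemma zero_order_deriv:
  assumes "zero_order (\<lambda>t. g t - c) a (Suc n)"
  shows "zero_order (deriv g) a n"
proof -
  obtain h r where h: "0 < r" "h holomorphic_on ball a r"
    "\<And>t. t \<in> ball a r \<Longrightarrow> h t \<noteq> 0" "\<And>t. t \<in> ball a r \<Longrightarrow> g t - c = (t - a) ^ Suc n * h t"
    using zero_orderE[OF assms, of 1] by (metis zero_less_one)
  show ?thesis
  proof (rule zero_orderI_nonzero)
    show "(\<lambda>t. of_nat (Suc n) * h t + (t - a) * deriv h t) holomorphic_on ball a r"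
      by (intro holomorphic_intros h(2) holomorphic_deriv) auto
    show "of_nat (Suc n) * h a + (a - a) * deriv h a \<noteq> 0" using h(1,3) by (simp del: of_nat_Suc)
    fix t assume t: "t \<in> ball a r"
    have dh: "(h has_field_derivative deriv h t) (at t)"
      using h(2) t holomorphic_derivI by blast
    have "((\<lambda>t. c + (t - a) ^ Suc n * h t) has_field_derivative
        (of_nat (Suc n) * (t - a) ^ n * h t + (t - a) ^ Suc n * deriv h t)) (at t)"
    proof -
      have 1: "((\<lambda>t. (t - a) ^ Suc n) has_field_derivative of_nat (Suc n) * (1 * (t - a) ^ (Suc n - Suc 0))) (at t)"
        by (rule DERIV_power) (auto intro!: derivative_eq_intros)
      show ?thesis
        by (rule DERIV_cong[OF DERIV_add[OF DERIV_const[of c] DERIV_mult[OF 1 dh]]])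
           (simp add: mult_ac del: of_nat_Suc)
    qed
    then have "(g has_field_derivative
        (of_nat (Suc n) * (t - a) ^ n * h t + (t - a) ^ Suc n * deriv h t)) (at t)"
    proof (rule has_field_derivative_transform_within_open[where S = "ball a r"])
      fix s assume "s \<in> ball a r"
      then show "c + (s - a) ^ Suc n * h s = g s" using h(4)[of s] by (simp add: algebra_simps)
    qed (use t in auto)
    then show "deriv g t = (t - a) ^ n * (of_nat (Suc n) * h t + (t - a) * deriv h t)"
      by (simp add: DERIV_imp_deriv algebra_simps)
  qed (use h in auto)
qed

text \<open>The nonvanishing factor has an \<open>n\<close>-th root on the disc, by means of a
  logarithm. So \<open>S\<close>, an \<open>n\<close>-th root of \<open>g - b\<close> with a simple
  zero, is a local coordinate at \<open>a\<close>; its inverse is the required map.\<close>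

lemma zero_order_local_form:
  assumes g: "zero_order (\<lambda>t. g t - b) a n" and n: "n > 0" and W: "open W" "a \<in> W"
  obtains \<psi> \<rho> where "\<rho> > 0" "\<psi> 0 = a" "\<psi> holomorphic_on ball 0 \<rho>" "inj_on \<psi> (ball 0 \<rho>)" "open (\<psi> ` ball 0 \<rho>)"
    "\<psi> ` ball 0 \<rho> \<subseteq> W" "\<And>s. s \<in> ball 0 \<rho> \<Longrightarrow> g (\<psi> s) = b + s ^ n"
proof -
  obtain \<epsilon> where \<epsilon>: "\<epsilon> > 0" "ball a \<epsilon> \<subseteq> W" using W openE by blast
  obtain h r where h: "0 < r" "r \<le> \<epsilon>" "h holomorphic_on ball a r"
    "\<And>t. t \<in> ball a r \<Longrightarrow> h t \<noteq> 0" "\<And>t. t \<in> ball a r \<Longrightarrow> g t - b = (t - a) ^ n * h t"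
    using zero_orderE[OF g \<epsilon>(1)] by metis
  obtain v where v: "v holomorphic_on ball a r" "\<And>t. t \<in> ball a r \<Longrightarrow> h t = exp (v t)"
    using contractible_imp_holomorphic_log[OF h(3) convex_imp_contractible[OF convex_ball]] h(4) by metis
  define S where "S t = (t - a) * exp (v t / of_nat n)" for t
  have Shol: "S holomorphic_on ball a r" unfolding S_def using n by (intro holomorphic_intros v) auto
  have Sn: "S t ^ n = g t - b" if "t \<in> ball a r" for t
    using h(5)[OF that] v(2)[OF that] n by (simp add: S_def power_mult_distrib flip: exp_of_nat_mult)
  have dS: "deriv S a \<noteq> 0"
  proof -
    have "v field_differentiable at a" using v(1) h(1) by (auto intro: holomorphic_on_imp_differentiable_at)
    then have dv: "(v has_field_derivative deriv v a) (at a)" by (simp add: DERIV_deriv_iff_field_differentiable)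
    have "(S has_field_derivative exp (v a / of_nat n)) (at a)"
      unfolding S_def using n by (auto intro!: derivative_eq_intros dv)
    then show ?thesis by (simp add: DERIV_imp_deriv)
  qed
  obtain r1 where r1: "r1 > 0" "ball a r1 \<subseteq> ball a r" "open (S ` ball a r1)" "inj_on S (ball a r1)"
    using has_complex_derivative_locally_invertible[OF Shol _ open_ball dS] h(1) by auto
  have S1: "S holomorphic_on ball a r1" using Shol r1 holomorphic_on_subset by blast
  obtain G where G: "G holomorphic_on (S ` ball a r1)" "\<And>t. t \<in> ball a r1 \<Longrightarrow> G (S t) = t"
    using holomorphic_has_inverse[OF S1 open_ball r1(4)] by metis
  have "0 \<in> S ` ball a r1" using r1(1) by (auto simp: S_def intro!: image_eqI[of _ _ a])
  then obtain \<rho> where \<rho>: "\<rho> > 0" "ball 0 \<rho> \<subseteq> S ` ball a r1" using r1(3) openE by blast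
  have SG: "S (G s) = s \<and> G s \<in> ball a r1" if "s \<in> ball 0 \<rho>" for s using \<rho>(2) G(2) that by auto
  show ?thesis
  proof (rule that[of \<rho> G])
    show "G 0 = a" using G(2)[of a] r1(1) by (simp add: S_def)
    show hol: "G holomorphic_on ball 0 \<rho>" using G(1) \<rho>(2) holomorphic_on_subset by blast
    show inj: "inj_on G (ball 0 \<rho>)" using SG by (metis inj_onI)
    show "open (G ` ball 0 \<rho>)" by (rule open_mapping_thm3[OF hol _ inj]) auto
    show "G ` ball 0 \<rho> \<subseteq> W" using SG r1(2) h(2) \<epsilon>(2) by fastforce
    fix s :: complex assume s: "s \<in> ball 0 \<rho>"
    have "G s \<in> ball a r" using SG[OF s] r1(2) by blast
    then show "g (G s) = b + s ^ n" using SG[OF s] Sn[of "G s"] by (metis add.commute diff_add_cancel)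
  qed (use \<rho> in auto)
qed

text \<open>The case \<open>Q a \<noteq> 0\<close> is \<open>(P / Q)' = (P' Q - P Q') / Q\<^sup>2\<close>.\<close>

lemma zero_order_wronskian_aux:
  assumes P: "P holomorphic_on W" and Q: "Q holomorphic_on W" and W: "open W" "a \<in> W" and Qa: "Q a \<noteq> 0"
    and G: "zero_order (\<lambda>t. P a * Q t - Q a * P t) a (Suc n)"
  shows "zero_order (\<lambda>t. P t * deriv Q t - deriv P t * Q t) a n"
proof -
  have "open (W \<inter> Q -` (- {0}))"
    using holomorphic_on_imp_continuous_on[OF Q] W by (intro continuous_open_preimage) auto
  moreover have "a \<in> W \<inter> Q -` (- {0})" using W Qa by auto
  ultimately obtain r where r: "r > 0" "ball a r \<subseteq> W \<inter> Q -` (- {0})" using openE by blast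
  have P': "P holomorphic_on ball a r" and Q': "Q holomorphic_on ball a r" and Q0: "\<And>t. t \<in> ball a r \<Longrightarrow> Q t \<noteq> 0"
    using r P Q holomorphic_on_subset by (blast, blast, blast)
  have "zero_order (\<lambda>t. (- 1 / (Q a * Q t)) * (P a * Q t - Q a * P t)) a (0 + Suc n)" (is "zero_order ?f a _")
  proof (rule zero_order_mult[OF zero_order_0I G])
    show "(\<lambda>t. - 1 / (Q a * Q t)) holomorphic_on ball a r"
      using Q0 Qa by (intro holomorphic_intros Q') auto
  qed (use r Qa in auto)
  then have "zero_order ?f a (Suc n)" unfolding add_0 .
  then have "zero_order (\<lambda>t. P t / Q t - P a / Q a) a (Suc n)"
    by (rule zero_order_cong[where W = "ball a r"]) (use r Q0 Qa in \<open>auto simp: field_simps\<close>)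
  then have "zero_order (deriv (\<lambda>t. P t / Q t)) a n" by (rule zero_order_deriv)
  moreover have "zero_order (\<lambda>t. - (Q t * Q t)) a 0"
    by (rule zero_order_0I[of _ "ball a r"]) (use r Qa Q' in \<open>auto intro!: holomorphic_intros\<close>)
  ultimately have "zero_order (\<lambda>t. - (Q t * Q t) * deriv (\<lambda>t. P t / Q t) t) a (0 + n)"
    by (rule zero_order_mult[rotated])
  then have "zero_order (\<lambda>t. - (Q t * Q t) * deriv (\<lambda>t. P t / Q t) t) a n" unfolding add_0 .
  then show ?thesis
  proof (rule zero_order_cong[where W = "ball a r"])
    fix t assume tb: "t \<in> ball a r"
    have "((\<lambda>t. P t / Q t) has_field_derivative (deriv P t * Q t - P t * deriv Q t) / (Q t * Q t)) (at t)"
      by (rule DERIV_divide) (use tb P' Q' Q0 holomorphic_derivI in \<open>auto simp: dist_commute\<close>)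
    then have "deriv (\<lambda>t. P t / Q t) t = (deriv P t * Q t - P t * deriv Q t) / (Q t * Q t)"
      by (rule DERIV_imp_deriv)
    then show "P t * deriv Q t - deriv P t * Q t = - (Q t * Q t) * deriv (\<lambda>t. P t / Q t) t"
      using Q0[OF tb] by simp
  qed (use r in auto)
qed

text \<open>Where \<open>Q a\<close> vanishes, \<open>P\<close> and \<open>Q\<close> change places;
  the Wronskian and the function in the hypothesis then only change sign.\<close>

lemma zero_order_wronskian:
  assumes P: "P holomorphic_on W" and Q: "Q holomorphic_on W" and W: "open W" "a \<in> W" and ne: "P a \<noteq> 0 \<or> Q a \<noteq> 0"
    and G: "zero_order (\<lambda>t. P a * Q t - Q a * P t) a (Suc n)"
  shows "zero_order (\<lambda>t. P t * deriv Q t - deriv P t * Q t) a n"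
proof (cases "Q a = 0")
  case False
  then show ?thesis using zero_order_wronskian_aux[OF P Q W False G] by simp
next
  case True
  then have Pa: "P a \<noteq> 0" using ne by simp
  have "zero_order (\<lambda>t. (-1) * (P a * Q t - Q a * P t)) a (Suc n)" using G by (intro zero_order_cmult) auto
  then have "zero_order (\<lambda>t. Q a * P t - P a * Q t) a (Suc n)" by simp
  from zero_order_wronskian_aux[OF Q P W Pa this]
  have "zero_order (\<lambda>t. (-1) * (Q t * deriv P t - deriv Q t * P t)) a n" by (intro zero_order_cmult) auto
  then show ?thesis by (simp add: algebra_simps)
qed

section \<open>Vectors, homogeneous coordinates and lifts\<close>

text \<open>Bilinear, without conjugation, so that pairings of holomorphic curves are holomorphic.
  It is the pairing that identifies lines with points of the dual plane.\<close>

definition dot :: "complex^3 \<Rightarrow> complex^3 \<Rightarrow> complex" where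
  "dot a v = a $ 1 * v $ 1 + a $ 2 * v $ 2 + a $ 3 * v $ 3"

definition crs :: "complex^3 \<Rightarrow> complex^3 \<Rightarrow> complex^3" where
  "crs a b = vector [a $ 2 * b $ 3 - a $ 3 * b $ 2, a $ 3 * b $ 1 - a $ 1 * b $ 3, a $ 1 * b $ 2 - a $ 2 * b $ 1]"

lemma crs_nth [simp]:
  "crs a b $ 1 = a $ 2 * b $ 3 - a $ 3 * b $ 2"
  "crs a b $ 2 = a $ 3 * b $ 1 - a $ 1 * b $ 3"
  "crs a b $ 3 = a $ 1 * b $ 2 - a $ 2 * b $ 1"
  by (simp_all add: crs_def)

lemma vec3_eq_iff: "(v::complex^3) = w \<longleftrightarrow> v $ 1 = w $ 1 \<and> v $ 2 = w $ 2 \<and> v $ 3 = w $ 3"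
  by (simp add: vec_eq_iff forall_3)

lemma dot_sum: "dot a v = (\<Sum>i\<in>UNIV. a $ i * v $ i)"
  by (simp add: dot_def sum_3)

lemma dot_add_left: "dot (a + b) v = dot a v + dot b v"
  and dot_add_right: "dot a (v + w) = dot a v + dot a w"
  and dot_diff_left: "dot (a - b) v = dot a v - dot b v"
  and dot_diff_right: "dot a (v - w) = dot a v - dot a w"
  and dot_scale_left: "dot (c *s a) v = c * dot a v"
  and dot_scale_right: "dot a (c *s v) = c * dot a v"
  and dot_commute: "dot a v = dot v a"
  by (simp_all add: dot_def algebra_simps)

lemma dot_zero [simp]: "dot 0 v = 0" "dot v 0 = 0"
  by (simp_all add: dot_def)

lemmas dot_simps = dot_add_left dot_add_right dot_diff_left dot_diff_right dot_scale_left dot_scale_right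

text \<open>The Binet-Cauchy identity. With a curve and its derivative for \<open>u\<close> and
  \<open>v\<close>, the right side is the Wronskian of the linear forms \<open>a\<close> and
  \<open>b\<close> along the curve.\<close>

lemma dot_crs_crs: "dot (crs a b) (crs u v) = dot a u * dot b v - dot a v * dot b u"
  by (simp add: dot_def algebra_simps)

lemma dot_crs_self [simp]: "dot a (crs a b) = 0" "dot b (crs a b) = 0" "dot (crs a b) a = 0" "dot (crs a b) b = 0"
  by (simp_all add: dot_def algebra_simps)

lemma crs_scale: "crs (c *s u) v = c *s crs u v" "crs u (c *s v) = c *s crs u v"
  by (simp_all add: vec3_eq_iff algebra_simps)

lemma crs_crs: "crs a (crs b c) = dot a c *s b - dot a b *s c"
  by (simp add: vec3_eq_iff dot_def algebra_simps)

lemma crs_self [simp]: "crs v v = 0"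
  by (simp add: vec3_eq_iff)

lemma crs_add_right: "crs a (v + w) = crs a v + crs a w"
  by (simp add: vec3_eq_iff algebra_simps)

lemma crs_anticommute: "crs b a = (-1) *s crs a b"
  by (simp add: vec3_eq_iff algebra_simps)

lemma vec3_nonzero_dot: "(v::complex^3) \<noteq> 0 \<Longrightarrow> \<exists>a. dot a v = 1"
proof -
  assume "v \<noteq> 0"
  then obtain i where i: "v $ i \<noteq> 0" by (auto simp: vec_eq_iff)
  show ?thesis by (rule exI[of _ "axis i (1 / v $ i)"]) (use i in \<open>auto simp: dot_sum axis_def if_distrib[of "\<lambda>x. x * _"] cong: if_cong\<close>)
qed

lemma crs_eq_0D:
  assumes "crs u v = 0" "u \<noteq> 0" shows "\<exists>c. v = c *s u"
proof -
  obtain a where a: "dot a u = 1" using vec3_nonzero_dot[OF assms(2)] by blast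
  have "crs a (crs u v) = 0" by (simp add: assms(1) vec3_eq_iff)
  then have "v = dot a v *s u" using a by (simp add: crs_crs)
  then show ?thesis by blast
qed

text \<open>\<open>crs a b\<close> is the common point of the lines \<open>a\<close> and
  \<open>b\<close>, and two distinct lines have only one.\<close>

lemma orthogonal_two:
  assumes "crs a b \<noteq> 0" "dot a v = 0" "dot b v = 0" "v \<noteq> 0"
  shows "\<exists>c. c \<noteq> 0 \<and> crs a b = c *s v"
proof -
  have "crs v (crs a b) = 0" using assms by (simp add: crs_crs dot_commute)
  then obtain c where "crs a b = c *s v" using crs_eq_0D[OF _ assms(4)] by blast
  then show ?thesis using assms(1) by (metis vector_smult_lzero)
qed

lemma coords_nonzero [simp]: "coords p \<noteq> 0"
  using Quotient3_rep_reflp[OF Quotient3_P2, of p] by simp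

lemma pt_coords [simp]: "pt (coords p) = p"
  by (rule Quotient3_abs_rep[OF Quotient3_P2])

lemma coords_pt: "v \<noteq> 0 \<Longrightarrow> \<exists>c. c \<noteq> 0 \<and> coords (pt v) = c *s v"
proof -
  assume v: "v \<noteq> 0"
  have "\<exists>a. v = a *s v" by (rule exI[of _ 1]) simp
  then obtain a where a: "v = a *s coords (pt v)"
    using Quotient3_rep_abs[OF Quotient3_P2, of v] v by auto
  then have "a \<noteq> 0" using v by auto
  then have "coords (pt v) = inverse a *s v" by (subst a) simp
  then show ?thesis using \<open>a \<noteq> 0\<close> by (metis inverse_nonzero_iff_nonzero)
qed

lemma pt_scale: "v \<noteq> 0 \<Longrightarrow> c \<noteq> 0 \<Longrightarrow> pt (c *s v) = pt v"
  using Quotient3_rel[OF Quotient3_P2, of v "c *s v"] by auto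

lemma pt_eqD: "pt v = pt w \<Longrightarrow> v \<noteq> 0 \<Longrightarrow> w \<noteq> 0 \<Longrightarrow> \<exists>c. c \<noteq> 0 \<and> w = c *s v"
proof -
  assume eq: "pt v = pt w" and nz: "v \<noteq> 0" "w \<noteq> 0"
  obtain c d where "c \<noteq> 0" "coords (pt v) = c *s v" "d \<noteq> 0" "coords (pt w) = d *s w"
    using coords_pt nz by metis
  then have "c *s v = d *s w" using eq by simp
  then have "inverse d *s (c *s v) = inverse d *s (d *s w)" by (rule arg_cong)
  then have "w = (inverse d * c) *s v" using \<open>d \<noteq> 0\<close> by (simp add: vector_smult_assoc)
  then show ?thesis using \<open>c \<noteq> 0\<close> \<open>d \<noteq> 0\<close> by (metis inverse_zero_imp_zero mult_eq_0_iff)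
qed

section \<open>Holomorphic curves in the space of vectors\<close>

definition holo3 :: "(complex \<Rightarrow> complex^3) \<Rightarrow> complex set \<Rightarrow> bool" where
  "holo3 f W \<longleftrightarrow> (\<forall>i. (\<lambda>t. f t $ i) holomorphic_on W)"

definition vderiv :: "(complex \<Rightarrow> complex^3) \<Rightarrow> complex \<Rightarrow> complex^3" where
  "vderiv f t = (\<chi> i. deriv (\<lambda>u. f u $ i) t)"

lemma holo3_subset: "holo3 f W \<Longrightarrow> W' \<subseteq> W \<Longrightarrow> holo3 f W'"
  unfolding holo3_def using holomorphic_on_subset by blast

lemma holo3_nth: "holo3 f W \<Longrightarrow> (\<lambda>t. f t $ i) holomorphic_on W"
  by (simp add: holo3_def)

lemma holo3_continuous: "holo3 f W \<Longrightarrow> continuous_on W f"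
proof -
  assume "holo3 f W"
  then have "continuous_on W (\<lambda>t. \<chi> i. f t $ i)"
    unfolding holo3_def using holomorphic_on_imp_continuous_on
    by (intro continuous_on_vec_lambda) blast
  then show ?thesis by simp
qed

lemma holo3_dot [holomorphic_intros]: "holo3 f W \<Longrightarrow> (\<lambda>t. dot l (f t)) holomorphic_on W"
  unfolding dot_def holo3_def by (intro holomorphic_intros) auto

lemma holo3_vderiv: "holo3 f W \<Longrightarrow> open W \<Longrightarrow> holo3 (vderiv f) W"
  unfolding holo3_def vderiv_def by (auto intro: holomorphic_deriv)

lemma holo3_crs: "holo3 f W \<Longrightarrow> holo3 g W \<Longrightarrow> holo3 (\<lambda>t. crs (f t) (g t)) W"
  unfolding holo3_def forall_3 by (auto intro!: holomorphic_intros)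

lemma holo3_smult: "c holomorphic_on W \<Longrightarrow> holo3 f W \<Longrightarrow> holo3 (\<lambda>t. c t *s f t) W"
  unfolding holo3_def by (auto intro!: holomorphic_intros)

lemma deriv_dot:
  assumes "holo3 f W" "open W" "t \<in> W"
  shows "deriv (\<lambda>t. dot l (f t)) t = dot l (vderiv f t)"
proof -
  have d: "((\<lambda>t. f t $ i) has_field_derivative vderiv f t $ i) (at t)" for i
    unfolding vderiv_def using holomorphic_derivI[OF holo3_nth[OF assms(1)] assms(2,3)] by simp
  show ?thesis unfolding dot_def
    by (rule DERIV_imp_deriv) (auto intro!: derivative_eq_intros d)
qed

lemma deriv_dot_dot:
  assumes "holo3 f W" "holo3 g W" "open W" "t \<in> W"
  shows "deriv (\<lambda>t. dot (g t) (f t)) t = dot (vderiv g t) (f t) + dot (g t) (vderiv f t)"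
proof -
  have d: "((\<lambda>t. f t $ i) has_field_derivative vderiv f t $ i) (at t)"
     "((\<lambda>t. g t $ i) has_field_derivative vderiv g t $ i) (at t)" for i
    unfolding vderiv_def using holomorphic_derivI[OF holo3_nth[OF assms(1)] assms(3,4)]
     holomorphic_derivI[OF holo3_nth[OF assms(2)] assms(3,4)] by simp_all
  show ?thesis unfolding dot_def
    by (rule DERIV_imp_deriv) (auto intro!: derivative_eq_intros d simp: algebra_simps)
qed

lemma vderiv_smult:
  assumes "c holomorphic_on W" "holo3 f W" "open W" "t \<in> W"
  shows "vderiv (\<lambda>t. c t *s f t) t = deriv c t *s f t + c t *s vderiv f t"
proof -
  have d: "((\<lambda>t. f t $ i) has_field_derivative vderiv f t $ i) (at t)" for i
    unfolding vderiv_def using holomorphic_derivI[OF holo3_nth[OF assms(2)] assms(3,4)] by simp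
  have c: "(c has_field_derivative deriv c t) (at t)" using holomorphic_derivI[OF assms(1,3,4)] .
  have "deriv (\<lambda>t. c t * f t $ i) t = deriv c t * f t $ i + c t * vderiv f t $ i" for i
    by (rule DERIV_imp_deriv) (auto intro!: derivative_eq_intros d c simp: algebra_simps)
  then show ?thesis by (simp add: vec_eq_iff) (simp add: vderiv_def)
qed

lemma vderiv_compose:
  assumes "holo3 f W'" "open W'" "\<tau> holomorphic_on W" "open W" "t \<in> W" "\<tau> t \<in> W'"
  shows "vderiv (\<lambda>t. f (\<tau> t)) t = deriv \<tau> t *s vderiv f (\<tau> t)"
proof -
  have "deriv (\<lambda>t. f (\<tau> t) $ i) t = deriv \<tau> t * deriv (\<lambda>u. f u $ i) (\<tau> t)" for i
  proof -
    have "((\<lambda>t. f (\<tau> t) $ i) has_field_derivative deriv (\<lambda>u. f u $ i) (\<tau> t) * deriv \<tau> t) (at t)"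
      by (rule DERIV_chain2[OF holomorphic_derivI[OF holo3_nth[OF assms(1)] assms(2,6)] holomorphic_derivI[OF assms(3,4,5)]])
    then show ?thesis by (simp add: DERIV_imp_deriv mult.commute)
  qed
  then show ?thesis by (simp add: vderiv_def vec_eq_iff)
qed

lemma vderiv_cong:
  assumes "\<And>t. t \<in> W \<Longrightarrow> f t = g t" "open W" "t \<in> W"
  shows "vderiv f t = vderiv g t"
  unfolding vderiv_def vec_eq_iff
proof (intro allI)
  fix i
  have "deriv (\<lambda>u. f u $ i) t = deriv (\<lambda>u. g u $ i) t"
    using assms by (intro deriv_cong_ev) (auto simp: eventually_nhds)
  then show "(\<chi> i. deriv (\<lambda>u. f u $ i) t) $ i = (\<chi> i. deriv (\<lambda>u. g u $ i) t) $ i" by simp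
qed

text \<open>The smallest order \<open>k\<close> among the coordinates that do not vanish identically
  near \<open>a\<close> is taken out; the coordinate \<open>j\<close> attaining it keeps the
  quotient nonzero on a whole disc.\<close>

lemma holo3_factor:
  assumes f: "holo3 f W" "open W" "a \<in> W" and nz: "\<not> (\<exists>r>0. \<forall>t\<in>ball a r. f t = 0)"
  shows "\<exists>k g r. r > 0 \<and> ball a r \<subseteq> W \<and> holo3 g (ball a r) \<and> (\<forall>t\<in>ball a r. g t \<noteq> 0 \<and> f t = (t - a) ^ k *s g t)"
proof -
  define I where "I = {i. \<exists>n. zero_order (\<lambda>t. f t $ i) a n}"
  have ex: "(\<exists>n. zero_order (\<lambda>t. f t $ i) a n) \<or> (\<exists>r>0. \<forall>t\<in>ball a r. f t $ i = 0)" for i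
    using zero_order_exists[OF holo3_nth[OF f(1)] f(2,3)] .
  have "I \<noteq> {}"
  proof
    assume "I = {}"
    then have "\<exists>r>0. \<forall>t\<in>ball a r. f t $ i = 0" for i using ex by (auto simp: I_def)
    then obtain r where r: "\<And>i. r i > (0::real) \<and> (\<forall>t\<in>ball a (r i). f t $ i = 0)" by metis
    have "Min (range r) > 0" using r by (simp add: finite_UNIV)
    moreover have "\<forall>t\<in>ball a (Min (range r)). f t = 0" using r by (auto simp: vec_eq_iff)
    ultimately show False using nz by blast
  qed
  have "\<forall>i\<in>I. \<exists>n. zero_order (\<lambda>t. f t $ i) a n" by (simp add: I_def)
  then obtain n where n: "\<And>i. i \<in> I \<Longrightarrow> zero_order (\<lambda>t. f t $ i) a (n i)" by metis
  define k where "k = Min (n ` I)"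
  have "k \<in> n ` I" unfolding k_def using \<open>I \<noteq> {}\<close> by (intro Min_in) auto
  then obtain j where j: "j \<in> I" "n j = k" by auto
  have le: "k \<le> n i" if "i \<in> I" for i using that unfolding k_def by (intro Min_le) auto
  have "\<exists>h r. r > 0 \<and> h holomorphic_on ball a r \<and> (\<forall>t\<in>ball a r. f t $ i = (t - a) ^ k * h t \<and> (i = j \<longrightarrow> h t \<noteq> 0))" for i
  proof (cases "i \<in> I")
    case True
    obtain h r where h: "r > 0" "h holomorphic_on ball a r" "\<forall>t\<in>ball a r. h t \<noteq> 0 \<and> f t $ i = (t - a) ^ n i * h t"
      using n[OF True] unfolding zero_order_def by blast
    have "(t - a) ^ n i = (t - a) ^ k * (t - a) ^ (n i - k)" for t using le[OF True] by (simp flip: power_add)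
    then show ?thesis
      using h j by (intro exI[of _ "\<lambda>t. (t - a) ^ (n i - k) * h t"] exI[of _ r]) (auto intro!: holomorphic_intros)
  next
    case False
    then obtain r where "r > 0" "\<forall>t\<in>ball a r. f t $ i = 0" using ex[of i] unfolding I_def by blast
    then show ?thesis using False j by (intro exI[of _ "\<lambda>t. 0"] exI[of _ r]) auto
  qed
  then obtain h r where h: "\<And>i. r i > (0::real) \<and> h i holomorphic_on ball a (r i) \<and>
      (\<forall>t\<in>ball a (r i). f t $ i = (t - a) ^ k * h i t \<and> (i = j \<longrightarrow> h i t \<noteq> 0))" by metis
  obtain \<epsilon> where \<epsilon>: "\<epsilon> > 0" "ball a \<epsilon> \<subseteq> W" using f openE by blast
  define R where "R = min \<epsilon> (Min (range r))"
  have R: "R > 0" using h \<epsilon> by (simp add: R_def finite_UNIV)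
  have Rr: "ball a R \<subseteq> ball a (r i)" for i
    by (rule subset_ball) (auto simp: R_def min.coboundedI2)
  have RW: "ball a R \<subseteq> W" using \<epsilon>(2) by (auto simp: R_def)
  show ?thesis
  proof (intro exI[of _ k] exI[of _ "\<lambda>t. \<chi> i. h i t"] exI[of _ R] conjI ballI R RW)
    show "holo3 (\<lambda>t. \<chi> i. h i t) (ball a R)"
    proof -
      have "(\<lambda>t. h i t) holomorphic_on ball a R" for i
        using h[of i] holomorphic_on_subset[OF _ Rr[of i]] by auto
      then show ?thesis by (simp add: holo3_def)
    qed
    fix t assume t: "t \<in> ball a R"
    show "(\<chi> i. h i t) \<noteq> 0" using h[of j] t Rr[of j] by (auto simp: vec_eq_iff intro!: exI[of _ j])
    show "f t = (t - a) ^ k *s (\<chi> i. h i t)" 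
    proof -
      have "f t $ i = (t - a) ^ k * h i t" for i using h[of i] t Rr[of i] by blast
      then show ?thesis by (simp add: vec_eq_iff)
    qed
  qed
qed

text \<open>Componentwise limits at \<open>a\<close>: different exponents would make
  \<open>h a\<close> or \<open>g a\<close> vanish. This is what makes orders and leading directions
  independent of a lift.\<close>

lemma vector_order_unique:
  fixes g h :: "complex \<Rightarrow> complex^3"
  assumes g: "isCont g a" "g a \<noteq> 0" and h: "isCont h a" "h a \<noteq> 0" and c: "isCont c a" "c a \<noteq> 0"
    and eq: "\<forall>\<^sub>F t in at a. (c t * (t - a) ^ k) *s g t = (t - a) ^ m *s h t"
  shows "k = m \<and> h a = c a *s g a"
proof -
  have comp: "((\<lambda>t. g t $ i) \<longlongrightarrow> g a $ i) (at a)" "((\<lambda>t. h t $ i) \<longlongrightarrow> h a $ i) (at a)" for i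
    using g(1) h(1) by (auto simp: isCont_def intro: tendsto_vec_nth)
  have c1: "(c \<longlongrightarrow> c a) (at a)" using c by (simp add: isCont_def)
  have ta: "((\<lambda>t. t - a) \<longlongrightarrow> 0) (at a)" by (auto intro!: tendsto_eq_intros)
  have ne: "\<forall>\<^sub>F t in at a. t \<noteq> a" by (rule eventually_neq_at_within)
  have "k \<le> m"
  proof (rule ccontr)
    assume km: "\<not> k \<le> m"
    have "h a $ i = 0" for i
    proof -
      have ev: "\<forall>\<^sub>F t in at a. c t * (t - a) ^ (k - m) * g t $ i = h t $ i"
        using eq ne
      proof eventually_elim
        case (elim t)
        have "(t - a) ^ k = (t - a) ^ m * (t - a) ^ (k - m)" using km by (simp flip: power_add)
        moreover have "c t * (t - a) ^ k * g t $ i = (t - a) ^ m * h t $ i"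
          using elim(1) by (metis vector_smult_component)
        ultimately have "(t - a) ^ m * (c t * (t - a) ^ (k - m) * g t $ i) = (t - a) ^ m * h t $ i" by (simp add: mult_ac)
        then show ?case using elim(2) by simp
      qed
      have "((\<lambda>t. c t * (t - a) ^ (k - m) * g t $ i) \<longlongrightarrow> c a * 0 ^ (k - m) * g a $ i) (at a)"
        by (intro tendsto_intros c1 ta comp)
      from tendsto_cong[THEN iffD1, OF ev this] have "h a $ i = c a * 0 ^ (k - m) * g a $ i"
        using comp(2) tendsto_unique by (metis trivial_limit_at)
      then show ?thesis using km by (simp add: zero_power)
    qed
    then show False using h(2) by (simp add: vec_eq_iff)
  qed
  moreover have "m \<le> k"
  proof (rule ccontr)
    assume km: "\<not> m \<le> k"
    have "c a * g a $ i = 0" for i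
    proof -
      have ev: "\<forall>\<^sub>F t in at a. (t - a) ^ (m - k) * h t $ i = c t * g t $ i"
        using eq ne
      proof eventually_elim
        case (elim t)
        have "(t - a) ^ m = (t - a) ^ k * (t - a) ^ (m - k)" using km by (simp flip: power_add)
        moreover have "c t * (t - a) ^ k * g t $ i = (t - a) ^ m * h t $ i"
          using elim(1) by (metis vector_smult_component)
        ultimately have "(t - a) ^ k * ((t - a) ^ (m - k) * h t $ i) = c t * (t - a) ^ k * g t $ i"
          by (metis mult.assoc)
        then have "(t - a) ^ k * ((t - a) ^ (m - k) * h t $ i) = (t - a) ^ k * (c t * g t $ i)" by (simp add: mult_ac)
        then show ?case using elim(2) by simp
      qed
      have "((\<lambda>t. (t - a) ^ (m - k) * h t $ i) \<longlongrightarrow> 0 ^ (m - k) * h a $ i) (at a)"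
        by (intro tendsto_intros ta comp)
      from tendsto_cong[THEN iffD1, OF ev this] have 1: "((\<lambda>t. c t * g t $ i) \<longlongrightarrow> 0 ^ (m - k) * h a $ i) (at a)" .
      have "((\<lambda>t. c t * g t $ i) \<longlongrightarrow> c a * g a $ i) (at a)" by (intro tendsto_intros c1 comp)
      from tendsto_unique[OF _ this 1] show ?thesis using km by (simp add: zero_power)
    qed
    then show False using g(2) c(2) by (simp add: vec_eq_iff)
  qed
  ultimately have km: "k = m" by simp
  have "c a * g a $ i = h a $ i" for i
  proof -
    have ev: "\<forall>\<^sub>F t in at a. c t * g t $ i = h t $ i"
      using eq ne
    proof eventually_elim
      case (elim t)
      then have "c t * (t - a) ^ k * g t $ i = (t - a) ^ k * h t $ i" using km by (metis vector_smult_component)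
      then show ?case using elim(2) by simp
    qed
    have "((\<lambda>t. c t * g t $ i) \<longlongrightarrow> c a * g a $ i) (at a)" by (intro tendsto_intros c1 comp)
    from tendsto_cong[THEN iffD1, OF ev this] show ?thesis
      using comp(2) tendsto_unique by (metis trivial_limit_at)
  qed
  then show ?thesis using km by (simp add: vec_eq_iff)
qed

section \<open>Holomorphic curves in the plane\<close>

locale curve =
  fixes X :: "'a topology" and A :: "'a atlas" and \<nu> :: "'a \<Rightarrow> P2"
  assumes riemann: "compact_riemann_surface X A" and hol: "holomorphic_to_P2 A \<nu>"
begin

lemma chart:
  assumes "(U, \<phi>) \<in> A"
  shows "openin X U" "open (\<phi> ` U)" "homeomorphic_map (subtopology X U) (top_of_set (\<phi> ` U)) \<phi>"
    "inj_on \<phi> U" "U \<subseteq> topspace X"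
proof -
  have "\<forall>(U, \<phi>)\<in>A. openin X U \<and> open (\<phi> ` U) \<and> homeomorphic_map (subtopology X U) (top_of_set (\<phi> ` U)) \<phi>"
    by (rule riemann[unfolded compact_riemann_surface_def, THEN conjunct2, THEN conjunct2, THEN conjunct2,
          THEN conjunct2, THEN conjunct1])
  then show 1: "openin X U" "open (\<phi> ` U)" "homeomorphic_map (subtopology X U) (top_of_set (\<phi> ` U)) \<phi>"
    using assms by auto
  then show "U \<subseteq> topspace X" using openin_subset by blast
  then show "inj_on \<phi> U"
    using homeomorphic_imp_injective_map[OF 1(3)] by (simp add: Int_absorb1)
qed

lemma chart_inv:
  assumes "(U, \<phi>) \<in> A"
  shows "t \<in> \<phi> ` U \<Longrightarrow> inv_into U \<phi> t \<in> U" "t \<in> \<phi> ` U \<Longrightarrow> \<phi> (inv_into U \<phi> t) = t"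
    "x \<in> U \<Longrightarrow> inv_into U \<phi> (\<phi> x) = x"
  using chart(4)[OF assms] by (auto simp: inv_into_into f_inv_into_f)

lemma chart_image:
  assumes "(U, \<phi>) \<in> A" "B \<subseteq> \<phi> ` U"
  shows "inv_into U \<phi> ` B = {x\<in>U. \<phi> x \<in> B}"
  using chart_inv[OF assms(1)] assms(2) by (force simp: image_iff)

lemma chart_image_open:
  assumes "(U, \<phi>) \<in> A" "B \<subseteq> \<phi> ` U" "open B"
  shows "openin X (inv_into U \<phi> ` B)"
proof -
  have "continuous_map (subtopology X U) (top_of_set (\<phi> ` U)) \<phi>"
    using chart(3)[OF assms(1)] by (rule homeomorphic_imp_continuous_map)
  moreover have "openin (top_of_set (\<phi> ` U)) B" using assms(2,3) by (simp add: open_subset)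
  ultimately have "openin (subtopology X U) {x \<in> topspace (subtopology X U). \<phi> x \<in> B}"
    by (rule openin_continuous_map_preimage)
  moreover have "topspace (subtopology X U) = U" using chart(5)[OF assms(1)] by auto
  ultimately have "openin (subtopology X U) (inv_into U \<phi> ` B)" by (metis chart_image[OF assms(1,2)])
  then show ?thesis using chart(1)[OF assms(1)] by (metis openin_trans_full)
qed

lemma chart_open_image:
  assumes "(U, \<phi>) \<in> A" "openin X N" "N \<subseteq> U"
  shows "open (\<phi> ` N)"
proof -
  have "openin (subtopology X U) N" using assms by (simp add: openin_open_subtopology chart(1))
  then have "openin (top_of_set (\<phi> ` U)) (\<phi> ` N)"
    using homeomorphic_imp_open_map[OF chart(3)[OF assms(1)]] by (simp add: open_map_def)
  then show ?thesis using chart(2)[OF assms(1)] openin_open_trans by blast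
qed

definition lift :: "'a set \<Rightarrow> ('a \<Rightarrow> complex) \<Rightarrow> complex set \<Rightarrow> (complex \<Rightarrow> complex^3) \<Rightarrow> bool" where
  "lift U \<phi> W f \<longleftrightarrow> (U, \<phi>) \<in> A \<and> open W \<and> W \<subseteq> \<phi> ` U \<and> holo3 f W \<and>
     (\<forall>t\<in>W. f t \<noteq> 0 \<and> \<nu> (inv_into U \<phi> t) = pt (f t))"

lemma liftD:
  assumes "lift U \<phi> W f"
  shows "(U, \<phi>) \<in> A" "open W" "W \<subseteq> \<phi> ` U" "holo3 f W" "t \<in> W \<Longrightarrow> f t \<noteq> 0"
    "t \<in> W \<Longrightarrow> \<nu> (inv_into U \<phi> t) = pt (f t)"
  using assms by (auto simp: lift_def)

lemma chart_at: "x \<in> topspace X \<Longrightarrow> \<exists>U \<phi>. (U, \<phi>) \<in> A \<and> x \<in> U"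
  using riemann unfolding compact_riemann_surface_def by auto

lemma lift_at_chart:
  assumes "(U, \<phi>) \<in> A" "x \<in> U"
  obtains W f where "lift U \<phi> W f" "\<phi> x \<in> W"
proof -
  obtain W f where "open W \<and> \<phi> x \<in> W \<and> W \<subseteq> \<phi> ` U \<and> (\<forall>i. (\<lambda>t. f t $ i) holomorphic_on W) \<and>
        (\<forall>t\<in>W. f t \<noteq> 0 \<and> \<nu> (inv_into U \<phi> t) = pt (f t))"
    using hol assms unfolding holomorphic_to_P2_def by fast
  then have "lift U \<phi> W f" "\<phi> x \<in> W" using assms(1) by (simp_all add: lift_def holo3_def)
  then show ?thesis by (rule that)
qed

lemma lift_at:
  assumes "x \<in> topspace X"
  obtains U \<phi> W f where "lift U \<phi> W f" "x \<in> U" "\<phi> x \<in> W"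
  using chart_at[OF assms] lift_at_chart by metis

lemma lift_coords:
  assumes "lift U \<phi> W f" "t \<in> W"
  obtains c where "c \<noteq> 0" "coords (\<nu> (inv_into U \<phi> t)) = c *s f t"
  using coords_pt[of "f t"] liftD(5,6)[OF assms(1) assms(2)] by metis

lemma lift_coords':
  assumes "lift U \<phi> W f" "x \<in> U" "\<phi> x \<in> W"
  obtains c where "c \<noteq> 0" "coords (\<nu> x) = c *s f (\<phi> x)"
  using lift_coords[OF assms(1,3)] chart_inv(3)[OF liftD(1)[OF assms(1)] assms(2)] by metis

text \<open>Both lifts represent the same points, so they differ by the change of charts \<tau> and
  a scalar \<open>u\<close>; the latter is holomorphic as the quotient of a coordinate that is
  nonzero at the point. Notions defined through lifts are well defined because of this.\<close>

lemma lift_change: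
  assumes l: "lift U \<phi> W f" "x \<in> U" "\<phi> x \<in> W" and l': "lift U' \<phi>' W' f'" "x \<in> U'" "\<phi>' x \<in> W'"
  obtains N \<tau> u where "open N" "\<phi> x \<in> N" "N \<subseteq> W" "\<tau> holomorphic_on N" "u holomorphic_on N" "\<tau> (\<phi> x) = \<phi>' x"
    "deriv \<tau> (\<phi> x) \<noteq> 0" "\<And>t. t \<in> N \<Longrightarrow> \<tau> t \<in> W'" "\<And>t. t \<in> N \<Longrightarrow> u t \<noteq> 0" "\<And>t. t \<in> N \<Longrightarrow> f' (\<tau> t) = u t *s f t"
proof -
  note c = liftD(1)[OF l(1)] and c' = liftD(1)[OF l'(1)]
  define D where "D = \<phi> ` (U \<inter> U')"
  define \<tau> where "\<tau> = \<phi>' \<circ> inv_into U \<phi>"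
  have D: "open D" unfolding D_def
    by (rule chart_open_image[OF c]) (use chart(1)[OF c] chart(1)[OF c'] in auto)
  have \<tau>: "\<tau> holomorphic_on D"
    using riemann c c' unfolding compact_riemann_surface_def D_def \<tau>_def by fast
  have \<tau>x: "\<tau> (\<phi> x) = \<phi>' x" using chart_inv(3)[OF c l(2)] by (simp add: \<tau>_def)
  have \<tau>inv: "inv_into U' \<phi>' (\<tau> t) = inv_into U \<phi> t" if tD: "t \<in> D" for t
  proof -
    obtain y where y: "y \<in> U" "y \<in> U'" "t = \<phi> y" using tD by (auto simp: D_def)
    then show ?thesis using chart_inv(3)[OF c] chart_inv(3)[OF c'] by (simp add: \<tau>_def)
  qed
  have inj: "inj_on \<tau> D"
  proof (rule inj_onI)
    fix s t assume st: "s \<in> D" "t \<in> D" "\<tau> s = \<tau> t"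
    then have "inv_into U \<phi> s = inv_into U \<phi> t" using \<tau>inv by metis
    then show "s = t" using st(1,2) chart_inv(2)[OF c] unfolding D_def by (metis IntD1 imageE image_eqI)
  qed
  have xD: "\<phi> x \<in> D" using l l' by (auto simp: D_def)
  obtain i where i: "f (\<phi> x) $ i \<noteq> 0" using liftD(5)[OF l(1) l(3)] by (auto simp: vec_eq_iff)
  define N where "N = (D \<inter> \<tau> -` W') \<inter> (W \<inter> (\<lambda>t. f t $ i) -` (- {0}))"
  define u where "u t = f' (\<tau> t) $ i / f t $ i" for t
  have fi: "(\<lambda>t. f t $ i) holomorphic_on W" and fi': "(\<lambda>t. f' t $ i) holomorphic_on W'"
    using liftD(4)[OF l(1)] liftD(4)[OF l'(1)] by (auto simp: holo3_def)
  have "open (D \<inter> \<tau> -` W')"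
    using \<tau> D liftD(2)[OF l'(1)] holomorphic_on_imp_continuous_on by (intro continuous_open_preimage) auto
  moreover have "open (W \<inter> (\<lambda>t. f t $ i) -` (- {0}))"
    using holomorphic_on_imp_continuous_on[OF fi] liftD(2)[OF l(1)] by (intro continuous_open_preimage) auto
  ultimately have oN: "open N" unfolding N_def by (rule open_Int)
  have main: "u t \<noteq> 0 \<and> f' (\<tau> t) = u t *s f t" if t: "t \<in> N" for t
  proof -
    have tt: "t \<in> D" "\<tau> t \<in> W'" "t \<in> W" "f t $ i \<noteq> 0" using t by (auto simp: N_def)
    have "pt (f t) = pt (f' (\<tau> t))" using liftD(6)[OF l(1) tt(3)] liftD(6)[OF l'(1) tt(2)] \<tau>inv[OF tt(1)] by simp
    then obtain k where k: "k \<noteq> 0" "f' (\<tau> t) = k *s f t"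
      using pt_eqD liftD(5)[OF l(1) tt(3)] liftD(5)[OF l'(1) tt(2)] by blast
    then have "u t = k" using tt by (simp add: u_def)
    then show ?thesis using k by simp
  qed
  show ?thesis
  proof (rule that[of N \<tau> u])
    show "\<phi> x \<in> N" using xD i l l' \<tau>x by (auto simp: N_def)
    show "N \<subseteq> W" by (auto simp: N_def)
    show \<tau>N: "\<tau> holomorphic_on N" by (rule holomorphic_on_subset[OF \<tau>]) (auto simp: N_def)
    have "((\<lambda>t. f' t $ i) \<circ> \<tau>) holomorphic_on N"
      by (rule holomorphic_on_compose_gen[OF \<tau>N fi']) (auto simp: N_def)
    moreover have "(\<lambda>t. f t $ i) holomorphic_on N" by (rule holomorphic_on_subset[OF fi]) (auto simp: N_def)
    ultimately show "u holomorphic_on N"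
      unfolding u_def comp_def by (intro holomorphic_intros) (auto simp: N_def)
    show "deriv \<tau> (\<phi> x) \<noteq> 0" by (rule holomorphic_injective_imp_regular[OF \<tau> D inj xD])
  qed (use main oN \<tau>x in \<open>auto simp: N_def\<close>)
qed

text \<open>The intersection multiplicity of the line \<open>l\<close> with the branch of the curve
  parametrized near \<open>x\<close>. Independence of the lift is part of
  \<open>ord_eq\<close>.\<close>

definition ord :: "complex^3 \<Rightarrow> 'a \<Rightarrow> nat" where
  "ord l x = (THE n. \<exists>U \<phi> W f. lift U \<phi> W f \<and> x \<in> U \<and> \<phi> x \<in> W \<and> zero_order (\<lambda>t. dot l (f t)) (\<phi> x) n)"

lemma ord_eq:
  assumes l: "lift U \<phi> W f" "x \<in> U" "\<phi> x \<in> W" and n: "zero_order (\<lambda>t. dot l (f t)) (\<phi> x) n"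
  shows "ord l x = n"
  unfolding ord_def
proof (rule the_equality)
  show "\<exists>U \<phi> W f. lift U \<phi> W f \<and> x \<in> U \<and> \<phi> x \<in> W \<and> zero_order (\<lambda>t. dot l (f t)) (\<phi> x) n"
    using assms by blast
  fix m assume "\<exists>U \<phi> W f. lift U \<phi> W f \<and> x \<in> U \<and> \<phi> x \<in> W \<and> zero_order (\<lambda>t. dot l (f t)) (\<phi> x) m"
  then obtain U' \<phi>' W' f' where l': "lift U' \<phi>' W' f'" "x \<in> U'" "\<phi>' x \<in> W'"
    and m: "zero_order (\<lambda>t. dot l (f' t)) (\<phi>' x) m" by blast
  obtain N \<tau> u where N: "open N" "\<phi> x \<in> N" "\<tau> holomorphic_on N" "u holomorphic_on N" "\<tau> (\<phi> x) = \<phi>' x"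
    "deriv \<tau> (\<phi> x) \<noteq> 0" "\<And>t. t \<in> N \<Longrightarrow> u t \<noteq> 0" "\<And>t. t \<in> N \<Longrightarrow> f' (\<tau> t) = u t *s f t"
    using lift_change[OF l l'] by metis
  have 1: "zero_order (\<lambda>t. dot l (f' (\<tau> t))) (\<phi> x) m"
    using m N by (intro zero_order_compose[of "\<lambda>t. dot l (f' t)" \<tau> _ m N]) auto
  have "zero_order (\<lambda>t. u t * dot l (f t)) (\<phi> x) (0 + n)"
    by (rule zero_order_mult[OF zero_order_0I n]) (use N in auto)
  then have "zero_order (\<lambda>t. dot l (f' (\<tau> t))) (\<phi> x) (0 + n)"
    by (rule zero_order_cong[where W = N]) (use N in \<open>auto simp: dot_scale_right\<close>)
  then show "m = n" using zero_order_unique[OF 1] by simp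
qed

text \<open>Common frame for linear forms, ternary forms and polars: the zero set is well defined in
  the plane, and pullbacks to lifts are holomorphic.\<close>

definition homog_fun :: "(complex^3 \<Rightarrow> complex) \<Rightarrow> bool" where
  "homog_fun G \<longleftrightarrow> (\<forall>v c. c \<noteq> 0 \<longrightarrow> G (c *s v) = 0 \<longleftrightarrow> G v = 0) \<and>
     (\<forall>f W. holo3 f W \<longrightarrow> (\<lambda>t. G (f t)) holomorphic_on W)"

lemma homog_fun_dot: "homog_fun (dot l)"
  by (simp add: homog_fun_def dot_scale_right holo3_dot)

lemma homog_fun_lift:
  assumes "homog_fun G" "lift U \<phi> W f" "t \<in> W"
  shows "G (coords (\<nu> (inv_into U \<phi> t))) = 0 \<longleftrightarrow> G (f t) = 0"
  using lift_coords[OF assms(2,3)] assms(1) unfolding homog_fun_def by metis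

lemma homog_fun_zero_order_near:
  assumes G: "homog_fun G" and l: "lift U \<phi> W f" "t \<in> W" and z: "zero_order (\<lambda>t. G (f t)) t n"
  obtains N where "openin X N" "inv_into U \<phi> t \<in> N" "\<And>y. y \<in> N \<Longrightarrow> y \<noteq> inv_into U \<phi> t \<Longrightarrow> G (coords (\<nu> y)) \<noteq> 0"
proof -
  obtain r where r: "r > 0" "\<And>s. s \<in> ball t r \<Longrightarrow> s \<noteq> t \<Longrightarrow> G (f s) \<noteq> 0"
    using zero_order_near[OF z] by blast
  obtain \<epsilon> where \<epsilon>: "\<epsilon> > 0" "ball t \<epsilon> \<subseteq> W" using liftD(2)[OF l(1)] l(2) openE by blast
  define B where "B = ball t (min r \<epsilon>)"
  have B: "B \<subseteq> W" "t \<in> B" "open B" using r \<epsilon> by (auto simp: B_def)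
  show ?thesis
  proof (rule that[of "inv_into U \<phi> ` B"])
    show "openin X (inv_into U \<phi> ` B)"
      using chart_image_open[OF liftD(1)[OF l(1)] _ B(3)] B(1) liftD(3)[OF l(1)] by blast
    show "inv_into U \<phi> t \<in> inv_into U \<phi> ` B" using B by blast
    fix y assume y: "y \<in> inv_into U \<phi> ` B" "y \<noteq> inv_into U \<phi> t"
    then obtain s where s: "s \<in> B" "y = inv_into U \<phi> s" "s \<noteq> t" by blast
    then have "G (f s) \<noteq> 0" using r(2) by (auto simp: B_def)
    then show "G (coords (\<nu> y)) \<noteq> 0" using homog_fun_lift[OF G l(1)] s B by blast
  qed
qed

text \<open>The identity theorem on a compact connected surface: the set \<open>F\<close> of points
  near which \<open>G\<close> vanishes identically is open and, zeros elsewhere being isolated, also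
  closed; it misses \<open>x0\<close>, hence is empty. Compactness leaves only finitely many
  isolated zeros.\<close>

lemma homog_fun_zeros:
  assumes G: "homog_fun G" and x0: "x0 \<in> topspace X" "G (coords (\<nu> x0)) \<noteq> 0"
  shows "finite {x\<in>topspace X. G (coords (\<nu> x)) = 0}"
    "lift U \<phi> W f \<Longrightarrow> t \<in> W \<Longrightarrow> \<exists>n. zero_order (\<lambda>t. G (f t)) t n"
proof -
  define F where "F = {x. \<exists>N. openin X N \<and> x \<in> N \<and> (\<forall>y\<in>N. G (coords (\<nu> y)) = 0)}"
  have oF: "openin X F"
    by (subst openin_subopen) (auto simp: F_def)
  have zo: "(\<exists>n. zero_order (\<lambda>t. G (f t)) t n) \<or> inv_into U \<phi> t \<in> F" if l: "lift U \<phi> W f" "t \<in> W" for U \<phi> W f t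
  proof (rule disjCI)
    assume nF: "inv_into U \<phi> t \<notin> F"
    have "(\<lambda>t. G (f t)) holomorphic_on W" using G liftD(4)[OF l(1)] by (simp add: homog_fun_def)
    then consider "\<exists>n. zero_order (\<lambda>t. G (f t)) t n" | r where "r > 0" "\<forall>s\<in>ball t r. G (f s) = 0"
      using zero_order_exists[OF _ liftD(2)[OF l(1)] l(2)] by blast
    then show "\<exists>n. zero_order (\<lambda>t. G (f t)) t n"
    proof cases
      case (2 r)
      define B where "B = ball t r \<inter> W"
      have B: "open B" "B \<subseteq> W" "t \<in> B" using 2 l liftD(2)[OF l(1)] by (auto simp: B_def)
      have "openin X (inv_into U \<phi> ` B)"
        using chart_image_open[OF liftD(1)[OF l(1)] _ B(1)] B(2) liftD(3)[OF l(1)] by blast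
      moreover have "\<forall>y\<in>inv_into U \<phi> ` B. G (coords (\<nu> y)) = 0"
        using homog_fun_lift[OF G l(1)] 2(2) by (auto simp: B_def)
      ultimately have "inv_into U \<phi> t \<in> F" using B(3) unfolding F_def by blast
      then show ?thesis using nF by simp
    qed
  qed
  have near: "\<exists>N. openin X N \<and> x \<in> N \<and> (\<forall>y\<in>N. y \<noteq> x \<longrightarrow> G (coords (\<nu> y)) \<noteq> 0)" if x: "x \<in> topspace X" "x \<notin> F" for x
  proof -
    obtain U \<phi> W f where l: "lift U \<phi> W f" "x \<in> U" "\<phi> x \<in> W" using lift_at[OF x(1)] by blast
    have inv: "inv_into U \<phi> (\<phi> x) = x" using chart_inv(3)[OF liftD(1)[OF l(1)] l(2)] .
    then obtain n where "zero_order (\<lambda>t. G (f t)) (\<phi> x) n" using zo[OF l(1,3)] x(2) by auto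
    from homog_fun_zero_order_near[OF G l(1,3) this] inv show ?thesis by metis
  qed
  have "openin X (topspace X - F)"
  proof (subst openin_subopen, intro ballI)
    fix x assume x: "x \<in> topspace X - F"
    then obtain N where N: "openin X N" "x \<in> N" "\<forall>y\<in>N. y \<noteq> x \<longrightarrow> G (coords (\<nu> y)) \<noteq> 0" using near by blast
    have "N \<subseteq> topspace X - F"
    proof
      fix y assume y: "y \<in> N"
      then show "y \<in> topspace X - F"
      proof (cases "y = x")
        case False
        then have "G (coords (\<nu> y)) \<noteq> 0" using N y by blast
        then show ?thesis using openin_subset[OF N(1)] y unfolding F_def by blast
      qed (use x in simp)
    qed
    then show "\<exists>T. openin X T \<and> x \<in> T \<and> T \<subseteq> topspace X - F" using N by blast
  qed
  then have "closedin X F" using openin_subset[OF oF] by (simp add: closedin_def)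
  moreover have "connected_space X" using riemann by (simp add: compact_riemann_surface_def)
  ultimately have "F = {} \<or> F = topspace X" using oF by (simp add: connected_space_clopen_in)
  moreover have "x0 \<notin> F" using x0 by (auto simp: F_def)
  ultimately have F: "F = {}" using x0 by auto
  show "lift U \<phi> W f \<Longrightarrow> t \<in> W \<Longrightarrow> \<exists>n. zero_order (\<lambda>t. G (f t)) t n" using zo F by blast
  obtain N where N: "\<And>x. x \<in> topspace X \<Longrightarrow> openin X (N x) \<and> x \<in> N x \<and> (\<forall>y\<in>N x. y \<noteq> x \<longrightarrow> G (coords (\<nu> y)) \<noteq> 0)"
    using near F by (metis empty_iff)
  have "compactin X (topspace X)" using riemann unfolding compact_riemann_surface_def compact_space_def by blast
  moreover have "\<And>U. U \<in> N ` topspace X \<Longrightarrow> openin X U" "topspace X \<subseteq> \<Union> (N ` topspace X)" using N by auto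
  ultimately obtain \<F> where \<F>: "finite \<F>" "\<F> \<subseteq> N ` topspace X" "topspace X \<subseteq> \<Union>\<F>"
    using compactinD by metis
  then obtain C where C: "finite C" "C \<subseteq> topspace X" "\<F> = N ` C" by (metis finite_subset_image)
  have "{x\<in>topspace X. G (coords (\<nu> x)) = 0} \<subseteq> C"
  proof
    fix x assume x: "x \<in> {x\<in>topspace X. G (coords (\<nu> x)) = 0}"
    then obtain y where y: "y \<in> C" "x \<in> N y" using \<F> C by blast
    then have "y \<in> topspace X" using C(2) by blast
    then have "x = y" using N[of y] x y(2) by blast
    then show "x \<in> C" using y by simp
  qed
  then show "finite {x\<in>topspace X. G (coords (\<nu> x)) = 0}" using C finite_subset by blast
qed

text \<open>Functions of homogeneous coordinates are continuous although \<open>coords\<close>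
  chooses representatives arbitrarily: on a lift they agree with a function of the holomorphic
  vector. \<open>P\<close> describes where \<open>H\<close> is invariant under scaling.\<close>

lemma continuous_map_homog:
  fixes H :: "complex^3 \<Rightarrow> 'c :: topological_space"
  assumes inv: "\<And>v c. v \<noteq> 0 \<Longrightarrow> P v \<Longrightarrow> c \<noteq> 0 \<Longrightarrow> H (c *s v) = H v" "\<And>v c. v \<noteq> 0 \<Longrightarrow> c \<noteq> 0 \<Longrightarrow> P (c *s v) \<longleftrightarrow> P v"
    and cont: "\<And>U \<phi> W f. lift U \<phi> W f \<Longrightarrow> open {t\<in>W. P (f t)} \<and> continuous_on {t\<in>W. P (f t)} (\<lambda>t. H (f t))"
  shows "openin X {x\<in>topspace X. P (coords (\<nu> x))}"
    "continuous_map (subtopology X {x\<in>topspace X. P (coords (\<nu> x))}) euclidean (\<lambda>x. H (coords (\<nu> x)))"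
proof -
  let ?N = "{x\<in>topspace X. P (coords (\<nu> x))}"
  have near: "\<exists>O'. openin X O' \<and> x \<in> O' \<and> O' \<subseteq> ?N \<and> (\<forall>y\<in>O'. H (coords (\<nu> y)) \<in> S)"
    if x: "x \<in> ?N" and S: "open S" "H (coords (\<nu> x)) \<in> S" for x S
  proof -
    obtain U \<phi> W f where l: "lift U \<phi> W f" "x \<in> U" "\<phi> x \<in> W" using lift_at x by blast
    have PH: "P (coords (\<nu> (inv_into U \<phi> t))) \<longleftrightarrow> P (f t)" "P (f t) \<Longrightarrow> H (coords (\<nu> (inv_into U \<phi> t))) = H (f t)" if tW: "t \<in> W" for t
    proof -
      obtain c where "c \<noteq> 0" "coords (\<nu> (inv_into U \<phi> t)) = c *s f t" using lift_coords[OF l(1) tW] by blast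
      then show "P (coords (\<nu> (inv_into U \<phi> t))) \<longleftrightarrow> P (f t)"
        "P (f t) \<Longrightarrow> H (coords (\<nu> (inv_into U \<phi> t))) = H (f t)"
        using inv(2)[of "f t" c] inv(1)[of "f t" c] liftD(5)[OF l(1) tW] by simp_all
    qed
    have ix: "inv_into U \<phi> (\<phi> x) = x" using chart_inv(3)[OF liftD(1)[OF l(1)] l(2)] .
    define B where "B = {t\<in>W. P (f t)} \<inter> (\<lambda>t. H (f t)) -` S"
    have oB: "open B" unfolding B_def using cont[OF l(1)] S by (intro continuous_open_preimage) auto
    have BW: "B \<subseteq> W" by (auto simp: B_def)
    have "openin X (inv_into U \<phi> ` B)"
      using chart_image_open[OF liftD(1)[OF l(1)] _ oB] BW liftD(3)[OF l(1)] by blast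
    moreover have "\<phi> x \<in> B" using PH[OF l(3)] ix x S l(3) by (auto simp: B_def)
    then have "x \<in> inv_into U \<phi> ` B" using ix by force
    moreover have "\<forall>y\<in>inv_into U \<phi> ` B. P (coords (\<nu> y)) \<and> H (coords (\<nu> y)) \<in> S" using PH by (auto simp: B_def)
    ultimately show ?thesis using openin_subset by (intro exI[of _ "inv_into U \<phi> ` B"]) blast
  qed
  show oN: "openin X ?N"
  proof (subst openin_subopen, intro ballI)
    fix x assume "x \<in> ?N"
    then obtain O' where "openin X O'" "x \<in> O'" "O' \<subseteq> ?N" using near[of x UNIV] by auto
    then show "\<exists>T. openin X T \<and> x \<in> T \<and> T \<subseteq> ?N" by blast
  qed
  show "continuous_map (subtopology X ?N) euclidean (\<lambda>x. H (coords (\<nu> x)))"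
    unfolding continuous_map_def
  proof (intro conjI allI impI)
    fix S :: "'c set" assume "openin euclidean S"
    then have S: "open S" by simp
    have "openin X {x \<in> topspace (subtopology X ?N). H (coords (\<nu> x)) \<in> S}"
    proof (subst openin_subopen, intro ballI)
      fix x assume "x \<in> {x \<in> topspace (subtopology X ?N). H (coords (\<nu> x)) \<in> S}"
      then obtain O' where "openin X O'" "x \<in> O'" "O' \<subseteq> ?N" "\<forall>y\<in>O'. H (coords (\<nu> y)) \<in> S"
        using near[of x S] S by auto
      then show "\<exists>T. openin X T \<and> x \<in> T \<and> T \<subseteq> {x \<in> topspace (subtopology X ?N). H (coords (\<nu> x)) \<in> S}"
        by (intro exI[of _ O']) auto
    qed
    then show "openin (subtopology X ?N) {x \<in> topspace (subtopology X ?N). H (coords (\<nu> x)) \<in> S}"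
      unfolding openin_open_subtopology[OF oN] by auto
  qed auto
qed

text \<open>A relation first, since order and direction might depend on the lift;
  \<open>kappa\<close> and \<open>gauss\<close> are then taken from it by unique choice.\<close>

definition tangent_rel :: "'a \<Rightarrow> nat \<Rightarrow> P2 \<Rightarrow> bool" where
  "tangent_rel x k l \<longleftrightarrow> (\<exists>U \<phi> W f g r. lift U \<phi> W f \<and> x \<in> U \<and> \<phi> x \<in> W \<and> r > 0 \<and> ball (\<phi> x) r \<subseteq> W \<and>
     holo3 g (ball (\<phi> x) r) \<and> (\<forall>t\<in>ball (\<phi> x) r. g t \<noteq> 0 \<and> crs (f t) (vderiv f t) = (t - \<phi> x) ^ k *s g t) \<and>
     l = pt (g (\<phi> x)))"

text \<open>A change of lift multiplies the cross product by \<open>u * u / deriv \<tau>\<close>: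
  the term with the derivative of \<open>u\<close> drops out because the cross product of
  \<open>f\<close> with itself is 0. This factor has no zero, so order and direction
  persist.\<close>

lemma tangent_rel_unique:
  assumes "tangent_rel x k l" "tangent_rel x k' l'" shows "k' = k \<and> l' = l"
proof -
  obtain U \<phi> W f g r where l: "lift U \<phi> W f" "x \<in> U" "\<phi> x \<in> W" and g: "r > 0" "ball (\<phi> x) r \<subseteq> W"
    "holo3 g (ball (\<phi> x) r)" "\<And>t. t \<in> ball (\<phi> x) r \<Longrightarrow> g t \<noteq> 0"
    "\<And>t. t \<in> ball (\<phi> x) r \<Longrightarrow> crs (f t) (vderiv f t) = (t - \<phi> x) ^ k *s g t" "l = pt (g (\<phi> x))"
    using assms(1) unfolding tangent_rel_def by blast
  obtain U' \<phi>' W' f' g' r' where l': "lift U' \<phi>' W' f'" "x \<in> U'" "\<phi>' x \<in> W'" and g': "r' > 0" "ball (\<phi>' x) r' \<subseteq> W'"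
    "holo3 g' (ball (\<phi>' x) r')" "\<And>t. t \<in> ball (\<phi>' x) r' \<Longrightarrow> g' t \<noteq> 0"
    "\<And>t. t \<in> ball (\<phi>' x) r' \<Longrightarrow> crs (f' t) (vderiv f' t) = (t - \<phi>' x) ^ k' *s g' t" "l' = pt (g' (\<phi>' x))"
    using assms(2) unfolding tangent_rel_def by blast
  obtain N \<tau> u where N: "open N" "\<phi> x \<in> N" "N \<subseteq> W" "\<tau> holomorphic_on N" "u holomorphic_on N" "\<tau> (\<phi> x) = \<phi>' x"
    "deriv \<tau> (\<phi> x) \<noteq> 0" "\<And>t. t \<in> N \<Longrightarrow> \<tau> t \<in> W'" "\<And>t. t \<in> N \<Longrightarrow> u t \<noteq> 0" "\<And>t. t \<in> N \<Longrightarrow> f' (\<tau> t) = u t *s f t"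
    using lift_change[OF l l'] by metis
  define a where "a = \<phi> x"
  \<comment> \<open>The difference quotient of \<tau>; it converts powers of
    \<open>\<tau> t - \<tau> a\<close> into powers of \<open>t - a\<close> and is nonzero at
    \<open>a\<close>.\<close>
  define d where "d t = (if t = a then deriv \<tau> a else (\<tau> t - \<tau> a) / (t - a))" for t
  have d: "d holomorphic_on N"
    using pole_theorem_open[OF N(4,1), of a "\<lambda>t. \<tau> t / (t - a)"] unfolding d_def diff_divide_distrib by simp
  have \<tau>d: "\<tau> t - \<tau> a = (t - a) * d t" for t by (simp add: d_def)
  have da: "d a \<noteq> 0" using N(7) by (simp add: d_def a_def)
  have contN: "isCont h a" if "h holomorphic_on N" for h
    using holomorphic_on_imp_continuous_on[OF that] N(1,2) by (simp add: a_def continuous_on_eq_continuous_at)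
  have "\<forall>\<^sub>F t in nhds a. t \<in> N" using N by (auto simp: a_def eventually_nhds)
  moreover have "\<forall>\<^sub>F t in nhds a. t \<in> ball a r" using g(1) by (intro eventually_nhds_in_open) auto
  moreover have "\<forall>\<^sub>F t in nhds a. \<tau> t \<in> ball (\<phi>' x) r'"
  proof -
    have "open (N \<inter> \<tau> -` ball (\<phi>' x) r')"
      using holomorphic_on_imp_continuous_on[OF N(4)] N(1) by (intro continuous_open_preimage) auto
    moreover have "a \<in> N \<inter> \<tau> -` ball (\<phi>' x) r'" using N(2,6) g'(1) by (simp add: a_def)
    ultimately have "\<forall>\<^sub>F t in nhds a. t \<in> N \<inter> \<tau> -` ball (\<phi>' x) r'" by (rule eventually_nhds_in_open)
    then show ?thesis by eventually_elim blast
  qed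
  ultimately have ev: "\<forall>\<^sub>F t in nhds a. (u t * u t * (t - a) ^ k) *s g t = (t - a) ^ k' *s ((deriv \<tau> t * d t ^ k') *s g' (\<tau> t))"
  proof eventually_elim
    case (elim t)
    have "deriv \<tau> t *s vderiv f' (\<tau> t) = vderiv (\<lambda>t. f' (\<tau> t)) t"
      using vderiv_compose[OF liftD(4)[OF l'(1)] liftD(2)[OF l'(1)] N(4,1) elim(1) N(8)[OF elim(1)]] by simp
    also have "\<dots> = vderiv (\<lambda>t. u t *s f t) t" by (rule vderiv_cong[of N]) (use N elim in auto)
    also have "\<dots> = deriv u t *s f t + u t *s vderiv f t"
      by (rule vderiv_smult[OF N(5) holo3_subset[OF liftD(4)[OF l(1)] N(3)] N(1) elim(1)])
    finally have "crs (f' (\<tau> t)) (deriv \<tau> t *s vderiv f' (\<tau> t)) = crs (u t *s f t) (deriv u t *s f t + u t *s vderiv f t)"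
      using N(10)[OF elim(1)] by simp
    then have "deriv \<tau> t *s crs (f' (\<tau> t)) (vderiv f' (\<tau> t)) = (u t * u t) *s crs (f t) (vderiv f t)"
      by (simp add: crs_scale crs_add_right vector_smult_assoc)
    moreover have "crs (f t) (vderiv f t) = (t - a) ^ k *s g t" using g(5) elim(2) by (simp add: a_def)
    moreover have "crs (f' (\<tau> t)) (vderiv f' (\<tau> t)) = (\<tau> t - \<tau> a) ^ k' *s g' (\<tau> t)" using g'(5) elim(3) N(6) by (simp add: a_def)
    ultimately have "(u t * u t) *s ((t - a) ^ k *s g t) = deriv \<tau> t *s (((t - a) ^ k' * d t ^ k') *s g' (\<tau> t))"
      by (simp add: \<tau>d power_mult_distrib)
    then show ?case by (simp add: vector_smult_assoc mult_ac)
  qed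
  have cg: "isCont g a" using holo3_continuous[OF g(3)] g(1) by (simp add: a_def continuous_on_eq_continuous_at)
  have cg': "isCont g' (\<tau> a)" using holo3_continuous[OF g'(3)] g'(1) N(6) by (simp add: a_def continuous_on_eq_continuous_at)
  have "holo3 (\<lambda>t. f t) N" using liftD(4)[OF l(1)] N(3) holo3_subset by blast
  have c1: "isCont (\<lambda>t. u t * u t) a" using contN[OF N(5)] by (intro isCont_mult)
  have c2: "isCont (\<lambda>t. deriv \<tau> t * d t ^ k') a"
    using contN[OF d] contN[OF holomorphic_deriv[OF N(4,1)]] by (intro isCont_mult isCont_power)
  have c3: "isCont (\<lambda>t. g' (\<tau> t)) a" using isCont_o2[OF contN[OF N(4)] cg'] .
  have c4: "isCont (\<lambda>t. (deriv \<tau> t * d t ^ k') *s g' (\<tau> t)) a"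
  proof -
    have "((\<lambda>t. ((deriv \<tau> t * d t ^ k') *s g' (\<tau> t)) $ i) \<longlongrightarrow> ((deriv \<tau> a * d a ^ k') *s g' (\<tau> a)) $ i) (at a)" for i
      unfolding vector_smult_component
      by (rule tendsto_mult[OF c2[unfolded isCont_def] tendsto_vec_nth[OF c3[unfolded isCont_def]]])
    then show ?thesis unfolding isCont_def by (rule vec_tendstoI)
  qed
  have ne: "(deriv \<tau> a * d a ^ k') *s g' (\<tau> a) \<noteq> 0"
    using da N(6,7) g'(1,4) by (simp add: a_def)
  have "k = k' \<and> (deriv \<tau> a * d a ^ k') *s g' (\<tau> a) = (u a * u a) *s g a"
  proof (rule vector_order_unique[OF cg _ c4 ne c1])
    show "g a \<noteq> 0" using g(1,4) by (simp add: a_def)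
    show "u a * u a \<noteq> 0" using N(2,9) by (simp add: a_def)
    show "\<forall>\<^sub>F t in at a. (u t * u t * (t - a) ^ k) *s g t = (t - a) ^ k' *s ((deriv \<tau> t * d t ^ k') *s g' (\<tau> t))"
      using ev by (simp add: eventually_nhds_conv_at)
  qed
  then have "k = k'" "pt ((deriv \<tau> a * d a ^ k') *s g' (\<tau> a)) = pt ((u a * u a) *s g a)" by auto
  moreover have "pt ((deriv \<tau> a * d a ^ k') *s g' (\<tau> a)) = pt (g' (\<tau> a))"
    by (rule pt_scale) (use da N(6,7) g'(1,4) in \<open>auto simp: a_def\<close>)
  moreover have "pt ((u a * u a) *s g a) = pt (g a)"
    by (rule pt_scale) (use N(2,9) g(1,4) in \<open>auto simp: a_def\<close>)
  ultimately show ?thesis using g(6) g'(6) N(6) by (simp add: a_def)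
qed

definition gauss :: "'a \<Rightarrow> P2" where "gauss x = (THE l. \<exists>k. tangent_rel x k l)"
definition kappa :: "'a \<Rightarrow> nat" where "kappa x = (THE k. \<exists>l. tangent_rel x k l)"

lemma gauss_eq: assumes "tangent_rel x k l" shows "gauss x = l"
  unfolding gauss_def
proof (rule the_equality)
  show "\<exists>k. tangent_rel x k l" using assms by blast
  show "l' = l" if "\<exists>k. tangent_rel x k l'" for l' using that tangent_rel_unique[OF assms] by blast
qed

lemma kappa_eq: assumes "tangent_rel x k l" shows "kappa x = k"
  unfolding kappa_def
proof (rule the_equality)
  show "\<exists>l. tangent_rel x k l" using assms by blast
  show "k' = k" if "\<exists>l. tangent_rel x k' l" for k' using that tangent_rel_unique[OF assms] by blast
qed

end

section \<open>Disc neighbourhoods of finitely many points\<close>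

lemma finite_separation:
  assumes "Hausdorff_space X" "finite S" "S \<subseteq> topspace X"
  obtains D where "\<And>x. x \<in> S \<Longrightarrow> openin X (D x) \<and> x \<in> D x" "disjoint_family_on D S"
proof -
  have "\<exists>D. (\<forall>x\<in>S. openin X (D x) \<and> x \<in> D x) \<and> disjoint_family_on D S"
    using assms(2,3)
  proof (induction S rule: finite_induct)
    case (insert x S)
    then obtain D where D: "\<forall>x\<in>S. openin X (D x) \<and> x \<in> D x" "disjoint_family_on D S" by auto
    have "\<exists>U V. openin X U \<and> openin X V \<and> x \<in> U \<and> y \<in> V \<and> disjnt U V" if "y \<in> S" for y
    proof -
      have "x \<noteq> y" "x \<in> topspace X" "y \<in> topspace X" using insert that by auto
      then show ?thesis using assms(1) unfolding Hausdorff_space_def by blast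
    qed
    then obtain U W where UW: "\<And>y. y \<in> S \<Longrightarrow> openin X (U y) \<and> openin X (W y) \<and> x \<in> U y \<and> y \<in> W y \<and> disjnt (U y) (W y)"
      by metis
    define D' where "D' y = (if y = x then topspace X \<inter> \<Inter> (U ` S) else D y \<inter> W y)" for y
    have "openin X (topspace X \<inter> \<Inter> (U ` S))"
    proof (cases "S = {}")
      case False
      then have "openin X (\<Inter> (U ` S))" using UW insert.hyps by (intro openin_Inter) auto
      then show ?thesis by (simp add: openin_Int)
    qed simp
    then have "\<forall>y\<in>insert x S. openin X (D' y) \<and> y \<in> D' y"
      using UW D insert by (auto simp: D'_def openin_Int)
    moreover have "disjoint_family_on D' (insert x S)"
      unfolding disjoint_family_on_def
    proof (intro ballI impI)
      fix y y' assume *: "y \<in> insert x S" "y' \<in> insert x S" "y \<noteq> y'"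
      show "D' y \<inter> D' y' = {}"
      proof (cases "y = x \<or> y' = x")
        case False
        then have "D y \<inter> D y' = {}" using * D(2) by (auto simp: disjoint_family_on_def)
        then show ?thesis using False by (auto simp: D'_def)
      next
        case True
        then obtain u where u: "u \<in> S" "u \<noteq> x" "(y = x \<and> y' = u) \<or> (y' = x \<and> y = u)" using * insert.hyps by auto
        have "U u \<inter> W u = {}" using UW[OF u(1)] by (simp add: disjnt_def)
        then show ?thesis using u by (auto simp: D'_def)
      qed
    qed
    ultimately show ?case by blast
  qed (simp add: disjoint_family_on_def)
  then show ?thesis using that by blast
qed

lemma exists_orthogonal: "\<exists>b::complex^3. b \<noteq> 0 \<and> dot b c = 0"
proof (cases "c $ 1 = 0 \<and> c $ 2 = 0")
  case True
  then show ?thesis by (intro exI[of _ "vector [1, 0, 0]"]) (auto simp: dot_def vec3_eq_iff)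
next
  case False
  then show ?thesis by (intro exI[of _ "vector [- c $ 2, c $ 1, 0]"]) (auto simp: dot_def vec3_eq_iff)
qed

context curve begin

lemma continuous_chart_inv:
  assumes "(U, \<phi>) \<in> A"
  shows "continuous_map (top_of_set (\<phi> ` U)) X (inv_into U \<phi>)"
  unfolding continuous_map_def
proof (intro conjI allI impI)
  show "inv_into U \<phi> \<in> topspace (top_of_set (\<phi> ` U)) \<rightarrow> topspace X"
    using chart_inv(1)[OF assms] chart(5)[OF assms] by auto
  fix N assume N: "openin X N"
  have "{t \<in> topspace (top_of_set (\<phi> ` U)). inv_into U \<phi> t \<in> N} = \<phi> ` (N \<inter> U)"
  proof (intro equalityI subsetI)
    fix t assume "t \<in> {t \<in> topspace (top_of_set (\<phi> ` U)). inv_into U \<phi> t \<in> N}"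
    then have "t \<in> \<phi> ` U" "inv_into U \<phi> t \<in> N" by auto
    then show "t \<in> \<phi> ` (N \<inter> U)" using chart_inv(1,2)[OF assms] by (metis IntI image_eqI)
  qed (use chart_inv(3)[OF assms] in auto)
  moreover have "open (\<phi> ` (N \<inter> U))"
    using chart_open_image[OF assms] N chart(1)[OF assms] by auto
  ultimately show "openin (top_of_set (\<phi> ` U)) {t \<in> topspace (top_of_set (\<phi> ` U)). inv_into U \<phi> t \<in> N}"
    by (metis chart_inv(1) image_mono inf_le2 open_subset)
qed

text \<open>Invariance of domain makes the injective continuous map \<open>h\<close> open, so it
  need not be known to be holomorphic here.\<close>

lemma chart_disc:
  fixes h :: "complex \<Rightarrow> complex"
  assumes c: "(U, \<phi>) \<in> A" and h: "continuous_on (ball 0 1) h" "inj_on h (ball 0 1)" "h ` ball 0 1 \<subseteq> \<phi> ` U"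
  defines "\<psi> \<equiv> \<lambda>s. inv_into U \<phi> (h s)"
  shows "openin X (\<psi> ` ball 0 1)"
    "homeomorphic_map (top_of_set (ball 0 1)) (subtopology X (\<psi> ` ball 0 1)) \<psi>"
proof -
  have op: "openin X (\<psi> ` B)" if "open B" "B \<subseteq> ball 0 1" for B :: "complex set"
  proof -
    have "open (h ` B)"
      using invariance_of_domain[of B h] h(1,2) that continuous_on_subset inj_on_subset by blast
    then have "openin X (inv_into U \<phi> ` h ` B)"
      using h(3) that(2) by (intro chart_image_open[OF c]) auto
    then show ?thesis by (simp add: \<psi>_def image_image)
  qed
  show 1: "openin X (\<psi> ` ball 0 1)" by (rule op) auto
  then have top: "topspace (subtopology X (\<psi> ` ball 0 1)) = \<psi> ` ball 0 1" using openin_subset by auto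
  show "homeomorphic_map (top_of_set (ball 0 1)) (subtopology X (\<psi> ` ball 0 1)) \<psi>"
  proof (rule bijective_open_imp_homeomorphic_map)
    have "continuous_map (top_of_set (ball 0 1)) (top_of_set (\<phi> ` U)) h" using h by auto
    then have "continuous_map (top_of_set (ball 0 1)) X (inv_into U \<phi> \<circ> h)"
      using continuous_chart_inv[OF c] continuous_map_compose by blast
    then show "continuous_map (top_of_set (ball 0 1)) (subtopology X (\<psi> ` ball 0 1)) \<psi>"
      by (simp add: continuous_map_in_subtopology \<psi>_def comp_def)
    show "open_map (top_of_set (ball 0 1)) (subtopology X (\<psi> ` ball 0 1)) \<psi>"
      unfolding open_map_def
    proof (intro allI impI)
      fix B assume o: "openin (top_of_set (ball (0::complex) 1)) B"
      have B: "open B" "B \<subseteq> ball 0 1" using openin_open_trans[OF o open_ball] openin_imp_subset[OF o] by simp_all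
      then show "openin (subtopology X (\<psi> ` ball 0 1)) (\<psi> ` B)"
        using op[OF B] 1 by (simp add: openin_open_subtopology image_mono)
    qed
    show "\<psi> ` topspace (top_of_set (ball 0 1)) = topspace (subtopology X (\<psi> ` ball 0 1))" using top by simp
    show "inj_on \<psi> (topspace (top_of_set (ball 0 1)))"
    proof (rule inj_onI)
      fix s t assume st: "s \<in> topspace (top_of_set (ball 0 1))" "t \<in> topspace (top_of_set (ball 0 1))" "\<psi> s = \<psi> t"
      then have "h s \<in> \<phi> ` U" "h t \<in> \<phi> ` U" using h(3) by auto
      then have "h s = h t" using chart_inv(2)[OF c] st(3) unfolding \<psi>_def by metis
      then show "s = t" using h(2) st by (auto dest: inj_onD)
    qed
  qed
qed

end

text \<open>The curve lies in no line, so every nonzero linear form has finitely many zeros on it.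
  The condition is self-dual: \<open>dual_nondeg\<close> passes it on to the Gauss map.\<close>

locale nondeg_curve = curve +
  assumes nondeg: "\<And>l. l \<noteq> 0 \<Longrightarrow> \<exists>x\<in>topspace X. dot l (coords (\<nu> x)) \<noteq> 0"
begin

lemma line_finite: "l \<noteq> 0 \<Longrightarrow> finite {x\<in>topspace X. dot l (coords (\<nu> x)) = 0}"
  using homog_fun_zeros(1)[OF homog_fun_dot] nondeg by blast

lemma ord_order:
  assumes "l \<noteq> 0" "lift U \<phi> W f" "x \<in> U" "\<phi> x \<in> W"
  shows "zero_order (\<lambda>t. dot l (f t)) (\<phi> x) (ord l x)"
proof -
  obtain n where "zero_order (\<lambda>t. dot l (f t)) (\<phi> x) n"
    using homog_fun_zeros(2)[OF homog_fun_dot _ _ assms(2,4)] nondeg[OF assms(1)] by blast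
  then show ?thesis using ord_eq[OF assms(2-4)] by blast
qed

lemma ord_pos_iff:
  assumes "l \<noteq> 0" "x \<in> topspace X"
  shows "ord l x > 0 \<longleftrightarrow> dot l (coords (\<nu> x)) = 0"
proof -
  obtain U \<phi> W f where l: "lift U \<phi> W f" "x \<in> U" "\<phi> x \<in> W" using lift_at[OF assms(2)] by blast
  obtain c where "c \<noteq> 0" "coords (\<nu> x) = c *s f (\<phi> x)" using lift_coords'[OF l] by blast
  then show ?thesis using zero_order_eq_0_iff[OF ord_order[OF assms(1) l]] by (simp add: dot_scale_right)
qed

lemma ord_scale:
  assumes "c \<noteq> 0" "l \<noteq> 0" "x \<in> topspace X"
  shows "ord (c *s l) x = ord l x"
proof -
  obtain U \<phi> W f where l: "lift U \<phi> W f" "x \<in> U" "\<phi> x \<in> W" using lift_at[OF assms(3)] by blast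
  have "zero_order (\<lambda>t. c * dot l (f t)) (\<phi> x) (ord l x)"
    by (rule zero_order_cmult[OF ord_order[OF assms(2) l] assms(1)])
  then show ?thesis by (intro ord_eq[OF l]) (simp add: dot_scale_left)
qed

text \<open>The line through \<open>\<nu> x\<close> and the common point \<open>crs a b\<close> of the lines \<open>a\<close> and \<open>b\<close>.\<close>

definition ray :: "complex^3 \<Rightarrow> complex^3 \<Rightarrow> 'a \<Rightarrow> complex^3" where
  "ray a b x = dot a (coords (\<nu> x)) *s b - dot b (coords (\<nu> x)) *s a"

lemma ray_nonzero:
  assumes "crs a b \<noteq> 0" "dot a (coords (\<nu> x)) \<noteq> 0 \<or> dot b (coords (\<nu> x)) \<noteq> 0"
  shows "ray a b x \<noteq> 0"
proof
  assume r: "ray a b x = 0"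
  have "crs a (ray a b x) = dot a (coords (\<nu> x)) *s crs a b"
    "crs b (ray a b x) = dot b (coords (\<nu> x)) *s crs a b"
    unfolding ray_def by (simp_all add: vec3_eq_iff algebra_simps)
  then have "dot a (coords (\<nu> x)) *s crs a b = 0" "dot b (coords (\<nu> x)) *s crs a b = 0"
    using r by (simp_all add: vec3_eq_iff)
  then show False using assms by simp
qed

lemma dot_ray [simp]: "dot (ray a b x) (coords (\<nu> x)) = 0"
  by (simp add: ray_def dot_simps)

text \<open>At \<open>x\<close>, the form \<open>ray a b x\<close> is up to a constant the
  combination of \<open>a\<close> and \<open>b\<close> vanishing there, and the Wronskian of
  \<open>a\<close> and \<open>b\<close> vanishes to one order less. The order of the ray is the
  ramification index of the projection from \<open>crs a b\<close>.\<close>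

lemma wronskian_order:
  assumes l: "lift U \<phi> W f" "x \<in> U" "\<phi> x \<in> W" and ab: "crs a b \<noteq> 0"
    and ne: "dot a (coords (\<nu> x)) \<noteq> 0 \<or> dot b (coords (\<nu> x)) \<noteq> 0"
  obtains n where "ord (ray a b x) x = Suc n"
    "zero_order (\<lambda>t. dot (crs a b) (crs (f t) (vderiv f t))) (\<phi> x) n"
proof -
  have x: "x \<in> topspace X" using l chart(5)[OF liftD(1)[OF l(1)]] by auto
  obtain c where c: "c \<noteq> 0" "coords (\<nu> x) = c *s f (\<phi> x)" using lift_coords'[OF l] by blast
  have ray: "ray a b x \<noteq> 0" using ray_nonzero[OF ab ne] .
  have "ord (ray a b x) x > 0" using ord_pos_iff[OF ray x] by simp
  then obtain n where n: "ord (ray a b x) x = Suc n" by (metis gr0_implies_Suc)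
  define P where "P t = dot a (f t)" for t
  define Q where "Q t = dot b (f t)" for t
  have "zero_order (\<lambda>t. dot (ray a b x) (f t)) (\<phi> x) (Suc n)" using ord_order[OF ray l] n by simp
  moreover have "dot (ray a b x) (f t) = c * (P (\<phi> x) * Q t - Q (\<phi> x) * P t)" for t
    by (simp add: ray_def dot_simps P_def Q_def c(2) algebra_simps)
  ultimately have "zero_order (\<lambda>t. c * (P (\<phi> x) * Q t - Q (\<phi> x) * P t)) (\<phi> x) (Suc n)" by simp
  then have "zero_order (\<lambda>t. inverse c * (c * (P (\<phi> x) * Q t - Q (\<phi> x) * P t))) (\<phi> x) (Suc n)"
    by (rule zero_order_cmult) (use c(1) in simp)
  then have G: "zero_order (\<lambda>t. P (\<phi> x) * Q t - Q (\<phi> x) * P t) (\<phi> x) (Suc n)"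
    using c(1) by (simp flip: mult.assoc)
  note f = liftD(2,4)[OF l(1)]
  have PQ: "P holomorphic_on W" "Q holomorphic_on W" unfolding P_def Q_def using f by (auto intro: holo3_dot)
  have "P (\<phi> x) \<noteq> 0 \<or> Q (\<phi> x) \<noteq> 0" using ne c by (auto simp: P_def Q_def dot_scale_right)
  from zero_order_wronskian[OF PQ f(1) l(3) this G]
  have "zero_order (\<lambda>t. P t * deriv Q t - deriv P t * Q t) (\<phi> x) n" .
  then have "zero_order (\<lambda>t. dot (crs a b) (crs (f t) (vderiv f t))) (\<phi> x) n"
  proof (rule zero_order_cong[OF _ f(1) l(3)])
    fix t assume t: "t \<in> W"
    show "dot (crs a b) (crs (f t) (vderiv f t)) = P t * deriv Q t - deriv P t * Q t"
      unfolding P_def Q_def deriv_dot[OF f(2,1) t] dot_crs_crs by (simp add: mult.commute)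
  qed
  then show ?thesis using that n by blast
qed

lemma tangent_exists:
  assumes x: "x \<in> topspace X" and lift: "lift U \<phi> W f" "x \<in> U" "\<phi> x \<in> W"
  obtains g r where "r > 0" "ball (\<phi> x) r \<subseteq> W" "holo3 g (ball (\<phi> x) r)"
    "\<And>t. t \<in> ball (\<phi> x) r \<Longrightarrow> g t \<noteq> 0"
    "\<And>t. t \<in> ball (\<phi> x) r \<Longrightarrow> crs (f t) (vderiv f t) = (t - \<phi> x) ^ kappa x *s g t"
    "gauss x = pt (g (\<phi> x))"
proof -
  let ?c = "coords (\<nu> x)"
  \<comment> \<open>Two independent forms that do not both vanish at the point have a Wronskian of
    finite order, so the cross product cannot vanish identically near it.\<close>
  obtain a where a: "dot a ?c = 1" using vec3_nonzero_dot[OF coords_nonzero] by blast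
  obtain b where b: "b \<noteq> 0" "dot b ?c = 0" using exists_orthogonal by blast
  have "crs a b \<noteq> 0"
  proof
    assume "crs a b = 0"
    moreover have "a \<noteq> 0" using a by auto
    ultimately obtain k where "b = k *s a" using crs_eq_0D by blast
    then show False using a b by (simp add: dot_scale_left)
  qed
  then obtain n where n: "zero_order (\<lambda>t. dot (crs a b) (crs (f t) (vderiv f t))) (\<phi> x) n"
    using wronskian_order[OF lift, of a b] a by auto
  have "\<not> (\<exists>r>0. \<forall>t\<in>ball (\<phi> x) r. crs (f t) (vderiv f t) = 0)"
  proof
    assume "\<exists>r>0. \<forall>t\<in>ball (\<phi> x) r. crs (f t) (vderiv f t) = 0"
    then obtain r where r: "r > 0" "\<forall>t\<in>ball (\<phi> x) r. crs (f t) (vderiv f t) = 0" by blast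
    obtain s where s: "s > 0" "\<And>t. t \<in> ball (\<phi> x) s \<Longrightarrow> t \<noteq> \<phi> x \<Longrightarrow> dot (crs a b) (crs (f t) (vderiv f t)) \<noteq> 0"
      using zero_order_near[OF n] by blast
    define t where "t = \<phi> x + of_real (min r s / 2)"
    have "dist (\<phi> x) t = min r s / 2" using r s by (simp add: t_def dist_norm)
    then have "t \<in> ball (\<phi> x) r" "t \<in> ball (\<phi> x) s" "t \<noteq> \<phi> x" using r s by auto
    then show False using r(2) s(2)[of t] dot_zero(2) by metis
  qed
  then obtain k g r where g: "r > 0" "ball (\<phi> x) r \<subseteq> W" "holo3 g (ball (\<phi> x) r)"
    "\<forall>t\<in>ball (\<phi> x) r. g t \<noteq> 0 \<and> crs (f t) (vderiv f t) = (t - \<phi> x) ^ k *s g t"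
    using holo3_factor[OF holo3_crs[OF liftD(4)[OF lift(1)] holo3_vderiv[OF liftD(4,2)[OF lift(1)]]] liftD(2)[OF lift(1)] lift(3)]
    by blast
  have rel: "tangent_rel x k (pt (g (\<phi> x)))"
    unfolding tangent_rel_def using lift g by blast
  show ?thesis
    by (rule that[of r g]) (use g kappa_eq[OF rel] gauss_eq[OF rel] in auto)
qed

text \<open>The vector \<open>g\<close> found at \<open>x\<close> also gives the tangent lines at
  all nearby points: there the power of \<open>t - \<phi> x\<close> is a nonzero scalar, so the
  cross product has order 0 and the direction of \<open>g\<close>.\<close>

lemma gauss_lift:
  assumes c: "(U, \<phi>) \<in> A" and xU: "x \<in> U" and l: "lift U \<phi> W f" "\<phi> x \<in> W"
  obtains g r where "r > 0" "ball (\<phi> x) r \<subseteq> W" "holo3 g (ball (\<phi> x) r)"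
    "\<And>t. t \<in> ball (\<phi> x) r \<Longrightarrow> g t \<noteq> 0"
    "\<And>t. t \<in> ball (\<phi> x) r \<Longrightarrow> crs (f t) (vderiv f t) = (t - \<phi> x) ^ kappa x *s g t"
    "\<And>t. t \<in> ball (\<phi> x) r \<Longrightarrow> gauss (inv_into U \<phi> t) = pt (g t)"
proof -
  have x: "x \<in> topspace X" using chart(5)[OF c] xU by blast
  obtain g r where g: "r > 0" "ball (\<phi> x) r \<subseteq> W" "holo3 g (ball (\<phi> x) r)"
    "\<And>t. t \<in> ball (\<phi> x) r \<Longrightarrow> g t \<noteq> 0"
    "\<And>t. t \<in> ball (\<phi> x) r \<Longrightarrow> crs (f t) (vderiv f t) = (t - \<phi> x) ^ kappa x *s g t"
    "gauss x = pt (g (\<phi> x))"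
    by (rule tangent_exists[OF x l(1) xU l(2)], rule that; assumption)
  have main: "gauss (inv_into U \<phi> t) = pt (g t)" if t: "t \<in> ball (\<phi> x) r" for t
  proof (cases "t = \<phi> x")
    case True
    then show ?thesis using g(6) chart_inv(3)[OF c xU] by simp
  next
    case False
    define y where "y = inv_into U \<phi> t"
    have tU: "t \<in> \<phi> ` U" using t g(2) liftD(3)[OF l(1)] by blast
    have y: "y \<in> U" "\<phi> y = t" using chart_inv(1,2)[OF c tU] by (simp_all add: y_def)
    have "open (ball (\<phi> x) r - {\<phi> x})" by auto
    then obtain s where s: "s > 0" "ball t s \<subseteq> ball (\<phi> x) r - {\<phi> x}" using t False openE by blast
    have hp: "(\<lambda>u. (u - \<phi> x) ^ kappa x) holomorphic_on ball t s" by (intro holomorphic_intros)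
    have h: "holo3 (\<lambda>u. (u - \<phi> x) ^ kappa x *s g u) (ball t s)"
      by (rule holo3_smult[OF hp holo3_subset[OF g(3)]]) (use s in blast)
    have "tangent_rel y 0 (pt ((t - \<phi> x) ^ kappa x *s g t))"
      unfolding tangent_rel_def
    proof (intro exI conjI)
      show "lift U \<phi> W f" "y \<in> U" "\<phi> y \<in> W" "0 < s" using l y t g(2) s by auto
      show "ball (\<phi> y) s \<subseteq> W" using s(2) g(2) y by auto
      show "holo3 (\<lambda>u. (u - \<phi> x) ^ kappa x *s g u) (ball (\<phi> y) s)" using h y by simp
      show "\<forall>u\<in>ball (\<phi> y) s. (u - \<phi> x) ^ kappa x *s g u \<noteq> 0 \<and>
              crs (f u) (vderiv f u) = (u - \<phi> y) ^ 0 *s ((u - \<phi> x) ^ kappa x *s g u)"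
      proof
        fix u assume "u \<in> ball (\<phi> y) s"
        then have "u \<in> ball (\<phi> x) r" "u \<noteq> \<phi> x" using s(2) y by auto
        then show "(u - \<phi> x) ^ kappa x *s g u \<noteq> 0 \<and>
              crs (f u) (vderiv f u) = (u - \<phi> y) ^ 0 *s ((u - \<phi> x) ^ kappa x *s g u)"
          using g(4,5) by simp
      qed
      show "pt ((t - \<phi> x) ^ kappa x *s g t) = pt ((\<phi> y - \<phi> x) ^ kappa x *s g (\<phi> y))" using y by simp
    qed
    then have "gauss y = pt ((t - \<phi> x) ^ kappa x *s g t)" by (rule gauss_eq)
    also have "\<dots> = pt (g t)" by (rule pt_scale) (use g(4)[OF t] False in auto)
    finally show ?thesis by (simp add: y_def)
  qed
  show ?thesis by (rule that[OF g(1-5) main])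
qed

lemma gauss_holomorphic: "holomorphic_to_P2 A gauss"
  unfolding holomorphic_to_P2_def
proof (clarify)
  fix U \<phi> x assume c: "(U, \<phi>) \<in> A" and xU: "x \<in> U"
  obtain W f where l: "lift U \<phi> W f" "\<phi> x \<in> W" using lift_at_chart[OF c xU] by blast
  obtain g r where g: "r > 0" "ball (\<phi> x) r \<subseteq> W" "holo3 g (ball (\<phi> x) r)"
    "\<And>t. t \<in> ball (\<phi> x) r \<Longrightarrow> g t \<noteq> 0"
    "\<And>t. t \<in> ball (\<phi> x) r \<Longrightarrow> crs (f t) (vderiv f t) = (t - \<phi> x) ^ kappa x *s g t"
    and main: "\<And>t. t \<in> ball (\<phi> x) r \<Longrightarrow> gauss (inv_into U \<phi> t) = pt (g t)"
    by (rule gauss_lift[OF c xU l], rule that; assumption)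
  show "\<exists>W f. open W \<and> \<phi> x \<in> W \<and> W \<subseteq> \<phi> ` U \<and> (\<forall>i. (\<lambda>t. f t $ i) holomorphic_on W) \<and>
          (\<forall>t\<in>W. f t \<noteq> 0 \<and> gauss (inv_into U \<phi> t) = pt (f t))"
    using g(1-4) liftD(3)[OF l(1)] main unfolding holo3_def
    by (intro exI[of _ "ball (\<phi> x) r"] exI[of _ g]) auto
qed

end

section \<open>Pencils of lines\<close>

context nondeg_curve begin

text \<open>The quotient of \<open>a\<close> by \<open>b\<close> may have poles; \<open>q\<close> is
  a bounded substitute for its absolute value, continuous on all of \<open>X\<close> and vanishing
  exactly where \<open>a\<close> does.\<close>

lemma chordal_continuous:
  assumes ne: "\<And>x. x \<in> topspace X \<Longrightarrow> dot a (coords (\<nu> x)) \<noteq> 0 \<or> dot b (coords (\<nu> x)) \<noteq> 0"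
  defines "q \<equiv> \<lambda>v. norm (dot a v) / max (norm (dot b v)) (norm (dot a v))"
  shows "continuous_map X euclideanreal (\<lambda>x. q (coords (\<nu> x)))"
proof -
  let ?P = "\<lambda>v. dot a v \<noteq> 0 \<or> dot b v \<noteq> 0"
  have "continuous_map (subtopology X {x\<in>topspace X. ?P (coords (\<nu> x))}) euclidean (\<lambda>x. q (coords (\<nu> x)))"
  proof (rule continuous_map_homog(2))
    fix v :: "complex^3" and c :: complex assume "c \<noteq> 0"
    moreover have "max (norm c * s) (norm c * t) = norm c * max s t" for s t
      by (simp add: max_mult_distrib_left)
    ultimately show "q (c *s v) = q v"
      by (simp add: q_def dot_scale_right norm_mult)
  next
    fix v :: "complex^3" and c :: complex assume "c \<noteq> 0"
    then show "?P (c *s v) \<longleftrightarrow> ?P v" by (simp add: dot_scale_right)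
  next
    fix U \<phi> W f assume l: "lift U \<phi> W f"
    have c: "continuous_on W (\<lambda>t. dot a (f t))" "continuous_on W (\<lambda>t. dot b (f t))"
      using liftD(4)[OF l] by (auto intro!: holomorphic_on_imp_continuous_on holo3_dot)
    have eq: "{t\<in>W. ?P (f t)} = (W \<inter> (\<lambda>t. dot a (f t)) -` (- {0})) \<union> (W \<inter> (\<lambda>t. dot b (f t)) -` (- {0}))" by auto
    have "open {t\<in>W. ?P (f t)}"
      unfolding eq using c liftD(2)[OF l] by (intro open_Un continuous_open_preimage) auto
    moreover have "continuous_on {t\<in>W. ?P (f t)} (\<lambda>t. q (f t))"
      unfolding q_def using c
      by (intro continuous_intros) (auto intro: continuous_on_subset simp: max_def split: if_splits)
    ultimately show "open {t\<in>W. ?P (f t)} \<and> continuous_on {t\<in>W. ?P (f t)} (\<lambda>t. q (f t))" by blast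
  qed
  moreover have "{x\<in>topspace X. ?P (coords (\<nu> x))} = topspace X" using ne by auto
  ultimately show ?thesis by simp
qed

lemma quotient_continuous:
  shows "openin X {x\<in>topspace X. dot b (coords (\<nu> x)) \<noteq> 0}"
    "continuous_map (subtopology X {x\<in>topspace X. dot b (coords (\<nu> x)) \<noteq> 0}) euclidean
       (\<lambda>x. dot a (coords (\<nu> x)) / dot b (coords (\<nu> x)))"
proof -
  have lifts: "open {t\<in>W. dot b (f t) \<noteq> 0} \<and> continuous_on {t\<in>W. dot b (f t) \<noteq> 0} (\<lambda>t. dot a (f t) / dot b (f t))"
    if l: "lift U \<phi> W f" for U \<phi> W f
  proof -
    have c: "continuous_on W (\<lambda>t. dot a (f t))" "continuous_on W (\<lambda>t. dot b (f t))"
      using liftD(4)[OF l] by (auto intro!: holomorphic_on_imp_continuous_on holo3_dot)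
    have "{t\<in>W. dot b (f t) \<noteq> 0} = W \<inter> (\<lambda>t. dot b (f t)) -` (- {0})" by auto
    moreover have "open (W \<inter> (\<lambda>t. dot b (f t)) -` (- {0}))"
      using c liftD(2)[OF l] by (intro continuous_open_preimage) auto
    moreover have "continuous_on {t\<in>W. dot b (f t) \<noteq> 0} (\<lambda>t. dot a (f t) / dot b (f t))"
      using c by (intro continuous_intros) (auto intro: continuous_on_subset)
    ultimately show ?thesis by simp
  qed
  show "openin X {x\<in>topspace X. dot b (coords (\<nu> x)) \<noteq> 0}"
    by (rule continuous_map_homog(1)[where H = "\<lambda>v. dot a v / dot b v"]) (auto simp: dot_scale_right lifts)
  show "continuous_map (subtopology X {x\<in>topspace X. dot b (coords (\<nu> x)) \<noteq> 0}) euclidean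
       (\<lambda>x. dot a (coords (\<nu> x)) / dot b (coords (\<nu> x)))"
    by (rule continuous_map_homog(2)[where H = "\<lambda>v. dot a v / dot b v" and P = "\<lambda>v. dot b v \<noteq> 0"])
      (auto simp: dot_scale_right lifts)
qed

text \<open>The quotient of \<open>a\<close> by \<open>b\<close> has a zero of order
  \<open>ord a x\<close>, and \<open>zero_order_local_form\<close> provides a coordinate in which it
  is a pure power. The neighbourhood \<open>D\<close> serves to keep the discs at different points
  apart.\<close>

lemma local_form_at:
  assumes b: "dot b (coords (\<nu> x)) \<noteq> 0" and x: "x \<in> topspace X" "dot a (coords (\<nu> x)) = 0" and a: "a \<noteq> 0"
    and D: "openin X D" "x \<in> D"
  obtains U \<phi> h \<rho> where "(U, \<phi>) \<in> A" "\<rho> > 0" "continuous_on (ball 0 \<rho>) h" "inj_on h (ball 0 \<rho>)"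
    "h ` ball 0 \<rho> \<subseteq> \<phi> ` U" "inv_into U \<phi> (h 0) = x" "inv_into U \<phi> ` h ` ball 0 \<rho> \<subseteq> D"
    "openin X (inv_into U \<phi> ` h ` ball 0 \<rho>)"
    "\<And>s. s \<in> ball 0 \<rho> \<Longrightarrow> dot b (coords (\<nu> (inv_into U \<phi> (h s)))) \<noteq> 0 \<and>
       dot a (coords (\<nu> (inv_into U \<phi> (h s)))) / dot b (coords (\<nu> (inv_into U \<phi> (h s)))) = s ^ ord a x"
proof -
  obtain U \<phi> W f where l: "lift U \<phi> W f" "x \<in> U" "\<phi> x \<in> W" using lift_at[OF x(1)] by blast
  note c = liftD(1)[OF l(1)]
  obtain k where k: "k \<noteq> 0" "coords (\<nu> x) = k *s f (\<phi> x)" using lift_coords'[OF l] by blast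
  define W' where "W' = (W \<inter> (\<lambda>t. dot b (f t)) -` (- {0})) \<inter> \<phi> ` (D \<inter> U)"
  have "continuous_on W (\<lambda>t. dot b (f t))"
    using liftD(4)[OF l(1)] by (auto intro!: holomorphic_on_imp_continuous_on holo3_dot)
  then have "open (W \<inter> (\<lambda>t. dot b (f t)) -` (- {0}))"
    using liftD(2)[OF l(1)] by (intro continuous_open_preimage) auto
  moreover have "open (\<phi> ` (D \<inter> U))" by (rule chart_open_image[OF c]) (use D chart(1)[OF c] in auto)
  ultimately have oW': "open W'" unfolding W'_def by (rule open_Int)
  have xW': "\<phi> x \<in> W'" using l k b D by (auto simp: W'_def dot_scale_right)
  have "zero_order (\<lambda>t. (1 / dot b (f t)) * dot a (f t)) (\<phi> x) (0 + ord a x)"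
  proof (rule zero_order_mult[OF zero_order_0I[OF _ oW' xW'] ord_order[OF a l]])
    have "(\<lambda>t. dot b (f t)) holomorphic_on W'"
      by (rule holomorphic_on_subset[OF holo3_dot[OF liftD(4)[OF l(1)]]]) (auto simp: W'_def)
    then show "(\<lambda>t. 1 / dot b (f t)) holomorphic_on W'"
      by (intro holomorphic_on_divide holomorphic_on_const) (auto simp: W'_def)
    show "1 / dot b (f (\<phi> x)) \<noteq> 0" using xW' by (simp add: W'_def)
  qed
  then have zo: "zero_order (\<lambda>t. dot a (f t) / dot b (f t) - 0) (\<phi> x) (ord a x)" by simp
  have "ord a x > 0" using ord_pos_iff[OF a x(1)] x(2) by simp
  then obtain h \<rho> where h: "\<rho> > 0" "h 0 = \<phi> x" "h holomorphic_on ball 0 \<rho>" "inj_on h (ball 0 \<rho>)" "open (h ` ball 0 \<rho>)"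
    "h ` ball 0 \<rho> \<subseteq> W'" "\<And>s. s \<in> ball 0 \<rho> \<Longrightarrow> dot a (f (h s)) / dot b (f (h s)) = 0 + s ^ ord a x"
    using zero_order_local_form[OF zo _ oW' xW'] by metis
  have sub: "h ` ball 0 \<rho> \<subseteq> \<phi> ` U" using h(6) by (auto simp: W'_def)
  show ?thesis
  proof (rule that[of U \<phi> \<rho> h])
    show "continuous_on (ball 0 \<rho>) h" using h(3) holomorphic_on_imp_continuous_on by blast
    show "inv_into U \<phi> (h 0) = x" using h(2) chart_inv(3)[OF c l(2)] by simp
    show "inv_into U \<phi> ` h ` ball 0 \<rho> \<subseteq> D"
    proof -
      have "inv_into U \<phi> t \<in> D" if tW: "t \<in> W'" for t
      proof -
        obtain y where "y \<in> D" "y \<in> U" "t = \<phi> y" using tW by (auto simp: W'_def)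
        then show ?thesis using chart_inv(3)[OF c] by simp
      qed
      then show ?thesis using h(6) by blast
    qed
    show "openin X (inv_into U \<phi> ` h ` ball 0 \<rho>)" by (rule chart_image_open[OF c sub h(5)])
    fix s :: complex assume s: "s \<in> ball 0 \<rho>"
    then have "h s \<in> W'" using h(6) by blast
    then have hs: "h s \<in> W" "dot b (f (h s)) \<noteq> 0" by (auto simp: W'_def)
    obtain m where m: "m \<noteq> 0" "coords (\<nu> (inv_into U \<phi> (h s))) = m *s f (h s)" using lift_coords[OF l(1) hs(1)] by blast
    show "dot b (coords (\<nu> (inv_into U \<phi> (h s)))) \<noteq> 0 \<and>
       dot a (coords (\<nu> (inv_into U \<phi> (h s)))) / dot b (coords (\<nu> (inv_into U \<phi> (h s)))) = s ^ ord a x"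
      using hs(2) m h(7)[OF s] by (simp add: dot_scale_right)
  qed (use c h sub in auto)
qed

text \<open>Beyond the local forms at the points of the fiber, a common radius is needed and further
  points over the disc must be excluded. By compactness \<open>q\<close> has a positive lower bound
  \<delta> outside the chosen discs, so a point whose value is close enough to \<beta> lies in one
  of them.\<close>

lemma local_model_pencil:
  assumes ab: "crs a b \<noteq> 0"
    and ne: "\<And>x. x \<in> topspace X \<Longrightarrow> dot a (coords (\<nu> x)) \<noteq> 0 \<or> dot b (coords (\<nu> x)) \<noteq> 0"
  shows "\<exists>r \<psi>. local_model X {x\<in>topspace X. dot b (coords (\<nu> x)) \<noteq> 0}
     (\<lambda>x. dot a (coords (\<nu> x)) / dot b (coords (\<nu> x))) (\<lambda>x. ord (ray a b x) x) \<beta> r \<psi>"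
proof -
  \<comment> \<open>The line of the pencil that belongs to the value \<beta>; with it in place of
    \<open>a\<close> the fiber becomes a zero set.\<close>
  define a' where "a' = a - \<beta> *s b"
  let ?b = "\<lambda>x. dot b (coords (\<nu> x))" and ?a = "\<lambda>x. dot a' (coords (\<nu> x))"
  define z where "z x = dot a (coords (\<nu> x)) / ?b x" for x
  define X0 where "X0 = {x\<in>topspace X. ?b x \<noteq> 0}"
  have a'0: "a' \<noteq> 0"
  proof
    assume "a' = 0"
    then have "a = \<beta> *s b" by (simp add: a'_def)
    then show False using ab by (simp add: vec3_eq_iff)
  qed
  have za: "z x - \<beta> = ?a x / ?b x" if "x \<in> X0" for x
    using that by (simp add: z_def X0_def a'_def dot_simps field_simps)
  define S where "S = {x\<in>X0. z x = \<beta>}"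
  have S: "x \<in> S \<longleftrightarrow> x \<in> topspace X \<and> ?b x \<noteq> 0 \<and> ?a x = 0" for x
    using za[of x] by (auto simp: S_def X0_def)
  have finS: "finite S" by (rule finite_subset[OF _ line_finite[OF a'0]]) (auto simp: S)
  have ne': "dot a' (coords (\<nu> x)) \<noteq> 0 \<or> dot b (coords (\<nu> x)) \<noteq> 0" if "x \<in> topspace X" for x
    using ne[OF that] by (auto simp: a'_def dot_simps)
  have ordS: "ord (ray a b x) x = ord a' x" "ord a' x > 0" if x: "x \<in> S" for x
  proof -
    have "dot a (coords (\<nu> x)) = \<beta> * ?b x" using x by (simp add: S a'_def dot_simps)
    then have "ray a b x = (- ?b x) *s a'" by (simp add: ray_def a'_def vec_eq_iff algebra_simps)
    then show "ord (ray a b x) x = ord a' x"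
      using ord_scale[of "- ?b x" a' x] a'0 x S[of x] by auto
    show "ord a' x > 0" using ord_pos_iff[OF a'0] x S by simp
  qed
  have haus: "Hausdorff_space X" using riemann by (simp add: compact_riemann_surface_def)
  obtain D where D: "\<And>x. x \<in> S \<Longrightarrow> openin X (D x) \<and> x \<in> D x" "disjoint_family_on D S"
    using finite_separation[OF haus finS] S by blast
  have "\<exists>U \<phi> h \<rho>. (U, \<phi>) \<in> A \<and> \<rho> > 0 \<and> continuous_on (ball 0 \<rho>) h \<and> inj_on h (ball 0 \<rho>) \<and>
    h ` ball 0 \<rho> \<subseteq> \<phi> ` U \<and> inv_into U \<phi> (h 0) = x \<and> inv_into U \<phi> ` h ` ball 0 \<rho> \<subseteq> D x \<and>
    openin X (inv_into U \<phi> ` h ` ball 0 \<rho>) \<and>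
    (\<forall>s\<in>ball 0 \<rho>. ?b (inv_into U \<phi> (h s)) \<noteq> 0 \<and>
       ?a (inv_into U \<phi> (h s)) / ?b (inv_into U \<phi> (h s)) = s ^ ord a' x)" if xS: "x \<in> S" for x
  proof -
    have *: "?b x \<noteq> 0" "x \<in> topspace X" "?a x = 0" "openin X (D x)" "x \<in> D x" using xS S D(1) by auto
    obtain U \<phi> h \<rho> where "(U, \<phi>) \<in> A" "\<rho> > 0" "continuous_on (ball 0 \<rho>) h" "inj_on h (ball 0 \<rho>)"
      "h ` ball 0 \<rho> \<subseteq> \<phi> ` U" "inv_into U \<phi> (h 0) = x" "inv_into U \<phi> ` h ` ball 0 \<rho> \<subseteq> D x"
      "openin X (inv_into U \<phi> ` h ` ball 0 \<rho>)"
      "\<And>s. s \<in> ball 0 \<rho> \<Longrightarrow> ?b (inv_into U \<phi> (h s)) \<noteq> 0 \<and>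
         ?a (inv_into U \<phi> (h s)) / ?b (inv_into U \<phi> (h s)) = s ^ ord a' x"
      by (rule local_form_at[OF *(1-3) a'0 *(4,5)], rule that; assumption)
    then show ?thesis
      by (intro exI[of _ U] exI[of _ \<phi>] exI[of _ h] exI[of _ \<rho>] conjI ballI; (assumption | blast))
  qed
  then obtain U \<phi> h \<rho> where H: "\<And>x. x \<in> S \<Longrightarrow> (U x, \<phi> x) \<in> A \<and> \<rho> x > (0::real) \<and> continuous_on (ball 0 (\<rho> x)) (h x) \<and> inj_on (h x) (ball 0 (\<rho> x)) \<and>
    h x ` ball 0 (\<rho> x) \<subseteq> \<phi> x ` U x \<and> inv_into (U x) (\<phi> x) (h x 0) = x \<and> inv_into (U x) (\<phi> x) ` h x ` ball 0 (\<rho> x) \<subseteq> D x \<and>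
    openin X (inv_into (U x) (\<phi> x) ` h x ` ball 0 (\<rho> x)) \<and>
    (\<forall>s\<in>ball 0 (\<rho> x). ?b (inv_into (U x) (\<phi> x) (h x s)) \<noteq> 0 \<and>
       ?a (inv_into (U x) (\<phi> x) (h x s)) / ?b (inv_into (U x) (\<phi> x) (h x s)) = s ^ ord a' x)"
    by metis
  define V' where "V' x = inv_into (U x) (\<phi> x) ` h x ` ball 0 (\<rho> x)" for x
  define q where "q = (\<lambda>v. norm (dot a' v) / max (norm (dot b v)) (norm (dot a' v)))"
  have q: "continuous_map X euclideanreal (\<lambda>x. q (coords (\<nu> x)))"
    using chordal_continuous[OF ne'] by (simp add: q_def)
  define K where "K = topspace X - (\<Union>x\<in>S. V' x)"
  have "openin X (\<Union>x\<in>S. V' x)" using H by (auto simp: V'_def)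
  then have "closedin X K" unfolding K_def by (rule closedin_diff[OF closedin_topspace])
  then have cK: "compactin X K"
    using riemann by (simp add: compact_riemann_surface_def closedin_compact_space)
  have compK: "compact ((\<lambda>x. q (coords (\<nu> x))) ` K)"
    using image_compactin[OF cK q] by simp
  have "0 \<notin> (\<lambda>x. q (coords (\<nu> x))) ` K"
  proof
    assume "0 \<in> (\<lambda>x. q (coords (\<nu> x))) ` K"
    then obtain x where x: "x \<in> K" "q (coords (\<nu> x)) = 0" by auto
    then have "x \<in> topspace X" by (simp add: K_def)
    then have "?a x = 0" using x(2) ne'[of x] by (auto simp: q_def max_def split: if_splits)
    then have "x \<in> S" using ne'[of x] \<open>x \<in> topspace X\<close> S by blast
    moreover have "x \<in> V' x" using H[OF \<open>x \<in> S\<close>] unfolding V'_def by (metis centre_in_ball image_eqI)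
    ultimately show False using x by (auto simp: K_def)
  qed
  then have "open (- (\<lambda>x. q (coords (\<nu> x))) ` K)" "0 \<in> - (\<lambda>x. q (coords (\<nu> x))) ` K"
    using compact_imp_closed[OF compK] by auto
  then obtain \<delta> where \<delta>: "\<delta> > 0" "ball 0 \<delta> \<subseteq> - (\<lambda>x. q (coords (\<nu> x))) ` K" using openE by blast
  \<comment> \<open>Small enough for the bound \<delta>, and for the roots of order
    \<open>ord a' x\<close> of values below \<open>r\<close> to stay in the disc of radius
    \<open>\<rho> x\<close>.\<close>
  define r where "r = Min (insert \<delta> ((\<lambda>x. \<rho> x ^ ord a' x) ` S))"
  have r: "r > 0" "r \<le> \<delta>" "\<And>x. x \<in> S \<Longrightarrow> r \<le> \<rho> x ^ ord a' x"
    using \<delta>(1) H finS by (auto simp: r_def)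
  \<comment> \<open>The local coordinate is rescaled to the unit disc, so that the value becomes
    \<open>\<beta> + r * s ^ ord a' x\<close>.\<close>
  define \<psi> where "\<psi> x s = inv_into (U x) (\<phi> x) (h x (of_real (root (ord a' x) r) * s))" for x and s :: complex
  have rt: "root (ord a' x) r > 0" "root (ord a' x) r ^ ord a' x = r" "root (ord a' x) r \<le> \<rho> x" if x: "x \<in> S" for x
  proof -
    show 1: "root (ord a' x) r > 0" "root (ord a' x) r ^ ord a' x = r" using ordS(2)[OF x] r(1) by auto
    have "root (ord a' x) r ^ ord a' x \<le> \<rho> x ^ ord a' x" using 1 r(3)[OF x] by simp
    then show "root (ord a' x) r \<le> \<rho> x" using H[OF x] ordS(2)[OF x] power_mono_iff[of "root (ord a' x) r" "\<rho> x" "ord a' x"] 1 by auto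
  qed
  have arg: "of_real (root (ord a' x) r) * s \<in> ball 0 (\<rho> x)" if x: "x \<in> S" and s: "s \<in> ball 0 1" for x and s :: complex
  proof -
    have "norm (of_real (root (ord a' x) r) * s) = root (ord a' x) r * norm s"
      using rt(1)[OF x] by (simp add: norm_mult)
    also have "\<dots> < root (ord a' x) r" using rt(1)[OF x] s by simp
    also have "\<dots> \<le> \<rho> x" by (rule rt(3)[OF x])
    finally show ?thesis by simp
  qed
  have val: "?b (\<psi> x s) \<noteq> 0 \<and> z (\<psi> x s) = \<beta> + of_real r * s ^ ord a' x \<and> \<psi> x s \<in> topspace X"
    if x: "x \<in> S" and s: "s \<in> ball 0 1" for x and s :: complex
  proof -
    have "\<forall>s\<in>ball 0 (\<rho> x). ?b (inv_into (U x) (\<phi> x) (h x s)) \<noteq> 0 \<and>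
       ?a (inv_into (U x) (\<phi> x) (h x s)) / ?b (inv_into (U x) (\<phi> x) (h x s)) = s ^ ord a' x"
      using H[OF x] by blast
    note B = bspec[OF this arg[OF x s]]
    have 1: "?b (\<psi> x s) \<noteq> 0" "?a (\<psi> x s) / ?b (\<psi> x s) = (of_real (root (ord a' x) r) * s) ^ ord a' x"
      unfolding \<psi>_def by (rule conjunct1[OF B], rule conjunct2[OF B])
    have 2: "\<psi> x s \<in> topspace X"
    proof -
      have "\<psi> x s \<in> V' x" using arg[OF x s] unfolding V'_def \<psi>_def by blast
      then show ?thesis using H[OF x] openin_subset unfolding V'_def by blast
    qed
    then have "z (\<psi> x s) - \<beta> = (of_real (root (ord a' x) r) * s) ^ ord a' x" using za[of "\<psi> x s"] 1 by (simp add: X0_def)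
    also have "\<dots> = of_real r * s ^ ord a' x"
      using rt(2)[OF x] by (simp add: power_mult_distrib flip: of_real_power)
    finally show ?thesis using 1 2 by (simp add: algebra_simps)
  qed
  have img: "{y\<in>X0. z y \<in> ball \<beta> r} = (\<Union>x\<in>S. \<psi> x ` ball 0 1)"
  proof (intro equalityI subsetI)
    fix y assume y: "y \<in> {y\<in>X0. z y \<in> ball \<beta> r}"
    then have yX: "y \<in> topspace X" "?b y \<noteq> 0" and d: "norm (z y - \<beta>) < r" by (auto simp: X0_def dist_norm norm_minus_commute)
    have zn: "norm (z y - \<beta>) = norm (?a y) / norm (?b y)" using za[of y] y by (simp add: norm_divide)
    have "q (coords (\<nu> y)) \<le> norm (?a y) / norm (?b y)"
    proof -
      have "norm (?b y) > 0" using yX by simp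
      then have "max (norm (?b y)) (norm (?a y)) * norm (?b y) > 0" by (intro mult_pos_pos) (auto simp: less_max_iff_disj)
      then show ?thesis unfolding q_def by (intro divide_left_mono) auto
    qed
    then have "q (coords (\<nu> y)) < \<delta>" using d zn r(2) by linarith
    moreover have "q (coords (\<nu> y)) \<ge> 0" by (simp add: q_def max_def)
    ultimately have "q (coords (\<nu> y)) \<in> ball 0 \<delta>" by (simp add: dist_norm)
    then have "y \<notin> K" using \<delta>(2) by blast
    then obtain x where x: "x \<in> S" "y \<in> V' x" using yX by (auto simp: K_def)
    then obtain s where s: "s \<in> ball 0 (\<rho> x)" "y = inv_into (U x) (\<phi> x) (h x s)" by (auto simp: V'_def)
    define s' where "s' = s / of_real (root (ord a' x) r)"
    have ss': "s = of_real (root (ord a' x) r) * s'" using rt(1)[OF x(1)] by (simp add: s'_def)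
    have "z y - \<beta> = s ^ ord a' x" using H[OF x(1)] s za[of y] y by auto
    then have "norm s ^ ord a' x < root (ord a' x) r ^ ord a' x" using d rt(2)[OF x(1)] by (simp add: norm_power)
    then have "norm s < root (ord a' x) r" using rt(1)[OF x(1)] by (meson less_imp_le power_less_imp_less_base)
    then have "norm s' < 1" using rt(1)[OF x(1)] by (simp add: s'_def norm_divide)
    then have "y \<in> \<psi> x ` ball 0 1" using s(2) ss' unfolding \<psi>_def by (intro image_eqI[of _ _ s']) auto
    then show "y \<in> (\<Union>x\<in>S. \<psi> x ` ball 0 1)" using x by blast
  next
    fix y assume "y \<in> (\<Union>x\<in>S. \<psi> x ` ball 0 1)"
    then obtain x s where x: "x \<in> S" "s \<in> ball 0 1" "y = \<psi> x s" by blast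
    have "norm s ^ ord a' x < 1" using x(2) ordS(2)[OF x(1)] by (simp add: power_less_one_iff)
    then show "y \<in> {y\<in>X0. z y \<in> ball \<beta> r}"
      using val[OF x(1,2)] x(3) r(1) by (auto simp: X0_def dist_norm norm_mult norm_power)
  qed
  have disc: "openin X (\<psi> x ` ball 0 1)" "homeomorphic_map (top_of_set (ball 0 1)) (subtopology X (\<psi> x ` ball 0 1)) (\<psi> x)"
    if x: "x \<in> S" for x
  proof -
    define k where "k = complex_of_real (root (ord a' x) r)"
    have k: "k \<noteq> 0" using rt(1)[OF x] by (simp add: k_def)
    have kb: "(\<lambda>s. k * s) ` ball 0 1 \<subseteq> ball 0 (\<rho> x)" using arg[OF x] by (auto simp: k_def)
    have cont: "continuous_on (ball 0 1) (\<lambda>s. h x (k * s))"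
      by (rule continuous_on_compose2[of "ball 0 (\<rho> x)" "h x"]) (use H[OF x] kb in \<open>auto intro!: continuous_intros\<close>)
    have inj: "inj_on (\<lambda>s. h x (k * s)) (ball 0 1)"
    proof (rule inj_onI)
      fix s t assume st: "s \<in> ball 0 1" "t \<in> ball 0 1" "h x (k * s) = h x (k * t)"
      have "inj_on (h x) (ball 0 (\<rho> x))" using H[OF x] by blast
      moreover have "k * s \<in> ball 0 (\<rho> x)" "k * t \<in> ball 0 (\<rho> x)" using kb st by blast+
      ultimately have "k * s = k * t" using st(3) by (meson inj_onD)
      then show "s = t" using k by simp
    qed
    have sub: "(\<lambda>s. h x (k * s)) ` ball 0 1 \<subseteq> \<phi> x ` U x" using H[OF x] kb by blast
    have c: "(U x, \<phi> x) \<in> A" using H[OF x] by blast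
    have "\<psi> x = (\<lambda>s. inv_into (U x) (\<phi> x) (h x (k * s)))" by (simp add: \<psi>_def k_def fun_eq_iff)
    then show "openin X (\<psi> x ` ball 0 1)" "homeomorphic_map (top_of_set (ball 0 1)) (subtopology X (\<psi> x ` ball 0 1)) (\<psi> x)"
      using chart_disc[OF c cont inj sub] by simp_all
  qed
  have "disjoint_family_on (\<lambda>x. \<psi> x ` ball 0 1) S"
    unfolding disjoint_family_on_def
  proof (intro ballI impI)
    fix x y assume xy: "x \<in> S" "y \<in> S" "x \<noteq> y"
    have sub: "\<psi> x ` ball 0 1 \<subseteq> D x" if x: "x \<in> S" for x
      using H[OF x] arg[OF x] unfolding \<psi>_def by blast
    have "D x \<inter> D y = {}" using D(2) xy by (simp add: disjoint_family_on_def)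
    then show "\<psi> x ` ball 0 1 \<inter> \<psi> y ` ball 0 1 = {}" using sub[OF xy(1)] sub[OF xy(2)] by blast
  qed
  moreover have "\<psi> x 0 = x" if x: "x \<in> S" for x using H[OF x] by (simp add: \<psi>_def)
  ultimately have "local_model X X0 z (\<lambda>x. ord (ray a b x) x) \<beta> r \<psi>"
    unfolding local_model_def S_def[symmetric]
    using r(1) finS disc img val ordS by (auto simp: S_def)
  then show ?thesis unfolding X0_def z_def by blast
qed

text \<open>The projection from \<open>crs a b\<close>, a point off the curve by \<open>ne\<close>,
  as a covering of the pencil of lines through it. Exchanging \<open>a\<close> and \<open>b\<close>
  only changes the sign of the ray, so the indices in both charts agree.\<close>

lemma pencil_cover:
  assumes ab: "crs a b \<noteq> 0"
    and ne: "\<And>x. x \<in> topspace X \<Longrightarrow> dot a (coords (\<nu> x)) \<noteq> 0 \<or> dot b (coords (\<nu> x)) \<noteq> 0"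
  shows "branched_cover X {x\<in>topspace X. dot b (coords (\<nu> x)) \<noteq> 0} {x\<in>topspace X. dot a (coords (\<nu> x)) \<noteq> 0}
     (\<lambda>x. dot a (coords (\<nu> x)) / dot b (coords (\<nu> x))) (\<lambda>x. dot b (coords (\<nu> x)) / dot a (coords (\<nu> x)))
     (\<lambda>x. ord (ray a b x) x)"
proof
  have ba: "crs b a \<noteq> 0" using ab by (metis crs_anticommute vector_mul_eq_0 zero_neq_neg_one)
  have "\<exists>r \<psi>. local_model X {x\<in>topspace X. dot a (coords (\<nu> x)) \<noteq> 0} (\<lambda>x. dot b (coords (\<nu> x)) / dot a (coords (\<nu> x)))
     (\<lambda>x. ord (ray b a x) x) 0 r \<psi>"
    by (rule local_model_pencil[OF ba]) (use ne in blast)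
  then obtain r \<psi> where m: "local_model X {x\<in>topspace X. dot a (coords (\<nu> x)) \<noteq> 0} (\<lambda>x. dot b (coords (\<nu> x)) / dot a (coords (\<nu> x)))
     (\<lambda>x. ord (ray b a x) x) 0 r \<psi>" by blast
  have "ord (ray b a x) x = ord (ray a b x) x" if x: "x \<in> topspace X" for x
  proof -
    have "ray b a x = (-1) *s ray a b x" by (simp add: ray_def vec_eq_iff)
    then show ?thesis using ord_scale[of "-1" "ray a b x" x] ray_nonzero[OF ab ne[OF x]] x by simp
  qed
  then have "local_model X {x\<in>topspace X. dot a (coords (\<nu> x)) \<noteq> 0} (\<lambda>x. dot b (coords (\<nu> x)) / dot a (coords (\<nu> x)))
     (\<lambda>x. ord (ray a b x) x) 0 r \<psi>"
    using m unfolding local_model_def by simp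
  then show "\<exists>r \<psi>. local_model X {x\<in>topspace X. dot a (coords (\<nu> x)) \<noteq> 0} (\<lambda>x. dot b (coords (\<nu> x)) / dot a (coords (\<nu> x)))
     (\<lambda>x. ord (ray a b x) x) 0 r \<psi>" by blast
  show "\<exists>r \<psi>. local_model X {x\<in>topspace X. dot b (coords (\<nu> x)) \<noteq> 0} (\<lambda>x. dot a (coords (\<nu> x)) / dot b (coords (\<nu> x)))
     (\<lambda>x. ord (ray a b x) x) \<beta> r \<psi>" for \<beta>
    by (rule local_model_pencil[OF ab]) (use ne in blast)
qed (use ne quotient_continuous in auto)

definition line_degree :: "complex^3 \<Rightarrow> nat" where
  "line_degree l = (\<Sum>x | x \<in> topspace X \<and> dot l (coords (\<nu> x)) = 0. ord l x)"

text \<open>Every line of the pencil is a fiber of the covering, \<open>b\<close> being the one at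
  infinity, and all fibers have the same size when counted with ramification.\<close>

lemma line_degree_pencil:
  assumes ab: "crs a b \<noteq> 0"
    and ne: "\<And>x. x \<in> topspace X \<Longrightarrow> dot a (coords (\<nu> x)) \<noteq> 0 \<or> dot b (coords (\<nu> x)) \<noteq> 0"
  shows "line_degree (a - \<beta> *s b) = line_degree b"
    "finite {x\<in>topspace X. ord (ray a b x) x \<noteq> 1}"
    "has_euler X (2 * int (line_degree b) - (\<Sum>x | x \<in> topspace X \<and> ord (ray a b x) x \<noteq> 1. int (ord (ray a b x) x) - 1))"
proof -
  interpret P: branched_cover X "{x\<in>topspace X. dot b (coords (\<nu> x)) \<noteq> 0}" "{x\<in>topspace X. dot a (coords (\<nu> x)) \<noteq> 0}"
     "\<lambda>x. dot a (coords (\<nu> x)) / dot b (coords (\<nu> x))" "\<lambda>x. dot b (coords (\<nu> x)) / dot a (coords (\<nu> x))"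
     "\<lambda>x. ord (ray a b x) x"
    by (rule pencil_cover[OF ab]) (use ne in blast)
  have deg: "line_degree (a - \<beta> *s b) = P.degr" for \<beta>
  proof -
    define a' where "a' = a - \<beta> *s b"
    have a'0: "a' \<noteq> 0"
    proof
      assume "a' = 0"
      then have "a = \<beta> *s b" by (simp add: a'_def)
      then show False using ab by (simp add: vec3_eq_iff)
    qed
    have fib: "P.fiber \<beta> = {x\<in>topspace X. dot a' (coords (\<nu> x)) = 0}"
      unfolding P.fiber_def a'_def using ne by (auto simp: dot_simps field_simps)
    have "line_degree a' = (\<Sum>x\<in>P.fiber \<beta>. ord (ray a b x) x)"
      unfolding line_degree_def fib
    proof (rule sum.cong[OF refl])
      fix x assume x: "x \<in> {x\<in>topspace X. dot a' (coords (\<nu> x)) = 0}"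
      then have eq: "dot a (coords (\<nu> x)) = \<beta> * dot b (coords (\<nu> x))" by (simp add: a'_def dot_simps)
      then have "dot b (coords (\<nu> x)) \<noteq> 0" using ne[of x] x by auto
      moreover have "ray a b x = (- dot b (coords (\<nu> x))) *s a'"
        using eq by (simp add: ray_def a'_def vec_eq_iff algebra_simps)
      ultimately show "ord a' x = ord (ray a b x) x" using ord_scale[of "- dot b (coords (\<nu> x))" a' x] a'0 x by auto
    qed
    then show ?thesis using P.sum_fiber by (simp add: a'_def)
  qed
  have degb: "line_degree b = P.degr"
  proof -
    have b0: "b \<noteq> 0" using ab by (auto simp: vec3_eq_iff)
    have fib: "P.fiber_inf = {x\<in>topspace X. dot b (coords (\<nu> x)) = 0}"
      unfolding P.fiber_inf_def using ne by auto
    have "line_degree b = (\<Sum>x\<in>P.fiber_inf. ord (ray a b x) x)"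
      unfolding line_degree_def fib
    proof (rule sum.cong[OF refl])
      fix x assume x: "x \<in> {x\<in>topspace X. dot b (coords (\<nu> x)) = 0}"
      then have "dot a (coords (\<nu> x)) \<noteq> 0" using ne[of x] by auto
      moreover have "ray a b x = dot a (coords (\<nu> x)) *s b" using x by (simp add: ray_def vec_eq_iff)
      ultimately show "ord b x = ord (ray a b x) x" using ord_scale[OF _ b0] x by simp
    qed
    then show ?thesis using P.sum_fiber_inf by simp
  qed
  show "line_degree (a - \<beta> *s b) = line_degree b" using deg degb by simp
  show "finite {x\<in>topspace X. ord (ray a b x) x \<noteq> 1}" by (rule P.riemann_hurwitz(1))
  show "has_euler X (2 * int (line_degree b) - (\<Sum>x | x \<in> topspace X \<and> ord (ray a b x) x \<noteq> 1. int (ord (ray a b x) x) - 1))"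
    using P.riemann_hurwitz(2) degb by simp
qed

end

section \<open>Ternary forms\<close>

text \<open>\<open>expansion\<close> freed from the chosen coordinates of points, so that its
  arguments can be rescaled and shifted.\<close>

definition expand :: "ternary \<Rightarrow> complex^3 \<Rightarrow> complex^3 \<Rightarrow> complex poly" where
  "expand F v w = (\<Sum>m\<in>Poly_Mapping.keys F.
     Polynomial.smult (Poly_Mapping.lookup F m) (\<Prod>i\<in>UNIV. [:v $ i, w $ i:] ^ Poly_Mapping.lookup m i))"

lemma expansion_eq: "expansion F p q = expand F (coords p) (coords q)"
  by (simp add: expansion_def expand_def)

lemma poly_expand: "poly (expand F v w) t = eval_form F (v + t *s w)"
  by (simp add: expand_def eval_form_def poly_sum poly_prod poly_power mult.commute)

lemma eval_form_scale:
  assumes "homogeneous d F" shows "eval_form F (c *s v) = c ^ d * eval_form F v"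
  unfolding eval_form_def sum_distrib_left
proof (rule sum.cong[OF refl])
  fix m assume "m \<in> Poly_Mapping.keys F"
  then have "(\<Sum>i\<in>UNIV. Poly_Mapping.lookup m i) = d" using assms by (simp add: homogeneous_def)
  then have "c ^ d = (\<Prod>i\<in>UNIV. c ^ Poly_Mapping.lookup m i)" by (simp flip: power_sum)
  then show "Poly_Mapping.lookup F m * (\<Prod>i\<in>UNIV. (c *s v) $ i ^ Poly_Mapping.lookup m i) =
        c ^ d * (Poly_Mapping.lookup F m * (\<Prod>i\<in>UNIV. v $ i ^ Poly_Mapping.lookup m i))"
    by (simp add: power_mult_distrib prod.distrib)
qed

lemma eval_form_pt:
  assumes "homogeneous d F" "v \<noteq> 0"
  shows "pt v \<in> zeros F \<longleftrightarrow> eval_form F v = 0"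
proof -
  obtain c where "c \<noteq> 0" "coords (pt v) = c *s v" using coords_pt[OF assms(2)] by blast
  then show ?thesis using eval_form_scale[OF assms(1)] by (simp add: zeros_def)
qed

lemma eval_form_holomorphic:
  assumes "holo3 f W" shows "(\<lambda>t. eval_form F (f t)) holomorphic_on W"
  unfolding eval_form_def using assms by (auto simp: holo3_def intro!: holomorphic_intros)

lemma coeff_linear_power:
  fixes a b :: complex
  shows "Polynomial.coeff ([:a, b:] ^ n) 0 = a ^ n" "Polynomial.coeff ([:a, b:] ^ n) (Suc 0) = of_nat n * a ^ (n - 1) * b"
proof -
  show 0: "Polynomial.coeff ([:a, b:] ^ n) 0 = a ^ n" for n by (simp add: coeff_0_power)
  show "Polynomial.coeff ([:a, b:] ^ n) (Suc 0) = of_nat n * a ^ (n - 1) * b"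
  proof (induction n)
    case (Suc n)
    have "Polynomial.coeff ([:a, b:] ^ Suc n) (Suc 0) = a * Polynomial.coeff ([:a, b:] ^ n) (Suc 0) + b * a ^ n"
      using 0[of n] by (simp add: coeff_pCons mult_pCons_left)
    also have "\<dots> = of_nat (Suc n) * a ^ (Suc n - 1) * b"
      unfolding Suc.IH by (cases n) (simp_all add: algebra_simps)
    finally show ?case .
  qed simp
qed

lemma prod_3: "(\<Prod>i\<in>(UNIV::3 set). f i) = f 1 * f 2 * f 3"
  unfolding UNIV_3 by (simp add: mult.assoc)

text \<open>Formal partial derivatives, monomial by monomial. An exponent truncated at 0 always
  comes with the factor 0.\<close>

definition grad :: "ternary \<Rightarrow> complex^3 \<Rightarrow> complex^3" where
  "grad F v = (\<Sum>m\<in>Poly_Mapping.keys F. Poly_Mapping.lookup F m *s vector [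
     of_nat (Poly_Mapping.lookup m 1) * v $ 1 ^ (Poly_Mapping.lookup m 1 - 1) * v $ 2 ^ Poly_Mapping.lookup m 2 * v $ 3 ^ Poly_Mapping.lookup m 3,
     of_nat (Poly_Mapping.lookup m 2) * v $ 1 ^ Poly_Mapping.lookup m 1 * v $ 2 ^ (Poly_Mapping.lookup m 2 - 1) * v $ 3 ^ Poly_Mapping.lookup m 3,
     of_nat (Poly_Mapping.lookup m 3) * v $ 1 ^ Poly_Mapping.lookup m 1 * v $ 2 ^ Poly_Mapping.lookup m 2 * v $ 3 ^ (Poly_Mapping.lookup m 3 - 1)])"

lemma dot_sum_left: "dot (\<Sum>m\<in>M. g m) w = (\<Sum>m\<in>M. dot (g m) w)"
  by (induction M rule: infinite_finite_induct) (simp_all add: dot_add_left)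

lemma coeff_expand_1: "Polynomial.coeff (expand F v w) (Suc 0) = dot (grad F v) w"
  unfolding expand_def grad_def dot_sum_left coeff_sum
proof (rule sum.cong[OF refl])
  fix m
  have c1: "Polynomial.coeff (p * q) (Suc 0) = Polynomial.coeff p 0 * Polynomial.coeff q (Suc 0) + Polynomial.coeff p (Suc 0) * Polynomial.coeff q 0" for p q :: "complex poly"
    by (simp add: coeff_mult)
  have c0: "Polynomial.coeff (p * q) 0 = Polynomial.coeff p 0 * Polynomial.coeff q 0" for p q :: "complex poly"
    by (simp add: coeff_mult)
  show "Polynomial.coeff (Polynomial.smult (Poly_Mapping.lookup F m) (\<Prod>i\<in>UNIV. [:v $ i, w $ i:] ^ Poly_Mapping.lookup m i)) (Suc 0) =
    dot (Poly_Mapping.lookup F m *s vector [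
     of_nat (Poly_Mapping.lookup m 1) * v $ 1 ^ (Poly_Mapping.lookup m 1 - 1) * v $ 2 ^ Poly_Mapping.lookup m 2 * v $ 3 ^ Poly_Mapping.lookup m 3,
     of_nat (Poly_Mapping.lookup m 2) * v $ 1 ^ Poly_Mapping.lookup m 1 * v $ 2 ^ (Poly_Mapping.lookup m 2 - 1) * v $ 3 ^ Poly_Mapping.lookup m 3,
     of_nat (Poly_Mapping.lookup m 3) * v $ 1 ^ Poly_Mapping.lookup m 1 * v $ 2 ^ Poly_Mapping.lookup m 2 * v $ 3 ^ (Poly_Mapping.lookup m 3 - 1)]) w"
    unfolding prod_3 coeff_smult c1 c0 coeff_linear_power dot_def vector_smult_component vector_3
    by (simp add: algebra_simps)
qed

lemma coeff_expand_0: "Polynomial.coeff (expand F v w) 0 = eval_form F v"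
  using poly_expand[of F v w 0] by (simp add: poly_0_coeff_0)

lemma expand_scale:
  assumes "homogeneous d F" shows "expand F (c *s v) (c *s w) = Polynomial.smult (c ^ d) (expand F v w)"
proof -
  have "poly (expand F (c *s v) (c *s w)) t = poly (Polynomial.smult (c ^ d) (expand F v w)) t" for t
  proof -
    have eq: "c *s v + t *s (c *s w) = c *s (v + t *s w)" by (simp add: vec_eq_iff algebra_simps)
    show ?thesis by (simp only: poly_expand eq poly_smult eval_form_scale[OF assms])
  qed
  then show ?thesis by (simp add: poly_eq_poly_eq_iff[symmetric] fun_eq_iff)
qed

lemma coeff_expand_scale: "Polynomial.coeff (expand F v (c *s w)) k = c ^ k * Polynomial.coeff (expand F v w) k"
proof -
  have "poly (expand F v (c *s w)) t = poly (pcompose (expand F v w) [:0, c:]) t" for t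
    by (simp add: poly_expand poly_pcompose vector_smult_assoc mult.commute)
  then have "expand F v (c *s w) = pcompose (expand F v w) [:0, c:]"
    by (simp add: poly_eq_poly_eq_iff[symmetric] fun_eq_iff)
  then show ?thesis by (simp add: coeff_pcompose_linear)
qed

lemma coeff_expand_scale_both:
  assumes "homogeneous d F" "c \<noteq> 0"
  shows "Polynomial.coeff (expand F (c *s v) w) k = c ^ d / c ^ k * Polynomial.coeff (expand F v w) k"
proof -
  have "w = c *s (inverse c *s w)" using assms by (simp add: vector_smult_assoc)
  then have "Polynomial.coeff (expand F (c *s v) w) k = c ^ d * Polynomial.coeff (expand F v (inverse c *s w)) k"
    using expand_scale[OF assms(1), of c v "inverse c *s w"] by simp
  then show ?thesis by (simp add: coeff_expand_scale divide_inverse power_inverse)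
qed

lemma dot_eqI: "(\<And>w. dot a w = dot b w) \<Longrightarrow> a = b"
proof -
  assume eq: "\<And>w. dot a w = dot b w"
  show ?thesis
    using eq[of "vector [1, 0, 0]"] eq[of "vector [0, 1, 0]"] eq[of "vector [0, 0, 1]"]
    by (simp add: dot_def vec3_eq_iff)
qed

lemma grad_scale:
  assumes "homogeneous d F" "c \<noteq> 0"
  shows "grad F (c *s v) = (c ^ d / c) *s grad F v"
  by (rule dot_eqI) (use coeff_expand_scale_both[OF assms, of v _ 1] in \<open>simp add: coeff_expand_1 dot_scale_left\<close>)

text \<open>\<open>expand F v v\<close> is \<open>eval_form F v\<close> times the power
  \<open>[:1, 1:] ^ d\<close>; the linear coefficients are compared.\<close>

lemma euler_identity:
  assumes "homogeneous d F" shows "dot (grad F v) v = of_nat d * eval_form F v"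
proof -
  have "poly (expand F v v) t = poly (Polynomial.smult (eval_form F v) ([:1, 1:] ^ d)) t" for t
  proof -
    have eq: "v + t *s v = (1 + t) *s v" by (simp add: vec_eq_iff algebra_simps)
    show ?thesis by (simp only: poly_expand eq eval_form_scale[OF assms] poly_smult poly_power) simp
  qed
  then have "expand F v v = Polynomial.smult (eval_form F v) ([:1, 1:] ^ d)"
    by (simp add: poly_eq_poly_eq_iff[symmetric] fun_eq_iff)
  then have "Polynomial.coeff (expand F v v) (Suc 0) = eval_form F v * of_nat d" by (simp add: coeff_linear_power)
  then show ?thesis by (simp add: coeff_expand_1)
qed

lemma deriv_eval_form:
  assumes "holo3 f W" "open W" "t \<in> W"
  shows "deriv (\<lambda>t. eval_form F (f t)) t = dot (grad F (f t)) (vderiv f t)"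
proof -
  have d: "((\<lambda>t. f t $ i) has_field_derivative vderiv f t $ i) (at t)" for i
    unfolding vderiv_def using holomorphic_derivI[OF holo3_nth[OF assms(1)] assms(2,3)] by simp
  have p: "((\<lambda>t. f t $ i ^ n) has_field_derivative of_nat n * (vderiv f t $ i * f t $ i ^ (n - 1))) (at t)" for i n
    using DERIV_power[OF d, of i n] by simp
  have "((\<lambda>t. eval_form F (f t)) has_field_derivative dot (grad F (f t)) (vderiv f t)) (at t)"
    unfolding eval_form_def grad_def dot_sum_left prod_3
  proof (rule DERIV_sum)
    fix m
    show "((\<lambda>t. Poly_Mapping.lookup F m * (f t $ 1 ^ Poly_Mapping.lookup m 1 * f t $ 2 ^ Poly_Mapping.lookup m 2 * f t $ 3 ^ Poly_Mapping.lookup m 3))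
      has_field_derivative dot (Poly_Mapping.lookup F m *s vector [
     of_nat (Poly_Mapping.lookup m 1) * f t $ 1 ^ (Poly_Mapping.lookup m 1 - 1) * f t $ 2 ^ Poly_Mapping.lookup m 2 * f t $ 3 ^ Poly_Mapping.lookup m 3,
     of_nat (Poly_Mapping.lookup m 2) * f t $ 1 ^ Poly_Mapping.lookup m 1 * f t $ 2 ^ (Poly_Mapping.lookup m 2 - 1) * f t $ 3 ^ Poly_Mapping.lookup m 3,
     of_nat (Poly_Mapping.lookup m 3) * f t $ 1 ^ Poly_Mapping.lookup m 1 * f t $ 2 ^ Poly_Mapping.lookup m 2 * f t $ 3 ^ (Poly_Mapping.lookup m 3 - 1)]) (vderiv f t)) (at t)"
      by (rule DERIV_cong[OF DERIV_cmult[OF DERIV_mult[OF DERIV_mult[OF p p] p]]])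
         (simp add: dot_def algebra_simps)
  qed
  then show ?thesis by (rule DERIV_imp_deriv)
qed

lemma order_0_ge_iff:
  assumes "(p :: complex poly) \<noteq> 0" shows "n \<le> Polynomial.order 0 p \<longleftrightarrow> (\<forall>k<n. Polynomial.coeff p k = 0)"
  using monom_1_dvd_iff[OF assms, of n] monom_1_dvd_iff'[of n p] by simp

text \<open>Covers lines contained in the curve as well, whose multiplicity is infinite.\<close>

lemma line_intersection_gt:
  "line_intersection F p q > enat n \<longleftrightarrow> (\<forall>k\<le>n. Polynomial.coeff (expansion F p q) k = 0)"
proof (cases "expansion F p q = 0")
  case False
  then show ?thesis
    using order_0_ge_iff[OF False, of "Suc n"] by (auto simp: line_intersection_def Suc_le_eq less_Suc_eq_le)
qed (simp add: line_intersection_def)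

lemma mult_at_coeff_eq_0:
  assumes "k < mult_at F p" shows "Polynomial.coeff (expansion F p q) k = 0"
  using not_less_Least[OF assms[unfolded mult_at_def]] by auto

text \<open>Needed for the minimum in \<open>mult_at\<close> to be attained. If the line from
  \<open>p\<close> towards \<open>O'\<close> consisted of zeros, its far end \<open>O'\<close> would
  be a zero too: read from \<open>O'\<close>, the polynomial vanishes for all nonzero
  \<open>t\<close>, hence also at 0.\<close>

lemma mult_at_exists:
  assumes "homogeneous d F" "eval_form F O' \<noteq> 0" "O' \<noteq> 0"
  shows "\<exists>q. Polynomial.coeff (expansion F p q) (mult_at F p) \<noteq> 0"
  unfolding mult_at_def
proof (rule LeastI_ex)
  have "\<exists>t. poly (expand F (coords p) O') t \<noteq> 0"
  proof (rule ccontr)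
    assume "\<not> ?thesis"
    then have all: "eval_form F (coords p + t *s O') = 0" for t by (simp add: poly_expand)
    have "poly (expand F O' (coords p)) t = 0" if "t \<noteq> 0" for t
    proof -
      have eq: "O' + t *s coords p = t *s (coords p + inverse t *s O')" using that by (simp add: vec_eq_iff algebra_simps)
      show ?thesis by (simp only: poly_expand eq eval_form_scale[OF assms(1)] all mult_zero_right)
    qed
    then have "infinite {t. poly (expand F O' (coords p)) t = 0}"
      using infinite_super[of "UNIV - {0}" "{t. poly (expand F O' (coords p)) t = 0}"]
      by (auto simp: infinite_UNIV_char_0)
    then have "expand F O' (coords p) = 0" using poly_roots_finite by blast
    then have "eval_form F O' = 0" using coeff_expand_0[of F O' "coords p"] by simp
    then show False using assms by simp
  qed
  then have "expand F (coords p) O' \<noteq> 0" by auto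
  then obtain k where k: "Polynomial.coeff (expand F (coords p) O') k \<noteq> 0" by (metis leading_coeff_0_iff)
  obtain c where c: "c \<noteq> 0" "coords (pt O') = c *s O'" using coords_pt[OF assms(3)] by blast
  then have "Polynomial.coeff (expansion F p (pt O')) k \<noteq> 0" using k by (simp add: expansion_eq coeff_expand_scale)
  then show "\<exists>k q. Polynomial.coeff (expansion F p q) k \<noteq> 0" by blast
qed

text \<open>The coefficients of degree 0 and 1 of the expansion are the value of \<open>F\<close>
  and the pairing of the gradient with the direction.\<close>

lemma singular_iff:
  assumes F: "homogeneous d F" "eval_form F O' \<noteq> 0" "O' \<noteq> 0" and p: "p \<in> zeros F"
  shows "p \<in> singular_points F \<longleftrightarrow> grad F (coords p) = 0"
    "p \<notin> singular_points F \<Longrightarrow> mult_at F p = 1"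
proof -
  have e0: "Polynomial.coeff (expansion F p q) 0 = 0" for q using p by (simp add: expansion_eq coeff_expand_0 zeros_def)
  have ex: "\<exists>q. Polynomial.coeff (expansion F p q) (mult_at F p) \<noteq> 0" by (rule mult_at_exists[OF F])
  then have m0: "mult_at F p \<noteq> 0" using e0 by metis
  show 1: "p \<in> singular_points F \<longleftrightarrow> grad F (coords p) = 0"
  proof
    assume "p \<in> singular_points F"
    then have "1 < mult_at F p" by (simp add: singular_points_def)
    then have *: "Polynomial.coeff (expansion F p q) 1 = 0" for q by (rule mult_at_coeff_eq_0)
    have "dot (grad F (coords p)) w = 0" for w
    proof (cases "w = 0")
      case False
      obtain c where c: "c \<noteq> 0" "coords (pt w) = c *s w" using coords_pt[OF False] by blast
      then show ?thesis using *[of "pt w"] by (simp add: expansion_eq coeff_expand_1 dot_scale_right)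
    qed simp
    then show "grad F (coords p) = 0" by (intro dot_eqI) simp
  next
    assume "grad F (coords p) = 0"
    then have "Polynomial.coeff (expansion F p q) 1 = 0" for q by (simp add: expansion_eq coeff_expand_1)
    then have "mult_at F p \<noteq> 1" using ex by metis
    then show "p \<in> singular_points F" using m0 p by (simp add: singular_points_def)
  qed
  show "mult_at F p = 1" if "p \<notin> singular_points F" using that m0 p by (simp add: singular_points_def)
qed

lemma line_iff: "p \<in> line l \<longleftrightarrow> dot (coords l) (coords p) = 0"
  by (simp add: line_def dot_sum)

lemma crs_coords_nonzero: "p \<noteq> q \<Longrightarrow> crs (coords p) (coords q) \<noteq> 0"
proof
  assume "p \<noteq> q" "crs (coords p) (coords q) = 0"
  then obtain c where c: "coords q = c *s coords p" using crs_eq_0D by fastforce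
  then have "c \<noteq> 0" using coords_nonzero[of q] by auto
  then have "pt (coords q) = pt (coords p)" unfolding c by (intro pt_scale) auto
  then show False using \<open>p \<noteq> q\<close> by simp
qed

lemma line_unique:
  assumes "p \<noteq> q" "p \<in> line l" "q \<in> line l" "v \<noteq> 0" "dot v (coords p) = 0" "dot v (coords q) = 0"
  shows "l = pt v"
proof -
  note n = crs_coords_nonzero[OF assms(1)]
  obtain c where c: "c \<noteq> 0" "crs (coords p) (coords q) = c *s coords l"
    using orthogonal_two[OF n, of "coords l"] assms by (auto simp: line_iff dot_commute)
  obtain k where k: "k \<noteq> 0" "crs (coords p) (coords q) = k *s v"
    using orthogonal_two[OF n, of v] assms by (auto simp: dot_commute)
  have "pt (c *s coords l) = pt (k *s v)" using c k by metis
  then show ?thesis using c k assms(4) by (simp add: pt_scale)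
qed

lemma second_point: "\<exists>q\<in>line l. q \<noteq> p"
proof -
  let ?u = "coords l"
  have "\<exists>b b'. dot ?u b = 0 \<and> dot ?u b' = 0 \<and> crs b b' \<noteq> 0"
  proof -
    consider "?u $ 1 \<noteq> 0" | "?u $ 2 \<noteq> 0" | "?u $ 3 \<noteq> 0" using coords_nonzero[of l] by (auto simp: vec3_eq_iff)
    then show ?thesis
    proof cases
      case 1
      then show ?thesis by (intro exI[of _ "vector [- ?u $ 2, ?u $ 1, 0]"] exI[of _ "vector [- ?u $ 3, 0, ?u $ 1]"])
        (auto simp: dot_def vec3_eq_iff)
    next
      case 2
      then show ?thesis by (intro exI[of _ "vector [?u $ 2, - ?u $ 1, 0]"] exI[of _ "vector [0, - ?u $ 3, ?u $ 2]"])
        (auto simp: dot_def vec3_eq_iff)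
    next
      case 3
      then show ?thesis by (intro exI[of _ "vector [?u $ 3, 0, - ?u $ 1]"] exI[of _ "vector [0, ?u $ 3, - ?u $ 2]"])
        (auto simp: dot_def vec3_eq_iff)
    qed
  qed
  then obtain b b' where b: "dot ?u b = 0" "dot ?u b' = 0" "crs b b' \<noteq> 0" by blast
  have nz: "b \<noteq> 0" "b' \<noteq> 0" using b(3) by (auto simp: vec3_eq_iff)
  have on: "pt v \<in> line l" if "dot ?u v = 0" "v \<noteq> 0" for v
    using coords_pt[OF that(2)] that(1) by (auto simp: line_iff dot_scale_right)
  have "pt b \<noteq> pt b'"
  proof
    assume "pt b = pt b'"
    then obtain c where "b' = c *s b" using pt_eqD nz by metis
    then show False using b(3) by (simp add: crs_scale)
  qed
  then show ?thesis using on[OF b(1) nz(1)] on[OF b(2) nz(2)] by metis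
qed

text \<open>At multiplicity 1 a line is tangent when the linear coefficient vanishes along it, and
  by Euler's identity the point itself lies on the line of the gradient.\<close>

lemma tangent_lines_smooth:
  assumes F: "homogeneous d F" "eval_form F O' \<noteq> 0" "O' \<noteq> 0" and p: "p \<in> zeros F" "p \<notin> singular_points F"
  shows "tangent_lines F p = {pt (grad F (coords p))}"
proof -
  have m: "mult_at F p = 1" and g: "grad F (coords p) \<noteq> 0"
    using singular_iff[OF F p(1)] p(2) by auto
  have ep: "dot (grad F (coords p)) (coords p) = 0"
    using euler_identity[OF F(1)] p(1) by (simp add: zeros_def)
  have gt: "line_intersection F p q > enat (mult_at F p) \<longleftrightarrow> dot (grad F (coords p)) (coords q) = 0" for q
  proof -
    have "(\<forall>k\<le>1. Polynomial.coeff (expansion F p q) k = 0) \<longleftrightarrow> Polynomial.coeff (expansion F p q) 0 = 0 \<and> Polynomial.coeff (expansion F p q) (Suc 0) = 0"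
      by (auto simp: le_Suc_eq)
    then show ?thesis unfolding m line_intersection_gt
      using p(1) by (simp add: expansion_eq coeff_expand_0 coeff_expand_1 zeros_def)
  qed
  obtain c where c: "c \<noteq> 0" "coords (pt (grad F (coords p))) = c *s grad F (coords p)" using coords_pt[OF g] by blast
  show ?thesis
  proof (intro equalityI subsetI)
    fix l assume "l \<in> tangent_lines F p"
    then obtain q where "p \<in> line l" "q \<in> line l" "q \<noteq> p" "dot (grad F (coords p)) (coords q) = 0"
      unfolding tangent_lines_def gt by blast
    then have "l = pt (grad F (coords p))" using line_unique[of p q l "grad F (coords p)"] ep g by auto
    then show "l \<in> {pt (grad F (coords p))}" by simp
  next
    fix l assume l: "l \<in> {pt (grad F (coords p))}"
    obtain q where q: "q \<in> line l" "q \<noteq> p" using second_point by blast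
    have "p \<in> line l" using l c ep by (simp add: line_iff dot_scale_left)
    moreover have "dot (grad F (coords p)) (coords q) = 0" using q(1) l c by (simp add: line_iff dot_scale_left)
    ultimately show "l \<in> tangent_lines F p" unfolding tangent_lines_def gt using q by blast
  qed
qed

text \<open>Kronecker substitution \<open>v = (s, s\<^sup>N, s\<^sup>N\<^sup>N)\<close> for large \<open>N\<close>.\<close>

lemma eval_form_nonzero:
  assumes "F \<noteq> 0" shows "\<exists>v. eval_form F v \<noteq> 0"
proof -
  \<comment> \<open>Larger than every exponent, so that \<open>code\<close> is an expansion in base
    \<open>N\<close> and no two monomials collide.\<close>
  define N where "N = Suc (\<Sum>m\<in>Poly_Mapping.keys F. \<Sum>i\<in>UNIV. Poly_Mapping.lookup m i)"
  define code where "code m = Poly_Mapping.lookup m 1 + N * (Poly_Mapping.lookup m 2 + N * Poly_Mapping.lookup m 3)" for m :: "3 \<Rightarrow>\<^sub>0 nat"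
  have lt: "Poly_Mapping.lookup m i < N" if "m \<in> Poly_Mapping.keys F" for m i
  proof -
    have "Poly_Mapping.lookup m i \<le> (\<Sum>i\<in>UNIV. Poly_Mapping.lookup m i)" by (rule member_le_sum) auto
    also have "\<dots> \<le> (\<Sum>m\<in>Poly_Mapping.keys F. \<Sum>i\<in>UNIV. Poly_Mapping.lookup m i)"
      by (rule member_le_sum[OF that]) auto
    finally show ?thesis by (simp add: N_def)
  qed
  have N: "N > 0" by (simp add: N_def)
  have inj: "m = m'" if "m \<in> Poly_Mapping.keys F" "m' \<in> Poly_Mapping.keys F" "code m = code m'" for m m'
  proof -
    have dm: "a = a' \<and> b = b'" if "a + N * b = a' + N * b'" "a < N" "a' < N" for a a' b b'
      using arg_cong[OF that(1), of "\<lambda>x. x mod N"] arg_cong[OF that(1), of "\<lambda>x. x div N"] that(2,3) N by simp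
    have 1: "Poly_Mapping.lookup m 1 = Poly_Mapping.lookup m' 1"
      "Poly_Mapping.lookup m 2 + N * Poly_Mapping.lookup m 3 = Poly_Mapping.lookup m' 2 + N * Poly_Mapping.lookup m' 3"
      using dm[OF that(3)[unfolded code_def] lt[OF that(1)] lt[OF that(2)]] by simp_all
    then have "Poly_Mapping.lookup m 2 = Poly_Mapping.lookup m' 2" "Poly_Mapping.lookup m 3 = Poly_Mapping.lookup m' 3"
      using dm[OF 1(2) lt[OF that(1)] lt[OF that(2)]] by simp_all
    then have "Poly_Mapping.lookup m i = Poly_Mapping.lookup m' i" for i using 1 exhaust_3[of i] by auto
    then show ?thesis by (rule poly_mapping_eqI)
  qed
  define p where "p = (\<Sum>m\<in>Poly_Mapping.keys F. Polynomial.monom (Poly_Mapping.lookup F m) (code m))"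
  obtain m0 where m0: "m0 \<in> Poly_Mapping.keys F" using assms by (metis ex_in_conv keys_eq_empty)
  have "Polynomial.coeff p (code m0) = (\<Sum>m\<in>Poly_Mapping.keys F. if m = m0 then Poly_Mapping.lookup F m else 0)"
    unfolding p_def coeff_sum by (rule sum.cong[OF refl]) (use inj m0 in auto)
  also have "\<dots> = Poly_Mapping.lookup F m0" using m0 by simp
  finally have "p \<noteq> 0" using m0 by (auto simp: in_keys_iff)
  then obtain s where s: "poly p s \<noteq> 0" by (metis poly_all_0_iff_0)
  have "poly p s = eval_form F (vector [s, s ^ N, s ^ (N * N)])"
    unfolding p_def eval_form_def poly_sum
    by (rule sum.cong[OF refl]) (simp add: poly_monom prod_3 code_def power_add power_mult algebra_simps flip: power_mult)
  then show ?thesis using s by auto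
qed

lemma degree_expand_le:
  assumes "homogeneous d F" shows "Polynomial.degree (expand F v w) \<le> d"
  unfolding expand_def
proof (rule degree_sum_le)
  fix m assume m: "m \<in> Poly_Mapping.keys F"
  have "Polynomial.degree (Polynomial.smult (Poly_Mapping.lookup F m) (\<Prod>i\<in>UNIV. [:v $ i, w $ i:] ^ Poly_Mapping.lookup m i))
    \<le> Polynomial.degree (\<Prod>i\<in>UNIV. [:v $ i, w $ i:] ^ Poly_Mapping.lookup m i)" by (rule degree_smult_le)
  also have "\<dots> \<le> (\<Sum>i\<in>UNIV. Polynomial.degree ([:v $ i, w $ i:] ^ Poly_Mapping.lookup m i))"
    using degree_prod_sum_le[of UNIV "\<lambda>i. [:v $ i, w $ i:] ^ Poly_Mapping.lookup m i"] by simp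
  also have "\<dots> \<le> (\<Sum>i\<in>UNIV. Poly_Mapping.lookup m i)"
  proof (rule sum_mono)
    fix i
    have "Polynomial.degree ([:v $ i, w $ i:] ^ Poly_Mapping.lookup m i) \<le> Polynomial.degree [:v $ i, w $ i:] * Poly_Mapping.lookup m i" by (rule degree_power_le)
    also have "\<dots> \<le> 1 * Poly_Mapping.lookup m i" by (intro mult_right_mono) auto
    finally show "Polynomial.degree ([:v $ i, w $ i:] ^ Poly_Mapping.lookup m i) \<le> Poly_Mapping.lookup m i" by simp
  qed
  also have "\<dots> = d" using assms m by (simp add: homogeneous_def)
  finally show "Polynomial.degree (Polynomial.smult (Poly_Mapping.lookup F m) (\<Prod>i\<in>UNIV. [:v $ i, w $ i:] ^ Poly_Mapping.lookup m i)) \<le> d" .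
qed simp

text \<open>Taking out \<open>t ^ d\<close> turns \<open>v + t w\<close> into
  \<open>w + v / t\<close>, so the coefficients are those of \<open>expand F w v\<close> in reverse
  order.\<close>

lemma coeff_expand_top:
  assumes "homogeneous d F" shows "Polynomial.coeff (expand F v w) d = eval_form F w"
proof -
  define q where "q = expand F w v"
  define r where "r = (\<Sum>k\<le>d. Polynomial.monom (Polynomial.coeff q k) (d - k))"
  have eq: "poly (expand F v w) t = poly r t" if "t \<noteq> 0" for t
  proof -
    have eq: "v + t *s w = t *s (w + inverse t *s v)" using that by (simp add: vec_eq_iff algebra_simps)
    have "poly (expand F v w) t = t ^ d * poly q (inverse t)"
      by (simp only: poly_expand eq eval_form_scale[OF assms] q_def)
    also have "poly q (inverse t) = (\<Sum>k\<le>d. Polynomial.coeff q k * inverse t ^ k)"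
      unfolding poly_altdef
      by (rule sum.mono_neutral_left) (use degree_expand_le[OF assms, of w v] in \<open>auto simp: q_def coeff_eq_0\<close>)
    also have "t ^ d * \<dots> = (\<Sum>k\<le>d. Polynomial.coeff q k * t ^ (d - k))"
      unfolding sum_distrib_left
    proof (rule sum.cong[OF refl])
      fix k assume "k \<in> {..d}"
      then have "t ^ d = t ^ (d - k) * t ^ k" by (simp flip: power_add)
      then show "t ^ d * (Polynomial.coeff q k * inverse t ^ k) = Polynomial.coeff q k * t ^ (d - k)"
        using that by (simp add: power_inverse field_simps)
    qed
    finally show ?thesis by (simp add: r_def poly_sum poly_monom)
  qed
  have "infinite {t. poly (expand F v w - r) t = 0}"
    using infinite_super[of "UNIV - {0}" "{t. poly (expand F v w - r) t = 0}"] eq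
    by (auto simp: infinite_UNIV_char_0)
  then have "expand F v w - r = 0" using poly_roots_finite by blast
  then have "expand F v w = r" by simp
  moreover have "Polynomial.coeff r d = (\<Sum>k\<le>d. if k = 0 then Polynomial.coeff q k else 0)"
    unfolding r_def coeff_sum by (rule sum.cong[OF refl]) auto
  ultimately show ?thesis by (simp add: q_def coeff_expand_0)
qed

text \<open>The three cross products form the basis dual to \<open>a\<close>, \<open>b\<close>,
  \<open>e\<close>, whose determinant is normalized to 1.\<close>

lemma cramer3:
  assumes "dot e (crs a b) = 1"
  shows "v = dot a v *s crs b e + dot b v *s crs e a + dot e v *s crs a b"
proof -
  have "dot e (crs a b) *s v = dot a v *s crs b e + dot b v *s crs e a + dot e v *s crs a b"
    unfolding vec3_eq_iff dot_def by (simp add: algebra_simps)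
  then show ?thesis using assms by simp
qed

lemma dual_basis:
  assumes "dot e (crs a b) = 1"
  shows "dot a (crs b e) = 1" "dot b (crs b e) = 0" "dot e (crs b e) = 0"
    "dot a (crs e a) = 0" "dot b (crs e a) = 1" "dot e (crs e a) = 0"
  using assms by (simp_all add: dot_def algebra_simps)

context curve begin

lemma homog_fun_grad:
  assumes "homogeneous d F" shows "homog_fun (\<lambda>v. dot (grad F v) u)"
  unfolding homog_fun_def
proof (intro conjI allI impI)
  fix v and c :: complex assume "c \<noteq> 0"
  then show "dot (grad F (c *s v)) u = 0 \<longleftrightarrow> dot (grad F v) u = 0"
    by (simp add: grad_scale[OF assms] dot_scale_left)
next
  fix f W assume f: "holo3 f W"
  show "(\<lambda>t. dot (grad F (f t)) u) holomorphic_on W"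
    unfolding grad_def dot_sum_left dot_scale_left dot_def vector_3
    using f by (auto simp: holo3_def intro!: holomorphic_intros)
qed

lemma homog_fun_eval: "homogeneous d F \<Longrightarrow> homog_fun (eval_form F)"
  by (simp add: homog_fun_def eval_form_scale eval_form_holomorphic)

end

context nondeg_curve begin

lemma infinite_surface: "infinite (topspace X)"
proof -
  obtain x where x: "x \<in> topspace X" using nondeg[of "axis 1 1"] by (auto simp: axis_eq_0_iff)
  obtain U \<phi> W f where l: "lift U \<phi> W f" "x \<in> U" "\<phi> x \<in> W" using lift_at[OF x] by blast
  have "infinite W" using liftD(2)[OF l(1)] l(3) by (metis empty_iff finite_imp_not_open)
  moreover have "inj_on (inv_into U \<phi>) W" using liftD(3)[OF l(1)] by (meson inj_on_inv_into inj_on_subset subset_refl)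
  ultimately have "infinite (inv_into U \<phi> ` W)" by (simp add: finite_image_iff)
  moreover have "inv_into U \<phi> ` W \<subseteq> topspace X"
    using chart_inv(1)[OF liftD(1)[OF l(1)]] liftD(3)[OF l(1)] chart(5)[OF liftD(1)[OF l(1)]] by blast
  ultimately show ?thesis using finite_subset by blast
qed

lemma point_fiber_finite: "finite {x\<in>topspace X. \<nu> x = p}"
proof -
  obtain b where "b \<noteq> 0" "dot b (coords p) = 0" using exists_orthogonal by blast
  then show ?thesis by (intro finite_subset[OF _ line_finite[of b]]) auto
qed

lemma preimage_finite:
  assumes "finite S" shows "finite {x\<in>topspace X. \<nu> x \<in> S}"
proof -
  have "{x\<in>topspace X. \<nu> x \<in> S} = (\<Union>p\<in>S. {x\<in>topspace X. \<nu> x = p})" by auto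
  then show ?thesis using assms point_fiber_finite by simp
qed

lemma point_near:
  assumes l: "lift U \<phi> W f" "x \<in> U" "\<phi> x \<in> W" and z: "zero_order g (\<phi> x) n" and B: "finite B"
  obtains t where "t \<in> W" "g t \<noteq> 0" "inv_into U \<phi> t \<notin> B" "inv_into U \<phi> t \<in> topspace X"
proof -
  obtain r where r: "r > 0" "\<And>t. t \<in> ball (\<phi> x) r \<Longrightarrow> t \<noteq> \<phi> x \<Longrightarrow> g t \<noteq> 0" using zero_order_near[OF z] by blast
  have "open (W \<inter> ball (\<phi> x) r)" "\<phi> x \<in> W \<inter> ball (\<phi> x) r" using liftD(2)[OF l(1)] r l by auto
  then have inf: "infinite (W \<inter> ball (\<phi> x) r)" by (metis empty_iff finite_imp_not_open)
  have inj: "inj_on (inv_into U \<phi>) W" using liftD(3)[OF l(1)] by (meson inj_on_inv_into)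
  have "finite {t\<in>W. inv_into U \<phi> t \<in> B}"
    using finite_vimage_IntI[OF B inj] by (simp add: vimage_def Int_def conj_commute)
  then have "finite ({t\<in>W. inv_into U \<phi> t \<in> B} \<union> {\<phi> x})" by simp
  then obtain t where t: "t \<in> W \<inter> ball (\<phi> x) r" "t \<notin> {t\<in>W. inv_into U \<phi> t \<in> B} \<union> {\<phi> x}"
    using inf by (meson finite_subset subsetI)
  have tW: "t \<in> W" "inv_into U \<phi> t \<notin> B" using t by auto
  have "g t \<noteq> 0" by (rule r(2)) (use t in auto)
  moreover have "inv_into U \<phi> t \<in> topspace X"
    using chart_inv(1)[OF liftD(1)[OF l(1)]] liftD(3)[OF l(1)] chart(5)[OF liftD(1)[OF l(1)]] tW by blast
  ultimately show ?thesis using that tW by blast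
qed

end

text \<open>Collects what links the form \<open>F\<close> to the surface: the surface maps onto the
  zero set, injectively over the complement of the finite set \<open>S0\<close>. The locale is
  instantiated twice, for the curve and for its dual.\<close>

locale plane_curve = nondeg_curve +
  fixes F :: ternary and d :: nat and S0 :: "P2 set"
  assumes form: "homogeneous d F" and image: "\<nu> ` topspace X = zeros F" and fin_sing: "finite (singular_points F)"
    and nonzero: "\<exists>v. eval_form F v \<noteq> 0" and d_pos: "d > 0"
    and fin_S0: "finite S0" and inj_S0: "inj_on \<nu> {x\<in>topspace X. \<nu> x \<notin> S0}"
begin

lemma eval_zero: "eval_form F 0 = 0"
  using eval_form_scale[OF form, of 0 0] d_pos by (simp add: zero_power vector_smult_lzero)

lemma singular_grad: "p \<in> zeros F \<Longrightarrow> p \<in> singular_points F \<longleftrightarrow> grad F (coords p) = 0"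
  using singular_iff(1)[OF form] nonzero eval_zero by metis

lemma on_curve: "x \<in> topspace X \<Longrightarrow> \<nu> x \<in> zeros F"
  using image by blast

lemma lift_eval:
  assumes "lift U \<phi> W f" "t \<in> W" shows "eval_form F (f t) = 0"
proof -
  have "inv_into U \<phi> t \<in> topspace X"
    using chart_inv(1)[OF liftD(1)[OF assms(1)]] liftD(3)[OF assms(1)] chart(5)[OF liftD(1)[OF assms(1)]] assms(2) by blast
  then have "eval_form F (coords (\<nu> (inv_into U \<phi> t))) = 0" using on_curve by (auto simp: zeros_def)
  then show ?thesis using homog_fun_lift[OF homog_fun_eval[OF form] assms] by simp
qed

lemma lift_grad:
  assumes "lift U \<phi> W f" "t \<in> W"
  shows "dot (grad F (f t)) (f t) = 0" "dot (grad F (f t)) (vderiv f t) = 0"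
proof -
  show "dot (grad F (f t)) (f t) = 0" using euler_identity[OF form] lift_eval[OF assms] by simp
  have "deriv (\<lambda>t. eval_form F (f t)) t = deriv (\<lambda>t. 0) t"
    using lift_eval[OF assms(1)] liftD(2)[OF assms(1)] assms(2) by (intro deriv_cong_ev) (auto simp: eventually_nhds)
  then show "dot (grad F (f t)) (vderiv f t) = 0"
    using deriv_eval_form[OF liftD(4,2)[OF assms(1)] assms(2)] by simp
qed

text \<open>By the identity theorem one point off the polar suffices. It is found where the curve is
  smooth and a Wronskian is nonzero: there the gradient is parallel to the cross product of
  \<open>f\<close> and its derivative.\<close>

lemma polar_finite:
  assumes O': "eval_form F (crs a b) \<noteq> 0"
  shows "finite {x\<in>topspace X. dot (grad F (coords (\<nu> x))) (crs a b) = 0}"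
proof -
  have ab: "crs a b \<noteq> 0" using O' eval_zero by auto
  have ne: "dot a (coords (\<nu> x)) \<noteq> 0 \<or> dot b (coords (\<nu> x)) \<noteq> 0" if "x \<in> topspace X" for x
  proof (rule ccontr)
    assume "\<not> ?thesis"
    then obtain c where "c \<noteq> 0" "crs a b = c *s coords (\<nu> x)"
      using orthogonal_two[OF ab, of "coords (\<nu> x)"] by auto
    then show False using O' on_curve[OF that] eval_form_scale[OF form] by (simp add: zeros_def)
  qed
  obtain x where x: "x \<in> topspace X" using infinite_surface by (metis finite.emptyI ex_in_conv)
  obtain U \<phi> W f where l: "lift U \<phi> W f" "x \<in> U" "\<phi> x \<in> W" using lift_at[OF x] by blast
  obtain n where "zero_order (\<lambda>t. dot (crs a b) (crs (f t) (vderiv f t))) (\<phi> x) n"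
    using wronskian_order[OF l ab ne[OF x]] by blast
  then obtain t where t: "t \<in> W" "dot (crs a b) (crs (f t) (vderiv f t)) \<noteq> 0"
    "inv_into U \<phi> t \<notin> {x\<in>topspace X. \<nu> x \<in> singular_points F}" "inv_into U \<phi> t \<in> topspace X"
    using point_near[OF l _ preimage_finite[OF fin_sing]] by blast
  define y where "y = inv_into U \<phi> t"
  obtain c where c: "c \<noteq> 0" "coords (\<nu> y) = c *s f t" using lift_coords[OF l(1) t(1)] by (auto simp: y_def)
  have "grad F (coords (\<nu> y)) \<noteq> 0" using t(3,4) singular_grad on_curve by (auto simp: y_def)
  then have g: "grad F (f t) \<noteq> 0" using grad_scale[OF form c(1)] c(2) by auto
  have "crs (f t) (vderiv f t) \<noteq> 0" using t(2) by auto
  then obtain k where "k \<noteq> 0" "crs (f t) (vderiv f t) = k *s grad F (f t)"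
    using orthogonal_two[of "f t" "vderiv f t" "grad F (f t)"] lift_grad[OF l(1) t(1)] g by (auto simp: dot_commute)
  then have "dot (grad F (f t)) (crs a b) \<noteq> 0" using t(2) by (simp add: dot_scale_right dot_commute)
  then have "dot (grad F (coords (\<nu> y))) (crs a b) \<noteq> 0"
    using grad_scale[OF form c(1)] c by (simp add: dot_scale_left)
  then show ?thesis using homog_fun_zeros(1)[OF homog_fun_grad[OF form], of y] t(4) by (simp add: y_def)
qed

end

section \<open>Intersections with lines\<close>

text \<open>Shifting the parameter by \<open>s\<close> turns the derivative at \<open>s\<close> into
  the linear coefficient of another expansion.\<close>

lemma pderiv_expand: "poly (pderiv (expand F v w)) s = dot (grad F (v + s *s w)) w"
proof -
  have "poly (pcompose (expand F v w) [:s, 1:]) u = poly (expand F (v + s *s w) w) u" for u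
  proof -
    have 1: "v + (s + u) *s w = v + s *s w + u *s w" by (simp add: vec_eq_iff algebra_simps)
    have 2: "poly [:s, 1:] u = s + u" by simp
    show ?thesis by (simp only: poly_pcompose poly_expand 1 2)
  qed
  then have "pcompose (expand F v w) [:s, 1:] = expand F (v + s *s w) w"
    by (simp add: poly_eq_poly_eq_iff[symmetric] fun_eq_iff)
  then have "pderiv (expand F (v + s *s w) w) = pcompose (pderiv (expand F v w)) [:s, 1:] * pderiv [:s, 1:]"
    by (simp flip: pderiv_pcompose)
  then have "poly (pderiv (expand F (v + s *s w) w)) 0 = poly (pderiv (expand F v w)) s"
    by (simp add: poly_pcompose pderiv_pCons)
  moreover have "poly (pderiv (expand F (v + s *s w) w)) 0 = Polynomial.coeff (expand F (v + s *s w) w) (Suc 0)"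
    by (simp add: poly_0_coeff_0 coeff_pderiv)
  ultimately show ?thesis by (simp add: coeff_expand_1)
qed

lemma order_prod_linear:
  fixes \<alpha> \<beta> :: "'b \<Rightarrow> complex"
  assumes "finite S" "\<And>x. x \<in> S \<Longrightarrow> \<alpha> x \<noteq> 0 \<or> \<beta> x \<noteq> 0"
  shows "(\<Prod>x\<in>S. [:\<alpha> x, \<beta> x:] ^ e x) \<noteq> 0 \<and>
     Polynomial.order 0 (\<Prod>x\<in>S. [:\<alpha> x, \<beta> x:] ^ e x) = (\<Sum>x | x \<in> S \<and> \<alpha> x = 0. e x)"
  using assms
proof (induction S rule: finite_induct)
  case (insert x S)
  let ?P = "\<Prod>x\<in>S. [:\<alpha> x, \<beta> x:] ^ e x"
  have IH: "?P \<noteq> 0" "Polynomial.order 0 ?P = (\<Sum>x | x \<in> S \<and> \<alpha> x = 0. e x)" using insert by auto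
  have nz: "[:\<alpha> x, \<beta> x:] ^ e x \<noteq> 0" using insert.prems[of x] by auto
  have "Polynomial.order 0 ([:\<alpha> x, \<beta> x:] ^ e x) = (if \<alpha> x = 0 then e x else 0)"
  proof (cases "\<alpha> x = 0")
    case True
    then have b: "\<beta> x \<noteq> 0" using insert.prems[of x] by auto
    have "[:\<alpha> x, \<beta> x:] ^ e x = Polynomial.smult (\<beta> x ^ e x) ([:- 0, 1:] ^ e x)"
      using True by (simp flip: smult_power)
    then show ?thesis using True b order_power_n_n[of 0 "e x"] by (simp add: order_smult del: minus_zero)
  next
    case False
    then have "poly ([:\<alpha> x, \<beta> x:] ^ e x) 0 \<noteq> 0" by (simp add: poly_power)
    then show ?thesis using False by (simp add: order_0I)
  qed
  moreover have "Polynomial.order 0 ([:\<alpha> x, \<beta> x:] ^ e x * ?P) = Polynomial.order 0 ([:\<alpha> x, \<beta> x:] ^ e x) + Polynomial.order 0 ?P"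
    using nz IH(1) by (intro order_mult) auto
  moreover have "(\<Sum>y | y \<in> insert x S \<and> \<alpha> y = 0. e y) = (if \<alpha> x = 0 then e x else 0) + (\<Sum>x | x \<in> S \<and> \<alpha> x = 0. e x)"
  proof (cases "\<alpha> x = 0")
    case True
    then have "{y. y \<in> insert x S \<and> \<alpha> y = 0} = insert x {y \<in> S. \<alpha> y = 0}" by auto
    then show ?thesis using True insert.hyps by simp
  next
    case False
    then have "{y. y \<in> insert x S \<and> \<alpha> y = 0} = {y \<in> S. \<alpha> y = 0}" by auto
    then show ?thesis using False by simp
  qed
  ultimately show ?case using insert.hyps nz IH by simp
qed simp

lemma roots_of_unity_scaled:
  assumes "n > 0" "\<epsilon> > (0::real)"
  shows "{s::complex. s ^ n = of_real \<epsilon>} = (\<lambda>\<zeta>. \<zeta> * of_real (root n \<epsilon>)) ` {\<zeta>. \<zeta> ^ n = 1}"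
proof (intro equalityI subsetI)
  have rt: "complex_of_real (root n \<epsilon>) ^ n = of_real \<epsilon>" "root n \<epsilon> > 0"
    using assms by (simp_all flip: of_real_power)
  fix s :: complex assume s: "s \<in> {s. s ^ n = of_real \<epsilon>}"
  then have "(s / of_real (root n \<epsilon>)) ^ n = 1" using rt assms by (simp add: power_divide)
  moreover have "s = s / of_real (root n \<epsilon>) * of_real (root n \<epsilon>)" using rt by simp
  ultimately show "s \<in> (\<lambda>\<zeta>. \<zeta> * of_real (root n \<epsilon>)) ` {\<zeta>. \<zeta> ^ n = 1}" by blast
qed (use assms in \<open>auto simp: power_mult_distrib simp flip: of_real_power\<close>)

text \<open>The point \<open>u\<close> on the line \<open>a\<close> is cut out by a second line
  \<open>b\<close>, constructed as a cross product; \<open>e\<close> normalizes the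
  determinant.\<close>

lemma complete_basis:
  assumes "a \<noteq> 0" "dot a u = 0" "u \<noteq> 0"
  obtains b e where "crs a b = u" "dot e (crs a b) = 1"
proof -
  obtain w where "dot w a = 1" using vec3_nonzero_dot[OF assms(1)] by blast
  then have "crs a (crs u w) = u" using assms(2) by (simp add: crs_crs dot_commute)
  moreover obtain e where "dot e u = 1" using vec3_nonzero_dot[OF assms(3)] by blast
  ultimately show ?thesis using that[of "crs u w" e] by simp
qed

context plane_curve begin

lemma pencil_nonvanishing:
  assumes O': "eval_form F (crs a b) \<noteq> 0" and x: "x \<in> topspace X"
  shows "dot a (coords (\<nu> x)) \<noteq> 0 \<or> dot b (coords (\<nu> x)) \<noteq> 0"
proof (rule ccontr)
  assume *: "\<not> ?thesis"
  have ab: "crs a b \<noteq> 0" using O' eval_zero by auto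
  obtain c where "c \<noteq> 0" "crs a b = c *s coords (\<nu> x)" using orthogonal_two[OF ab, of "coords (\<nu> x)"] * by auto
  then show False using O' on_curve[OF x] eval_form_scale[OF form] by (simp add: zeros_def)
qed

context
  fixes a b e :: "complex^3"
  assumes det: "dot e (crs a b) = 1" and O': "eval_form F (crs a b) \<noteq> 0"
begin

text \<open>Coordinates for the projection from \<open>crs a b\<close>: \<open>z\<close> names the
  line of the pencil, \<open>\<sigma>\<close> is an affine coordinate on it with
  \<open>crs a b\<close> at infinity, and \<open>p \<zeta>\<close> is the restriction of
  \<open>F\<close> to the line in this coordinate.\<close>

private definition z where "z x = dot a (coords (\<nu> x)) / dot b (coords (\<nu> x))"
private definition \<sigma> where "\<sigma> x = dot e (coords (\<nu> x)) / dot b (coords (\<nu> x))"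
private definition fib where "fib \<zeta> = {x\<in>topspace X. dot b (coords (\<nu> x)) \<noteq> 0 \<and> z x = \<zeta>}"
private definition vec where "vec \<zeta> = \<zeta> *s crs b e + crs e a"
private definition p where "p \<zeta> = expand F (vec \<zeta>) (crs a b)"

lemma dot_vec:
  "dot a (vec \<zeta> + s *s crs a b) = \<zeta>" "dot b (vec \<zeta> + s *s crs a b) = 1" "dot e (vec \<zeta> + s *s crs a b) = s"
  using dual_basis[OF det] det by (simp_all add: vec_def dot_simps)

lemma vec_nonzero: "vec \<zeta> + s *s crs a b \<noteq> 0"
  using dot_vec(2)[of \<zeta> s] by auto

lemma coords_fib:
  assumes "x \<in> fib \<zeta>"
  shows "coords (\<nu> x) = dot b (coords (\<nu> x)) *s (vec \<zeta> + \<sigma> x *s crs a b)"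
proof -
  have x: "dot b (coords (\<nu> x)) \<noteq> 0" "z x = \<zeta>" using assms by (auto simp: fib_def)
  then have "dot a (coords (\<nu> x)) = dot b (coords (\<nu> x)) * \<zeta>" "dot e (coords (\<nu> x)) = dot b (coords (\<nu> x)) * \<sigma> x"
    by (auto simp: z_def \<sigma>_def)
  then show ?thesis
    by (subst cramer3[OF det, of "coords (\<nu> x)"]) (simp add: vec_def vec_eq_iff algebra_simps)
qed

lemma fib_pt: "x \<in> fib \<zeta> \<Longrightarrow> \<nu> x = pt (vec \<zeta> + \<sigma> x *s crs a b)"
proof -
  assume x: "x \<in> fib \<zeta>"
  have "pt (coords (\<nu> x)) = pt (vec \<zeta> + \<sigma> x *s crs a b)"
    by (subst coords_fib[OF x], rule pt_scale[OF vec_nonzero]) (use x in \<open>simp add: fib_def\<close>)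
  then show ?thesis by simp
qed

text \<open>A root gives a zero of \<open>F\<close> on the line, and every zero comes from a point
  of \<open>X\<close> because \<nu> maps onto the zero set.\<close>

lemma roots_p: "{s. poly (p \<zeta>) s = 0} = \<sigma> ` fib \<zeta>"
proof (intro equalityI subsetI)
  fix s assume "s \<in> {s. poly (p \<zeta>) s = 0}"
  then have "eval_form F (vec \<zeta> + s *s crs a b) = 0" by (simp add: p_def poly_expand)
  then have "pt (vec \<zeta> + s *s crs a b) \<in> zeros F" using eval_form_pt[OF form vec_nonzero] by simp
  then obtain x where x: "x \<in> topspace X" "\<nu> x = pt (vec \<zeta> + s *s crs a b)" using image by force
  obtain k where k: "k \<noteq> 0" "coords (\<nu> x) = k *s (vec \<zeta> + s *s crs a b)"
    unfolding x(2) using coords_pt[OF vec_nonzero] by blast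
  have "dot a (coords (\<nu> x)) = k * \<zeta>" "dot b (coords (\<nu> x)) = k" "dot e (coords (\<nu> x)) = k * s"
    unfolding k(2) dot_scale_right dot_vec by simp_all
  then have "x \<in> fib \<zeta>" "\<sigma> x = s" using x(1) k(1) by (simp_all add: fib_def z_def \<sigma>_def)
  then show "s \<in> \<sigma> ` fib \<zeta>" by blast
next
  fix s assume "s \<in> \<sigma> ` fib \<zeta>"
  then obtain x where x: "x \<in> fib \<zeta>" "s = \<sigma> x" by blast
  then have "pt (vec \<zeta> + s *s crs a b) \<in> zeros F" using fib_pt[OF x(1)] on_curve[of x] by (simp add: fib_def)
  then show "s \<in> {s. poly (p \<zeta>) s = 0}" using eval_form_pt[OF form vec_nonzero] by (simp add: p_def poly_expand)
qed

lemma p_degree: "Polynomial.degree (p \<zeta>) = d" "Polynomial.lead_coeff (p \<zeta>) = eval_form F (crs a b)" "p \<zeta> \<noteq> 0"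
proof -
  have c: "Polynomial.coeff (p \<zeta>) d = eval_form F (crs a b)" by (simp add: p_def coeff_expand_top[OF form])
  then have "d \<le> Polynomial.degree (p \<zeta>)" using O' by (intro le_degree) simp
  then show "Polynomial.degree (p \<zeta>) = d" using degree_expand_le[OF form] by (simp add: p_def le_antisym)
  with c show "Polynomial.lead_coeff (p \<zeta>) = eval_form F (crs a b)" by simp
  show "p \<zeta> \<noteq> 0" using c O' by auto
qed

text \<open>Points that give a multiple root on their line of the pencil, and points where \<nu> may
  fail to be injective.\<close>

private definition bad where
  "bad = {x\<in>topspace X. dot (grad F (coords (\<nu> x))) (crs a b) = 0} \<union> {x\<in>topspace X. \<nu> x \<in> S0}"

lemma finite_bad: "finite bad"
  unfolding bad_def using polar_finite[OF O'] preimage_finite[OF fin_S0] by simp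

text \<open>A multiple root would be a zero of the derivative, hence a point of the polar. So all
  roots are simple, there are \<open>d\<close> of them, and they correspond one to one to the points
  of the fiber.\<close>

lemma generic_fiber:
  assumes \<zeta>: "\<zeta> \<notin> z ` bad"
  shows "card (fib \<zeta>) = d" "poly (p \<zeta>) s = eval_form F (crs a b) * (\<Prod>x\<in>fib \<zeta>. s - \<sigma> x)"
proof -
  have nb: "x \<notin> bad" if "x \<in> fib \<zeta>" for x using that \<zeta> by (auto simp: fib_def)
  have inj: "inj_on \<sigma> (fib \<zeta>)"
  proof (rule inj_onI)
    fix x y assume xy: "x \<in> fib \<zeta>" "y \<in> fib \<zeta>" "\<sigma> x = \<sigma> y"
    then have "\<nu> x = \<nu> y" using fib_pt by simp
    moreover have "x \<in> {x\<in>topspace X. \<nu> x \<notin> S0}" "y \<in> {x\<in>topspace X. \<nu> x \<notin> S0}"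
      using nb xy by (auto simp: bad_def fib_def)
    ultimately show "x = y" using inj_S0 by (meson inj_onD)
  qed
  have "rsquarefree (p \<zeta>)"
    unfolding rsquarefree_roots
  proof (intro allI notI, elim conjE)
    fix s assume s: "poly (p \<zeta>) s = 0" "poly (pderiv (p \<zeta>)) s = 0"
    then obtain x where x: "x \<in> fib \<zeta>" "s = \<sigma> x" using roots_p[of \<zeta>] by blast
    have "dot (grad F (vec \<zeta> + \<sigma> x *s crs a b)) (crs a b) = 0"
      using s(2) x(2) by (simp add: p_def pderiv_expand)
    moreover have "grad F (coords (\<nu> x)) = (dot b (coords (\<nu> x)) ^ d / dot b (coords (\<nu> x))) *s grad F (vec \<zeta> + \<sigma> x *s crs a b)"
      by (subst coords_fib[OF x(1)], rule grad_scale[OF form]) (use x in \<open>simp add: fib_def\<close>)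
    ultimately have "dot (grad F (coords (\<nu> x))) (crs a b) = 0" by (simp only: dot_scale_left mult_zero_right)
    then show False using nb[OF x(1)] x(1) by (auto simp: bad_def fib_def)
  qed
  then have dec: "p \<zeta> = Polynomial.smult (eval_form F (crs a b)) (\<Prod>u\<in>{s. poly (p \<zeta>) s = 0}. [:-u, 1:])"
    using complex_poly_decompose_rsquarefree[of "p \<zeta>"] p_degree(2) by simp
  have fin: "finite {s. poly (p \<zeta>) s = 0}" using poly_roots_finite[OF p_degree(3)] .
  have "d = Polynomial.degree (\<Prod>u\<in>{s. poly (p \<zeta>) s = 0}. [:-u, 1:])"
    using p_degree(1)[of \<zeta>] O' by (subst (asm) dec) simp
  also have "\<dots> = (\<Sum>u\<in>{s. poly (p \<zeta>) s = 0}. Polynomial.degree [:-u, 1:])" by (rule degree_prod_eq_sum_degree) auto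
  also have "\<dots> = card {s. poly (p \<zeta>) s = 0}" by simp
  also have "\<dots> = card (fib \<zeta>)" unfolding roots_p using inj by (rule card_image)
  finally show "card (fib \<zeta>) = d" by simp
  have "poly (p \<zeta>) s = eval_form F (crs a b) * (\<Prod>u\<in>\<sigma> ` fib \<zeta>. s - u)"
    by (subst dec) (simp add: poly_prod roots_p)
  also have "(\<Prod>u\<in>\<sigma> ` fib \<zeta>. s - u) = (\<Prod>x\<in>fib \<zeta>. s - \<sigma> x)" using inj by (simp add: prod.reindex)
  finally show "poly (p \<zeta>) s = eval_form F (crs a b) * (\<Prod>x\<in>fib \<zeta>. s - \<sigma> x)" .
qed

lemma ord_ray_fib:
  assumes x: "x \<in> topspace X" "dot a (coords (\<nu> x)) = 0"
  shows "ord (ray a b x) x = ord a x"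
proof -
  have a0: "a \<noteq> 0" using det by (auto simp: dot_def)
  have "dot b (coords (\<nu> x)) \<noteq> 0" using pencil_nonvanishing[OF O' x(1)] x(2) by simp
  moreover have "ray a b x = (- dot b (coords (\<nu> x))) *s a" using x(2) by (simp add: ray_def vec_eq_iff)
  ultimately show ?thesis using ord_scale[of "- dot b (coords (\<nu> x))" a x] a0 x(1) by auto
qed

text \<open>The factorization on a special line is the limit of those on the generic lines
  \<open>r * \<epsilon>\<close> as \<epsilon> decreases to 0. In the local model each point
  \<open>x\<close> over the special line is approached by \<open>ord a x\<close> points, so its
  factor acquires this exponent.\<close>

lemma special_fiber:
  "line_degree a = d"
  "poly (p 0) s0 = eval_form F (crs a b) * (\<Prod>x\<in>fib 0. (s0 - \<sigma> x) ^ ord a x)"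
proof -
  define X0 where "X0 = {x\<in>topspace X. dot b (coords (\<nu> x)) \<noteq> 0}"
  have ab: "crs a b \<noteq> 0" using O' eval_zero by auto
  have "\<exists>r \<psi>. local_model X X0 z (\<lambda>x. ord (ray a b x) x) 0 r \<psi>"
    unfolding X0_def z_def by (rule local_model_pencil[OF ab]) (use pencil_nonvanishing[OF O'] in blast)
  then obtain r \<psi> where m: "local_model X X0 z (\<lambda>x. ord (ray a b x) x) 0 r \<psi>" by blast
  have fibS: "fib \<zeta> = {x\<in>X0. z x = \<zeta>}" for \<zeta> by (auto simp: fib_def X0_def)
  have S0: "x \<in> fib 0 \<longleftrightarrow> x \<in> topspace X \<and> dot a (coords (\<nu> x)) = 0" for x
    using pencil_nonvanishing[OF O', of x] by (auto simp: fib_def z_def)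
  have r: "r > 0" and finS: "finite (fib 0)" using m by (auto simp: local_model_def fibS)
  have e: "ord (ray a b x) x = ord a x" "ord a x > 0" if x: "x \<in> fib 0" for x
  proof -
    show 1: "ord (ray a b x) x = ord a x" using ord_ray_fib S0 x by blast
    have "ord (ray a b x) x > 0" using m x unfolding local_model_def fibS by blast
    then show "ord a x > 0" using 1 by simp
  qed
  have psi: "homeomorphic_map (top_of_set (ball 0 1)) (subtopology X (\<psi> x ` ball 0 1)) (\<psi> x)" "\<psi> x 0 = x"
    if x: "x \<in> fib 0" for x
    using m x unfolding local_model_def fibS by simp_all
  have subX0: "\<psi> x ` ball 0 1 \<subseteq> X0" if x: "x \<in> fib 0" for x
  proof -
    have "{y \<in> X0. z y \<in> ball 0 r} = (\<Union>x\<in>fib 0. \<psi> x ` ball 0 1)" using m unfolding local_model_def fibS by blast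
    then show ?thesis using x by blast
  qed
  have cont: "isCont (\<lambda>s. \<sigma> (\<psi> x s)) 0" if x: "x \<in> fib 0" for x
  proof -
    have "continuous_map (top_of_set (ball 0 1)) X (\<psi> x)"
      using homeomorphic_imp_continuous_map[OF psi(1)[OF x]] continuous_map_in_subtopology by blast
    then have "continuous_map (top_of_set (ball 0 1)) (subtopology X X0) (\<psi> x)"
      using subX0[OF x] by (intro continuous_map_into_subtopology) auto
    moreover have "continuous_map (subtopology X X0) euclidean \<sigma>"
      unfolding X0_def \<sigma>_def by (rule quotient_continuous(2))
    ultimately have "continuous_map (top_of_set (ball 0 1)) euclidean (\<sigma> \<circ> \<psi> x)"
      using continuous_map_compose by blast
    then have "continuous_on (ball 0 1) (\<lambda>s. \<sigma> (\<psi> x s))" by (simp add: comp_def)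
    then show ?thesis by (simp add: continuous_on_eq_continuous_at)
  qed
  define R where "R n = {\<zeta>::complex. \<zeta> ^ n = 1}" for n
  have R: "finite (R (ord a x))" "card (R (ord a x)) = ord a x" if x: "x \<in> fib 0" for x
    using e(2)[OF x] card_roots_unity_eq[of "ord a x"] finite_roots_unity[of "ord a x"] by (auto simp: R_def)
  \<comment> \<open>The points of the nearby fiber are indexed by a point over the special line and
    a root of unity, so that the index set no longer depends on \<epsilon> and limits can be taken
    factor by factor.\<close>
  have prod_eps: "(\<Prod>y\<in>fib (of_real (r * \<epsilon>)). s0 - \<sigma> y) =
     (\<Prod>x\<in>fib 0. \<Prod>\<zeta>\<in>R (ord a x). s0 - \<sigma> (\<psi> x (\<zeta> * of_real (root (ord a x) \<epsilon>))))"
    if eps: "0 < \<epsilon>" "\<epsilon> < 1" for \<epsilon> :: real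
  proof -
    define T where "T x = {s\<in>ball 0 1. 0 + of_real r * s ^ ord (ray a b x) x \<in> {complex_of_real (r * \<epsilon>)}}" for x
    have Teq: "T x = (\<lambda>\<zeta>. \<zeta> * of_real (root (ord a x) \<epsilon>)) ` R (ord a x)" if x: "x \<in> fib 0" for x
    proof -
      have "T x = {s. s ^ ord a x = of_real \<epsilon>}"
      proof (intro equalityI subsetI)
        fix s :: complex assume s: "s \<in> {s. s ^ ord a x = of_real \<epsilon>}"
        then have "norm s ^ ord a x < 1" using eps by (auto simp: norm_power[symmetric])
        then have "norm s < 1" by (metis norm_ge_zero not_less one_le_power)
        then show "s \<in> T x" using s e(1)[OF x] by (simp add: T_def)
      qed (use r e(1)[OF x] in \<open>auto simp: T_def\<close>)
      then show ?thesis using roots_of_unity_scaled[OF e(2)[OF x] eps(1)] by (simp add: R_def)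
    qed
    have "{complex_of_real (r * \<epsilon>)} \<subseteq> ball 0 r" using r eps by (simp add: norm_mult)
    from local_model_preimage[OF m this] have fibe: "fib (of_real (r * \<epsilon>)) = (\<Union>x\<in>fib 0. \<psi> x ` T x)"
      unfolding fibS T_def by simp
    have Tball: "T x \<subseteq> ball 0 1" for x by (auto simp: T_def)
    have finT: "finite (T x)" if x: "x \<in> fib 0" for x using Teq[OF x] R(1)[OF x] by simp
    have dis: "disjoint_family_on (\<lambda>x. \<psi> x ` ball 0 1) (fib 0)" using m unfolding local_model_def fibS by blast
    have "(\<Prod>y\<in>fib (of_real (r * \<epsilon>)). s0 - \<sigma> y) = (\<Prod>x\<in>fib 0. \<Prod>y\<in>\<psi> x ` T x. s0 - \<sigma> y)"
      unfolding fibe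
    proof (rule prod.UNION_disjoint)
      show "\<forall>i\<in>fib 0. \<forall>j\<in>fib 0. i \<noteq> j \<longrightarrow> \<psi> i ` T i \<inter> \<psi> j ` T j = {}"
      proof (intro ballI impI)
        fix i j assume ij: "i \<in> fib 0" "j \<in> fib 0" "i \<noteq> j"
        then have "\<psi> i ` ball 0 1 \<inter> \<psi> j ` ball 0 1 = {}" using dis by (simp add: disjoint_family_on_def)
        then show "\<psi> i ` T i \<inter> \<psi> j ` T j = {}" using image_mono[OF Tball[of i], of "\<psi> i"] image_mono[OF Tball[of j], of "\<psi> j"] by blast
      qed
    qed (use finS finT in auto)
    also have "\<dots> = (\<Prod>x\<in>fib 0. \<Prod>\<zeta>\<in>R (ord a x). s0 - \<sigma> (\<psi> x (\<zeta> * of_real (root (ord a x) \<epsilon>))))"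
    proof (rule prod.cong[OF refl])
      fix x assume x: "x \<in> fib 0"
      have "inj_on (\<psi> x) (ball 0 1)" using homeomorphic_imp_injective_map[OF psi(1)[OF x]] by simp
      then have "inj_on (\<psi> x) (T x)" using Tball inj_on_subset by blast
      then have "(\<Prod>y\<in>\<psi> x ` T x. s0 - \<sigma> y) = (\<Prod>s\<in>T x. s0 - \<sigma> (\<psi> x s))" by (simp add: prod.reindex)
      moreover have "inj_on (\<lambda>\<zeta>. \<zeta> * complex_of_real (root (ord a x) \<epsilon>)) (R (ord a x))"
        using eps e(2)[OF x] by (intro inj_onI) (auto simp: mult_right_cancel)
      ultimately show "(\<Prod>y\<in>\<psi> x ` T x. s0 - \<sigma> y) = (\<Prod>\<zeta>\<in>R (ord a x). s0 - \<sigma> (\<psi> x (\<zeta> * of_real (root (ord a x) \<epsilon>))))"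
        unfolding Teq[OF x] by (simp add: prod.reindex)
    qed
    finally show ?thesis .
  qed
  have "((\<lambda>\<epsilon>. \<Prod>x\<in>fib 0. \<Prod>\<zeta>\<in>R (ord a x). s0 - \<sigma> (\<psi> x (\<zeta> * of_real (root (ord a x) \<epsilon>))))
     \<longlongrightarrow> (\<Prod>x\<in>fib 0. \<Prod>\<zeta>\<in>R (ord a x). s0 - \<sigma> x)) (at_right 0)"
  proof (intro tendsto_prod tendsto_diff tendsto_const)
    fix x \<zeta> assume x: "x \<in> fib 0"
    have "((\<lambda>\<epsilon>. root (ord a x) \<epsilon>) \<longlongrightarrow> root (ord a x) 0) (at_right 0)"
      by (intro tendsto_intros)
    then have "((\<lambda>\<epsilon>. \<zeta> * complex_of_real (root (ord a x) \<epsilon>)) \<longlongrightarrow> \<zeta> * complex_of_real (root (ord a x) 0)) (at_right 0)"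
      by (intro tendsto_intros)
    then have "((\<lambda>\<epsilon>. \<zeta> * complex_of_real (root (ord a x) \<epsilon>)) \<longlongrightarrow> 0) (at_right 0)" by simp
    from isCont_tendsto_compose[OF cont[OF x] this]
    show "((\<lambda>\<epsilon>. \<sigma> (\<psi> x (\<zeta> * of_real (root (ord a x) \<epsilon>)))) \<longlongrightarrow> \<sigma> x) (at_right 0)"
      using psi(2)[OF x] by simp
  qed
  then have lim1: "((\<lambda>\<epsilon>. eval_form F (crs a b) * (\<Prod>x\<in>fib 0. \<Prod>\<zeta>\<in>R (ord a x). s0 - \<sigma> (\<psi> x (\<zeta> * of_real (root (ord a x) \<epsilon>)))))
     \<longlongrightarrow> eval_form F (crs a b) * (\<Prod>x\<in>fib 0. \<Prod>\<zeta>\<in>R (ord a x). s0 - \<sigma> x)) (at_right 0)"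
    by (rule tendsto_mult[OF tendsto_const])
  have "(\<lambda>\<zeta>. poly (p \<zeta>) s0) holomorphic_on UNIV"
    unfolding p_def poly_expand
    by (rule eval_form_holomorphic) (auto simp: holo3_def vec_def intro!: holomorphic_intros)
  then have "isCont (\<lambda>\<zeta>. poly (p \<zeta>) s0) 0"
    using holomorphic_on_imp_continuous_on continuous_on_eq_continuous_at open_UNIV by blast
  moreover have "((\<lambda>\<epsilon>. complex_of_real (r * \<epsilon>)) \<longlongrightarrow> 0) (at_right 0)"
    by (auto intro!: tendsto_eq_intros)
  ultimately have lim2: "((\<lambda>\<epsilon>. poly (p (complex_of_real (r * \<epsilon>))) s0) \<longlongrightarrow> poly (p 0) s0) (at_right 0)"
    by (rule isCont_tendsto_compose)
  \<comment> \<open>Only finitely many \<epsilon> belong to bad lines; 0 may be among them and is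
    removed before passing to a neighbourhood of it.\<close>
  have "finite ((\<lambda>\<epsilon>. complex_of_real (r * \<epsilon>)) -` (z ` bad))"
    using finite_bad r by (intro finite_vimageI) (auto simp: inj_def)
  then have fb: "finite ({\<epsilon>. complex_of_real (r * \<epsilon>) \<in> z ` bad} - {0})" by (simp add: vimage_def)
  have good: "\<forall>\<^sub>F \<epsilon> in at_right 0. 0 < \<epsilon> \<and> \<epsilon> < 1 \<and> complex_of_real (r * \<epsilon>) \<notin> z ` bad"
  proof -
    have "open (- ({\<epsilon>. complex_of_real (r * \<epsilon>) \<in> z ` bad} - {0}))" using finite_imp_closed[OF fb] by (rule open_Compl)
    then have "\<forall>\<^sub>F \<epsilon> in nhds 0. \<epsilon> \<in> - ({\<epsilon>. complex_of_real (r * \<epsilon>) \<in> z ` bad} - {0})"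
      by (rule eventually_nhds_in_open) simp
    then have "\<forall>\<^sub>F \<epsilon> in at_right 0. \<epsilon> \<in> - ({\<epsilon>. complex_of_real (r * \<epsilon>) \<in> z ` bad} - {0})"
      by (rule filter_leD[OF at_within_le_nhds])
    moreover have "\<forall>\<^sub>F \<epsilon> in at_right (0::real). \<epsilon> < 1" unfolding eventually_at_right_field by (intro exI[of _ 1]) auto
    moreover have "\<forall>\<^sub>F \<epsilon> in at_right (0::real). 0 < \<epsilon>" by (rule eventually_at_right_less)
    ultimately show ?thesis by eventually_elim auto
  qed
  have "\<forall>\<^sub>F \<epsilon> in at_right 0. poly (p (complex_of_real (r * \<epsilon>))) s0 =
     eval_form F (crs a b) * (\<Prod>x\<in>fib 0. \<Prod>\<zeta>\<in>R (ord a x). s0 - \<sigma> (\<psi> x (\<zeta> * of_real (root (ord a x) \<epsilon>))))"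
    using good
  proof eventually_elim
    case (elim \<epsilon>)
    then have e: "0 < \<epsilon>" "\<epsilon> < 1" "complex_of_real (r * \<epsilon>) \<notin> z ` bad" by simp_all
    show ?case unfolding generic_fiber(2)[OF e(3)] prod_eps[OF e(1,2)] by (rule refl)
  qed
  from tendsto_cong[THEN iffD1, OF this lim2] have lim3: "((\<lambda>\<epsilon>. eval_form F (crs a b) * (\<Prod>x\<in>fib 0. \<Prod>\<zeta>\<in>R (ord a x). s0 - \<sigma> (\<psi> x (\<zeta> * of_real (root (ord a x) \<epsilon>)))))
     \<longlongrightarrow> poly (p 0) s0) (at_right 0)" .
  have "poly (p 0) s0 = eval_form F (crs a b) * (\<Prod>x\<in>fib 0. \<Prod>\<zeta>\<in>R (ord a x). s0 - \<sigma> x)"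
    by (rule tendsto_unique[OF _ lim3 lim1]) simp
  also have "(\<Prod>x\<in>fib 0. \<Prod>\<zeta>\<in>R (ord a x). s0 - \<sigma> x) = (\<Prod>x\<in>fib 0. (s0 - \<sigma> x) ^ ord a x)"
    using R(2) by (intro prod.cong) auto
  finally show "poly (p 0) s0 = eval_form F (crs a b) * (\<Prod>x\<in>fib 0. (s0 - \<sigma> x) ^ ord a x)" .
  obtain \<epsilon> where \<epsilon>: "0 < \<epsilon>" "\<epsilon> < 1" "complex_of_real (r * \<epsilon>) \<notin> z ` bad"
    using eventually_happens'[OF _ good] by force
  then have "complex_of_real (r * \<epsilon>) \<in> ball 0 r" "complex_of_real (r * \<epsilon>) \<noteq> 0" using r by (auto simp: norm_mult)
  from local_model_card(2)[OF m this] have "card (fib (of_real (r * \<epsilon>))) = (\<Sum>x\<in>fib 0. ord (ray a b x) x)"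
    by (simp add: fibS)
  then have "d = (\<Sum>x\<in>fib 0. ord a x)" using generic_fiber(1)[OF \<epsilon>(3)] e(1) by simp
  moreover have "fib 0 = {x. x \<in> topspace X \<and> dot a (coords (\<nu> x)) = 0}" using S0 by auto
  ultimately show "line_degree a = d" by (simp add: line_degree_def)
qed

text \<open>Homogeneous form of \<open>special_fiber\<close>. The case \<open>\<beta> = 0\<close>
  concerns multiples of the center \<open>crs a b\<close>, which the affine coordinate on the line
  misses.\<close>

lemma line_factor:
  assumes v: "dot a v = 0"
  shows "eval_form F v = eval_form F (crs a b) *
    (\<Prod>x | x \<in> topspace X \<and> dot a (coords (\<nu> x)) = 0.
       (dot e v - dot e (coords (\<nu> x)) / dot b (coords (\<nu> x)) * dot b v) ^ ord a x)"
proof -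
  define \<beta> where "\<beta> = dot b v"
  define \<eta> where "\<eta> = dot e v"
  have v: "v = \<beta> *s crs e a + \<eta> *s crs a b" using cramer3[OF det, of v] v by (simp add: \<beta>_def \<eta>_def)
  have fib0: "fib 0 = {x. x \<in> topspace X \<and> dot a (coords (\<nu> x)) = 0}"
    using pencil_nonvanishing[OF O'] by (auto simp: fib_def z_def)
  have dsum: "d = (\<Sum>x\<in>fib 0. ord a x)" using special_fiber(1) by (simp add: line_degree_def fib0)
  have "eval_form F v = eval_form F (crs a b) * (\<Prod>x\<in>fib 0. (\<eta> - \<sigma> x * \<beta>) ^ ord a x)"
  proof (cases "\<beta> = 0")
    case True
    then have "eval_form F v = \<eta> ^ d * eval_form F (crs a b)" using v by (simp add: eval_form_scale[OF form])
    then show ?thesis using True by (simp add: dsum power_sum)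
  next
    case False
    have "\<beta> *s (vec 0 + (\<eta> / \<beta>) *s crs a b) = \<beta> *s crs e a + \<eta> *s crs a b"
      using False by (simp add: vec_def vec_eq_iff algebra_simps)
    then have "\<beta> *s (vec 0 + (\<eta> / \<beta>) *s crs a b) = v" using v by simp
    then have "eval_form F v = \<beta> ^ d * poly (p 0) (\<eta> / \<beta>)"
      using eval_form_scale[OF form, of \<beta> "vec 0 + (\<eta> / \<beta>) *s crs a b"] by (simp only: p_def poly_expand)
    also have "\<dots> = eval_form F (crs a b) * (\<beta> ^ d * (\<Prod>x\<in>fib 0. (\<eta> / \<beta> - \<sigma> x) ^ ord a x))"
      by (simp add: special_fiber(2))
    also have "\<beta> ^ d * (\<Prod>x\<in>fib 0. (\<eta> / \<beta> - \<sigma> x) ^ ord a x) = (\<Prod>x\<in>fib 0. \<beta> ^ ord a x * (\<eta> / \<beta> - \<sigma> x) ^ ord a x)"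
      by (simp add: dsum power_sum prod.distrib)
    also have "\<dots> = (\<Prod>x\<in>fib 0. (\<eta> - \<sigma> x * \<beta>) ^ ord a x)"
      using False by (intro prod.cong) (auto simp: power_mult_distrib[symmetric] algebra_simps)
    finally show ?thesis .
  qed
  then show ?thesis unfolding fib0 \<sigma>_def \<beta>_def \<eta>_def .
qed

end

lemma line_degree_eq:
  assumes "a \<noteq> 0" "dot a u = 0" "eval_form F u \<noteq> 0"
  shows "line_degree a = d"
proof -
  have "u \<noteq> 0" using assms(3) eval_zero by auto
  then obtain b e where "crs a b = u" "dot e (crs a b) = 1" using complete_basis[OF assms(1,2)] by blast
  then show ?thesis using special_fiber(1)[of e a b] assms(3) by simp
qed

text \<open>Along the line \<open>F\<close> is a product of linear factors indexed by the points of
  \<open>X\<close> over it. Only the factors of points over \<open>p\<close> vanish at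
  \<open>t = 0\<close>, and simply, because they do not vanish at \<open>q\<close>.\<close>

lemma line_intersection_eq:
  assumes pq: "p \<noteq> q" "p \<in> line l" "q \<in> line l" and u: "dot (coords l) u = 0" "eval_form F u \<noteq> 0"
  shows "line_intersection F p q = enat (\<Sum>x | x \<in> topspace X \<and> \<nu> x = p. ord (coords l) x)"
proof -
  define a where "a = coords l"
  have "u \<noteq> 0" using u(2) eval_zero by auto
  then obtain b e where be: "crs a b = u" "dot e (crs a b) = 1"
    using complete_basis[of a u] u(1) unfolding a_def by (metis coords_nonzero)
  have O': "eval_form F (crs a b) \<noteq> 0" using be u by simp
  note det = be(2)
  have ap: "dot a (coords p) = 0" "dot a (coords q) = 0" using pq by (auto simp: line_iff a_def)
  define S where "S = {x. x \<in> topspace X \<and> dot a (coords (\<nu> x)) = 0}"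
  have finS: "finite S" unfolding S_def using line_finite[of a] by (simp add: a_def)
  define \<sigma> where "\<sigma> x = dot e (coords (\<nu> x)) / dot b (coords (\<nu> x))" for x
  have bS: "dot b (coords (\<nu> x)) \<noteq> 0" if "x \<in> S" for x
    using pencil_nonvanishing[OF O', of x] that by (auto simp: S_def)
  have eq: "dot e (coords p') - \<sigma> x * dot b (coords p') = 0 \<longleftrightarrow> \<nu> x = p'" if x: "x \<in> S" and p': "dot a (coords p') = 0" for x p'
  proof
    assume "dot e (coords p') - \<sigma> x * dot b (coords p') = 0"
    then have 1: "dot b (coords (\<nu> x)) * dot e (coords p') = dot e (coords (\<nu> x)) * dot b (coords p')"
      using bS[OF x] by (simp add: \<sigma>_def field_simps)
    have ax: "dot a (coords (\<nu> x)) = 0" using x by (simp add: S_def)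
    have "crs (coords (\<nu> x)) (coords p') = 0"
    proof -
      have cx: "coords (\<nu> x) = dot b (coords (\<nu> x)) *s crs e a + dot e (coords (\<nu> x)) *s crs a b"
        using cramer3[OF det, of "coords (\<nu> x)"] ax by simp
      have cp: "coords p' = dot b (coords p') *s crs e a + dot e (coords p') *s crs a b"
        using cramer3[OF det, of "coords p'"] p' by simp
      have gen: "crs (m *s v + n *s w) (m' *s v + n' *s w) = (m * n' - n * m') *s crs v w" for m n m' n' v w
        by (simp add: vec3_eq_iff algebra_simps)
      show ?thesis by (subst cx, subst cp, subst gen) (use 1 in simp)
    qed
    then show "\<nu> x = p'" using crs_coords_nonzero by blast
  next
    assume "\<nu> x = p'"
    then show "dot e (coords p') - \<sigma> x * dot b (coords p') = 0" using bS[OF x] by (auto simp: \<sigma>_def)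
  qed
  define \<alpha> where "\<alpha> x = dot e (coords p) - \<sigma> x * dot b (coords p)" for x
  define \<beta> where "\<beta> x = dot e (coords q) - \<sigma> x * dot b (coords q)" for x
  have nz: "\<alpha> x \<noteq> 0 \<or> \<beta> x \<noteq> 0" if x: "x \<in> S" for x
    using eq[OF x ap(1)] eq[OF x ap(2)] pq(1) by (auto simp: \<alpha>_def \<beta>_def)
  have "poly (expansion F p q) t = poly (Polynomial.smult (eval_form F u) (\<Prod>x\<in>S. [:\<alpha> x, \<beta> x:] ^ ord a x)) t" for t
  proof -
    have "dot a (coords p + t *s coords q) = 0" using ap by (simp add: dot_simps)
    from line_factor[OF det O' this]
    have "eval_form F (coords p + t *s coords q) = eval_form F (crs a b) * (\<Prod>x\<in>S.
       (dot e (coords p + t *s coords q) - \<sigma> x * dot b (coords p + t *s coords q)) ^ ord a x)"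
      unfolding S_def \<sigma>_def .
    also have "(\<Prod>x\<in>S. (dot e (coords p + t *s coords q) - \<sigma> x * dot b (coords p + t *s coords q)) ^ ord a x)
      = (\<Prod>x\<in>S. (\<alpha> x + t * \<beta> x) ^ ord a x)"
      by (intro prod.cong refl arg_cong[where f = "\<lambda>y. y ^ _"]) (simp add: \<alpha>_def \<beta>_def dot_simps algebra_simps)
    finally show ?thesis
      by (simp add: expansion_eq poly_expand be(1) poly_prod poly_power)
  qed
  then have ex: "expansion F p q = Polynomial.smult (eval_form F u) (\<Prod>x\<in>S. [:\<alpha> x, \<beta> x:] ^ ord a x)"
    by (simp add: poly_eq_poly_eq_iff[symmetric] fun_eq_iff)
  note op = order_prod_linear[OF finS nz, where e = "ord a"]
  have "expansion F p q \<noteq> 0" unfolding ex using op u(2) by simp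
  moreover have "Polynomial.order 0 (expansion F p q) = (\<Sum>x | x \<in> S \<and> \<alpha> x = 0. ord a x)"
    unfolding ex using op u(2) by (simp add: order_smult)
  moreover have "{x. x \<in> S \<and> \<alpha> x = 0} = {x. x \<in> topspace X \<and> \<nu> x = p}"
    using eq[OF _ ap(1)] ap by (auto simp: S_def \<alpha>_def)
  ultimately show ?thesis by (simp add: line_intersection_def a_def)
qed

end

section \<open>The Gauss map\<close>

lemma punctured_zero:
  assumes "h holomorphic_on ball a r" "r > 0" "\<And>t. t \<in> ball a r \<Longrightarrow> t \<noteq> a \<Longrightarrow> h t = 0"
  shows "h a = (0::complex)"
proof (rule ccontr)
  assume h: "h a \<noteq> 0"
  have "zero_order h a 0" by (rule zero_order_0I[OF assms(1)]) (use assms(2) h in auto)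
  then obtain s where s: "s > 0" "\<And>t. t \<in> ball a s \<Longrightarrow> t \<noteq> a \<Longrightarrow> h t \<noteq> 0" using zero_order_near by blast
  define t where "t = a + of_real (min r s / 2)"
  have "norm (t - a) = min r s / 2" using assms(2) s(1) by (simp add: t_def)
  then have "t \<in> ball a r" "t \<in> ball a s" "t \<noteq> a" using assms(2) s(1) by (auto simp: dist_norm norm_minus_commute)
  then show False using s(2) assms(3) by blast
qed

lemma zero_order_power: "zero_order (\<lambda>t. (t - a) ^ k) a k"
  by (rule zero_orderI_nonzero[of "\<lambda>_. 1" UNIV]) auto

text \<open>Both lines \<open>l\<close> and \<open>g\<close> pass through \<open>c\<close>, so
  unless they coincide their intersection is a nonzero multiple of \<open>c\<close>, where
  \<open>b\<close> does not vanish.\<close>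

lemma crs_orthogonal: "dot l c = 0 \<Longrightarrow> dot g c = 0 \<Longrightarrow> dot b c \<noteq> 0 \<Longrightarrow> dot (crs l b) g = 0 \<Longrightarrow> crs l g = 0"
proof (rule ccontr)
  assume *: "dot l c = 0" "dot g c = 0" "dot b c \<noteq> 0" "dot (crs l b) g = 0" "crs l g \<noteq> 0"
  have "c \<noteq> 0" using *(3) by auto
  then obtain k where k: "k \<noteq> 0" "crs l g = k *s c" using orthogonal_two *(5,1,2) by blast
  have "dot (crs l b) g = - dot b (crs l g)" by (simp add: dot_def algebra_simps)
  also have "\<dots> = - k * dot b c" by (simp add: k dot_simps)
  finally show False using * k by simp
qed

lemma pt_eq_iff_crs:
  assumes "v \<noteq> 0" "w \<noteq> 0" shows "pt v = pt w \<longleftrightarrow> crs v w = 0"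
proof
  assume "pt v = pt w"
  then obtain c where "w = c *s v" using pt_eqD assms by blast
  then show "crs v w = 0" by (simp add: crs_scale)
next
  assume "crs v w = 0"
  then obtain c where "w = c *s v" using crs_eq_0D assms by blast
  then show "pt v = pt w" using pt_scale[of v c] assms by auto
qed

lemma line_commute: "p \<in> line l \<longleftrightarrow> l \<in> line p"
  by (simp add: line_iff dot_commute)

lemma infinite_line: "infinite (line l)"
proof -
  obtain b where b: "b \<noteq> 0" "dot b (coords l) = 0" using exists_orthogonal by blast
  obtain q where q: "q \<in> line l" "q \<noteq> pt b" using second_point by blast
  define h where "h t = coords q + t *s b" for t
  have qb: "crs (coords q) b \<noteq> 0"
    using pt_eq_iff_crs[of "coords q" b] q(2) b(1) by simp
  have nz: "h t \<noteq> 0" for t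
  proof
    assume "h t = 0"
    then have "crs (h t) b = 0" by (simp add: vec3_eq_iff)
    moreover have "crs (h t) b = crs (coords q) b" by (simp add: h_def vec3_eq_iff algebra_simps)
    ultimately show False using qb by simp
  qed
  have "inj (\<lambda>t. pt (h t))"
  proof (rule injI)
    fix s t assume "pt (h s) = pt (h t)"
    then have "crs (h s) (h t) = 0" using pt_eq_iff_crs nz by blast
    moreover have "crs (h s) (h t) = (t - s) *s crs (coords q) b" by (simp add: h_def vec3_eq_iff algebra_simps)
    ultimately show "s = t" using qb by simp
  qed
  moreover have "range (\<lambda>t. pt (h t)) \<subseteq> line l"
  proof
    fix p assume "p \<in> range (\<lambda>t. pt (h t))"
    then obtain t where p: "p = pt (h t)" by blast
    obtain c where c: "coords p = c *s h t" using coords_pt[OF nz[of t]] p by blast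
    have "dot (coords l) (coords q) = 0" "dot (coords l) b = 0" using q b by (simp_all add: line_iff dot_commute)
    then have "dot (coords l) (h t) = 0" by (simp add: h_def dot_simps)
    then show "p \<in> line l" by (simp add: line_iff c dot_scale_right)
  qed
  ultimately show ?thesis
    using infinite_UNIV_char_0[where ?'a = complex] finite_imageD finite_subset by blast
qed

context nondeg_curve begin

lemma gauss_curve: "curve X A gauss"
  by (rule curve.intro[OF riemann gauss_holomorphic])

interpretation dual: curve X A gauss by (rule gauss_curve)

text \<open>Off the point both equations hold because a cross product is orthogonal to its factors;
  at the point they follow by continuity.\<close>

lemma gauss_lift_orthogonal:
  assumes x: "x \<in> topspace X" and l: "lift U \<phi> W f" "x \<in> U" "\<phi> x \<in> W"
  obtains g r where "r > 0" "ball (\<phi> x) r \<subseteq> W" "dual.lift U \<phi> (ball (\<phi> x) r) g"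
    "\<And>t. t \<in> ball (\<phi> x) r \<Longrightarrow> crs (f t) (vderiv f t) = (t - \<phi> x) ^ kappa x *s g t"
    "\<And>t. t \<in> ball (\<phi> x) r \<Longrightarrow> dot (g t) (f t) = 0"
    "\<And>t. t \<in> ball (\<phi> x) r \<Longrightarrow> dot (g t) (vderiv f t) = 0"
proof -
  note lD = liftD[OF l(1)]
  obtain g r where g: "r > 0" "ball (\<phi> x) r \<subseteq> W" "holo3 g (ball (\<phi> x) r)"
    "\<And>t. t \<in> ball (\<phi> x) r \<Longrightarrow> g t \<noteq> 0"
    "\<And>t. t \<in> ball (\<phi> x) r \<Longrightarrow> crs (f t) (vderiv f t) = (t - \<phi> x) ^ kappa x *s g t"
    "\<And>t. t \<in> ball (\<phi> x) r \<Longrightarrow> gauss (inv_into U \<phi> t) = pt (g t)"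
    by (rule gauss_lift[OF lD(1) l(2) l(1) l(3)], rule that; assumption)
  have hf: "holo3 f (ball (\<phi> x) r)" using holo3_subset[OF lD(4) g(2)] .
  have hf': "holo3 (vderiv f) (ball (\<phi> x) r)" by (rule holo3_vderiv[OF hf]) simp
  have ne: "dot (g t) (f t) = 0 \<and> dot (g t) (vderiv f t) = 0" if t: "t \<in> ball (\<phi> x) r" "t \<noteq> \<phi> x" for t
  proof -
    have "(t - \<phi> x) ^ kappa x * dot (g t) v = dot (crs (f t) (vderiv f t)) v" for v
      by (simp add: g(5)[OF t(1)] dot_scale_left)
    from this[of "f t"] this[of "vderiv f t"] t(2) show ?thesis by simp
  qed
  have hol: "(\<lambda>t. dot (g t) (k t)) holomorphic_on ball (\<phi> x) r" if "holo3 k (ball (\<phi> x) r)" for k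
    using holo3_nth[OF that] holo3_nth[OF g(3)] unfolding dot_def by (intro holomorphic_intros) auto
  have 0: "dot (g (\<phi> x)) (f (\<phi> x)) = 0"
    by (rule punctured_zero[OF hol[OF hf] g(1)]) (use ne in blast)
  have 1: "dot (g (\<phi> x)) (vderiv f (\<phi> x)) = 0"
    by (rule punctured_zero[OF hol[OF hf'] g(1)]) (use ne in blast)
  show ?thesis
  proof (rule that[OF g(1,2) _ g(5)])
    show "dual.lift U \<phi> (ball (\<phi> x) r) g"
      unfolding dual.lift_def using lD(1,3) g by auto
    show "dot (g t) (f t) = 0" if "t \<in> ball (\<phi> x) r" for t
      using ne[OF that] 0 by (cases "t = \<phi> x") simp_all
    show "dot (g t) (vderiv f t) = 0" if "t \<in> ball (\<phi> x) r" for t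
      using ne[OF that] 1 by (cases "t = \<phi> x") simp_all
  qed
qed

lemma gauss_incident: "x \<in> topspace X \<Longrightarrow> dot (coords (gauss x)) (coords (\<nu> x)) = 0"
proof -
  assume x: "x \<in> topspace X"
  obtain U \<phi> W f where l: "lift U \<phi> W f" "x \<in> U" "\<phi> x \<in> W" using lift_at[OF x] by blast
  obtain g r where g: "r > 0" "dual.lift U \<phi> (ball (\<phi> x) r) g" "\<And>t. t \<in> ball (\<phi> x) r \<Longrightarrow> dot (g t) (f t) = 0"
    by (rule gauss_lift_orthogonal[OF x l], rule that; assumption)
  have c: "\<phi> x \<in> ball (\<phi> x) r" using g(1) by simp
  obtain k where k: "coords (\<nu> x) = k *s f (\<phi> x)" using lift_coords'[OF l] by blast
  obtain k' where k': "coords (gauss x) = k' *s g (\<phi> x)" using dual.lift_coords'[OF g(2) l(2) c] by blast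
  show ?thesis by (simp add: k k' dot_simps g(3)[OF c])
qed

text \<open>The order of the Wronskian splits into the zeros already taken out of the cross product,
  \<open>kappa x\<close> in number, and the order of the dual linear form.\<close>

lemma dual_order:
  assumes ab: "crs a b \<noteq> 0" and x: "x \<in> topspace X"
    and ne: "dot a (coords (\<nu> x)) \<noteq> 0 \<or> dot b (coords (\<nu> x)) \<noteq> 0"
    and l: "lift U \<phi> W f" "x \<in> U" "\<phi> x \<in> W"
    and g: "r > 0" "ball (\<phi> x) r \<subseteq> W" "dual.lift U \<phi> (ball (\<phi> x) r) g"
      "\<And>t. t \<in> ball (\<phi> x) r \<Longrightarrow> crs (f t) (vderiv f t) = (t - \<phi> x) ^ kappa x *s g t"
  obtains m where "zero_order (\<lambda>t. dot (crs a b) (g t)) (\<phi> x) m" "ord (ray a b x) x = Suc (kappa x + m)"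
proof -
  obtain n where n: "ord (ray a b x) x = Suc n" "zero_order (\<lambda>t. dot (crs a b) (crs (f t) (vderiv f t))) (\<phi> x) n"
    using wronskian_order[OF l ab ne] by blast
  have eq: "dot (crs a b) (crs (f t) (vderiv f t)) = (t - \<phi> x) ^ kappa x * dot (crs a b) (g t)" if "t \<in> ball (\<phi> x) r" for t
    using g(4)[OF that] by (simp add: dot_scale_right)
  have z: "zero_order (\<lambda>t. (t - \<phi> x) ^ kappa x * dot (crs a b) (g t)) (\<phi> x) n"
    by (rule zero_order_cong[OF n(2), of "ball (\<phi> x) r"]) (use g(1) eq in auto)
  have hg: "(\<lambda>t. dot (crs a b) (g t)) holomorphic_on ball (\<phi> x) r"
    by (rule holo3_dot[OF dual.liftD(4)[OF g(3)]])
  have "\<not> (\<exists>s>0. \<forall>t\<in>ball (\<phi> x) s. dot (crs a b) (g t) = 0)"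
  proof
    assume "\<exists>s>0. \<forall>t\<in>ball (\<phi> x) s. dot (crs a b) (g t) = 0"
    then obtain s where s: "s > 0" "\<And>t. t \<in> ball (\<phi> x) s \<Longrightarrow> dot (crs a b) (g t) = 0" by blast
    then have "(t - \<phi> x) ^ kappa x * dot (crs a b) (g t) = 0" if "t \<in> ball (\<phi> x) s" for t using that by simp
    then show False using zero_order_not_zero[OF z s(1)] by blast
  qed
  then obtain m where m: "zero_order (\<lambda>t. dot (crs a b) (g t)) (\<phi> x) m"
    using zero_order_exists[OF hg open_ball] g(1) centre_in_ball by blast
  have "kappa x + m = n"
    by (rule zero_order_unique[OF zero_order_mult[OF zero_order_power m] z])
  then show ?thesis using that[OF m] n(1) by simp
qed

text \<open>At any \<open>x\<close> not mapped to the point \<open>l\<close> the projection from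
  \<open>l\<close> has a Wronskian of finite order; by \<open>dual_order\<close> the form
  \<open>l\<close> on the Gauss map has finite order there, so it does not vanish
  identically.\<close>

lemma dual_nondeg: "nondeg_curve X A gauss"
proof (intro nondeg_curve.intro gauss_curve nondeg_curve_axioms.intro)
  fix l :: "complex^3" assume l0: "l \<noteq> 0"
  have "infinite (topspace X - {x\<in>topspace X. \<nu> x = pt l})"
    using infinite_surface point_fiber_finite[of "pt l"] by (rule Diff_infinite_finite[rotated])
  then have "topspace X - {x\<in>topspace X. \<nu> x = pt l} \<noteq> {}" by (metis finite.emptyI)
  then obtain x where x: "x \<in> topspace X" "\<nu> x \<noteq> pt l" by blast
  obtain a0 where a0: "a0 \<noteq> 0" "dot a0 l = 0" using exists_orthogonal by blast
  obtain b e where b: "crs a0 b = l" using complete_basis[OF a0(1,2) l0] by blast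
  have ne: "dot a0 (coords (\<nu> x)) \<noteq> 0 \<or> dot b (coords (\<nu> x)) \<noteq> 0"
  proof (rule ccontr)
    assume "\<not> ?thesis"
    then obtain c where "c \<noteq> 0" "l = c *s coords (\<nu> x)"
      using orthogonal_two[of a0 b "coords (\<nu> x)"] b l0 by auto
    then show False using x(2) pt_scale[of "coords (\<nu> x)" c] by simp
  qed
  obtain U \<phi> W f where lf: "lift U \<phi> W f" "x \<in> U" "\<phi> x \<in> W" using lift_at[OF x(1)] by blast
  obtain g r where g: "r > 0" "ball (\<phi> x) r \<subseteq> W" "dual.lift U \<phi> (ball (\<phi> x) r) g"
    "\<And>t. t \<in> ball (\<phi> x) r \<Longrightarrow> crs (f t) (vderiv f t) = (t - \<phi> x) ^ kappa x *s g t"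
    by (rule gauss_lift_orthogonal[OF x(1) lf], rule that; assumption)
  have ab: "crs a0 b \<noteq> 0" using b l0 by simp
  obtain m where m: "zero_order (\<lambda>t. dot (crs a0 b) (g t)) (\<phi> x) m"
    using dual_order[OF ab x(1) ne lf g] by blast
  obtain s where s: "s > 0" "\<And>t. t \<in> ball (\<phi> x) s \<Longrightarrow> t \<noteq> \<phi> x \<Longrightarrow> dot l (g t) \<noteq> 0"
    using zero_order_near[OF m] b by auto
  define t where "t = \<phi> x + of_real (min r s / 2)"
  have "norm (t - \<phi> x) = min r s / 2" using s(1) g(1) by (simp add: t_def)
  then have t: "t \<in> ball (\<phi> x) r" "t \<in> ball (\<phi> x) s" "t \<noteq> \<phi> x" using s(1) g(1) by (auto simp: dist_norm norm_minus_commute)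
  obtain c where c: "c \<noteq> 0" "coords (gauss (inv_into U \<phi> t)) = c *s g t" using dual.lift_coords[OF g(3) t(1)] by blast
  have "dot l (coords (gauss (inv_into U \<phi> t))) \<noteq> 0" using s(2)[OF t(2,3)] c by (simp add: dot_scale_right)
  moreover have "inv_into U \<phi> t \<in> topspace X"
    using chart_inv(1)[OF liftD(1)[OF lf(1)], of t] chart(5)[OF liftD(1)[OF lf(1)]] liftD(3)[OF lf(1)] t(1) g(2) by blast
  ultimately show "\<exists>x\<in>topspace X. dot l (coords (gauss x)) \<noteq> 0" by blast
qed

end

context nondeg_curve begin

interpretation dual: nondeg_curve X A gauss by (rule dual_nondeg)

text \<open>The local contribution to the ramification divisor: the index of the projection exceeds
  1 where \<open>kappa\<close> is positive and where the tangent line passes through the center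
  \<open>crs a b\<close>.\<close>

lemma ord_ray_dual:
  assumes ab: "crs a b \<noteq> 0" and x: "x \<in> topspace X"
    and ne: "dot a (coords (\<nu> x)) \<noteq> 0 \<or> dot b (coords (\<nu> x)) \<noteq> 0"
  shows "ord (ray a b x) x = Suc (kappa x + dual.ord (crs a b) x)"
proof -
  obtain U \<phi> W f where lf: "lift U \<phi> W f" "x \<in> U" "\<phi> x \<in> W" using lift_at[OF x] by blast
  obtain g r where g: "r > 0" "ball (\<phi> x) r \<subseteq> W" "dual.lift U \<phi> (ball (\<phi> x) r) g"
    "\<And>t. t \<in> ball (\<phi> x) r \<Longrightarrow> crs (f t) (vderiv f t) = (t - \<phi> x) ^ kappa x *s g t"
    by (rule gauss_lift_orthogonal[OF x lf], rule that; assumption)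
  obtain m where m: "zero_order (\<lambda>t. dot (crs a b) (g t)) (\<phi> x) m" "ord (ray a b x) x = Suc (kappa x + m)"
    using dual_order[OF ab x ne lf g] by blast
  have "\<phi> x \<in> ball (\<phi> x) r" using g(1) by simp
  from dual.ord_eq[OF g(3) lf(2) this m(1)] m(2) show ?thesis by simp
qed

text \<open>A line \<open>l\<close> through \<open>\<nu> x\<close> is the ray at \<open>x\<close> of
  a pencil whose center lies on \<open>l\<close>, away from \<open>\<nu> x\<close>. The order
  exceeds \<open>kappa x + 1\<close> exactly when the tangent line passes through this center too,
  that is, when it is \<open>l\<close>.\<close>

lemma ord_tangent:
  assumes l: "l \<noteq> 0" "dot l (coords (\<nu> x)) = 0" and x: "x \<in> topspace X"
  shows "ord l x \<ge> Suc (kappa x)" "ord l x = Suc (kappa x) \<longleftrightarrow> pt l \<noteq> gauss x"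
proof -
  define c where "c = coords (\<nu> x)"
  define g where "g = coords (gauss x)"
  obtain b where b: "dot b c \<noteq> 0" using vec3_nonzero_dot[of c] by (force simp: c_def)
  have lb: "crs l b \<noteq> 0"
  proof
    assume "crs l b = 0"
    then obtain k where "b = k *s l" using crs_eq_0D l(1) by blast
    then show False using b l(2) by (simp add: dot_scale_left c_def)
  qed
  have ray: "ray l b x = (- dot b c) *s l" using l(2) by (simp add: ray_def c_def vec_eq_iff)
  have "ord l x = ord (ray l b x) x" using ord_scale[of "- dot b c" l x] b l(1) x ray by simp
  also have "\<dots> = Suc (kappa x + dual.ord (crs l b) x)"
    by (rule ord_ray_dual[OF lb x]) (use b in \<open>simp add: c_def\<close>)
  finally have o: "ord l x = Suc (kappa x + dual.ord (crs l b) x)" .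
  have gc: "dot g c = 0" using gauss_incident[OF x] by (simp add: g_def c_def)
  have "dual.ord (crs l b) x > 0 \<longleftrightarrow> dot (crs l b) g = 0"
    using dual.ord_pos_iff[OF lb x] by (simp add: g_def)
  also have "\<dots> \<longleftrightarrow> crs l g = 0"
  proof
    assume "dot (crs l b) g = 0"
    then show "crs l g = 0" using crs_orthogonal[of l c g b] l(2) gc b by (simp add: c_def)
  next
    assume "crs l g = 0"
    then obtain k where "g = k *s l" using crs_eq_0D l(1) by blast
    then show "dot (crs l b) g = 0" by (simp add: dot_scale_right)
  qed
  also have "\<dots> \<longleftrightarrow> pt l = gauss x" using pt_eq_iff_crs[of l g] l(1) by (simp add: g_def)
  finally show "ord l x = Suc (kappa x) \<longleftrightarrow> pt l \<noteq> gauss x" using o by auto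
  show "ord l x \<ge> Suc (kappa x)" using o by simp
qed

text \<open>Differentiating \<open>dot (g t) (f t) = 0\<close> and using
  \<open>dot (g t) (vderiv f t) = 0\<close> leaves \<open>dot (vderiv g t) (f t) = 0\<close>. So
  \<open>f\<close> is orthogonal to \<open>g\<close> and its derivative, hence parallel to their
  cross product.\<close>

lemma biduality:
  assumes x: "x \<in> topspace X" shows "dual.gauss x = \<nu> x"
proof -
  obtain U \<phi> W f where lf: "lift U \<phi> W f" "x \<in> U" "\<phi> x \<in> W" using lift_at[OF x] by blast
  obtain g r where g: "r > 0" "ball (\<phi> x) r \<subseteq> W" "dual.lift U \<phi> (ball (\<phi> x) r) g"
    "\<And>t. t \<in> ball (\<phi> x) r \<Longrightarrow> dot (g t) (f t) = 0"
    "\<And>t. t \<in> ball (\<phi> x) r \<Longrightarrow> dot (g t) (vderiv f t) = 0"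
    by (rule gauss_lift_orthogonal[OF x lf], rule that; assumption)
  have c: "\<phi> x \<in> ball (\<phi> x) r" using g(1) by simp
  have hf: "holo3 f (ball (\<phi> x) r)" using holo3_subset[OF liftD(4)[OF lf(1)] g(2)] .
  have hg: "holo3 g (ball (\<phi> x) r)" by (rule dual.liftD(4)[OF g(3)])
  have gf': "dot (vderiv g t) (f t) = 0" if t: "t \<in> ball (\<phi> x) r" for t
  proof -
    have "deriv (\<lambda>t. dot (g t) (f t)) t = deriv (\<lambda>t. 0) t"
      using t g(4) by (intro deriv_cong_ev) (auto intro!: eventually_nhds_in_open[THEN eventually_mono, of "ball (\<phi> x) r"])
    then show ?thesis using deriv_dot_dot[OF hf hg _ t] g(5)[OF t] by simp
  qed
  obtain s k where s: "k > 0" "ball (\<phi> x) k \<subseteq> ball (\<phi> x) r" "holo3 s (ball (\<phi> x) k)"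
    "\<And>t. t \<in> ball (\<phi> x) k \<Longrightarrow> s t \<noteq> 0"
    "\<And>t. t \<in> ball (\<phi> x) k \<Longrightarrow> crs (g t) (vderiv g t) = (t - \<phi> x) ^ dual.kappa x *s s t"
    "dual.gauss x = pt (s (\<phi> x))"
    by (rule dual.tangent_exists[OF x g(3) lf(2) c], rule that; assumption)
  have hf2: "holo3 f (ball (\<phi> x) k)" using holo3_subset[OF hf s(2)] .
  have hc: "holo3 (\<lambda>t. crs (s t) (f t)) (ball (\<phi> x) k)" by (rule holo3_crs[OF s(3) hf2])
  have z: "crs (s t) (f t) = 0" if t: "t \<in> ball (\<phi> x) k" "t \<noteq> \<phi> x" for t
  proof -
    have tr: "t \<in> ball (\<phi> x) r" using t s(2) by blast
    have "(t - \<phi> x) ^ dual.kappa x *s crs (s t) (f t) = crs (crs (g t) (vderiv g t)) (f t)"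
      by (simp add: s(5)[OF t(1)] crs_scale)
    also have "\<dots> = (-1) *s crs (f t) (crs (g t) (vderiv g t))" by (rule crs_anticommute)
    also have "\<dots> = 0" unfolding crs_crs using g(4)[OF tr] gf'[OF tr] by (simp add: dot_commute)
    finally show ?thesis using t(2) by simp
  qed
  have "crs (s (\<phi> x)) (f (\<phi> x)) $ i = 0" for i
    by (rule punctured_zero[OF holo3_nth[OF hc] s(1)]) (use z in simp)
  then have "crs (s (\<phi> x)) (f (\<phi> x)) = 0" by (simp add: vec_eq_iff)
  moreover have "f (\<phi> x) \<noteq> 0" "s (\<phi> x) \<noteq> 0" using liftD(5)[OF lf(1,3)] s(1,4) by auto
  ultimately have "pt (s (\<phi> x)) = pt (f (\<phi> x))" using pt_eq_iff_crs by blast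
  then show ?thesis
    using s(6) liftD(6)[OF lf(1,3)] chart_inv(3)[OF liftD(1)[OF lf(1)] lf(2)] by simp
qed

end

section \<open>Branches over a point of the plane\<close>

context plane_curve begin

interpretation dual: nondeg_curve X A gauss by (rule dual_nondeg)

text \<open>All points of a line contained in the curve would come from the finitely many zeros of
  the linear form on \<open>X\<close>, but a line is infinite.\<close>

lemma off_curve:
  assumes "a \<noteq> 0" obtains u where "dot a u = 0" "eval_form F u \<noteq> 0"
proof -
  have "\<exists>u. dot a u = 0 \<and> eval_form F u \<noteq> 0"
  proof (rule ccontr)
    assume no: "\<not> ?thesis"
    obtain c where c: "c \<noteq> 0" "coords (pt a) = c *s a" using coords_pt[OF assms] by blast
    have "line (pt a) \<subseteq> \<nu> ` {x\<in>topspace X. dot a (coords (\<nu> x)) = 0}"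
    proof
      fix p assume "p \<in> line (pt a)"
      then have a: "dot a (coords p) = 0" using c by (simp add: line_iff dot_scale_left)
      then have "p \<in> zeros F" using no by (auto simp: zeros_def)
      then have "p \<in> \<nu> ` topspace X" using image by simp
      then obtain x where "x \<in> topspace X" "\<nu> x = p" by blast
      then show "p \<in> \<nu> ` {x\<in>topspace X. dot a (coords (\<nu> x)) = 0}" using a by blast
    qed
    then have "finite (line (pt a))" by (rule finite_subset[OF _ finite_imageI[OF line_finite[OF assms]]])
    then show False using infinite_line by blast
  qed
  then show ?thesis using that by blast
qed

lemma line_degree_const: "a \<noteq> 0 \<Longrightarrow> line_degree a = d"
  using off_curve line_degree_eq by metis

definition branches :: "P2 \<Rightarrow> 'a set" where "branches p = {x\<in>topspace X. \<nu> x = p}"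

lemma finite_branches: "finite (branches p)"
  unfolding branches_def by (rule point_fiber_finite)

lemma line_intersection_branches:
  assumes "p \<noteq> q" "p \<in> line l" "q \<in> line l"
  shows "line_intersection F p q = enat (\<Sum>x\<in>branches p. ord (coords l) x)"
proof -
  obtain u where u: "dot (coords l) u = 0" "eval_form F u \<noteq> 0" using off_curve[OF coords_nonzero] by blast
  show ?thesis using line_intersection_eq[OF assms u] by (simp add: branches_def)
qed

text \<open>A transversal branch contributes \<open>kappa x + 1\<close>, and every branch tangent to
  \<open>l\<close> contributes strictly more.\<close>

lemma line_intersection_tangent:
  assumes p: "p \<in> line l"
  defines "e \<equiv> \<Sum>x\<in>branches p. Suc (kappa x)"
  shows "(\<Sum>x\<in>branches p. ord (coords l) x) \<ge> e"
    "(\<Sum>x\<in>branches p. ord (coords l) x) = e \<longleftrightarrow> l \<notin> gauss ` branches p"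
proof -
  have o: "ord (coords l) x \<ge> Suc (kappa x)" "ord (coords l) x = Suc (kappa x) \<longleftrightarrow> l \<noteq> gauss x"
    if "x \<in> branches p" for x
    using ord_tangent[of "coords l" x] that p by (simp_all add: branches_def line_iff)
  show "(\<Sum>x\<in>branches p. ord (coords l) x) \<ge> e" unfolding e_def using o(1) by (auto intro: sum_mono)
  show "(\<Sum>x\<in>branches p. ord (coords l) x) = e \<longleftrightarrow> l \<notin> gauss ` branches p"
  proof
    assume eq: "(\<Sum>x\<in>branches p. ord (coords l) x) = e"
    show "l \<notin> gauss ` branches p"
    proof
      assume "l \<in> gauss ` branches p"
      then obtain x where x: "x \<in> branches p" "l = gauss x" by blast
      have "e < (\<Sum>x\<in>branches p. ord (coords l) x)" unfolding e_def
      proof (rule sum_strict_mono_ex1[OF finite_branches])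
        show "\<forall>x\<in>branches p. Suc (kappa x) \<le> ord (coords l) x" using o(1) by blast
        show "\<exists>x\<in>branches p. Suc (kappa x) < ord (coords l) x"
          using o[OF x(1)] x by (intro bexI[of _ x]) auto
      qed
      then show False using eq by simp
    qed
  next
    assume "l \<notin> gauss ` branches p"
    then show "(\<Sum>x\<in>branches p. ord (coords l) x) = e" unfolding e_def
      using o(2) by (intro sum.cong) auto
  qed
qed

text \<open>The multiplicity is the least intersection number with a line through \<open>p\<close>.
  Only finitely many of these lines are tangent to a branch, so some line attains the lower
  bound.\<close>

lemma mult_at_branches:
  assumes p: "p \<in> zeros F"
  shows "mult_at F p = (\<Sum>x\<in>branches p. Suc (kappa x))"
proof (rule antisym)
  let ?e = "\<Sum>x\<in>branches p. Suc (kappa x)"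
  have fp: "eval_form F (coords p) = 0" using p by (simp add: zeros_def)
  obtain v where v: "eval_form F v \<noteq> 0" "v \<noteq> 0" using nonzero eval_zero by auto
  obtain q where q: "Polynomial.coeff (expansion F p q) (mult_at F p) \<noteq> 0"
    using mult_at_exists[OF form v] by blast
  \<comment> \<open>In the direction of \<open>p\<close> itself the expansion is identically zero,
    so \<open>q\<close> spans a line with \<open>p\<close>.\<close>
  have "p \<noteq> q"
  proof
    assume "p = q"
    have "poly (expansion F p p) t = 0" for t
    proof -
      have "coords p + t *s coords p = (1 + t) *s coords p" by (simp add: vec_eq_iff algebra_simps)
      then show ?thesis by (simp only: expansion_eq poly_expand eval_form_scale[OF form] fp mult_zero_right)
    qed
    then have "expansion F p p = 0" by (simp add: poly_eq_poly_eq_iff[symmetric] fun_eq_iff)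
    then show False using q \<open>p = q\<close> by simp
  qed
  define l where "l = pt (crs (coords p) (coords q))"
  obtain c where c: "coords l = c *s crs (coords p) (coords q)"
    using coords_pt[OF crs_coords_nonzero[OF \<open>p \<noteq> q\<close>]] by (auto simp: l_def)
  have l: "p \<in> line l" "q \<in> line l" by (simp_all add: line_iff c dot_scale_left)
  have "\<not> line_intersection F p q > enat (mult_at F p)" unfolding line_intersection_gt using q by blast
  then have "(\<Sum>x\<in>branches p. ord (coords l) x) \<le> mult_at F p"
    using line_intersection_branches[OF \<open>p \<noteq> q\<close> l] by simp
  then show "?e \<le> mult_at F p" using line_intersection_tangent(1)[OF l(1)] by linarith
  have "infinite (line p - gauss ` branches p)"
    using infinite_line finite_branches by (simp add: Diff_infinite_finite)
  then obtain l' where l': "l' \<in> line p" "l' \<notin> gauss ` branches p"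
    by (metis DiffE ex_in_conv finite.emptyI)
  then have pl': "p \<in> line l'" by (simp add: line_commute)
  obtain q' where q': "q' \<in> line l'" "q' \<noteq> p" using second_point by blast
  have e: "line_intersection F p q' = enat ?e"
    using line_intersection_branches[OF q'(2)[symmetric] pl' q'(1)] line_intersection_tangent(2)[OF pl'] l'(2) by simp
  show "mult_at F p \<le> ?e"
  proof (rule ccontr)
    assume "\<not> ?thesis"
    then have "\<forall>k\<le>?e. Polynomial.coeff (expansion F p q') k = 0" using mult_at_coeff_eq_0 by simp
    then have "line_intersection F p q' > enat ?e" unfolding line_intersection_gt .
    then show False using e by simp
  qed
qed

text \<open>A line through \<open>p\<close> meets the curve there with more than the multiplicity
  exactly when it is tangent to some branch.\<close>

lemma tangent_lines_branches:
  assumes p: "p \<in> zeros F"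
  shows "tangent_lines F p = gauss ` branches p"
proof (intro equalityI subsetI)
  fix l assume "l \<in> tangent_lines F p"
  then obtain q where q: "p \<in> line l" "q \<in> line l" "q \<noteq> p" "line_intersection F p q > enat (mult_at F p)"
    by (auto simp: tangent_lines_def)
  then have "(\<Sum>x\<in>branches p. ord (coords l) x) > mult_at F p" using line_intersection_branches[of p q l] by simp
  then show "l \<in> gauss ` branches p" using line_intersection_tangent[OF q(1)] mult_at_branches[OF p] by auto
next
  fix l assume l: "l \<in> gauss ` branches p"
  then have pl: "p \<in> line l" using gauss_incident by (auto simp: branches_def line_iff)
  obtain q where q: "q \<in> line l" "q \<noteq> p" using second_point by blast
  have "(\<Sum>x\<in>branches p. ord (coords l) x) > mult_at F p"
    using line_intersection_tangent[OF pl] mult_at_branches[OF p] l by auto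
  then have "line_intersection F p q > enat (mult_at F p)"
    using line_intersection_branches[OF q(2)[symmetric] pl q(1)] by simp
  then show "l \<in> tangent_lines F p" using pl q by (auto simp: tangent_lines_def)
qed

lemma branches_nonempty: "p \<in> zeros F \<Longrightarrow> branches p \<noteq> {}"
  using image by (force simp: branches_def)

text \<open>A sum of terms \<open>kappa + 1\<close> below 2 has room for only one branch, with
  \<open>kappa\<close> zero.\<close>

lemma kappa_smooth:
  assumes p: "p \<in> zeros F" "p \<notin> singular_points F" and x: "x \<in> branches p"
  shows "kappa x = 0" "branches p = {x}"
proof -
  have m: "(\<Sum>x\<in>branches p. Suc (kappa x)) < 2"
    using p mult_at_branches[OF p(1)] by (simp add: singular_points_def)
  have s: "(\<Sum>x\<in>branches p. Suc (kappa x)) = Suc (kappa x) + (\<Sum>x\<in>branches p - {x}. Suc (kappa x))"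
    by (rule sum.remove[OF finite_branches x])
  then show "kappa x = 0" using m by simp
  have "card (branches p - {x}) = 0" using m s sum_Suc[of kappa "branches p - {x}"] by linarith
  then have "branches p - {x} = {}" using card_0_eq[OF finite_Diff[OF finite_branches[of p], of "{x}"]] by blast
  then show "branches p = {x}" using x by blast
qed

text \<open>Two tangent lines need two branches, which already exhaust the multiplicity 2.\<close>

lemma kappa_node:
  assumes p: "p \<in> nodes F" and x: "x \<in> branches p"
  shows "kappa x = 0"
proof -
  have pz: "p \<in> zeros F" and t: "card (gauss ` branches p) = 2" and m: "(\<Sum>x\<in>branches p. Suc (kappa x)) = 2"
    using p tangent_lines_branches mult_at_branches by (auto simp: nodes_def)
  have "(\<Sum>x\<in>branches p. Suc (kappa x)) = card (branches p) + (\<Sum>x\<in>branches p. kappa x)"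
    by (simp add: sum_Suc add.commute)
  moreover have "card (branches p) \<ge> 2" using card_image_le[OF finite_branches, of gauss p] t by simp
  ultimately have "(\<Sum>x\<in>branches p. kappa x) = 0" using m by simp
  then show ?thesis using x finite_branches by simp
qed

text \<open>Every branch is tangent to \<open>l\<close>, so the intersection number 3 is at least
  the multiplicity 2 plus the number of branches. Hence there is a single branch, and its
  \<open>kappa\<close> is 1.\<close>

lemma kappa_cusp:
  assumes p: "p \<in> cusps F"
  shows "(\<Sum>x\<in>branches p. kappa x) = 1"
proof -
  obtain l where l: "tangent_lines F p = {l}" "\<And>q. q \<in> line l \<Longrightarrow> q \<noteq> p \<Longrightarrow> line_intersection F p q = 3"
    using p by (auto simp: cusps_def)
  have pz: "p \<in> zeros F" and m: "(\<Sum>x\<in>branches p. Suc (kappa x)) = 2"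
    using p mult_at_branches by (auto simp: cusps_def)
  have t: "gauss ` branches p = {l}" using l(1) tangent_lines_branches[OF pz] by simp
  have pl: "p \<in> line l" using l(1) by (auto simp: tangent_lines_def)
  obtain q where q: "q \<in> line l" "q \<noteq> p" using second_point by blast
  have "enat (\<Sum>x\<in>branches p. ord (coords l) x) = 3"
    using line_intersection_branches[OF q(2)[symmetric] pl q(1)] l(2)[OF q] by simp
  then have o: "(\<Sum>x\<in>branches p. ord (coords l) x) = 3" by (simp add: numeral_eq_enat)
  have "ord (coords l) x \<ge> Suc (Suc (kappa x))" if "x \<in> branches p" for x
    using ord_tangent[of "coords l" x] that pl t by (force simp: branches_def line_iff)
  then have "(\<Sum>x\<in>branches p. Suc (Suc (kappa x))) \<le> 3" unfolding o[symmetric] by (auto intro: sum_mono)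
  then have "(\<Sum>x\<in>branches p. Suc (kappa x)) + card (branches p) \<le> 3" by (simp add: sum_Suc)
  then have "card (branches p) \<le> 1" using m by simp
  moreover have "card (branches p) > 0" using branches_nonempty[OF pz] finite_branches by (simp add: card_gt_0_iff)
  ultimately have "card (branches p) = 1" by simp
  then show ?thesis using m by (simp add: sum_Suc)
qed

lemma kappa_sum:
  assumes sing: "singular_points F = nodes F \<union> cusps F"
  shows "{x\<in>topspace X. kappa x \<noteq> 0} \<subseteq> {x\<in>topspace X. \<nu> x \<in> cusps F}"
    "(\<Sum>x | x \<in> topspace X \<and> \<nu> x \<in> cusps F. kappa x) = card (cusps F)"
proof -
  show "{x\<in>topspace X. kappa x \<noteq> 0} \<subseteq> {x\<in>topspace X. \<nu> x \<in> cusps F}"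
  proof clarify
    fix x assume x: "x \<in> topspace X" "kappa x > 0"
    have b: "x \<in> branches (\<nu> x)" using x by (simp add: branches_def)
    show "\<nu> x \<in> cusps F"
      using kappa_smooth(1)[OF on_curve[OF x(1)] _ b] kappa_node[OF _ b] x(2) sing by auto
  qed
  have fc: "finite (cusps F)" using fin_sing sing by simp
  have un: "{x. x \<in> topspace X \<and> \<nu> x \<in> cusps F} = (\<Union>p\<in>cusps F. branches p)" by (auto simp: branches_def)
  have "(\<Sum>x | x \<in> topspace X \<and> \<nu> x \<in> cusps F. kappa x) = (\<Sum>p\<in>cusps F. \<Sum>x\<in>branches p. kappa x)"
    by (subst un, rule sum.UNION_disjoint) (use fc finite_branches in \<open>auto simp: branches_def\<close>)
  also have "\<dots> = card (cusps F)" by (simp add: kappa_cusp)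
  finally show "(\<Sum>x | x \<in> topspace X \<and> \<nu> x \<in> cusps F. kappa x) = card (cusps F)" .
qed

text \<open>Riemann-Hurwitz for the projection from \<open>v\<close>: the ramification comes from the cusps and from
  the tangent lines through \<open>v\<close>.\<close>

lemma euler_formula:
  assumes sing: "singular_points F = nodes F \<union> cusps F" and v: "eval_form F v \<noteq> 0"
  shows "has_euler X (2 * int d - int (card (cusps F)) - int (dual.line_degree v))"
proof -
  have v0: "v \<noteq> 0" using v eval_zero by auto
  obtain a where a: "a \<noteq> 0" "dot a v = 0" using exists_orthogonal by blast
  obtain b e where b: "crs a b = v" using complete_basis[OF a v0] by blast
  have ab: "crs a b \<noteq> 0" "eval_form F (crs a b) \<noteq> 0" using b v v0 by simp_all
  have ne: "dot a (coords (\<nu> x)) \<noteq> 0 \<or> dot b (coords (\<nu> x)) \<noteq> 0" if "x \<in> topspace X" for x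
    by (rule pencil_nonvanishing[OF ab(2) that])
  note P = line_degree_pencil[OF ab(1) ne]
  have b0: "b \<noteq> 0" using ab(1) by (auto simp: vec3_eq_iff)
  \<comment> \<open>The points where \<open>kappa\<close> or the dual order is positive, so that
    either sum may be restricted to \<open>S\<close> or extended to it.\<close>
  define S where "S = {x. x \<in> topspace X \<and> ord (ray a b x) x \<noteq> 1}"
  have finS: "finite S" using P(2) by (simp add: S_def)
  have o: "ord (ray a b x) x = Suc (kappa x + dual.ord v x)" if "x \<in> topspace X" for x
    using ord_ray_dual[OF ab(1) that ne[OF that]] b by simp
  have "(\<Sum>x\<in>S. int (ord (ray a b x) x) - 1) = (\<Sum>x\<in>S. int (kappa x) + int (dual.ord v x))"
    using o by (intro sum.cong) (auto simp: S_def)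
  also have "\<dots> = int (\<Sum>x\<in>S. kappa x) + int (\<Sum>x\<in>S. dual.ord v x)" by (simp add: sum.distrib)
  also have "(\<Sum>x\<in>S. kappa x) = (\<Sum>x | x \<in> topspace X \<and> kappa x \<noteq> 0. kappa x)"
    using finS o by (intro sum.mono_neutral_right) (auto simp: S_def)
  also have "\<dots> = (\<Sum>x | x \<in> topspace X \<and> \<nu> x \<in> cusps F. kappa x)"
  proof (rule sum.mono_neutral_left)
    show "finite {x. x \<in> topspace X \<and> \<nu> x \<in> cusps F}"
      using preimage_finite[of "cusps F"] fin_sing sing by simp
  qed (use kappa_sum(1)[OF sing] in auto)
  also have "\<dots> = card (cusps F)" by (rule kappa_sum(2)[OF sing])
  also have "(\<Sum>x\<in>S. dual.ord v x) = dual.line_degree v"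
    unfolding dual.line_degree_def
  proof (rule sum.mono_neutral_right[OF finS])
    show "{x. x \<in> topspace X \<and> dot v (coords (gauss x)) = 0} \<subseteq> S"
      using o dual.ord_pos_iff[OF v0] by (fastforce simp: S_def)
    show "\<forall>x\<in>S - {x. x \<in> topspace X \<and> dot v (coords (gauss x)) = 0}. dual.ord v x = 0"
      using dual.ord_pos_iff[OF v0] by (auto simp: S_def)
  qed
  finally show ?thesis using P(3) line_degree_const[OF b0] by (simp add: S_def algebra_simps)
qed

end

section \<open>The dual curve\<close>

lemma eval_form_superset:
  assumes "finite K" "Poly_Mapping.keys F \<subseteq> K"
  shows "eval_form F v = (\<Sum>m\<in>K. Poly_Mapping.lookup F m * (\<Prod>i\<in>UNIV. (v $ i) ^ Poly_Mapping.lookup m i))"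
  unfolding eval_form_def by (rule sum.mono_neutral_left) (use assms in \<open>auto simp: in_keys_iff\<close>)

lemma eval_form_add: "eval_form (F + G) v = eval_form F v + eval_form G v"
proof -
  define K where "K = Poly_Mapping.keys F \<union> Poly_Mapping.keys G"
  have K: "finite K" "Poly_Mapping.keys F \<subseteq> K" "Poly_Mapping.keys G \<subseteq> K" "Poly_Mapping.keys (F + G) \<subseteq> K"
    using Poly_Mapping.keys_add[of F G] by (auto simp: K_def)
  show ?thesis
    by (simp only: eval_form_superset[OF K(1,2)] eval_form_superset[OF K(1,3)] eval_form_superset[OF K(1,4)]
        lookup_add distrib_right sum.distrib)
qed

definition variable :: "3 \<Rightarrow> complex \<Rightarrow> ternary" where
  "variable k c = Poly_Mapping.single (Poly_Mapping.single k 1) c"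

lemma eval_variable: "eval_form (variable k c) v = c * v $ k"
proof -
  have "eval_form (variable k c) v = (\<Sum>m\<in>{Poly_Mapping.single k 1}.
      Poly_Mapping.lookup (variable k c) m * (\<Prod>i\<in>UNIV. (v $ i) ^ Poly_Mapping.lookup m i))"
    by (rule eval_form_superset) (auto simp: variable_def)
  also have "\<dots> = c * (\<Prod>i\<in>UNIV. (v $ i) ^ Poly_Mapping.lookup (Poly_Mapping.single k 1) i)"
    by (simp add: variable_def)
  also have "(\<Prod>i\<in>UNIV. (v $ i) ^ Poly_Mapping.lookup (Poly_Mapping.single k 1) i) = (\<Prod>i\<in>UNIV. if k = i then v $ i else 1)"
    by (intro prod.cong) (auto simp: lookup_single)
  finally show ?thesis by simp
qed

lemma homogeneous_variable: "homogeneous 1 (variable k c)"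
proof -
  have "(\<Sum>i\<in>UNIV. Poly_Mapping.lookup (Poly_Mapping.single k (1::nat)) i) = (\<Sum>i\<in>UNIV. if k = i then 1 else 0)"
    by (intro sum.cong) (auto simp: lookup_single)
  then show ?thesis by (auto simp: homogeneous_def variable_def split: if_splits)
qed

lemma homogeneous_add: "homogeneous d F \<Longrightarrow> homogeneous d G \<Longrightarrow> homogeneous d (F + G)"
  using Poly_Mapping.keys_add[of F G] unfolding homogeneous_def by blast

definition linear_form :: "complex^3 \<Rightarrow> ternary" where
  "linear_form a = variable 1 (a $ 1) + variable 2 (a $ 2) + variable 3 (a $ 3)"

lemma eval_linear_form: "eval_form (linear_form a) v = dot a v"
  by (simp add: linear_form_def eval_form_add eval_variable dot_def)

lemma homogeneous_linear_form: "homogeneous 1 (linear_form a)"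
  unfolding linear_form_def by (intro homogeneous_add homogeneous_variable)

text \<open>A linear form vanishing at \<open>q\<close> but not at \<open>p\<close> separates the
  two points.\<close>

lemma zariski_closure_point:
  assumes "S \<subseteq> {q}" shows "zariski_closure S \<subseteq> {q}"
proof
  fix p assume p: "p \<in> zariski_closure S"
  have "p = q"
  proof (rule ccontr)
    assume "p \<noteq> q"
    then have "crs (coords q) (coords p) \<noteq> 0" by (intro crs_coords_nonzero) simp
    then obtain u where u: "dot u (crs (coords q) (coords p)) = 1" using vec3_nonzero_dot by blast
    define a where "a = crs u (coords q)"
    have "dot a (coords q) = 0" by (simp add: a_def)
    then have "S \<subseteq> zeros (linear_form a)" using assms by (auto simp: zeros_def eval_linear_form)
    then have "p \<in> zeros (linear_form a)"
      using p homogeneous_linear_form unfolding zariski_closure_def by blast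
    then have "dot a (coords p) = 0" by (simp add: zeros_def eval_linear_form)
    moreover have "dot a (coords p) = dot u (crs (coords q) (coords p))" by (simp add: a_def dot_def algebra_simps)
    ultimately show False using u by simp
  qed
  then show "p \<in> {q}" by simp
qed

lemma expand_root:
  assumes F: "homogeneous d F" "d > 0" "eval_form F w \<noteq> 0"
  obtains t where "eval_form F (v + t *s w) = 0"
proof -
  have "Polynomial.coeff (expand F v w) d \<noteq> 0" using coeff_expand_top[OF F(1)] F(3) by simp
  then have "Polynomial.degree (expand F v w) \<noteq> 0" using F(2) le_degree by fastforce
  then have "\<not> constant (poly (expand F v w))" by (simp add: constant_degree)
  then obtain t where "poly (expand F v w) t = 0" using fundamental_theorem_of_algebra by blast
  then show ?thesis using that by (simp add: poly_expand)
qed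

text \<open>Projection from \<open>w\<close>, a point off the curve, reaches each of the infinitely
  many lines through \<open>w\<close>, since by the fundamental theorem of algebra every such line
  meets the curve.\<close>

lemma infinite_zeros:
  assumes F: "homogeneous d F" "d > 0" "eval_form F w \<noteq> 0" "w \<noteq> 0"
  shows "infinite (zeros F)"
proof
  assume fin: "finite (zeros F)"
  obtain c where c: "c \<noteq> 0" "coords (pt w) = c *s w" using coords_pt[OF F(4)] by blast
  have "line (pt w) \<subseteq> (\<lambda>p. pt (crs w (coords p))) ` zeros F"
  proof
    fix m assume m: "m \<in> line (pt w)"
    obtain q where q: "q \<in> line m" "q \<noteq> pt w" using second_point by blast
    have wm: "pt w \<in> line m" using m line_commute by blast
    have wq: "crs w (coords q) \<noteq> 0" using pt_eq_iff_crs[OF F(4), of "coords q"] q(2) by simp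
    have meq: "m = pt (crs w (coords q))"
      by (rule line_unique[OF q(2)[symmetric] wm q(1) wq]) (simp_all add: c dot_scale_right)
    obtain t where t: "eval_form F (coords q + t *s w) = 0" using expand_root[OF F(1-3)] by blast
    define v where "v = coords q + t *s w"
    have wv: "crs w v = crs w (coords q)" by (simp add: v_def crs_add_right crs_scale)
    have v0: "v \<noteq> 0" using wq wv by (metis crs_self crs_scale(2) vector_smult_lzero)
    obtain k where k: "k \<noteq> 0" "coords (pt v) = k *s v" using coords_pt[OF v0] by blast
    have "pt v \<in> zeros F" using t v0 eval_form_pt[OF F(1) v0] by (simp add: v_def)
    moreover have "pt (crs w (coords (pt v))) = m" unfolding k(2) crs_scale(2) wv meq using pt_scale[OF wq k(1)] .
    ultimately show "m \<in> (\<lambda>p. pt (crs w (coords p))) ` zeros F" by blast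
  qed
  then show False using infinite_line fin finite_subset finite_imageI by metis
qed

lemma reduced_equation_nonzero:
  assumes "reduced_equation d F C"
  shows "homogeneous d F" "d > 0" "C = zeros F" "\<exists>w. eval_form F w \<noteq> 0 \<and> w \<noteq> 0"
proof -
  show F: "homogeneous d F" "d > 0" "C = zeros F" using assms by (auto simp: reduced_equation_def)
  have "F \<noteq> 0" using assms using not_squarefree_0 by (auto simp: reduced_equation_def)
  then obtain w where w: "eval_form F w \<noteq> 0" using eval_form_nonzero by blast
  have "eval_form F 0 = 0" using eval_form_scale[OF F(1), of 0 0] F(2) by (simp add: zero_power vector_smult_lzero)
  then show "\<exists>w. eval_form F w \<noteq> 0 \<and> w \<noteq> 0" using w by metis
qed

definition dual_points :: "P2 set \<Rightarrow> P2 set" where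
  "dual_points C = {l. \<exists>d F. reduced_equation d F C \<and> (\<exists>p\<in>C. p \<notin> singular_points F \<and> l \<in> tangent_lines F p)}"

lemma dual_curve_eq: "dual_curve C = zariski_closure (dual_points C)"
  by (simp add: dual_curve_def dual_points_def)

text \<open>The dual of a line is a point, hence not a curve.\<close>

lemma dual_degenerate:
  assumes l: "l \<noteq> 0" "\<And>p. p \<in> C \<Longrightarrow> dot l (coords p) = 0"
  shows "dual_curve C \<subseteq> {pt l}"
  unfolding dual_curve_eq
proof (rule zariski_closure_point, rule subsetI)
  fix m assume "m \<in> dual_points C"
  then obtain d F p where red: "reduced_equation d F C" and p: "p \<in> C" "p \<notin> singular_points F" "m \<in> tangent_lines F p"
    by (auto simp: dual_points_def)
  note F = reduced_equation_nonzero[OF red]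
  obtain w where w: "eval_form F w \<noteq> 0" "w \<noteq> 0" using F(4) by blast
  obtain v where v: "dot l v = 1" using vec3_nonzero_dot[OF l(1)] dot_commute by metis
  \<comment> \<open>A zero of \<open>F\<close> is a point of \<open>C\<close>, hence lies on the
    line \<open>l\<close>.\<close>
  have off: "eval_form F x \<noteq> 0" if x: "dot l x \<noteq> 0" for x
  proof
    assume e: "eval_form F x = 0"
    have x0: "x \<noteq> 0" using x by auto
    then have "pt x \<in> C" using eval_form_pt[OF F(1) x0] e F(3) by simp
    moreover obtain c where "c \<noteq> 0" "coords (pt x) = c *s x" using coords_pt[OF x0] by blast
    ultimately show False using l(2)[of "pt x"] x by (simp add: dot_scale_right)
  qed
  \<comment> \<open>Conversely, the line from \<open>u\<close> in the transversal direction
    \<open>v\<close> carries a zero of \<open>F\<close>, which by \<open>off\<close> can only be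
    \<open>u\<close>.\<close>
  have on: "eval_form F u = 0" if u: "dot l u = 0" for u
  proof -
    have "eval_form F v \<noteq> 0" by (rule off) (simp add: v)
    then obtain t where t: "eval_form F (u + t *s v) = 0" using expand_root[OF F(1,2)] by blast
    then have "dot l (u + t *s v) = 0" using off by blast
    then have "t = 0" using u v by (simp add: dot_simps)
    then show ?thesis using t by simp
  qed
  have pz: "p \<in> zeros F" using p F(3) by simp
  have g0: "grad F (coords p) \<noteq> 0" using singular_iff(1)[OF F(1) w pz] p(2) by simp
  \<comment> \<open>Moving along \<open>l\<close> keeps \<open>F\<close> zero, so the gradient at
    \<open>p\<close> annihilates \<open>l\<close> and is a multiple of its equation.\<close>
  have tang: "dot (grad F (coords p)) u = 0" if u: "dot l u = 0" for u
  proof -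
    have "poly (expand F (coords p) u) t = 0" for t
      unfolding poly_expand by (rule on) (use l(2)[OF p(1)] u in \<open>simp add: dot_simps\<close>)
    then have "expand F (coords p) u = 0" by (simp add: poly_eq_poly_eq_iff[symmetric] fun_eq_iff)
    then show ?thesis using coeff_expand_1[of F "coords p" u] by simp
  qed
  have "crs l (grad F (coords p)) = 0"
  proof (rule dot_eqI)
    fix u
    have "dot (crs l (grad F (coords p))) u = - dot (grad F (coords p)) (crs l u)" by (simp add: dot_def algebra_simps)
    also have "\<dots> = 0" using tang[of "crs l u"] by simp
    finally show "dot (crs l (grad F (coords p))) u = dot 0 u" by simp
  qed
  then have "pt l = pt (grad F (coords p))" using pt_eq_iff_crs[OF l(1) g0] by simp
  moreover have "m = pt (grad F (coords p))" using p(3) tangent_lines_smooth[OF F(1) w pz p(2)] by simp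
  ultimately show "m \<in> {pt l}" by simp
qed

lemma holo3_grad: "homogeneous d F \<Longrightarrow> holo3 f W \<Longrightarrow> holo3 (\<lambda>t. grad F (f t)) W"
proof -
  assume F: "homogeneous d F" and f: "holo3 f W"
  have "(\<lambda>t. dot (grad F (f t)) u) holomorphic_on W" for u
    unfolding grad_def dot_def using f unfolding holo3_def
    by (auto simp: vector_3 intro!: holomorphic_intros)
  from this[of "axis 1 1"] this[of "axis 2 1"] this[of "axis 3 1"]
  show ?thesis unfolding holo3_def forall_3 by (simp add: dot_def axis_def)
qed

context nondeg_curve begin

interpretation dual: nondeg_curve X A gauss by (rule dual_nondeg)

text \<open>The gradient along \<open>f\<close> and the vector \<open>g\<close> are both orthogonal
  to \<open>f\<close> and its derivative, hence parallel off the point, and at it by continuity. As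
  \<open>F\<close> is any form vanishing on the image, the lemma serves all reduced equations of a
  curve.\<close>

lemma tangent_gauss:
  assumes F: "homogeneous d F" "eval_form F w \<noteq> 0" "w \<noteq> 0" and im: "\<nu> ` topspace X \<subseteq> zeros F"
    and x: "x \<in> topspace X" "\<nu> x \<notin> singular_points F"
  shows "tangent_lines F (\<nu> x) = {gauss x}"
proof -
  obtain U \<phi> W f where lf: "lift U \<phi> W f" "x \<in> U" "\<phi> x \<in> W" using lift_at[OF x(1)] by blast
  note lD = liftD[OF lf(1)]
  obtain g r where g: "r > 0" "ball (\<phi> x) r \<subseteq> W" "dual.lift U \<phi> (ball (\<phi> x) r) g"
    "\<And>t. t \<in> ball (\<phi> x) r \<Longrightarrow> crs (f t) (vderiv f t) = (t - \<phi> x) ^ kappa x *s g t"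
    by (rule gauss_lift_orthogonal[OF x(1) lf], rule that; assumption)
  have c: "\<phi> x \<in> ball (\<phi> x) r" using g(1) by simp
  have hf: "holo3 f (ball (\<phi> x) r)" using holo3_subset[OF lD(4) g(2)] .
  have hg: "holo3 g (ball (\<phi> x) r)" by (rule dual.liftD(4)[OF g(3)])
  have e0: "eval_form F (f t) = 0" if t: "t \<in> ball (\<phi> x) r" for t
  proof -
    have tW: "t \<in> W" using t g(2) by blast
    have "inv_into U \<phi> t \<in> topspace X" using chart_inv(1)[OF lD(1)] chart(5)[OF lD(1)] lD(3) tW by blast
    then have "pt (f t) \<in> zeros F" using im lD(6)[OF tW] by auto
    then show ?thesis using eval_form_pt[OF F(1) lD(5)[OF tW]] by simp
  qed
  have gf: "dot (grad F (f t)) (f t) = 0" if "t \<in> ball (\<phi> x) r" for t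
    using euler_identity[OF F(1)] e0[OF that] by simp
  have gf': "dot (grad F (f t)) (vderiv f t) = 0" if t: "t \<in> ball (\<phi> x) r" for t
  proof -
    have "deriv (\<lambda>t. eval_form F (f t)) t = deriv (\<lambda>t. 0) t"
      using t e0 by (intro deriv_cong_ev) (auto intro!: eventually_nhds_in_open[THEN eventually_mono, of "ball (\<phi> x) r"])
    then show ?thesis using deriv_eval_form[OF hf _ t] by simp
  qed
  have hc: "holo3 (\<lambda>t. crs (g t) (grad F (f t))) (ball (\<phi> x) r)"
    by (rule holo3_crs[OF hg holo3_grad[OF F(1) hf]])
  have z: "crs (g t) (grad F (f t)) = 0" if t: "t \<in> ball (\<phi> x) r" "t \<noteq> \<phi> x" for t
  proof -
    have "(t - \<phi> x) ^ kappa x *s crs (g t) (grad F (f t)) = crs (crs (f t) (vderiv f t)) (grad F (f t))"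
      by (simp add: g(4)[OF t(1)] crs_scale)
    also have "\<dots> = (-1) *s crs (grad F (f t)) (crs (f t) (vderiv f t))" by (rule crs_anticommute)
    also have "\<dots> = 0" unfolding crs_crs using gf[OF t(1)] gf'[OF t(1)] by simp
    finally show ?thesis using t(2) by simp
  qed
  have "crs (g (\<phi> x)) (grad F (f (\<phi> x))) $ i = 0" for i
    by (rule punctured_zero[OF holo3_nth[OF hc] g(1)]) (use z in simp)
  then have cz: "crs (g (\<phi> x)) (grad F (f (\<phi> x))) = 0" by (simp add: vec_eq_iff)
  obtain k where k: "k \<noteq> 0" "coords (\<nu> x) = k *s f (\<phi> x)" using lift_coords'[OF lf] by blast
  have gs: "grad F (coords (\<nu> x)) = (k ^ d / k) *s grad F (f (\<phi> x))" unfolding k(2) by (rule grad_scale[OF F(1) k(1)])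
  have nz: "\<nu> x \<in> zeros F" using im x by blast
  have g0: "grad F (coords (\<nu> x)) \<noteq> 0" using singular_iff(1)[OF F nz] x(2) by simp
  then have g1: "grad F (f (\<phi> x)) \<noteq> 0" using gs by auto
  have "tangent_lines F (\<nu> x) = {pt (grad F (coords (\<nu> x)))}" by (rule tangent_lines_smooth[OF F nz x(2)])
  also have "pt (grad F (coords (\<nu> x))) = pt (grad F (f (\<phi> x)))" unfolding gs by (rule pt_scale[OF g1]) (use k in simp)
  also have "\<dots> = pt (g (\<phi> x))" using pt_eq_iff_crs[of "g (\<phi> x)" "grad F (f (\<phi> x))"] cz g1 dual.liftD(5)[OF g(3) c] by simp
  also have "\<dots> = gauss x" using dual.liftD(6)[OF g(3) c] chart_inv(3)[OF lD(1) lf(2)] by simp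
  finally show ?thesis .
qed

text \<open>By the identity theorem a form with all but finitely many points of the surface as zeros
  vanishes on all of it; this takes the place of a density argument for Zariski closures.\<close>

lemma form_vanishes:
  assumes G: "homogeneous e G" and B: "finite B" and van: "\<And>x. x \<in> topspace X - B \<Longrightarrow> \<nu> x \<in> zeros G"
  shows "\<nu> ` topspace X \<subseteq> zeros G"
proof (rule ccontr)
  assume "\<not> ?thesis"
  then obtain x0 where "x0 \<in> topspace X" "eval_form G (coords (\<nu> x0)) \<noteq> 0" by (auto simp: zeros_def)
  then have "finite {x\<in>topspace X. eval_form G (coords (\<nu> x)) = 0}" by (rule homog_fun_zeros(1)[OF homog_fun_eval[OF G]])
  moreover have "topspace X - B \<subseteq> {x\<in>topspace X. eval_form G (coords (\<nu> x)) = 0}" using van by (auto simp: zeros_def)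
  ultimately have "finite (topspace X - B)" using finite_subset by blast
  then show False using infinite_surface B by simp
qed

end

context nondeg_curve begin

interpretation dual: nondeg_curve X A gauss by (rule dual_nondeg)

text \<open>The dual curve is caught between the Gauss image and the zeros of any form vanishing on
  it: its defining points are tangent lines at smooth points, which miss only finitely many points
  of \<open>X\<close>, and a form vanishing on them vanishes on the whole image.\<close>

lemma dual_points_gauss:
  assumes im: "\<nu> ` topspace X = C" and red: "reduced_equation d F C" and sing: "finite (singular_points F)"
  shows "dual_points C \<subseteq> gauss ` topspace X"
    "x \<in> topspace X \<Longrightarrow> \<nu> x \<notin> singular_points F \<Longrightarrow> gauss x \<in> dual_points C"
    "gauss ` topspace X \<subseteq> dual_curve C"
    "homogeneous e G \<Longrightarrow> gauss ` topspace X \<subseteq> zeros G \<Longrightarrow> dual_curve C \<subseteq> zeros G"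
proof -
  show 1: "dual_points C \<subseteq> gauss ` topspace X"
  proof
    fix m assume "m \<in> dual_points C"
    then obtain d F p where red: "reduced_equation d F C" and p: "p \<in> C" "p \<notin> singular_points F" "m \<in> tangent_lines F p"
      by (auto simp: dual_points_def)
    note F = reduced_equation_nonzero[OF red]
    obtain w where w: "eval_form F w \<noteq> 0" "w \<noteq> 0" using F(4) by blast
    have "p \<in> \<nu> ` topspace X" using p im by simp
    then obtain x where x: "x \<in> topspace X" "p = \<nu> x" by blast
    have "tangent_lines F (\<nu> x) = {gauss x}"
      by (rule tangent_gauss[OF F(1) w _ x(1)]) (use im F(3) p x in auto)
    then show "m \<in> gauss ` topspace X" using p(3) x by simp
  qed
  note F = reduced_equation_nonzero[OF red]
  obtain w where w: "eval_form F w \<noteq> 0" "w \<noteq> 0" using F(4) by blast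
  have 2: "gauss x \<in> dual_points C" if x: "x \<in> topspace X" "\<nu> x \<notin> singular_points F" for x
  proof -
    have "tangent_lines F (\<nu> x) = {gauss x}"
      by (rule tangent_gauss[OF F(1) w _ x]) (use im F(3) in auto)
    moreover have "\<nu> x \<in> C" using im x by blast
    ultimately show ?thesis using red x(2) unfolding dual_points_def by blast
  qed
  then show "x \<in> topspace X \<Longrightarrow> \<nu> x \<notin> singular_points F \<Longrightarrow> gauss x \<in> dual_points C" .
  show "gauss ` topspace X \<subseteq> dual_curve C"
  proof -
    have "gauss ` topspace X \<subseteq> zeros G" if G: "homogeneous e G" and S: "dual_points C \<subseteq> zeros G" for e G
      by (rule dual.form_vanishes[OF G preimage_finite[OF sing]]) (use S 2 in blast)
    then show ?thesis unfolding dual_curve_eq zariski_closure_def by blast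
  qed
  show "homogeneous e G \<Longrightarrow> gauss ` topspace X \<subseteq> zeros G \<Longrightarrow> dual_curve C \<subseteq> zeros G"
    using 1 unfolding dual_curve_eq zariski_closure_def by blast
qed

end

section \<open>Surjectivity of the Gauss map onto the dual curve\<close>

lemma continuous_eval_grad:
  "continuous_on S (\<lambda>v. dot (grad F v) u)"
  unfolding grad_def dot_def by (auto simp: vector_3 intro!: continuous_intros)

text \<open>Near a smooth point the curve is a graph over the projection from \<open>u\<close>.\<close>

lemma graph_unique:
  assumes u: "dot (grad F v0) u \<noteq> 0"
  obtains \<delta> where "\<delta> > 0" "\<And>v t. v \<in> ball v0 \<delta> \<Longrightarrow> v + t *s u \<in> ball v0 \<delta> \<Longrightarrow> eval_form F v = eval_form F (v + t *s u) \<Longrightarrow> t = 0"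
proof -
  define c where "c = dot (grad F v0) u"
  have "isCont (\<lambda>v. dot (grad F v) u) v0" using continuous_eval_grad[of UNIV] by (simp add: continuous_on_eq_continuous_at)
  moreover have "norm c / 2 > 0" using u by (simp add: c_def)
  ultimately obtain \<delta> where \<delta>: "\<delta> > 0" "\<And>v. dist v v0 < \<delta> \<Longrightarrow> dist (dot (grad F v) u) c < norm c / 2"
    unfolding continuous_at_eps_delta c_def by blast
  have "t = 0" if v: "v \<in> ball v0 \<delta>" "v + t *s u \<in> ball v0 \<delta>" "eval_form F v = eval_form F (v + t *s u)" for v t
  proof -
    have seg: "v + s *s u \<in> ball v0 \<delta>" if s: "s \<in> closed_segment 0 t" for s
    proof -
      obtain \<rho> where \<rho>: "0 \<le> \<rho>" "\<rho> \<le> 1" "s = \<rho> *\<^sub>R t" using s by (auto simp: in_segment)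
      have "v + s *s u = (1 - \<rho>) *\<^sub>R v + \<rho> *\<^sub>R (v + t *s u)"
        unfolding \<rho>(3) vec_eq_iff by (simp add: scaleR_conv_of_real[where 'a = complex] algebra_simps)
      then show ?thesis using convexD_alt[OF convex_ball v(1,2) \<rho>(1,2)] by simp
    qed
    have hol: "holo3 (\<lambda>s. v + s *s u) UNIV" by (auto simp: holo3_def intro!: holomorphic_intros)
    have vd: "vderiv (\<lambda>s. v + s *s u) s = u" for s
      by (auto simp: vderiv_def vec_eq_iff intro!: DERIV_imp_deriv derivative_eq_intros)
    \<comment> \<open>On the segment this function has a derivative of modulus at most half of that
      of \<open>c\<close>. If \<open>F\<close> has equal values at both ends, the increment
      \<open>c * t\<close> is bounded by half of itself.\<close>
    have der: "((\<lambda>s. eval_form F (v + s *s u) - c * s) has_field_derivative (dot (grad F (v + s *s u)) u - c)) (at s within closed_segment 0 t)" for s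
    proof -
      have "((\<lambda>s. eval_form F (v + s *s u)) has_field_derivative deriv (\<lambda>s. eval_form F (v + s *s u)) s) (at s)"
        using holomorphic_derivI[OF eval_form_holomorphic[OF hol] open_UNIV] by simp
      then have "((\<lambda>s. eval_form F (v + s *s u)) has_field_derivative dot (grad F (v + s *s u)) u) (at s)"
        using deriv_eval_form[OF hol open_UNIV, of s F] vd by simp
      then have "((\<lambda>s. eval_form F (v + s *s u) - c * s) has_field_derivative (dot (grad F (v + s *s u)) u - c)) (at s)"
        by (auto intro!: derivative_eq_intros)
      then show ?thesis by (rule has_field_derivative_at_within)
    qed
    have "norm ((eval_form F (v + t *s u) - c * t) - (eval_form F (v + 0 *s u) - c * 0)) \<le> norm c / 2 * norm (t - 0)"
    proof (rule field_differentiable_bound[OF convex_closed_segment der])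
      show "norm (dot (grad F (v + s *s u)) u - c) \<le> norm c / 2" if "s \<in> closed_segment 0 t" for s
        using \<delta>(2)[of "v + s *s u"] seg[OF that] by (simp add: dist_norm norm_minus_commute)
    qed auto
    then have "norm c * norm t \<le> norm c * norm t / 2" using v(3) by (simp add: norm_mult)
    then show "t = 0" using u by (auto simp: c_def)
  qed
  then show ?thesis using that \<delta>(1) by blast
qed

lemma open_sub:
  assumes "open W" "continuous_on W h" "open T" shows "open {t\<in>W. h t \<in> T}"
  using continuous_open_preimage[OF assms(2,1,3)] by (simp add: vimage_def Int_def)

context curve begin

lemma openin_infinite:
  assumes "openin X N" "N \<noteq> {}" shows "infinite N"
proof
  assume fin: "finite N"
  obtain x where x: "x \<in> N" using assms(2) by blast
  then have "x \<in> topspace X" using openin_subset[OF assms(1)] by blast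
  then obtain U \<phi> where c: "(U, \<phi>) \<in> A" "x \<in> U" using chart_at by blast
  have "open (\<phi> ` (N \<inter> U))" by (rule chart_open_image[OF c(1)]) (use assms(1) chart(1)[OF c(1)] in auto)
  moreover have "finite (\<phi> ` (N \<inter> U))" "\<phi> ` (N \<inter> U) \<noteq> {}" using fin x c(2) by auto
  ultimately show False using finite_imp_not_open by blast
qed

text \<open>A disc minus finitely many points is connected, so near each puncture only one of the
  two sets is present; filling the punctures accordingly gives an open partition of all of
  \<open>X\<close>.\<close>

lemma connected_minus_finite:
  assumes P: "finite P" and T: "openin X T1" "openin X T2" "T1 \<inter> T2 = {}" "topspace X - P \<subseteq> T1 \<union> T2"
  shows "T1 = {} \<or> T2 = {}"
proof -
  \<comment> \<open>\<open>T1\<close> enlarged by those punctures that have a neighbourhood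
    contained, apart from \<open>P\<close>, in \<open>T1\<close>.\<close>
  define U1 where "U1 = \<Union>{N. openin X N \<and> N - P \<subseteq> T1}"
  define U2 where "U2 = \<Union>{N. openin X N \<and> N - P \<subseteq> T2}"
  have o: "openin X U1" "openin X U2" unfolding U1_def U2_def by auto
  have sub: "T1 \<subseteq> U1" "T2 \<subseteq> U2" using T(1,2) unfolding U1_def U2_def by auto
  \<comment> \<open>The intersection is open and finite, and a nonempty open set of the surface is
    infinite.\<close>
  have "U1 \<inter> U2 \<subseteq> P" using T(3) unfolding U1_def U2_def by blast
  then have "finite (U1 \<inter> U2)" using P finite_subset by blast
  then have dis: "U1 \<inter> U2 = {}" using openin_infinite[OF openin_Int[OF o]] by blast
  have "topspace X \<subseteq> U1 \<union> U2"
  proof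
    fix x assume "x \<in> topspace X"
    then obtain U \<phi> where c: "(U, \<phi>) \<in> A" "x \<in> U" using chart_at by blast
    obtain r where r: "r > 0" "ball (\<phi> x) r \<subseteq> \<phi> ` U" using chart(2)[OF c(1)] c(2) openE by blast
    define B where "B = ball (\<phi> x) r - \<phi> ` (P \<inter> U)"
    define J where "J = inv_into U \<phi> ` B"
    define N where "N = inv_into U \<phi> ` ball (\<phi> x) r"
    have "connected B" unfolding B_def by (rule connected_open_delete_finite) (use P in auto)
    moreover have BU: "B \<subseteq> \<phi> ` U" using r(2) by (auto simp: B_def)
    ultimately have "connectedin (top_of_set (\<phi> ` U)) B" by (simp add: connectedin_subtopology)
    then have J: "connectedin X J"
      unfolding J_def using connectedin_continuous_map_image[OF continuous_chart_inv[OF c(1)]] by blast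
    have JP: "J \<inter> P = {}"
    proof -
      have False if "t \<in> B" "inv_into U \<phi> t \<in> P" for t
      proof -
        have "t \<in> \<phi> ` U" using that BU by blast
        then have "inv_into U \<phi> t \<in> P \<inter> U" "t = \<phi> (inv_into U \<phi> t)" using chart_inv(1,2)[OF c(1), of t] that by auto
        then have "t \<in> \<phi> ` (P \<inter> U)" by blast
        then show False using that by (simp add: B_def)
      qed
      then show ?thesis by (auto simp: J_def)
    qed
    have "J \<subseteq> topspace X" using connectedin_subset_topspace[OF J] .
    then have JT: "J \<subseteq> T1 \<union> T2" using JP T(4) by blast
    have "T1 \<inter> J = {} \<or> T2 \<inter> J = {}"
      using J JT T(1-3) unfolding connectedin by blast
    then have JJ: "J \<subseteq> T2 \<or> J \<subseteq> T1" using JT by blast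
    have NJ: "N - P \<subseteq> J"
    proof
      fix y assume y: "y \<in> N - P"
      then obtain t where t: "t \<in> ball (\<phi> x) r" "y = inv_into U \<phi> t" by (auto simp: N_def)
      then have tU: "t \<in> \<phi> ` U" using r(2) by blast
      have "t \<notin> \<phi> ` (P \<inter> U)"
      proof
        assume "t \<in> \<phi> ` (P \<inter> U)"
        then obtain z where "z \<in> P" "z \<in> U" "t = \<phi> z" by blast
        then show False using y t chart_inv(3)[OF c(1)] by auto
      qed
      then show "y \<in> J" using t by (auto simp: J_def B_def)
    qed
    have N: "openin X N" unfolding N_def by (rule chart_image_open[OF c(1) r(2) open_ball])
    have "\<phi> x \<in> ball (\<phi> x) r" using r(1) by simp
    then have "inv_into U \<phi> (\<phi> x) \<in> N" unfolding N_def by (rule imageI)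
    then have xN: "x \<in> N" using chart_inv(3)[OF c] by simp
    show "x \<in> U1 \<union> U2" using JJ NJ N xN unfolding U1_def U2_def by blast
  qed
  moreover have "connected_space X" using riemann by (simp add: compact_riemann_surface_def)
  ultimately have "U1 = {} \<or> U2 = {}" using o dis unfolding connected_space_def by blast
  then show ?thesis using sub by blast
qed

end

text \<open>Points of the plane differ exactly when the cross product of their vectors is nonzero,
  an open condition on the pair of parameters.\<close>

lemma separate_points:
  assumes X: "curve X A \<nu>" and Y: "curve Y B \<mu>" and xy: "x \<in> topspace X" "y \<in> topspace Y" "\<nu> x \<noteq> \<mu> y"
  obtains N M where "openin X N" "x \<in> N" "openin Y M" "y \<in> M" "\<And>x' y'. x' \<in> N \<Longrightarrow> y' \<in> M \<Longrightarrow> \<nu> x' \<noteq> \<mu> y'"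
proof -
  interpret c1: curve X A \<nu> by (rule X)
  interpret c2: curve Y B \<mu> by (rule Y)
  obtain U \<phi> W f where f: "c1.lift U \<phi> W f" "x \<in> U" "\<phi> x \<in> W" using c1.lift_at[OF xy(1)] by blast
  obtain U' \<psi> W' m where m: "c2.lift U' \<psi> W' m" "y \<in> U'" "\<psi> y \<in> W'" using c2.lift_at[OF xy(2)] by blast
  note fD = c1.liftD[OF f(1)] and mD = c2.liftD[OF m(1)]
  have nz: "crs (f t) (m s) \<noteq> 0 \<longleftrightarrow> \<nu> (inv_into U \<phi> t) \<noteq> \<mu> (inv_into U' \<psi> s)" if "t \<in> W" "s \<in> W'" for t s
    using pt_eq_iff_crs[OF fD(5) mD(5)] fD(6) mD(6) that by simp
  have "crs (f (\<phi> x)) (m (\<psi> y)) \<noteq> 0"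
    using nz[OF f(3) m(3)] xy(3) c1.chart_inv(3)[OF fD(1) f(2)] c2.chart_inv(3)[OF mD(1) m(2)] by simp
  then obtain u where u: "dot u (crs (f (\<phi> x)) (m (\<psi> y))) = 1" using vec3_nonzero_dot by blast
  define h where "h p = dot u (crs (f (fst p)) (m (snd p)))" for p
  have cf: "continuous_on (W \<times> W') (\<lambda>p. f (fst p))"
    by (rule continuous_on_compose2[OF holo3_continuous[OF fD(4)] continuous_on_fst[OF continuous_on_id]]) auto
  have cm: "continuous_on (W \<times> W') (\<lambda>p. m (snd p))"
    by (rule continuous_on_compose2[OF holo3_continuous[OF mD(4)] continuous_on_snd[OF continuous_on_id]]) auto
  have "continuous_on (W \<times> W') h" unfolding h_def dot_def crs_nth
    using cf cm by (auto intro!: continuous_intros)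
  then have op: "open {p \<in> W \<times> W'. h p \<in> - {0}}"
    by (rule open_sub[OF open_Times[OF fD(2) mD(2)]]) auto
  have xy': "(\<phi> x, \<psi> y) \<in> {p \<in> W \<times> W'. h p \<in> - {0}}" using f(3) m(3) u by (simp add: h_def)
  obtain P Q where PQ: "open P" "open Q" "(\<phi> x, \<psi> y) \<in> P \<times> Q" "P \<times> Q \<subseteq> {p \<in> W \<times> W'. h p \<in> - {0}}"
    by (rule open_prod_elim[OF op xy'], rule that; assumption)
  have sub: "P \<subseteq> W" "Q \<subseteq> W'" using PQ(3,4) by auto
  show ?thesis
  proof (rule that)
    show "openin X (inv_into U \<phi> ` P)" by (rule c1.chart_image_open[OF fD(1) _ PQ(1)]) (use sub fD(3) in blast)
    show "openin Y (inv_into U' \<psi> ` Q)" by (rule c2.chart_image_open[OF mD(1) _ PQ(2)]) (use sub mD(3) in blast)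
    show "x \<in> inv_into U \<phi> ` P" using PQ(3) c1.chart_inv(3)[OF fD(1) f(2)] by force
    show "y \<in> inv_into U' \<psi> ` Q" using PQ(3) c2.chart_inv(3)[OF mD(1) m(2)] by force
    fix x' y' assume "x' \<in> inv_into U \<phi> ` P" "y' \<in> inv_into U' \<psi> ` Q"
    then obtain t s where ts: "t \<in> P" "s \<in> Q" "x' = inv_into U \<phi> t" "y' = inv_into U' \<psi> s" by blast
    then have "h (t, s) \<noteq> 0" using PQ(4) by auto
    then have "crs (f t) (m s) \<noteq> 0" by (auto simp: h_def)
    then show "\<nu> x' \<noteq> \<mu> y'" using nz[of t s] ts sub by blast
  qed
qed

text \<open>The image of a compact surface is closed, here expressed on \<open>Y\<close>: finitely
  many of the separating neighbourhoods cover \<open>X\<close>, and the corresponding neighbourhoods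
  of \<open>y\<close> are intersected.\<close>

lemma image_closed:
  assumes X: "curve X A \<nu>" and Y: "curve Y B \<mu>"
  shows "openin Y {y\<in>topspace Y. \<mu> y \<notin> \<nu> ` topspace X}"
proof (subst openin_subopen, rule ballI)
  fix y assume y: "y \<in> {y\<in>topspace Y. \<mu> y \<notin> \<nu> ` topspace X}"
  have "\<exists>N M. openin X N \<and> x \<in> N \<and> openin Y M \<and> y \<in> M \<and> (\<forall>x'\<in>N. \<forall>y'\<in>M. \<nu> x' \<noteq> \<mu> y')" if x: "x \<in> topspace X" for x
  proof -
    have "\<nu> x \<noteq> \<mu> y"
    proof
      assume "\<nu> x = \<mu> y"
      then have "\<mu> y \<in> \<nu> ` topspace X" using imageI[OF x, of \<nu>] by simp
      then show False using y by blast
    qed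
    from separate_points[OF X Y x _ this] y show ?thesis by (metis (no_types, lifting) mem_Collect_eq)
  qed
  then obtain N M where NM: "\<And>x. x \<in> topspace X \<Longrightarrow> openin X (N x) \<and> x \<in> N x \<and> openin Y (M x) \<and> y \<in> M x \<and> (\<forall>x'\<in>N x. \<forall>y'\<in>M x. \<nu> x' \<noteq> \<mu> y')"
    by metis
  have comp: "compact_space X" using X by (simp add: curve_def compact_riemann_surface_def)
  have "Ball (N ` topspace X) (openin X)" using NM by blast
  moreover have "\<Union>(N ` topspace X) = topspace X"
  proof
    show "\<Union>(N ` topspace X) \<subseteq> topspace X" using NM openin_subset by fast
  qed (use NM in blast)
  ultimately have "\<exists>\<F>. finite \<F> \<and> \<F> \<subseteq> N ` topspace X \<and> \<Union>\<F> = topspace X"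
    using comp unfolding compact_space by simp
  then obtain \<F> where \<F>: "finite \<F>" "\<F> \<subseteq> N ` topspace X" "\<Union>\<F> = topspace X" by metis
  obtain K where K: "K \<subseteq> topspace X" "finite K" "\<F> = N ` K" using finite_subset_image[OF \<F>(1,2)] by blast
  define V' where "V' = topspace Y \<inter> \<Inter>(M ` K)"
  have "openin Y V'" unfolding V'_def by (rule openin_Int_Inter) (use K NM in auto)
  moreover have "y \<in> V'" using y K NM by (auto simp: V'_def)
  moreover have "V' \<subseteq> {y\<in>topspace Y. \<mu> y \<notin> \<nu> ` topspace X}"
  proof
    fix y' assume y': "y' \<in> V'"
    have "\<mu> y' \<notin> \<nu> ` topspace X"
    proof
      assume "\<mu> y' \<in> \<nu> ` topspace X"
      then obtain x' where x': "x' \<in> topspace X" "\<mu> y' = \<nu> x'" by blast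
      then obtain x where x: "x \<in> K" "x' \<in> N x" using \<F>(3) K(3) by auto
      then have "y' \<in> M x" using y' by (auto simp: V'_def)
      then show False using NM[of x] x K(1) x'(2) by fastforce
    qed
    then show "y' \<in> {y\<in>topspace Y. \<mu> y \<notin> \<nu> ` topspace X}" using y' by (simp add: V'_def)
  qed
  ultimately show "\<exists>T. openin Y T \<and> y \<in> T \<and> T \<subseteq> {y\<in>topspace Y. \<mu> y \<notin> \<nu> ` topspace X}" by blast
qed

text \<open>At a smooth point, two parametrized branches of the same curve coincide as sets: both are graphs
  over a common projection, and the projection of the first one is an open map.\<close>

lemma image_open:
  assumes X: "nondeg_curve X A \<nu>" and Y: "curve Y B \<mu>"
    and F: "homogeneous d F" "eval_form F w \<noteq> 0" "w \<noteq> 0"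
    and im: "\<nu> ` topspace X \<subseteq> zeros F" "\<mu> ` topspace Y \<subseteq> zeros F"
    and xy: "x \<in> topspace X" "y \<in> topspace Y" "\<nu> x = \<mu> y" "\<nu> x \<notin> singular_points F"
  obtains M where "openin Y M" "y \<in> M" "\<mu> ` M \<subseteq> \<nu> ` topspace X"
proof -
  interpret c1: nondeg_curve X A \<nu> by (rule X)
  interpret c2: curve Y B \<mu> by (rule Y)
  obtain U \<phi> W f where f: "c1.lift U \<phi> W f" "x \<in> U" "\<phi> x \<in> W" using c1.lift_at[OF xy(1)] by blast
  obtain U' \<psi> W' m where m: "c2.lift U' \<psi> W' m" "y \<in> U'" "\<psi> y \<in> W'" using c2.lift_at[OF xy(2)] by blast
  note fD = c1.liftD[OF f(1)] and mD = c2.liftD[OF m(1)]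
  have Ff: "eval_form F (f t) = 0" if t: "t \<in> W" for t
  proof -
    have "inv_into U \<phi> t \<in> topspace X" using c1.chart_inv(1)[OF fD(1)] c1.chart(5)[OF fD(1)] fD(3) t by blast
    then have "pt (f t) \<in> zeros F" using im(1) fD(6)[OF t] by auto
    then show ?thesis using eval_form_pt[OF F(1) fD(5)[OF t]] by simp
  qed
  have Fm: "eval_form F (m s) = 0" if s: "s \<in> W'" for s
  proof -
    have "inv_into U' \<psi> s \<in> topspace Y" using c2.chart_inv(1)[OF mD(1)] c2.chart(5)[OF mD(1)] mD(3) s by blast
    then have "pt (m s) \<in> zeros F" using im(2) mD(6)[OF s] by auto
    then show ?thesis using eval_form_pt[OF F(1) mD(5)[OF s]] by simp
  qed
  define f0 where "f0 = f (\<phi> x)"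
  have f00: "f0 \<noteq> 0" using fD(5)[OF f(3)] by (simp add: f0_def)
  have pf0: "pt f0 = \<nu> x" using fD(6)[OF f(3)] c1.chart_inv(3)[OF fD(1) f(2)] by (simp add: f0_def)
  obtain k0 where k0: "k0 \<noteq> 0" "coords (\<nu> x) = k0 *s f0" using coords_pt[OF f00] pf0 by auto
  have xz: "\<nu> x \<in> zeros F" using im(1) xy(1) by blast
  have "grad F (coords (\<nu> x)) \<noteq> 0" using singular_iff(1)[OF F xz] xy(4) by simp
  then have g0: "grad F f0 \<noteq> 0" unfolding k0(2) grad_scale[OF F(1) k0(1)] by auto
  obtain u where u: "dot u (grad F f0) = 1" using vec3_nonzero_dot[OF g0] by blast
  have gf0: "dot (grad F f0) f0 = 0" using euler_identity[OF F(1)] Ff[OF f(3)] by (simp add: f0_def)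
  have fu: "crs f0 u \<noteq> 0"
  proof
    assume "crs f0 u = 0"
    then obtain k where "u = k *s f0" using crs_eq_0D f00 by blast
    then show False using u gf0 by (simp add: dot_scale_left dot_commute)
  qed
  obtain s where s: "dot s (crs f0 u) = 1" using vec3_nonzero_dot[OF fu] by blast
  \<comment> \<open>Both \<open>a\<close> and \<open>b\<close> vanish at \<open>u\<close>, a
    direction transversal to the curve; their quotient is the projection from \<open>u\<close>, with
    the value 0 at \<open>f0\<close>.\<close>
  define a where "a = crs u f0"
  define b where "b = crs u s"
  have au: "dot a u = 0" "dot a f0 = 0" "dot b u = 0" by (simp_all add: a_def b_def)
  have "dot b f0 = dot s (crs f0 u)" by (simp add: b_def dot_def algebra_simps)
  then have bf: "dot b f0 = 1" using s by simp
  have a0: "a \<noteq> 0" using fu crs_anticommute[of u f0] by (auto simp: a_def)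
  have ab: "crs a b \<noteq> 0"
  proof
    assume "crs a b = 0"
    then obtain k where "b = k *s a" using crs_eq_0D a0 by blast
    then show False using bf au by (simp add: dot_scale_left)
  qed
  have span: "\<exists>t. v = t *s u" if v: "dot a v = 0" "dot b v = 0" for v
  proof -
    have u0: "u \<noteq> 0" using u by auto
    obtain c where c: "c \<noteq> 0" "crs a b = c *s u" using orthogonal_two[OF ab au(1) au(3) u0] by blast
    have "crs v (crs a b) = 0" unfolding crs_crs using v by (simp add: dot_commute)
    then have "crs u v = 0" unfolding c(2) using c(1) crs_anticommute[of u v] by (simp add: crs_scale)
    then show ?thesis using crs_eq_0D u0 by blast
  qed
  have u': "dot (grad F f0) u \<noteq> 0" using u by (simp add: dot_commute)
  obtain \<delta> where \<delta>: "\<delta> > 0" "\<And>v t. v \<in> ball f0 \<delta> \<Longrightarrow> v + t *s u \<in> ball f0 \<delta> \<Longrightarrow> eval_form F v = eval_form F (v + t *s u) \<Longrightarrow> t = 0"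
    using graph_unique[OF u'] by blast
  \<comment> \<open>Representatives on which \<open>b\<close> is 1; two of them with the same
    projection differ by a multiple of \<open>u\<close>.\<close>
  define n where "n v = (1 / dot b v) *s v" for v
  have cn: "continuous_on {v. dot b v \<noteq> 0} n"
    unfolding n_def dot_def by (auto simp: vector_scalar_mult_def intro!: continuous_intros)
  have ob: "open {v. dot b v \<noteq> 0}"
    unfolding dot_def by (intro open_Collect_neq continuous_intros)
  define Q where "Q = {v \<in> {v. dot b v \<noteq> 0}. n v \<in> ball f0 \<delta>}"
  have Q: "open Q" unfolding Q_def by (rule open_sub[OF ob cn open_ball])
  have nk: "n (k *s f0) = f0" if "k \<noteq> 0" for k using that bf by (simp add: n_def dot_scale_right)
  have fQ: "k *s f0 \<in> Q" if "k \<noteq> 0" for k using that nk[OF that] bf \<delta>(1) by (simp add: Q_def dot_scale_right)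
  have "open {t\<in>W. f t \<in> Q}" by (rule open_sub[OF fD(2) holo3_continuous[OF fD(4)] Q])
  moreover have "\<phi> x \<in> {t\<in>W. f t \<in> Q}" using f(3) fQ[of 1] by (simp add: f0_def)
  ultimately obtain r where r: "r > 0" "ball (\<phi> x) r \<subseteq> {t\<in>W. f t \<in> Q}" using openE by blast
  define \<zeta> where "\<zeta> v = dot a v / dot b v" for v
  have cz: "continuous_on Q \<zeta>"
    unfolding \<zeta>_def dot_def by (intro continuous_intros) (auto simp: Q_def dot_def)
  have hz: "(\<lambda>t. \<zeta> (f t)) holomorphic_on ball (\<phi> x) r"
  proof -
    have "holo3 f (ball (\<phi> x) r)" by (rule holo3_subset[OF fD(4)]) (use r(2) in blast)
    then show ?thesis unfolding \<zeta>_def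
      using r(2) by (intro holomorphic_on_divide holo3_dot) (auto simp: Q_def)
  qed
  \<comment> \<open>A constant projection would be 0, and then \<open>a\<close> would vanish along
    the whole branch, against nondegeneracy.\<close>
  have nc: "\<not> (\<lambda>t. \<zeta> (f t)) constant_on ball (\<phi> x) r"
  proof
    assume "(\<lambda>t. \<zeta> (f t)) constant_on ball (\<phi> x) r"
    then obtain c where c: "\<And>t. t \<in> ball (\<phi> x) r \<Longrightarrow> \<zeta> (f t) = c" by (auto simp: constant_on_def)
    have "c = 0" using c[of "\<phi> x"] r(1) au(2) by (simp add: \<zeta>_def f0_def)
    then have "dot a (f t) = 0" if "t \<in> ball (\<phi> x) r" for t
      using c[OF that] r(2) that by (auto simp: \<zeta>_def Q_def)
    then show False using zero_order_not_zero[OF c1.ord_order[OF a0 f] r(1)] by blast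
  qed
  define Z where "Z = (\<lambda>t. \<zeta> (f t)) ` ball (\<phi> x) r"
  have Z: "open Z" unfolding Z_def
    by (rule open_mapping_thm[OF hz open_ball connected_ball open_ball subset_refl nc])
  define R where "R = {v\<in>Q. \<zeta> v \<in> Z}"
  have R: "open R" unfolding R_def by (rule open_sub[OF Q cz Z])
  \<comment> \<open>Parameters of the second branch whose projection is also attained on the first
    one; both points are zeros of \<open>F\<close>, so \<open>graph_unique\<close> makes them
    equal.\<close>
  define M1 where "M1 = {s\<in>W'. m s \<in> R}"
  have M1: "open M1" unfolding M1_def by (rule open_sub[OF mD(2) holo3_continuous[OF mD(4)] R])
  have "pt (m (\<psi> y)) = pt f0" using pf0 xy(3) mD(6)[OF m(3)] c2.chart_inv(3)[OF mD(1) m(2)] by simp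
  then obtain k where k: "k \<noteq> 0" "m (\<psi> y) = k *s f0" using pt_eqD[of f0 "m (\<psi> y)"] f00 mD(5)[OF m(3)] by auto
  have "\<zeta> (f (\<phi> x)) \<in> Z" unfolding Z_def using r(1) by (intro imageI) simp
  moreover have "\<zeta> (k *s f0) = \<zeta> (f (\<phi> x))" using au(2) by (simp add: \<zeta>_def dot_scale_right f0_def)
  ultimately have yM: "\<psi> y \<in> M1" using m(3) fQ[OF k(1)] by (simp add: M1_def R_def k(2))
  show ?thesis
  proof (rule that)
    show "openin Y (inv_into U' \<psi> ` M1)"
      by (rule c2.chart_image_open[OF mD(1) _ M1]) (use mD(3) in \<open>auto simp: M1_def\<close>)
    show "y \<in> inv_into U' \<psi> ` M1" using yM c2.chart_inv(3)[OF mD(1) m(2)] by force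
    show "\<mu> ` inv_into U' \<psi> ` M1 \<subseteq> \<nu> ` topspace X"
    proof clarify
      fix s assume s: "s \<in> M1"
      then have sW: "s \<in> W'" "m s \<in> Q" "\<zeta> (m s) \<in> Z" by (auto simp: M1_def R_def)
      then obtain t where t: "t \<in> ball (\<phi> x) r" "\<zeta> (m s) = \<zeta> (f t)" by (auto simp: Z_def)
      have tW: "t \<in> W" "f t \<in> Q" using t r(2) by auto
      have q: "dot b (m s) \<noteq> 0" "dot b (f t) \<noteq> 0" "n (m s) \<in> ball f0 \<delta>" "n (f t) \<in> ball f0 \<delta>"
        using sW(2) tW(2) by (auto simp: Q_def)
      have "dot a (n (m s) - n (f t)) = 0" "dot b (n (m s) - n (f t)) = 0"
        using q t(2) by (simp_all add: n_def dot_simps \<zeta>_def field_simps)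
      then obtain \<tau> where "n (m s) - n (f t) = \<tau> *s u" using span by blast
      then have ns: "n (m s) = n (f t) + \<tau> *s u" by (simp add: algebra_simps)
      have "eval_form F (n (f t)) = eval_form F (n (m s))"
        unfolding n_def eval_form_scale[OF F(1)] Ff[OF tW(1)] Fm[OF sW(1)] by simp
      then have "\<tau> = 0" using \<delta>(2)[of "n (f t)" \<tau>] q(3,4) unfolding ns by blast
      then have "n (m s) = n (f t)" using ns by simp
      moreover have "pt (n v) = pt v" if "dot b v \<noteq> 0" for v
        unfolding n_def by (rule pt_scale) (use that in auto)
      ultimately have "pt (m s) = pt (f t)" using q(1,2) by metis
      then have "\<mu> (inv_into U' \<psi> s) = \<nu> (inv_into U \<phi> t)" using mD(6)[OF sW(1)] fD(6)[OF tW(1)] by simp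
      moreover have "inv_into U \<phi> t \<in> topspace X"
        using c1.chart_inv(1)[OF fD(1)] c1.chart(5)[OF fD(1)] fD(3) tW(1) by blast
      ultimately show "\<mu> (inv_into U' \<psi> s) \<in> \<nu> ` topspace X" by blast
    qed
  qed
qed

text \<open>The part of \<open>Y\<close> over the image of \<open>X\<close> is closed by compactness
  and, away from singular points, open because branches through the same smooth point
  coincide.\<close>

lemma curve_surjective:
  assumes X: "nondeg_curve X A \<nu>" and Y: "curve Y B \<mu>"
    and F: "homogeneous d F" "eval_form F w \<noteq> 0" "w \<noteq> 0" "finite (singular_points F)"
    and im: "\<nu> ` topspace X \<subseteq> zeros F" "\<mu> ` topspace Y = zeros F"
  shows "\<nu> ` topspace X = zeros F"
proof -
  interpret c1: nondeg_curve X A \<nu> by (rule X)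
  interpret c2: nondeg_curve Y B \<mu>
  proof (intro nondeg_curve.intro Y nondeg_curve_axioms.intro)
    fix l :: "complex^3" assume "l \<noteq> 0"
    then obtain x where x: "x \<in> topspace X" "dot l (coords (\<nu> x)) \<noteq> 0" using c1.nondeg by blast
    then have "\<nu> x \<in> \<mu> ` topspace Y" using im by blast
    then show "\<exists>y\<in>topspace Y. dot l (coords (\<mu> y)) \<noteq> 0" using x(2) by auto
  qed
  \<comment> \<open>The comparison of branches needs smooth points, so the finitely many points over
    singular ones are removed, which does not disconnect \<open>Y\<close>.\<close>
  define P where "P = {y\<in>topspace Y. \<mu> y \<in> singular_points F}"
  define T1 where "T1 = {y\<in>topspace Y. \<mu> y \<in> \<nu> ` topspace X \<and> \<mu> y \<notin> singular_points F}"
  define T2 where "T2 = {y\<in>topspace Y. \<mu> y \<notin> \<nu> ` topspace X}"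
  have finP: "finite P" unfolding P_def by (rule c2.preimage_finite[OF F(4)])
  have "Hausdorff_space Y" using c2.riemann by (simp add: compact_riemann_surface_def)
  then have clP: "closedin Y P" by (rule closedin_Hausdorff_finite) (use finP in \<open>auto simp: P_def\<close>)
  have T1: "openin Y T1"
  proof (subst openin_subopen, rule ballI)
    fix y assume "y \<in> T1"
    then obtain x where x: "x \<in> topspace X" "y \<in> topspace Y" "\<nu> x = \<mu> y" "\<nu> x \<notin> singular_points F"
      by (auto simp: T1_def)
    obtain M where M: "openin Y M" "y \<in> M" "\<mu> ` M \<subseteq> \<nu> ` topspace X"
      using image_open[OF X Y F(1-3) im(1) _ x] im(2) by auto
    have "openin Y (M - P)" using M(1) clP by (rule openin_diff)
    moreover have "y \<in> M - P" using M(2) x by (simp add: P_def)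
    moreover have "M - P \<subseteq> T1" using M(3) openin_subset[OF M(1)] by (auto simp: T1_def P_def)
    ultimately show "\<exists>T. openin Y T \<and> y \<in> T \<and> T \<subseteq> T1" by blast
  qed
  have T2: "openin Y T2" unfolding T2_def using image_closed[OF c1.curve_axioms Y] .
  have "T1 = {} \<or> T2 = {}"
    by (rule c2.connected_minus_finite[OF finP T1 T2]) (auto simp: T1_def T2_def P_def)
  moreover have "T1 \<noteq> {}"
  proof -
    have "infinite (topspace X - {x\<in>topspace X. \<nu> x \<in> singular_points F})"
      using c1.infinite_surface c1.preimage_finite[OF F(4)] by (simp add: Diff_infinite_finite)
    then have "topspace X - {x\<in>topspace X. \<nu> x \<in> singular_points F} \<noteq> {}" by (metis finite.emptyI)
    then obtain x where x: "x \<in> topspace X" "\<nu> x \<notin> singular_points F" by blast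
    then have "\<nu> x \<in> \<mu> ` topspace Y" using im by blast
    then obtain y where "y \<in> topspace Y" "\<mu> y = \<nu> x" by auto
    then have "y \<in> T1" using x by (auto simp: T1_def)
    then show ?thesis by blast
  qed
  ultimately have "T2 = {}" by blast
  then have "zeros F \<subseteq> \<nu> ` topspace X" unfolding im(2)[symmetric] by (auto simp: T2_def)
  then show ?thesis using im(1) by blast
qed

text \<open>The last two conclusions are what a second application, with the dual curve in place of
  \<open>C\<close> and the same surface, requires.\<close>

theorem plucker_euler:
  assumes norm: "normalization C X A \<nu>" and C: "C \<in> V d c n" and D: "dual_curve C \<in> V d' c' n'"
    and normD: "normalization (dual_curve C) Y B \<mu>"
  obtains \<gamma> where "euler_characteristic X = 2 * int d - int c - int d'"
    "normalization (dual_curve C) X A \<gamma>" "dual_curve (dual_curve C) = C"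
proof -
  obtain F where F: "reduced_equation d F C" "singular_points F = nodes F \<union> cusps F"
    "finite (cusps F)" "card (cusps F) = c" "finite (nodes F)"
    using C by (auto simp: V_def)
  obtain G where G: "reduced_equation d' G (dual_curve C)" "singular_points G = nodes G \<union> cusps G"
    "finite (cusps G)" "finite (nodes G)"
    using D by (auto simp: V_def)
  note FE = reduced_equation_nonzero[OF F(1)] and GE = reduced_equation_nonzero[OF G(1)]
  obtain w where w: "eval_form F w \<noteq> 0" "w \<noteq> 0" using FE(4) by blast
  obtain w' where w': "eval_form G w' \<noteq> 0" "w' \<noteq> 0" using GE(4) by blast
  have sF: "finite (singular_points F)" and sG: "finite (singular_points G)" using F G by simp_all
  obtain S0 where S0: "finite S0" "inj_on \<nu> {x\<in>topspace X. \<nu> x \<notin> S0}" using norm by (auto simp: normalization_def)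
  have im: "\<nu> ` topspace X = C" using norm by (simp add: normalization_def)
  have cX: "curve X A \<nu>" using norm by (simp add: normalization_def curve_def)
  have cY: "curve Y B \<mu>" using normD by (simp add: normalization_def curve_def)
  \<comment> \<open>A curve inside a line would have a dual with at most one point, whereas a form
    of positive degree has infinitely many zeros.\<close>
  have ndX: "nondeg_curve X A \<nu>"
  proof (intro nondeg_curve.intro cX nondeg_curve_axioms.intro, rule ccontr)
    fix l :: "complex^3" assume l: "l \<noteq> 0" and "\<not> (\<exists>x\<in>topspace X. dot l (coords (\<nu> x)) \<noteq> 0)"
    then have z: "dot l (coords p) = 0" if "p \<in> C" for p using that im by blast
    have "dual_curve C \<subseteq> {pt l}" using dual_degenerate[OF l, of C] z by blast
    then have "zeros G \<subseteq> {pt l}" using GE(3) by simp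
    then have "finite (zeros G)" by (rule finite_subset) simp
    then show False using infinite_zeros[OF GE(1,2) w'] by blast
  qed
  interpret P: plane_curve X A \<nu> F d S0
    by (intro plane_curve.intro ndX plane_curve_axioms.intro) (use FE im sF w S0 in auto)
  interpret dual: nondeg_curve X A P.gauss by (rule P.dual_nondeg)
  have sub: "P.gauss ` topspace X \<subseteq> zeros G"
    using P.dual_points_gauss(3)[OF im F(1) sF] GE(3) by simp
  have "\<mu> ` topspace Y = zeros G" using normD GE(3) by (simp add: normalization_def)
  then have surj: "P.gauss ` topspace X = zeros G"
    by (rule curve_surjective[OF P.dual_nondeg cY GE(1) w' sG sub])
  \<comment> \<open>Outside \<open>S1\<close> the tangent line to the dual curve at
    \<open>P.gauss z\<close> is \<open>\<nu> z\<close> by biduality, so the Gauss map inherits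
    injectivity from \<nu>.\<close>
  define S1 where "S1 = singular_points G \<union> P.gauss ` {x\<in>topspace X. \<nu> x \<in> S0}"
  have S1: "finite S1" unfolding S1_def using sG P.preimage_finite[OF S0(1)] by simp
  have inj: "inj_on P.gauss {x\<in>topspace X. P.gauss x \<notin> S1}"
  proof (rule inj_onI)
    fix x y assume x: "x \<in> {x\<in>topspace X. P.gauss x \<notin> S1}" and y: "y \<in> {x\<in>topspace X. P.gauss x \<notin> S1}"
      and eq: "P.gauss x = P.gauss y"
    have t: "tangent_lines G (P.gauss z) = {\<nu> z}" if "z \<in> {x\<in>topspace X. P.gauss x \<notin> S1}" for z
      using dual.tangent_gauss[OF GE(1) w' sub, of z] that P.biduality[of z] by (simp add: S1_def)
    have "\<nu> x = \<nu> y" using t[OF x] t[OF y] eq by simp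
    moreover have "\<nu> x \<notin> S0" "\<nu> y \<notin> S0" using x y by (auto simp: S1_def)
    ultimately show "x = y" using S0(2) x y by (auto dest: inj_onD)
  qed
  interpret Q: plane_curve X A P.gauss G d' S1
    by (intro plane_curve.intro P.dual_nondeg plane_curve_axioms.intro) (use GE surj sG w' S1 inj in auto)
  \<comment> \<open>The tangent lines through \<open>w\<close>, as counted by
    \<open>dual.line_degree\<close>, are the intersections of the dual curve with a line, hence
    \<open>d'\<close> in number.\<close>
  have "euler_characteristic X = 2 * int d - int c - int d'"
    using has_euler_imp[OF P.euler_formula[OF F(2) w(1)]] Q.line_degree_const[OF w(2)] F(4) by simp
  moreover have "normalization (dual_curve C) X A P.gauss"
    unfolding normalization_def using P.riemann P.gauss_holomorphic surj GE(3) S1 inj by auto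
  moreover have "dual_curve (dual_curve C) = C"
  proof
    have imG: "P.gauss ` topspace X = dual_curve C" using surj GE(3) by simp
    have bi: "dual.gauss ` topspace X = C" using P.biduality im by auto
    show "C \<subseteq> dual_curve (dual_curve C)"
      using dual.dual_points_gauss(3)[OF imG G(1) sG] bi by simp
    show "dual_curve (dual_curve C) \<subseteq> C"
      using dual.dual_points_gauss(4)[OF imG G(1) sG FE(1)] bi FE(3) by simp
  qed
  ultimately show ?thesis using that by blast
qed

section \<open>The linear transformation\<close>

lemma vec3_eq: "(x :: 'a^3) = y \<longleftrightarrow> x $ 1 = y $ 1 \<and> x $ 2 = y $ 2 \<and> x $ 3 = y $ 3"
  by (simp add: vec_eq_iff forall_3)

lemma plucker_matrix_mult:
  "(plucker_matrix :: ('a::comm_ring_1)^3^3) *v x =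
     vector [2 * x $ 1 - x $ 2 - x $ 3, 3 * x $ 1 - 2 * x $ 2 - 3 * x $ 3, x $ 3]"
  by (simp add: vec3_eq matrix_vector_mult_def sum_3 plucker_matrix_def vector_3)

lemma plucker_diagonalizable: "diagonalizable_with (plucker_matrix :: rat^3^3) (vector [-1, 1, 1])"
proof -
  \<comment> \<open>The columns are eigenvectors: (1, 3, 0) for -1, and (1, 1, 0) and (1, 0, 1) for
    1.\<close>
  define P :: "rat^3^3" where "P = vector [vector [1, 1, 1], vector [3, 1, 0], vector [0, 0, 1]]"
  define P' :: "rat^3^3" where "P' = vector [vector [-1/2, 1/2, 1/2], vector [3/2, -1/2, -3/2], vector [0, 0, 1]]"
  have P: "P ** P' = mat 1" "P' ** P = mat 1"
    by (simp_all add: vec3_eq matrix_matrix_mult_def sum_3 P_def P'_def vector_3 mat_def)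
  then have inv: "invertible P" by (auto simp: invertible_def)
  \<comment> \<open>\<open>matrix_inv\<close> is a choice among inverses; their uniqueness
    identifies it with \<open>P'\<close>.\<close>
  have "\<exists>B. P ** B = mat 1 \<and> B ** P = mat 1" using P by blast
  then have m: "P ** matrix_inv P = mat 1 \<and> matrix_inv P ** P = mat 1"
    unfolding matrix_inv_def by (rule someI_ex)
  have "matrix_inv P = matrix_inv P ** (P ** P')" by (simp add: P(1))
  also have "\<dots> = P'" using m by (simp add: matrix_mul_assoc)
  finally have "matrix_inv P = P'" .
  moreover have "P' ** plucker_matrix ** P = (\<chi> i j. if i = j then (vector [-1, 1, 1] :: rat^3) $ i else 0)"
    by (simp add: vec3_eq matrix_matrix_mult_def sum_3 P_def P'_def vector_3 plucker_matrix_def)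
  ultimately show ?thesis using inv unfolding diagonalizable_with_def by metis
qed

lemma plucker_eigenform: "eigenform (plucker_matrix :: rat^3^3) (-1) plucker_form"
proof -
  have "Vector_Spaces.linear (*s) (*) (plucker_form :: rat^3 \<Rightarrow> rat)"
    by unfold_locales (auto simp: plucker_form_def algebra_simps)
  moreover have "(plucker_form :: rat^3 \<Rightarrow> rat) \<noteq> (\<lambda>x. 0)"
  proof
    assume "(plucker_form :: rat^3 \<Rightarrow> rat) = (\<lambda>x. 0)"
    then have "plucker_form (vector [1, 0, 0] :: rat^3) = 0" by metis
    then show False by (simp add: plucker_form_def vector_3)
  qed
  moreover have "(plucker_form :: rat^3 \<Rightarrow> rat) \<circ> (*v) plucker_matrix = (\<lambda>x. -1 * plucker_form x)"
    by (simp add: fun_eq_iff plucker_matrix_mult plucker_form_def vector_3 algebra_simps)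
  ultimately show ?thesis unfolding eigenform_def by blast
qed

lemma plucker_reflection: "lattice_reflection {x :: int^3. even (x $ 3)} ((*v) plucker_matrix)"
  unfolding lattice_reflection_def
proof
  let ?L = "{x :: int^3. even (x $ 3)}" and ?D = "(*v) (plucker_matrix :: int^3^3)"
  have "?D (?D x) = x" for x by (simp add: vec3_eq plucker_matrix_mult vector_3)
  moreover have "?D x \<in> ?L" if "x \<in> ?L" for x using that by (simp add: plucker_matrix_mult vector_3)
  ultimately show "?D ` ?L = ?L" by (metis (no_types, lifting) image_eqI subsetI image_subsetI subset_antisym)
  \<comment> \<open>The root (1, 3, 0) is the eigenvector for -1, and \<open>plucker_form\<close>
    takes the value -2 on it, which explains the sign.\<close>
  show "\<exists>r\<in>?L. \<exists>f :: int^3 \<Rightarrow> int. (\<forall>x\<in>?L. \<forall>y\<in>?L. f (x + y) = f x + f y) \<and> f r = 2 \<and> (\<forall>x\<in>?L. ?D x = x - f x *s r)"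
    by (intro bexI[of _ "vector [1, 3, 0]"] exI[of _ "\<lambda>x. - plucker_form x"])
      (auto simp: plucker_form_def vec3_eq plucker_matrix_mult vector_3 algebra_simps)
qed

theorem mainTheorem1:
  shows
    "(\<forall>(C :: P2 set) (d :: nat) (c :: nat) (n :: nat) (d' :: nat) (c' :: nat) (n' :: nat)
        (X :: 'a topology) A \<nu> (X' :: 'b topology) A' \<nu>'.
        C \<in> V d c n \<and> irreducible_curve C \<and> dual_curve C \<in> V d' c' n' \<and>
        normalization C X A \<nu> \<and> normalization (dual_curve C) X' A' \<nu>' \<longrightarrow>
        (let e = euler_characteristic X; e' = euler_characteristic X' in
           int d' = 2 * int d - int c - e \<and>
           int c' = 3 * int d - 2 * int c - 3 * e \<and>
           e' = e \<and>
           vector [int d', int c', e'] = plucker_matrix *v (vector [int d, int c, e] :: int^3) \<and>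
           plucker_form (vector [int d, int c, e] :: int^3) = int d' - int d)) \<and>
     diagonalizable_with (plucker_matrix :: rat^3^3) (vector [-1, 1, 1]) \<and>
     eigenform (plucker_matrix :: rat^3^3) (-1) plucker_form \<and>
     lattice_reflection {x :: int^3. even (x $ 3)} ((*v) plucker_matrix)"
proof (intro conjI plucker_diagonalizable plucker_eigenform plucker_reflection allI impI)
  fix C :: "P2 set" and d c n d' c' n' :: nat and X :: "'a topology" and A \<nu> and X' :: "'b topology" and A' \<nu>'
  assume "C \<in> V d c n \<and> irreducible_curve C \<and> dual_curve C \<in> V d' c' n' \<and>
        normalization C X A \<nu> \<and> normalization (dual_curve C) X' A' \<nu>'"
  then have C: "C \<in> V d c n" and D: "dual_curve C \<in> V d' c' n'"
    and N: "normalization C X A \<nu>" and N': "normalization (dual_curve C) X' A' \<nu>'" by simp_all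
  obtain \<gamma> where e1: "euler_characteristic X = 2 * int d - int c - int d'"
    and \<gamma>: "normalization (dual_curve C) X A \<gamma>" and dd: "dual_curve (dual_curve C) = C"
    by (rule plucker_euler[OF N C D N'], rule that; assumption)
  have C': "dual_curve (dual_curve C) \<in> V d c n" and N2: "normalization (dual_curve (dual_curve C)) X A \<nu>"
    using dd C N by simp_all
  \<comment> \<open>The surface \<open>X\<close> again, now normalizing the dual curve by \<gamma>.
    Substituting \<open>d' = 2 d - c - e\<close> into \<open>c' = 2 d' - d - e\<close> gives
    \<open>3 d - 2 c - 3 e\<close>.\<close>
  have e2: "euler_characteristic X = 2 * int d' - int c' - int d"
    using plucker_euler[OF \<gamma> D C' N2] by blast
  \<comment> \<open>Its right side is that of \<open>e2\<close>, so the two surfaces, possibly of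
    different types, need no direct comparison.\<close>
  have e3: "euler_characteristic X' = 2 * int d' - int c' - int d"
    using plucker_euler[OF N' D C' N2] by blast
  show "let e = euler_characteristic X; e' = euler_characteristic X' in
           int d' = 2 * int d - int c - e \<and>
           int c' = 3 * int d - 2 * int c - 3 * e \<and>
           e' = e \<and>
           vector [int d', int c', e'] = plucker_matrix *v (vector [int d, int c, e] :: int^3) \<and>
           plucker_form (vector [int d, int c, e] :: int^3) = int d' - int d"
    using e1 e2 e3 by (simp add: Let_def plucker_matrix_mult vec3_eq vector_3 plucker_form_def)
qed

end
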